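(* Suppose $S$ is a finite sum of operators of the form $T_{u_1} \cdots T_{u_n}$, where each $u_j \in \mathcal{U}$. Then the following are equivalent: (a) $S - T_{\tilde{S}}$ is a compact operator; (b) $\tilde{S} \in \mathrm{HOP}$; (c) $\displaystyle\lim_{z \to \partial D} (1 - |z|^2)^2 (\Delta \tilde{S})(z) = 0$.
   Context: $D$ is the open unit disk in $\mathbb{C}$ and $dA$ is area measure on $D$ normalized so that $D$ has measure $1$. The Bergman space $L^2_a$ is the Hilbert space of analytic functions on $D$ lying in $L^2(D,dA)$; $\langle\cdot,\cdot\rangle$ is taken in $L^2(D,dA)$. For $u\in L^\infty(D,dA)$, $T_u$ is the Toeplitz operator on $L^2_a$, $T_uf=P(uf)$, with $P$ the orthogonal projection of $L^2(D,dA)$ onto $L^2_a$. For $z\in D$, $k_z(w)=(1-|z|^2)/(1-\bar z w)^2$ is the normalized Bergman reproducing kernel. For a bounded operator $S$ on $L^2_a$, the Berezin transform of $S$ is the function $\tilde S(z)=\langle Sk_z,k_z\rangle$ on $D$; it is bounded and real analytic on $D$. $\Delta$ is the usual Laplacian. $\lim_{z\to\partial D}$ means the limit as $|z|\to1$, $z\in D$. $H^\infty$ is the algebra of bounded analytic functions on $D$. $\mathcal{U}$ is the $C^*$-subalgebra of $L^\infty(D,dA)$ generated by $H^\infty$. $\mathcal{M}$ is the maximal ideal space of $H^\infty$: the set of multiplicative linear maps of $H^\infty$ onto $\mathbb{C}$, with the weak-star topology (a compact Hausdorff space). $D$ is regarded as a subset of $\mathcal{M}$ via point evaluations, and is dense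 in $\mathcal{M}$ (corona theorem). Via the Gelfand transform, $\mathcal{U}$ is identified with $C(\mathcal{M})$: each $u\in\mathcal{U}$ is a continuous function on $D$ that extends uniquely to a continuous function on $\mathcal{M}$, also denoted $u$. For $S$ as in the claim, $\tilde S\in\mathcal{U}$. For $z\in D$ let $\phi_z(w)=\frac{z-w}{1-\bar z w}$. For $m\in\mathcal{M}$, the Hoffman map $\phi_m\colon D\to\mathcal{M}$ is $\phi_m(w)=\lim_{z\to m}\phi_z(w)$ (limit in $\mathcal{M}$ along $z\in D$; it exists, and $\phi_m$ is continuous, by Hoffman). $\mathrm{HOP}$ ("harmonic on parts") is the set of functions $u\in\mathcal{U}$ such that $u\circ\phi_m$ is harmonic on $D$ for every $m\in\mathcal{M}\setminus D$. *)

theory Defs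
  imports "HOL-Complex_Analysis.Complex_Analysis"
begin

abbreviation unit_disk :: "complex set" where
  "unit_disk \<equiv> ball 0 1"

text \<open>The space of \<open>area\<close> is the disk itself, so measurability, integrals and \<open>AE\<close>
  statements ignore the values of functions off the disk.\<close>

definition area :: "complex measure" where
  "area = uniform_measure (lebesgue_on unit_disk) unit_disk"


section \<open>The Bergman space\<close>

definition L2_inner :: "(complex \<Rightarrow> complex) \<Rightarrow> (complex \<Rightarrow> complex) \<Rightarrow> complex" where
  "L2_inner f g = (LINT z|area. f z * cnj (g z))"

text \<open>Analytic functions on the disk are represented by total functions vanishing off the disk, so
  that equality of representatives is equality on the disk.\<close>

definition bergman_functions :: "(complex \<Rightarrow> complex) set" where
  "bergman_functions = {f. f holomorphic_on unit_disk \<and> integrable area (\<lambda>z. (cmod (f z))\<^sup>2)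
     \<and> (\<forall>z. z \<notin> unit_disk \<longrightarrow> f z = 0)}"

lemma sets_area: "sets area = sets (lebesgue_on unit_disk)"
  and space_area [simp]: "space area = unit_disk"
  by (simp_all add: area_def)

lemma emeasure_disk: "emeasure (lebesgue_on unit_disk) unit_disk = ennreal pi"
proof -
  have "emeasure lborel unit_disk = ennreal pi"
    by (subst emeasure_ball) (simp_all add: unit_ball_vol_2)
  then show ?thesis
    by (simp add: emeasure_restrict_space)
qed

lemma prob_space_area: "emeasure area (space area) = 1"
  using emeasure_disk pi_gt_zero
  by (simp add: area_def emeasure_uniform_measure_1 del: emeasure_uniform_measure)

lemma finite_measure_area: "finite_measure area"
  by (rule finite_measureI) (use prob_space_area in simp)

lemma AE_area_iff: "(AE z in area. P z) \<longleftrightarrow> (AE z in lebesgue. z \<in> unit_disk \<longrightarrow> P z)"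
proof -
  have "(\<lambda>z. indicator unit_disk z / ennreal pi) \<in> borel_measurable (lebesgue_on unit_disk)"
    by (intro borel_measurable_divide_ennreal borel_measurable_indicator) auto
  then have "(AE z in area. P z) \<longleftrightarrow>
      (AE z in lebesgue_on unit_disk. 0 < indicator unit_disk z / ennreal pi \<longrightarrow> P z)"
    unfolding area_def uniform_measure_def emeasure_disk by (rule AE_density)
  also have "\<dots> \<longleftrightarrow> (AE z in lebesgue_on unit_disk. z \<in> unit_disk \<longrightarrow> P z)"
    by (intro AE_cong) (auto simp: indicator_def divide_ennreal_def)
  finally show ?thesis
    by (simp add: AE_restrict_space_iff)
qed

lemma continuous_imp_measurable_area:
  "continuous_on unit_disk f \<Longrightarrow> f \<in> borel_measurable area"
  using continuous_imp_measurable_on_sets_lebesgue[of unit_disk f]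
  by (simp add: measurable_def sets_area)

lemma continuous_AE_zero:
  fixes f :: "complex \<Rightarrow> complex"
  assumes f: "continuous_on unit_disk f" and ae: "AE z in area. f z = 0" and z: "z \<in> unit_disk"
  shows "f z = 0"
proof (rule ccontr)
  assume "f z \<noteq> 0"
  let ?U = "unit_disk \<inter> f -` (- {0})"
  have "open ?U"
    by (rule continuous_open_preimage[OF f]) auto
  moreover have "z \<in> ?U"
    using z \<open>f z \<noteq> 0\<close> by auto
  ultimately have "\<not> negligible ?U"
    using open_not_negligible by blast
  moreover have "AE z in lebesgue. z \<notin> ?U"
    using ae unfolding AE_area_iff by eventually_elim auto
  then have "negligible ?U"
    unfolding negligible_iff_null_sets
    by (rule AE_iff_null_sets[THEN iffD2, rotated]) (use \<open>open ?U\<close> in auto)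
  ultimately show False by blast
qed

lemma bergman_measurable: "f \<in> bergman_functions \<Longrightarrow> f \<in> borel_measurable area"
  by (rule continuous_imp_measurable_area)
    (auto simp: bergman_functions_def intro: holomorphic_on_imp_continuous_on)

lemma L2_inner_integrable:
  assumes "f \<in> borel_measurable area" "g \<in> borel_measurable area"
    "integrable area (\<lambda>z. (cmod (f z))\<^sup>2)" "integrable area (\<lambda>z. (cmod (g z))\<^sup>2)"
  shows "integrable area (\<lambda>z. f z * cnj (g z))"
proof (rule Bochner_Integration.integrable_bound)
  show "integrable area (\<lambda>z. (cmod (f z))\<^sup>2 + (cmod (g z))\<^sup>2)"
    using assms by simp
  have [measurable]: "cnj \<in> borel_measurable borel"
    by (intro borel_measurable_continuous_onI continuous_intros)
  show "(\<lambda>z. f z * cnj (g z)) \<in> borel_measurable area"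
    using assms by measurable
  have "cmod (f z) * cmod (g z) \<le> (cmod (f z))\<^sup>2 + (cmod (g z))\<^sup>2" for z
  proof -
    have "2 * (cmod (f z) * cmod (g z)) \<le> (cmod (f z))\<^sup>2 + (cmod (g z))\<^sup>2"
      using sum_squares_bound[of "cmod (f z)" "cmod (g z)"] by (simp add: mult.assoc)
    moreover have "0 \<le> cmod (f z) * cmod (g z)" by simp
    ultimately show ?thesis by linarith
  qed
  then show "AE z in area. norm (f z * cnj (g z)) \<le> norm ((cmod (f z))\<^sup>2 + (cmod (g z))\<^sup>2)"
    by (auto simp: norm_mult)
qed

lemma bergman_inner_integrable:
  "f \<in> bergman_functions \<Longrightarrow> g \<in> bergman_functions \<Longrightarrow> integrable area (\<lambda>z. f z * cnj (g z))"
  by (rule L2_inner_integrable) (auto intro: bergman_measurable simp: bergman_functions_def)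

lemma bergman_add:
  assumes "f \<in> bergman_functions" "g \<in> bergman_functions"
  shows "(\<lambda>z. f z + g z) \<in> bergman_functions"
proof -
  have "integrable area (\<lambda>z. (cmod (f z + g z))\<^sup>2)"
  proof (rule Bochner_Integration.integrable_bound)
    show "integrable area (\<lambda>z. 2 * (cmod (f z))\<^sup>2 + 2 * (cmod (g z))\<^sup>2)"
      using assms by (simp add: bergman_functions_def)
    show "(\<lambda>z. (cmod (f z + g z))\<^sup>2) \<in> borel_measurable area"
      using assms[THEN bergman_measurable] by measurable
    have "(cmod (f z + g z))\<^sup>2 \<le> 2 * (cmod (f z))\<^sup>2 + 2 * (cmod (g z))\<^sup>2" for z
    proof -
      have "(cmod (f z + g z))\<^sup>2 \<le> (cmod (f z) + cmod (g z))\<^sup>2"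
        by (intro power_mono norm_triangle_ineq) simp
      also have "\<dots> \<le> 2 * (cmod (f z))\<^sup>2 + 2 * (cmod (g z))\<^sup>2"
        using sum_squares_bound[of "cmod (f z)" "cmod (g z)"] by (simp add: power2_sum)
      finally show ?thesis .
    qed
    then show "AE z in area. norm ((cmod (f z + g z))\<^sup>2)
        \<le> norm (2 * (cmod (f z))\<^sup>2 + 2 * (cmod (g z))\<^sup>2)"
      by auto
  qed
  with assms show ?thesis
    by (auto simp: bergman_functions_def intro: holomorphic_intros)
qed

lemma bergman_scale:
  "f \<in> bergman_functions \<Longrightarrow> (\<lambda>z. c * f z) \<in> bergman_functions"
  by (auto simp: bergman_functions_def norm_mult power_mult_distrib intro!: holomorphic_intros)

lemma bergman_zero: "(\<lambda>z. 0) \<in> bergman_functions"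
  by (simp add: bergman_functions_def)

text \<open>The underlying real Hilbert space structure is registered with the type class
  \<^class>\<open>real_inner\<close>; \<open>scaleC\<close> and \<open>cinner\<close> give the complex structure.\<close>

typedef bergman = bergman_functions
  morphisms fun_of to_bergman
  using bergman_zero by blast

setup_lifting type_definition_bergman

lift_definition scaleC :: "complex \<Rightarrow> bergman \<Rightarrow> bergman" is "\<lambda>c f z. c * f z"
  by (rule bergman_scale)

lift_definition cinner :: "bergman \<Rightarrow> bergman \<Rightarrow> complex" is L2_inner .

instantiation bergman :: real_inner
begin

lift_definition zero_bergman :: bergman is "\<lambda>z. 0"
  by (rule bergman_zero)

lift_definition plus_bergman :: "bergman \<Rightarrow> bergman \<Rightarrow> bergman" is "\<lambda>f g z. f z + g z"
  by (rule bergman_add)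

lift_definition uminus_bergman :: "bergman \<Rightarrow> bergman" is "\<lambda>f z. - f z"
  using bergman_scale[of _ "-1"] by simp

lift_definition minus_bergman :: "bergman \<Rightarrow> bergman \<Rightarrow> bergman" is "\<lambda>f g z. f z - g z"
  using bergman_add[OF _ bergman_scale[of _ "-1"]] by simp

lift_definition scaleR_bergman :: "real \<Rightarrow> bergman \<Rightarrow> bergman" is "\<lambda>r f z. of_real r * f z"
  by (rule bergman_scale)

definition inner_bergman :: "bergman \<Rightarrow> bergman \<Rightarrow> real" where
  "inner_bergman f g = Re (cinner f g)"

definition norm_bergman :: "bergman \<Rightarrow> real" where
  "norm_bergman f = sqrt (inner f f)"

definition dist_bergman :: "bergman \<Rightarrow> bergman \<Rightarrow> real" where
  "dist_bergman f g = norm (f - g)"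

definition sgn_bergman :: "bergman \<Rightarrow> bergman" where
  "sgn_bergman f = inverse (norm f) *\<^sub>R f"

definition uniformity_bergman :: "(bergman \<times> bergman) filter" where
  "uniformity_bergman = (INF e\<in>{0<..}. principal {(x, y). dist x y < e})"

definition open_bergman :: "bergman set \<Rightarrow> bool" where
  "open_bergman U \<longleftrightarrow> (\<forall>x\<in>U. eventually (\<lambda>(x', y). x' = x \<longrightarrow> y \<in> U) uniformity)"

instance
proof
  fix f g h :: bergman and a b :: real
  show "f + g + h = f + (g + h)" "f + g = g + f" "0 + f = f" "- f + f = 0" "f - g = f + - g"
    "a *\<^sub>R (f + g) = a *\<^sub>R f + a *\<^sub>R g" "(a + b) *\<^sub>R f = a *\<^sub>R f + b *\<^sub>R f"
    "a *\<^sub>R b *\<^sub>R f = (a * b) *\<^sub>R f" "1 *\<^sub>R f = f"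
    by (transfer; simp add: fun_eq_iff algebra_simps)+
  show "dist f g = norm (f - g)" "sgn f = inverse (norm f) *\<^sub>R f" "norm f = sqrt (inner f f)"
    by (simp_all add: dist_bergman_def sgn_bergman_def norm_bergman_def)
  show "(uniformity :: (bergman \<times> bergman) filter)
      = (INF e\<in>{0<..}. principal {(x, y). dist x y < e})"
    by (rule uniformity_bergman_def)
  show "open U \<longleftrightarrow> (\<forall>x\<in>U. \<forall>\<^sub>F (x', y) in uniformity. x' = x \<longrightarrow> y \<in> U)" for U :: "bergman set"
    by (rule open_bergman_def)
  have cnj: "L2_inner u v = cnj (L2_inner v u)" for u v
    unfolding L2_inner_def
    using Bochner_Integration.integral_cnj[of area "\<lambda>z. v z * cnj (u z)"] by (simp add: mult.commute del: Bochner_Integration.integral_cnj)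
  show "inner f g = inner g f"
    unfolding inner_bergman_def by transfer (subst cnj, simp)
  show "inner (f + g) h = inner f h + inner g h"
    unfolding inner_bergman_def
    by transfer (simp add: L2_inner_def distrib_right bergman_inner_integrable)
  show "inner (a *\<^sub>R f) g = a * inner f g"
    unfolding inner_bergman_def by transfer (simp add: L2_inner_def mult.assoc)
  have sq: "inner f f = (LINT z|area. (cmod (fun_of f z))\<^sup>2)"
    unfolding inner_bergman_def
    by transfer (simp add: L2_inner_def complex_norm_square[symmetric] del: of_real_power)
  show "0 \<le> inner f f"
    unfolding sq by simp
  show "inner f f = 0 \<longleftrightarrow> f = 0"
  proof
    have f: "fun_of f \<in> bergman_functions"
      by (rule fun_of)
    assume "inner f f = 0"
    then have "AE z in area. (cmod (fun_of f z))\<^sup>2 = 0"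
      unfolding sq using f
      by (subst integral_nonneg_eq_0_iff_AE[symmetric]) (auto simp: bergman_functions_def)
    then have "AE z in area. fun_of f z = 0"
      by simp
    then have "fun_of f z = 0" if "z \<in> unit_disk" for z
      using continuous_AE_zero[OF _ _ that] f
      by (auto simp: bergman_functions_def holomorphic_on_imp_continuous_on)
    then have "fun_of f z = 0" for z
      using f by (cases "z \<in> unit_disk") (auto simp: bergman_functions_def)
    then show "f = 0"
      by transfer auto
  next
    assume "f = 0"
    then have "fun_of f z = 0" for z
      by (simp add: zero_bergman.rep_eq)
    then show "inner f f = 0"
      by (simp add: sq)
  qed
qed

end

definition compact_operator :: "(bergman \<Rightarrow> bergman) \<Rightarrow> bool" where
  "compact_operator K \<longleftrightarrow>
     (\<forall>f g. K (f + g) = K f + K g) \<and> (\<forall>c f. K (scaleC c f) = scaleC c (K f)) \<and>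
     compact (closure (K ` cball 0 1))"


section \<open>Toeplitz operators and the Berezin transform\<close>

definition Linf :: "(complex \<Rightarrow> complex) set" where
  "Linf = {u \<in> borel_measurable area. \<exists>B. AE z in area. cmod (u z) \<le> B}"

text \<open>Orthogonal projection of \<open>L\<^sup>2\<close> onto the Bergman space.\<close>

definition bergman_proj :: "(complex \<Rightarrow> complex) \<Rightarrow> bergman" where
  "bergman_proj g = (THE h. \<forall>f. L2_inner (\<lambda>w. g w - fun_of h w) (fun_of f) = 0)"

definition toeplitz :: "(complex \<Rightarrow> complex) \<Rightarrow> bergman \<Rightarrow> bergman" where
  "toeplitz u f = bergman_proj (\<lambda>w. u w * fun_of f w)"

definition normalized_kernel :: "complex \<Rightarrow> bergman" where
  "normalized_kernel z = to_bergman (\<lambda>w. if w \<in> unit_disk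
     then of_real (1 - (cmod z)\<^sup>2) / (1 - cnj z * w)\<^sup>2 else 0)"

lemma kernel_denominator_nonzero:
  assumes "z \<in> unit_disk" "w \<in> cball 0 1"
  shows "1 - cnj z * w \<noteq> 0"
proof
  assume "1 - cnj z * w = 0"
  then have "cmod z * cmod w = 1"
    by (metis complex_mod_cnj eq_iff_diff_eq_0 norm_mult norm_one)
  moreover have "cmod z * cmod w \<le> cmod z * 1"
    using assms by (intro mult_left_mono) auto
  ultimately show False
    using assms by simp
qed

lemma bounded_holomorphic_in_bergman:
  assumes f: "f holomorphic_on unit_disk" and b: "bounded (f ` unit_disk)"
    and z: "\<And>z. z \<notin> unit_disk \<Longrightarrow> f z = 0"
  shows "f \<in> bergman_functions"
proof -
  obtain B where B: "\<And>w. w \<in> unit_disk \<Longrightarrow> cmod (f w) \<le> B"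
    using b unfolding bounded_iff by blast
  have m: "f \<in> borel_measurable area"
    by (intro continuous_imp_measurable_area holomorphic_on_imp_continuous_on f)
  have "integrable area (\<lambda>z. (cmod (f z))\<^sup>2)"
  proof (rule finite_measure.integrable_const_bound[OF finite_measure_area, where B = "B\<^sup>2"])
    show "AE z in area. norm ((cmod (f z))\<^sup>2) \<le> B\<^sup>2"
      by (intro AE_I2) (auto intro!: power_mono B)
    show "(\<lambda>z. (cmod (f z))\<^sup>2) \<in> borel_measurable area"
      using m by measurable
  qed
  with f z show ?thesis
    by (simp add: bergman_functions_def)
qed

lemma fun_of_normalized_kernel:
  assumes z: "z \<in> unit_disk" and w: "w \<in> unit_disk"
  shows "fun_of (normalized_kernel z) w = of_real (1 - (cmod z)\<^sup>2) / (1 - cnj z * w)\<^sup>2"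
proof -
  let ?k = "\<lambda>w. of_real (1 - (cmod z)\<^sup>2) / (1 - cnj z * w)\<^sup>2 :: complex"
  let ?K = "\<lambda>w. if w \<in> unit_disk
    then of_real (1 - (cmod z)\<^sup>2) / (1 - cnj z * w)\<^sup>2 else (0::complex)"
  have nz: "(1 - cnj z * w)\<^sup>2 \<noteq> 0" if "w \<in> cball 0 1" for w
    using kernel_denominator_nonzero[OF z that] by simp
  have "continuous_on (cball 0 1) ?k"
    by (intro continuous_intros ballI nz)
  then have "bounded (?k ` cball 0 1)"
    by (intro compact_imp_bounded compact_continuous_image compact_cball)
  then have "bounded (?k ` unit_disk)"
    by (rule bounded_subset) (intro image_mono ball_subset_cball)
  then have b: "bounded (?K ` unit_disk)"
    by simp
  have "?k holomorphic_on unit_disk"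
    by (intro holomorphic_intros nz) auto
  then have "?K holomorphic_on unit_disk"
    by (rule holomorphic_transform) simp
  with b have "?K \<in> bergman_functions"
    by (intro bounded_holomorphic_in_bergman) auto
  with w show ?thesis
    by (simp add: normalized_kernel_def to_bergman_inverse)
qed

definition berezin :: "(bergman \<Rightarrow> bergman) \<Rightarrow> complex \<Rightarrow> complex" where
  "berezin S z = cinner (S (normalized_kernel z)) (normalized_kernel z)"


section \<open>Bounded analytic functions and their maximal ideal space\<close>

definition Hinf :: "(complex \<Rightarrow> complex) set" where
  "Hinf = {f. f holomorphic_on unit_disk \<and> bounded (f ` unit_disk)
     \<and> (\<forall>z. z \<notin> unit_disk \<longrightarrow> f z = 0)}"

definition cstar_subalgebra :: "(complex \<Rightarrow> complex) set \<Rightarrow> bool" where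
  "cstar_subalgebra A \<longleftrightarrow> A \<subseteq> Linf \<and> (\<lambda>z. 0) \<in> A \<and>
     (\<forall>u\<in>A. \<forall>v\<in>A. (\<lambda>z. u z + v z) \<in> A \<and> (\<lambda>z. u z * v z) \<in> A) \<and>
     (\<forall>u\<in>A. (\<forall>c. (\<lambda>z. c * u z) \<in> A) \<and> (\<lambda>z. cnj (u z)) \<in> A) \<and>
     (\<forall>u\<in>Linf. (\<forall>e>0. \<exists>v\<in>A. AE z in area. cmod (u z - v z) \<le> e) \<longrightarrow> u \<in> A)"

text \<open>Norm closedness makes every \<open>C\<^sup>*\<close>-subalgebra saturated under almost everywhere equality.
  Each class in the algebra generated by \<open>Hinf\<close> has a representative continuous on the disk; these
  representatives make up \<open>UU\<close>. Values off the disk are irrelevant for membership.\<close>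

definition UU :: "(complex \<Rightarrow> complex) set" where
  "UU = {u. continuous_on unit_disk u \<and> u \<in> \<Inter>{A. cstar_subalgebra A \<and> Hinf \<subseteq> A}}"

text \<open>On \<open>maximal_ideals\<close> the product topology of the function type is the topology of pointwise
  convergence on \<open>Hinf\<close>, that is, the weak-star topology.\<close>

definition maximal_ideals :: "((complex \<Rightarrow> complex) \<Rightarrow> complex) set" where
  "maximal_ideals = {m \<in> extensional Hinf.
     (\<forall>f\<in>Hinf. \<forall>g\<in>Hinf. m (\<lambda>z. f z + g z) = m f + m g \<and> m (\<lambda>z. f z * g z) = m f * m g) \<and>
     (\<forall>c. \<forall>f\<in>Hinf. m (\<lambda>z. c * f z) = c * m f) \<and> m ` Hinf = UNIV}"

definition point_eval :: "complex \<Rightarrow> (complex \<Rightarrow> complex) \<Rightarrow> complex" where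
  "point_eval z = restrict (\<lambda>f. f z) Hinf"

text \<open>The filter of points \<open>z\<close> of the disk tending to \<open>m\<close> in the maximal ideal space; it is
  nontrivial for every \<open>m\<close> by the corona theorem.\<close>

definition disk_to :: "((complex \<Rightarrow> complex) \<Rightarrow> complex) \<Rightarrow> complex filter" where
  "disk_to m = inf (filtercomap point_eval (nhds m)) (principal unit_disk)"

text \<open>The continuous extension of \<open>u \<in> UU\<close> from the (dense) disk to the maximal ideal space.\<close>

definition max_ext :: "(complex \<Rightarrow> complex) \<Rightarrow> ((complex \<Rightarrow> complex) \<Rightarrow> complex) \<Rightarrow> complex" where
  "max_ext u m = Lim (disk_to m) u"

definition disk_aut :: "complex \<Rightarrow> complex \<Rightarrow> complex" where
  "disk_aut z w = (z - w) / (1 - cnj z * w)"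

definition hoffman_map ::
    "((complex \<Rightarrow> complex) \<Rightarrow> complex) \<Rightarrow> complex \<Rightarrow> ((complex \<Rightarrow> complex) \<Rightarrow> complex)" where
  "hoffman_map m w = (THE p. p \<in> maximal_ideals \<and>
     ((\<lambda>z. point_eval (disk_aut z w)) \<longlongrightarrow> p) (disk_to m))"


section \<open>Harmonicity\<close>

definition dir_deriv :: "complex \<Rightarrow> (complex \<Rightarrow> complex) \<Rightarrow> complex \<Rightarrow> complex" where
  "dir_deriv v f z = vector_derivative (\<lambda>t. f (z + of_real t * v)) (at 0)"

definition laplacian :: "(complex \<Rightarrow> complex) \<Rightarrow> complex \<Rightarrow> complex" where
  "laplacian f z = dir_deriv 1 (dir_deriv 1 f) z + dir_deriv \<i> (dir_deriv \<i> f) z"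

definition C1_on :: "complex set \<Rightarrow> (complex \<Rightarrow> complex) \<Rightarrow> bool" where
  "C1_on U f \<longleftrightarrow> (\<forall>v\<in>{1, \<i>}. continuous_on U (dir_deriv v f) \<and>
     (\<forall>z\<in>U. (\<lambda>t::real. f (z + of_real t * v)) differentiable (at 0)))"

definition harmonic_on :: "complex set \<Rightarrow> (complex \<Rightarrow> complex) \<Rightarrow> bool" where
  "harmonic_on U f \<longleftrightarrow> C1_on U f \<and> C1_on U (dir_deriv 1 f) \<and> C1_on U (dir_deriv \<i> f) \<and>
     (\<forall>z\<in>U. laplacian f z = 0)"

definition HOP :: "(complex \<Rightarrow> complex) set" where
  "HOP = {u \<in> UU. \<forall>m \<in> maximal_ideals - point_eval ` unit_disk.
     harmonic_on unit_disk (\<lambda>w. max_ext u (hoffman_map m w))}"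

end

theory Submission
  imports Defs
begin

text \<open>Let \<open>m\<close> be a point of the closure of the disk in the maximal ideal space, not in the disk. Conjugating
  \<open>S\<close> by the unitary operator that implements \<open>\<phi>\<^sub>z\<close> replaces each symbol \<open>u\<close> by \<open>u \<circ> \<phi>\<^sub>z\<close>. As \<open>z\<close> tends to
  \<open>m\<close> these functions converge locally uniformly to \<open>u \<circ> \<phi>\<^sub>m\<close>, so the conjugated operators converge
  strongly to an operator \<open>S\<^sub>m\<close>, and the Berezin transform \<open>V\<^sub>m\<close> of \<open>S\<^sub>m\<close> is the composition of the Berezin
  transform of \<open>S\<close> with \<open>\<phi>\<^sub>m\<close>. The same limit applies to \<open>(1 - \<bar>z\<bar>\<^sup>2)\<^sup>2 \<Delta>\<close> of the Berezin transforms, whence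
  (b) and (c) both say that every \<open>V\<^sub>m\<close> is harmonic.

  As in the work of Axler and Zheng, Schur's test shows that a sum of Toeplitz products is compact if
  and only if its Berezin transform vanishes at the boundary. Hence (a) says that every \<open>V\<^sub>m\<close> is its own
  Berezin transform, which holds if \<open>V\<^sub>m\<close> is harmonic. Conversely, assume this and let \<open>q\<close> be the extension of
  \<open>(1 - \<bar>z\<bar>\<^sup>2)\<^sup>2 \<Delta>\<close> of the Berezin transform of \<open>S\<close> to the closure of the disk. Then \<open>q \<circ> \<phi>\<^sub>m\<close> has mean value
  \<open>q m\<close>. If \<open>Re (t q)\<close> has a maximum \<open>s \<noteq> 0\<close> off the disk at \<open>m\<close>, then \<open>Re (t q \<circ> \<phi>\<^sub>m)\<close> is constant,
  so \<open>Re (t V\<^sub>m)\<close> differs from a harmonic function by a nonzero multiple of \<open>ln (1 - \<bar>w\<bar>\<^sup>2)\<close>, which contradicts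
  the mean value property of \<open>V\<^sub>m\<close>. So \<open>q\<close> vanishes off the disk.\<close>

section \<open>Automorphisms of the disk\<close>

text \<open>Convergence of all bounded analytic functions at the moving point z says nothing direct
  about their values at \<open>disk_aut z w\<close>; that these converge too is Hoffman's theorem.
  Its proof manufactures bounded analytic functions that copy the values
  \<open>f (disk_aut k w)\<close> at points k close to z, hence the section on interpolation. For
  compactness the obstacle is that strong convergence only makes the conjugated operators applied to
  1 small in norm, while Schur's test wants weighted integral bounds uniform in z. They come from a
  growth bound of order \<open>(1 - |x|^2) powr (- 1/4)\<close>, which Toeplitz operators preserve
  with constants that depend only on the bounds of the symbols. The invariant Laplacian of a Berezin
  transform is rewritten as a quadratic form of the operator, so that it passes to strong limits. A
  single bounded function equal to its Berezin transform is hard to analyse; here all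
  \<open>V_m\<close> have this property at once and \<open>hoffman_map\<close> does not lead back
  into the disk, so compactness supplies an extremal m.\<close>

definition pdist :: "complex \<Rightarrow> complex \<Rightarrow> real" where
  "pdist z w = cmod (disk_aut z w)"

lemma one_minus_cnj_mult_nonzero:
  assumes "z \<in> unit_disk" "w \<in> unit_disk"
  shows "1 - cnj z * w \<noteq> 0"
  using kernel_denominator_nonzero[of z w] assms by auto

lemma disk_aut_identity:
  "(cmod (1 - cnj z * w))\<^sup>2 - (cmod (z - w))\<^sup>2 = (1 - (cmod z)\<^sup>2) * (1 - (cmod w)\<^sup>2)"
  unfolding cmod_power2 by (simp add: power2_eq_square algebra_simps)

lemma one_minus_norm_disk_aut:
  assumes "z \<in> unit_disk" "w \<in> unit_disk"
  shows "1 - (cmod (disk_aut z w))\<^sup>2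
    = (1 - (cmod z)\<^sup>2) * (1 - (cmod w)\<^sup>2) / (cmod (1 - cnj z * w))\<^sup>2"
proof -
  have "cmod (1 - cnj z * w) \<noteq> 0"
    using one_minus_cnj_mult_nonzero[OF assms] by simp
  then show ?thesis
    unfolding disk_aut_identity[symmetric] disk_aut_def norm_divide power_divide
    by (simp add: field_simps)
qed

lemma norm_sq_less_one: "z \<in> unit_disk \<Longrightarrow> (cmod z)\<^sup>2 < 1"
  by (simp add: abs_square_less_1)

lemma disk_aut_in_disk:
  assumes "z \<in> unit_disk" "w \<in> unit_disk"
  shows "disk_aut z w \<in> unit_disk"
proof -
  have "0 < (1 - (cmod z)\<^sup>2) * (1 - (cmod w)\<^sup>2) / (cmod (1 - cnj z * w))\<^sup>2"
    using assms norm_sq_less_one one_minus_cnj_mult_nonzero[OF assms] by simp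
  then have "(cmod (disk_aut z w))\<^sup>2 < 1"
    unfolding one_minus_norm_disk_aut[OF assms, symmetric] by simp
  then show ?thesis
    by (simp add: abs_square_less_1)
qed

lemma disk_aut_self [simp]: "disk_aut z z = 0"
  and disk_aut_zero_right [simp]: "disk_aut z 0 = z"
  and disk_aut_zero_left [simp]: "disk_aut 0 z = - z"
  by (simp_all add: disk_aut_def)

lemma one_minus_cnj_disk_aut:
  assumes "z \<in> unit_disk" "w \<in> unit_disk"
  shows "1 - cnj z * disk_aut z w = of_real (1 - (cmod z)\<^sup>2) / (1 - cnj z * w)"
  using one_minus_cnj_mult_nonzero[OF assms] complex_norm_square[of z]
  by (simp add: disk_aut_def field_simps)

lemma of_real_one_minus_norm_sq: "of_real (1 - (cmod z)\<^sup>2) = 1 - cnj z * z"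
  using complex_norm_square[of z] by (simp add: mult.commute)

lemma one_minus_norm_sq_pos: "z \<in> unit_disk \<Longrightarrow> 0 < 1 - (cmod z)\<^sup>2"
  using norm_sq_less_one by simp

lemma disk_aut_involution:
  assumes "z \<in> unit_disk" "w \<in> unit_disk"
  shows "disk_aut z (disk_aut z w) = w"
proof -
  have nz: "1 - cnj z * w \<noteq> 0" "1 - cnj z * z \<noteq> 0"
    using one_minus_cnj_mult_nonzero assms by auto
  have "z - disk_aut z w = w * (1 - cnj z * z) / (1 - cnj z * w)"
    using nz by (simp add: disk_aut_def field_simps)
  then have "disk_aut z (disk_aut z w)
      = (w * (1 - cnj z * z) / (1 - cnj z * w)) / ((1 - cnj z * z) / (1 - cnj z * w))"
    unfolding disk_aut_def[of z "disk_aut z w"] one_minus_cnj_disk_aut[OF assms]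
      of_real_one_minus_norm_sq by simp
  then show ?thesis
    using nz by simp
qed

text \<open>\<open>disk_aut z\<close> followed by \<open>disk_aut w\<close> is an automorphism
  vanishing at \<open>disk_aut z w\<close>, so it is a unimodular multiple of
  \<open>disk_aut (disk_aut z w)\<close>; up to sign this is the constant.\<close>

definition aut_phase :: "complex \<Rightarrow> complex \<Rightarrow> complex" where
  "aut_phase z w = (1 - w * cnj z) / (1 - cnj w * z)"

lemma norm_aut_phase:
  assumes "z \<in> unit_disk" "w \<in> unit_disk"
  shows "cmod (aut_phase z w) = 1"
proof -
  have "cmod (1 - w * cnj z) = cmod (cnj (1 - cnj w * z))"
    by (simp add: mult.commute)
  then show ?thesis
    using one_minus_cnj_mult_nonzero[OF assms(2,1)]
    unfolding aut_phase_def norm_divide complex_mod_cnj by simp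
qed

lemma one_minus_cnj_disk_aut_mult:
  assumes "z \<in> unit_disk" "w \<in> unit_disk" "x \<in> unit_disk"
  shows "(1 - cnj w * disk_aut z x) * (1 - cnj z * x)
    = (1 - cnj w * z) * (1 - cnj (disk_aut z w) * x)"
proof -
  have nz: "1 - cnj z * x \<noteq> 0" "1 - cnj w * z \<noteq> 0"
    using one_minus_cnj_mult_nonzero assms by auto
  have "1 - cnj w * z = cnj (1 - cnj z * w)"
    by (simp add: mult.commute)
  then have c: "(1 - cnj w * z) * cnj (disk_aut z w) = cnj (z - w)"
    using nz(2) unfolding disk_aut_def complex_cnj_divide by (simp add: mult.commute)
  have d: "disk_aut z x * (1 - cnj z * x) = z - x"
    using nz by (simp add: disk_aut_def)
  have "(1 - cnj w * disk_aut z x) * (1 - cnj z * x)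
      = 1 - cnj z * x - cnj w * (disk_aut z x * (1 - cnj z * x))"
    by (simp add: algebra_simps)
  also have "\<dots> = (1 - cnj w * z) - cnj (z - w) * x"
    unfolding d by (simp add: algebra_simps)
  also have "\<dots> = (1 - cnj w * z) * (1 - cnj (disk_aut z w) * x)"
    unfolding c[symmetric] by (simp add: algebra_simps)
  finally show ?thesis .
qed

lemma disk_aut_compose:
  assumes "z \<in> unit_disk" "w \<in> unit_disk" "x \<in> unit_disk"
  shows "disk_aut w (disk_aut z x) = - aut_phase z w * disk_aut (disk_aut z w) x"
proof -
  have nz: "1 - cnj z * x \<noteq> 0" "1 - cnj w * z \<noteq> 0" "1 - cnj z * w \<noteq> 0"
    "1 - cnj w * disk_aut z x \<noteq> 0" "1 - cnj (disk_aut z w) * x \<noteq> 0"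
    using one_minus_cnj_mult_nonzero assms disk_aut_in_disk by auto
  have d: "disk_aut z x * (1 - cnj z * x) = z - x" "disk_aut z w * (1 - cnj z * w) = z - w"
    using nz by (simp_all add: disk_aut_def)
  have "(w - disk_aut z x) * (1 - cnj z * x) = w * (1 - cnj z * x) - disk_aut z x * (1 - cnj z * x)"
    by (simp add: algebra_simps)
  also have "\<dots> = x * (1 - cnj z * w) - (z - w)"
    unfolding d by (simp add: algebra_simps)
  also have "\<dots> = - (1 - cnj z * w) * (disk_aut z w - x)"
    unfolding d(2)[symmetric] by (simp add: algebra_simps)
  finally have e: "(w - disk_aut z x) * (1 - cnj z * x) = - (1 - cnj z * w) * (disk_aut z w - x)" .
  have "disk_aut w (disk_aut z x)
      = ((w - disk_aut z x) * (1 - cnj z * x)) / ((1 - cnj w * disk_aut z x) * (1 - cnj z * x))"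
    using nz(1) by (simp add: disk_aut_def[of w])
  also have "\<dots> = (- (1 - cnj z * w) * (disk_aut z w - x))
        / ((1 - cnj w * disk_aut z x) * (1 - cnj z * x))"
    unfolding e ..
  also have "\<dots> = - aut_phase z w * disk_aut (disk_aut z w) x"
    unfolding one_minus_cnj_disk_aut_mult[OF assms] aut_phase_def disk_aut_def[of "disk_aut z w" x]
    by (simp only: times_divide_times_eq minus_mult_left[symmetric] minus_divide_left[symmetric] mult.commute[of "cnj z" w])
  finally show ?thesis .
qed

lemma holomorphic_disk_aut:
  assumes "z \<in> unit_disk" shows "disk_aut z holomorphic_on unit_disk"
  unfolding disk_aut_def
  by (intro holomorphic_intros) (use one_minus_cnj_mult_nonzero[OF assms] in auto)

lemma continuous_on_disk_aut [continuous_intros]: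
  assumes "continuous_on S f" "continuous_on S g"
    and "\<And>x. x \<in> S \<Longrightarrow> f x \<in> unit_disk" "\<And>x. x \<in> S \<Longrightarrow> g x \<in> unit_disk"
  shows "continuous_on S (\<lambda>x. disk_aut (f x) (g x))"
  unfolding disk_aut_def
  by (intro continuous_intros assms) (use one_minus_cnj_mult_nonzero assms(3,4) in auto)

text \<open>Up to sign the derivative is the normalized kernel at z; weighting a composition with
  \<open>disk_aut z\<close> by this kernel therefore gives an isometry.\<close>

lemma deriv_disk_aut:
  assumes "z \<in> unit_disk" "w \<in> unit_disk"
  shows "(disk_aut z has_field_derivative - (of_real (1 - (cmod z)\<^sup>2) / (1 - cnj z * w)\<^sup>2)) (at w)"
  unfolding disk_aut_def of_real_one_minus_norm_sq
  by (rule derivative_eq_intros refl | use one_minus_cnj_mult_nonzero[OF assms] in force)+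
    (use one_minus_cnj_mult_nonzero[OF assms] in
      \<open>simp add: power2_eq_square diff_divide_distrib[symmetric] minus_divide_left algebra_simps\<close>)

lemma disk_aut_image: "z \<in> unit_disk \<Longrightarrow> disk_aut z ` unit_disk = unit_disk"
  using disk_aut_in_disk disk_aut_involution by (force simp: image_iff)

section \<open>The pseudohyperbolic distance\<close>

lemma pdist_commute: "pdist z w = pdist w z"
  unfolding pdist_def disk_aut_def norm_divide
  by (metis complex_cnj_cnj complex_cnj_diff complex_cnj_mult complex_cnj_one complex_mod_cnj
      mult.commute norm_minus_commute)

lemma pdist_less_one: "z \<in> unit_disk \<Longrightarrow> w \<in> unit_disk \<Longrightarrow> pdist z w < 1"
  using disk_aut_in_disk[of z w] by (simp add: pdist_def)

lemma pdist_nonneg [simp]: "0 \<le> pdist z w"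
  by (simp add: pdist_def)

lemma pdist_eq_0_iff: "z \<in> unit_disk \<Longrightarrow> w \<in> unit_disk \<Longrightarrow> pdist z w = 0 \<longleftrightarrow> z = w"
  using one_minus_cnj_mult_nonzero by (auto simp: pdist_def disk_aut_def)

lemma pdist_invariant:
  assumes "z \<in> unit_disk" "w \<in> unit_disk" "x \<in> unit_disk"
  shows "pdist (disk_aut z w) (disk_aut z x) = pdist w x"
  using disk_aut_compose[OF assms(1) disk_aut_in_disk[OF assms(1,2)] assms(3)]
    norm_aut_phase[OF assms(1) disk_aut_in_disk[OF assms(1,2)]] disk_aut_involution[OF assms(1,2)]
  by (simp add: pdist_def norm_mult)

lemma pdist_le_euclidean:
  assumes "z \<in> unit_disk" "w \<in> unit_disk"
  shows "pdist z w \<le> dist z w / (1 - cmod z)"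
proof -
  have "cmod (cnj z * w) \<le> cmod z * 1"
    unfolding norm_mult using assms by (intro mult_mono) auto
  then have "1 - cmod z \<le> cmod (1 - cnj z * w)"
    using norm_triangle_ineq2[of 1 "cnj z * w"] by simp
  then show ?thesis
    unfolding pdist_def disk_aut_def norm_divide dist_norm
    using assms by (intro divide_left_mono mult_pos_pos) auto
qed

lemma schwarz_bound:
  assumes f: "f holomorphic_on unit_disk" and b: "\<And>z. z \<in> unit_disk \<Longrightarrow> cmod (f z) \<le> C"
    and "f 0 = 0" and w: "w \<in> unit_disk"
  shows "cmod (f w) \<le> C * cmod w"
proof (rule field_le_epsilon)
  fix e :: real assume "0 < e"
  have C: "0 \<le> C"
    using b[of 0] by (simp add: \<open>f 0 = 0\<close>)
  \<comment> \<open>Dividing by \<open>C + e\<close> makes the bound strict, as Schwarz's lemma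
    demands, and also covers \<open>C = 0\<close>.\<close>
  let ?g = "\<lambda>z. f z / of_real (C + e)"
  have "cmod (?g w) \<le> cmod w"
  proof (rule Schwarz_Lemma(1))
    show "?g holomorphic_on unit_disk"
      by (intro holomorphic_intros f) (use C \<open>0 < e\<close> in \<open>auto simp: complex_eq_iff\<close>)
    show "cmod (?g z) < 1" if "cmod z < 1" for z
    proof -
      have "cmod (f z) < C + e"
        using b[of z] that \<open>0 < e\<close> by auto
      then show ?thesis
        using C \<open>0 < e\<close> by (simp add: norm_divide flip: of_real_add)
    qed
  qed (use \<open>f 0 = 0\<close> w in auto)
  then have "cmod (f w) \<le> (C + e) * cmod w"
    using C \<open>0 < e\<close> by (simp add: norm_divide field_simps flip: of_real_add)
  also have "\<dots> \<le> C * cmod w + e"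
    using w \<open>0 < e\<close> mult_left_le[of "cmod w" e] by (simp add: algebra_simps)
  finally show "cmod (f w) \<le> C * cmod w + e" .
qed

text \<open>Schwarz's lemma for \<open>f \<circ> disk_aut a\<close> minus its value at 0, which is
  bounded by \<open>2 * C\<close>. The constant 2 is not sharp; it enters the numerical constants
  below.\<close>

lemma schwarz_pick_bound:
  assumes f: "f holomorphic_on unit_disk" and b: "\<And>z. z \<in> unit_disk \<Longrightarrow> cmod (f z) \<le> C"
    and "a \<in> unit_disk" "z \<in> unit_disk"
  shows "cmod (f a - f z) \<le> 2 * C * pdist a z"
proof -
  let ?g = "\<lambda>w. f (disk_aut a w) - f a"
  have "?g holomorphic_on unit_disk"
  proof (intro holomorphic_intros)
    have "(f \<circ> disk_aut a) holomorphic_on unit_disk"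
      by (rule holomorphic_on_compose_gen[OF holomorphic_disk_aut f])
        (use assms disk_aut_in_disk in auto)
    then show "(\<lambda>w. f (disk_aut a w)) holomorphic_on unit_disk"
      by (simp add: o_def)
  qed
  moreover have "cmod (?g w) \<le> 2 * C" if "w \<in> unit_disk" for w
    using b[OF disk_aut_in_disk[OF assms(3) that]] b[OF assms(3)]
      norm_triangle_ineq4[of "f (disk_aut a w)" "f a"] by linarith
  ultimately have "cmod (?g (disk_aut a z)) \<le> 2 * C * cmod (disk_aut a z)"
    by (intro schwarz_bound) (use assms disk_aut_in_disk in auto)
  then show ?thesis
    using disk_aut_involution[OF assms(3,4)] by (simp add: pdist_def norm_minus_commute)
qed

text \<open>This is Schwarz-Pick for \<open>disk_aut a\<close> itself. The factor 2, inherited from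
  there, only affects constants.\<close>

lemma pdist_triangle_weak:
  assumes "a \<in> unit_disk" "b \<in> unit_disk" "c \<in> unit_disk"
  shows "pdist a c \<le> pdist a b + 2 * pdist b c"
proof -
  have "cmod (disk_aut a b - disk_aut a c) \<le> 2 * 1 * pdist b c"
    using assms disk_aut_in_disk
    by (intro schwarz_pick_bound holomorphic_disk_aut) (auto intro: less_imp_le)
  then show ?thesis
    unfolding pdist_def[of a] using norm_triangle_ineq2[of "disk_aut a c" "disk_aut a b"]
    by (simp add: norm_minus_commute)
qed

section \<open>Area measure\<close>

text \<open>Coordinates in \<open>real ^ 2\<close>, where the Jacobian in the change of variables
  formula is the determinant of a matrix.\<close>

definition complex_of_vec :: "real ^ 2 \<Rightarrow> complex" where
  "complex_of_vec x = Complex (x $ 1) (x $ 2)"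

definition vec_of_complex :: "complex \<Rightarrow> real ^ 2" where
  "vec_of_complex z = vector [Re z, Im z]"

lemma complex_of_vec_inverse [simp]:
  "complex_of_vec (vec_of_complex z) = z" "vec_of_complex (complex_of_vec x) = x"
  by (simp_all add: complex_of_vec_def vec_of_complex_def vec_eq_iff forall_2)

lemma bounded_linear_complex_of_vec: "bounded_linear complex_of_vec"
  unfolding linear_conv_bounded_linear[symmetric]
  by (intro linearI)
    (simp_all add: complex_of_vec_def complex_eq_iff)

lemma bounded_linear_vec_of_complex: "bounded_linear vec_of_complex"
  unfolding linear_conv_bounded_linear[symmetric]
  by (intro linearI)
    (simp_all add: vec_of_complex_def vec_eq_iff forall_2)

lemma lborel_complex: "(lborel :: complex measure) = distr lborel borel complex_of_vec"
proof (rule lborel_eqI)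
  have [measurable]: "complex_of_vec \<in> borel_measurable borel"
    by (intro borel_measurable_continuous_onI linear_continuous_on bounded_linear_complex_of_vec)
  fix l u :: complex assume le: "\<And>b. b \<in> Basis \<Longrightarrow> l \<bullet> b \<le> u \<bullet> b"
  have vi: "complex_of_vec -` box l u = box (vec_of_complex l) (vec_of_complex u)"
    by (auto simp: complex_of_vec_def vec_of_complex_def in_box_complex_iff mem_box_cart forall_2)
  have "Re l \<le> Re u" "Im l \<le> Im u"
    using le[of 1] le[of \<i>] by (simp_all add: Basis_complex_def inner_complex_def)
  then have "\<forall>b\<in>Basis. vec_of_complex l \<bullet> b \<le> vec_of_complex u \<bullet> b"
    by (auto simp: Basis_vec_def inner_axis vec_of_complex_def exhaust_2 forall_2 axis_eq_axis
        intro: exhaust_2)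
  moreover have "(\<Prod>b\<in>Basis. (vec_of_complex u - vec_of_complex l) \<bullet> b) = (Re u - Re l) * (Im u - Im l)"
  proof -
    have B: "(Basis :: (real^2) set) = {axis 1 1, axis 2 1}"
      by (auto simp: Basis_vec_def) (metis (full_types) exhaust_2)
    show ?thesis
      unfolding B by (subst prod.insert)
        (auto simp: axis_eq_axis inner_axis vec_of_complex_def)
  qed
  ultimately show "emeasure (distr lborel borel complex_of_vec) (box l u) = (\<Prod>b\<in>Basis. (u - l) \<bullet> b)"
    by (simp add: emeasure_distr vi emeasure_lborel_box_eq Basis_complex_def inner_complex_def
        prod.insert complex_eq_iff)
qed simp

lemma
  shows lebesgue_complex: "(lebesgue :: complex measure) = distr lebesgue lebesgue complex_of_vec"
    and measurable_complex_of_vec: "complex_of_vec \<in> lebesgue \<rightarrow>\<^sub>M lebesgue"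
proof -
  have m: "complex_of_vec \<in> lborel \<rightarrow>\<^sub>M lborel"
    by (simp, intro borel_measurable_continuous_onI linear_continuous_on bounded_linear_complex_of_vec)
  have d: "distr lebesgue lborel complex_of_vec = (lborel :: complex measure)"
    by (subst distr_completion[OF m]) (simp add: lborel_complex[symmetric] cong: distr_cong)
  show "complex_of_vec \<in> lebesgue \<rightarrow>\<^sub>M lebesgue"
    by (rule completion.measurable_completion2) (use m d in \<open>auto intro: measurable_completion\<close>)
  have "lebesgue = completion (distr lebesgue lborel complex_of_vec)"
    unfolding d ..
  also have "\<dots> = distr lebesgue lebesgue complex_of_vec"
    by (rule completion.completion_distr_eq) (use m d in \<open>auto intro: measurable_completion\<close>)
  finally show "(lebesgue :: complex measure) = distr lebesgue lebesgue complex_of_vec" .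
qed

text \<open>An analytic injection has Jacobian \<open>|g'|^2\<close>: its real derivative is
  multiplication by g', a rotation followed by a dilation. Only measures of images are treated;
  integrals follow by comparing measures in \<open>area_eq_distr\<close>.\<close>

lemma emeasure_lebesgue_holomorphic_image:
  assumes E: "E \<in> sets lebesgue" "E \<subseteq> unit_disk"
    and d: "\<And>z. z \<in> E \<Longrightarrow> (g has_field_derivative g' z) (at z)"
    and g': "continuous_on unit_disk g'"
    and inj: "inj_on g E" and im: "g ` E \<subseteq> unit_disk"
  shows "emeasure lebesgue (g ` E) = (\<integral>\<^sup>+z. ennreal ((cmod (g' z))\<^sup>2) * indicator E z \<partial>lebesgue)"
proof -
  define G where "G = vec_of_complex \<circ> g \<circ> complex_of_vec"
  define G' where "G' x = (\<lambda>h. vec_of_complex (g' (complex_of_vec x) * complex_of_vec h))" for x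
  define E' where "E' = complex_of_vec -` E"
  have E': "E' \<in> sets lebesgue"
    using measurable_sets[OF measurable_complex_of_vec E(1)] by (simp add: E'_def)
  have [simp]: "complex_of_vec x \<in> E \<longleftrightarrow> x \<in> E'" for x
    by (simp add: E'_def)
  have der: "(G has_derivative G' x) (at x within E')" if "x \<in> E'" for x
  proof -
    have "(g has_derivative (\<lambda>h. g' (complex_of_vec x) * h)) (at (complex_of_vec x))"
      using d that by (simp add: has_field_derivative_def)
    then have "((\<lambda>y. g (complex_of_vec y)) has_derivative (\<lambda>h. g' (complex_of_vec x) * complex_of_vec h)) (at x)"
      by (rule has_derivative_compose[OF bounded_linear_imp_has_derivative[OF bounded_linear_complex_of_vec]])
    from bounded_linear.has_derivative[OF bounded_linear_vec_of_complex this] show ?thesis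
      unfolding G_def G'_def o_def by (rule has_derivative_at_withinI)
  qed
  have det: "\<bar>det (matrix (G' x))\<bar> = (cmod (g' (complex_of_vec x)))\<^sup>2" for x
    unfolding cmod_power2
    by (simp add: det_2 matrix_def G'_def vec_of_complex_def complex_of_vec_def axis_def
        power2_eq_square)
  have injG: "inj_on G E'"
  proof (rule inj_onI)
    fix x y assume xy: "x \<in> E'" "y \<in> E'" and "G x = G y"
    then have "g (complex_of_vec x) = g (complex_of_vec y)"
      unfolding G_def o_def by (metis complex_of_vec_inverse(1))
    then have "complex_of_vec x = complex_of_vec y"
      using inj xy by (auto dest: inj_onD)
    then show "x = y"
      by (metis complex_of_vec_inverse(2))
  qed
  have GE: "G ` E' = vec_of_complex ` (g ` E)"
  proof -
    have "complex_of_vec ` E' = E"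
      unfolding E'_def by (metis complex_of_vec_inverse(1) surjI surj_image_vimage_eq)
    then show ?thesis
      unfolding G_def image_comp[symmetric] by simp
  qed
  have vim: "G ` E' = complex_of_vec -` (g ` E)"
    unfolding GE by (auto simp: image_iff) (metis complex_of_vec_inverse(2))
  have diffG: "G differentiable_on E'"
    using der unfolding differentiable_on_def differentiable_def by blast
  have GEs: "G ` E' \<in> sets lebesgue"
    by (rule differentiable_image_in_sets_lebesgue[OF E' _ diffG]) simp
  have diffg: "g differentiable_on E"
    unfolding differentiable_on_def using d
    by (meson differentiable_at_withinI field_differentiable_def
        field_differentiable_imp_differentiable)
  have gE: "g ` E \<in> sets lebesgue"
    by (rule differentiable_image_in_sets_lebesgue[OF E(1) _ diffg]) simp
  have em: "emeasure lebesgue (g ` E) = emeasure lebesgue (G ` E')"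
    by (subst lebesgue_complex, subst emeasure_distr[OF measurable_complex_of_vec gE])
      (simp add: vim)
  \<comment> \<open>The image lies in the disk, so its measure is finite; this yields integrability
    of the Jacobian.\<close>
  have lm: "G ` E' \<in> lmeasurable"
  proof (rule fmeasurableI[OF GEs])
    have "emeasure lebesgue (g ` E) \<le> emeasure lebesgue unit_disk"
      by (rule emeasure_mono[OF im]) auto
    also have "\<dots> < \<infinity>"
      using emeasure_bounded_finite[of unit_disk] by auto
    finally show "emeasure lebesgue (G ` E') < \<infinity>"
      unfolding em .
  qed
  let ?J = "\<lambda>x. (cmod (g' (complex_of_vec x)))\<^sup>2"
  have "?J integrable_on E'"
    using measurable_differentiable_image_eq[OF E' der injG] lm unfolding det by simp
  moreover have "measure lebesgue (G ` E') = integral E' ?J"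
    using measure_differentiable_image_eq[OF E' der injG] \<open>?J integrable_on E'\<close> unfolding det by simp
  ultimately have "(?J has_integral measure lebesgue (G ` E')) E'"
    using integrable_integral by fastforce
  then have hi: "((\<lambda>x. indicator E' x * ?J x) has_integral measure lebesgue (G ` E')) UNIV"
    by (subst (asm) has_integral_restrict_UNIV[symmetric])
      (simp add: indicator_def of_bool_def if_distrib[of "\<lambda>x. x * _"] cong: if_cong)
  have nn: "integral\<^sup>N lebesgue (\<lambda>x. indicator E' x * ?J x) = measure lebesgue (G ` E')"
    and Jm: "(\<lambda>x. indicator E' x * ?J x) \<in> lebesgue \<rightarrow>\<^sub>M borel"
    using has_integral_iff_nn_integral_lebesgue[THEN iffD1, OF _ hi] by auto
  have Jm': "(\<lambda>z. ennreal ((cmod (g' z))\<^sup>2) * indicator E z) \<in> borel_measurable lebesgue"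
  proof -
    have "(\<lambda>z. (cmod (g' z))\<^sup>2) \<in> borel_measurable (lebesgue_on unit_disk)"
      by (intro continuous_imp_measurable_on_sets_lebesgue continuous_intros g') auto
    then have "(\<lambda>z. (cmod (g' z))\<^sup>2) \<in> borel_measurable (lebesgue_on E)"
      using E by (auto intro: measurable_restrict_mono)
    then have "(\<lambda>z. indicator E z *\<^sub>R (cmod (g' z))\<^sup>2) \<in> borel_measurable lebesgue"
      using E by (simp add: borel_measurable_restrict_space_iff)
    from measurable_ennreal[THEN measurable_compose[OF this]] show ?thesis
      by (simp add: indicator_def of_bool_def if_distrib if_distribR cong: if_cong)
  qed
  have "emeasure lebesgue (g ` E) = ennreal (measure lebesgue (G ` E'))"
    unfolding em by (rule emeasure_eq_measure2) (use lm in \<open>auto simp: fmeasurable_def\<close>)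
  also have "\<dots> = (\<integral>\<^sup>+x. ennreal (?J x) * indicator E' x \<partial>lebesgue)"
    unfolding nn[symmetric]
    by (intro nn_integral_cong) (simp add: indicator_def)
  also have "\<dots> = (\<integral>\<^sup>+z. ennreal ((cmod (g' z))\<^sup>2) * indicator E z \<partial>lebesgue)"
  proof -
    let ?F = "\<lambda>z. ennreal ((cmod (g' z))\<^sup>2) * indicator E z"
    have "integral\<^sup>N lebesgue ?F = integral\<^sup>N (distr lebesgue lebesgue complex_of_vec) ?F"
      by (rule arg_cong[where f = "\<lambda>M. integral\<^sup>N M ?F", OF lebesgue_complex])
    also have "\<dots> = integral\<^sup>N lebesgue (\<lambda>x. ?F (complex_of_vec x))"
      by (rule nn_integral_distr[OF measurable_complex_of_vec]) (use Jm' in simp)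
    finally show ?thesis
      by (simp add: indicator_def)
  qed
  finally show ?thesis .
qed

lemma area_eq_density: "area = density (lebesgue_on unit_disk) (\<lambda>_. ennreal (1 / pi))"
proof -
  have "indicator unit_disk \<in> borel_measurable (lebesgue_on unit_disk)"
    by (rule borel_measurable_indicator) simp
  then show ?thesis
    unfolding area_def uniform_measure_def emeasure_disk
    by (intro density_cong)
      (auto simp: divide_ennreal_def inverse_ennreal field_simps intro!: AE_I2
        borel_measurable_times_ennreal)
qed

lemma nn_integral_area:
  assumes "f \<in> borel_measurable area"
  shows "(\<integral>\<^sup>+z. f z \<partial>area) = ennreal (1 / pi) * (\<integral>\<^sup>+z. f z * indicator unit_disk z \<partial>lebesgue)"
proof -
  have f: "f \<in> borel_measurable (lebesgue_on unit_disk)"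
    using assms by (simp add: measurable_def sets_area)
  show ?thesis
    unfolding area_eq_density
    by (subst nn_integral_density)
      (use f in \<open>auto simp: nn_integral_cmult nn_integral_restrict_space\<close>)
qed

lemma sets_area_iff: "E \<in> sets area \<longleftrightarrow> E \<in> sets lebesgue \<and> E \<subseteq> unit_disk"
  unfolding sets_area by (auto simp: sets_restrict_space_iff)

lemma emeasure_area:
  assumes "E \<in> sets area"
  shows "emeasure area E = ennreal (1 / pi) * emeasure lebesgue E"
proof -
  have "E \<inter> unit_disk = E"
    using assms by (auto simp: sets_area_iff)
  then show ?thesis
    using assms nn_integral_area[of "indicator E"] sets_area_iff[of E]
    by (simp add: indicator_inter_arith[symmetric])
qed

text \<open>An analytic bijection of the disk with inverse h, packaged so that the automorphisms
  \<open>disk_aut z\<close> and the rotations share one change of variables formula.\<close>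

locale disk_change =
  fixes g g' h :: "complex \<Rightarrow> complex"
  assumes g: "\<And>z. z \<in> unit_disk \<Longrightarrow> g z \<in> unit_disk" "\<And>z. z \<in> unit_disk \<Longrightarrow> h (g z) = z"
    and h: "\<And>z. z \<in> unit_disk \<Longrightarrow> h z \<in> unit_disk" "\<And>z. z \<in> unit_disk \<Longrightarrow> g (h z) = z"
    and deriv: "\<And>z. z \<in> unit_disk \<Longrightarrow> (g has_field_derivative g' z) (at z)"
    and cont: "continuous_on unit_disk g'"
    and holo: "h holomorphic_on unit_disk"
begin

lemma measurable: "g \<in> area \<rightarrow>\<^sub>M area"
proof (rule measurableI)
  fix E assume E: "E \<in> sets area"
  have "g -` E \<inter> space area = h ` E"
    using E g h by (force simp: sets_area_iff image_iff)
  moreover have "h ` E \<in> sets lebesgue"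
  proof (rule differentiable_image_in_sets_lebesgue)
    have "h holomorphic_on E"
      using holo E by (auto simp: sets_area_iff intro: holomorphic_on_subset)
    then show "h differentiable_on E"
      using holomorphic_on_imp_differentiable_on by blast
  qed (use E in \<open>auto simp: sets_area_iff\<close>)
  ultimately show "g -` E \<inter> space area \<in> sets area"
    using E h by (auto simp: sets_area_iff)
qed (use g in auto)

lemma jacobian_measurable [measurable]: "(\<lambda>z. (cmod (g' z))\<^sup>2) \<in> borel_measurable area"
  by (intro continuous_imp_measurable_area continuous_intros cont)

lemma area_eq_distr: "area = distr (density area (\<lambda>z. ennreal ((cmod (g' z))\<^sup>2))) area g"
proof (rule measure_eqI)
  fix E assume E: "E \<in> sets area"
  define F where "F = g -` E \<inter> unit_disk"
  have F: "F \<in> sets area"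
    using measurable_sets[OF measurable E] by (simp add: F_def)
  have gF: "g ` F = E"
    using E g h by (force simp: F_def sets_area_iff image_iff)
  have "emeasure area E = ennreal (1 / pi) * emeasure lebesgue (g ` F)"
    unfolding gF by (rule emeasure_area[OF E])
  also have "emeasure lebesgue (g ` F)
      = (\<integral>\<^sup>+z. ennreal ((cmod (g' z))\<^sup>2) * indicator F z \<partial>lebesgue)"
  proof (rule emeasure_lebesgue_holomorphic_image)
    show "inj_on g F"
      using g by (metis F_def Int_iff inj_onI)
  qed (use F g deriv cont in \<open>auto simp: sets_area_iff\<close>)
  also have "\<dots> = (\<integral>\<^sup>+z. ennreal ((cmod (g' z))\<^sup>2) * indicator F z * indicator unit_disk z \<partial>lebesgue)"
    by (intro nn_integral_cong) (auto simp: F_def indicator_def)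
  also have "ennreal (1 / pi) * \<dots> = (\<integral>\<^sup>+z. ennreal ((cmod (g' z))\<^sup>2) * indicator F z \<partial>area)"
    by (rule nn_integral_area[symmetric]) (use F in measurable)
  also have "\<dots> = emeasure (density area (\<lambda>z. ennreal ((cmod (g' z))\<^sup>2))) F"
    by (rule emeasure_density[symmetric]) (use F in measurable)
  also have "\<dots> = emeasure (distr (density area (\<lambda>z. ennreal ((cmod (g' z))\<^sup>2))) area g) E"
    by (subst emeasure_distr) (use measurable E in \<open>auto simp: F_def\<close>)
  finally show "emeasure area E = \<dots>" .
qed simp

lemma nn_integral_change:
  assumes "f \<in> borel_measurable area"
  shows "(\<integral>\<^sup>+z. f z \<partial>area) = (\<integral>\<^sup>+z. ennreal ((cmod (g' z))\<^sup>2) * f (g z) \<partial>area)"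
proof -
  have [measurable]: "(\<lambda>z. f (g z)) \<in> borel_measurable area"
    using measurable_compose[OF measurable assms] .
  show ?thesis
    by (subst area_eq_distr, subst nn_integral_distr)
      (use measurable assms in \<open>auto simp: nn_integral_density\<close>)
qed

lemma
  fixes f :: "complex \<Rightarrow> 'b::{banach, second_countable_topology}"
  assumes "f \<in> borel_measurable area"
  shows integral_change: "(LINT z|area. f z) = (LINT z|area. (cmod (g' z))\<^sup>2 *\<^sub>R f (g z))"
    and integrable_change: "integrable area f \<longleftrightarrow> integrable area (\<lambda>z. (cmod (g' z))\<^sup>2 *\<^sub>R f (g z))"
proof -
  have [measurable]: "(\<lambda>z. f (g z)) \<in> borel_measurable area"
    using measurable_compose[OF measurable assms] .
  show "(LINT z|area. f z) = (LINT z|area. (cmod (g' z))\<^sup>2 *\<^sub>R f (g z))"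
    by (subst area_eq_distr, subst integral_distr)
      (use measurable assms in \<open>auto simp: integral_density\<close>)
  show "integrable area f \<longleftrightarrow> integrable area (\<lambda>z. (cmod (g' z))\<^sup>2 *\<^sub>R f (g z))"
    by (subst area_eq_distr, subst integrable_distr_eq)
      (use measurable assms in \<open>auto simp: integrable_density\<close>)
qed

end

definition bkern :: "complex \<Rightarrow> complex \<Rightarrow> complex" where
  "bkern z w = of_real (1 - (cmod z)\<^sup>2) / (1 - cnj z * w)\<^sup>2"

lemma continuous_on_bkern:
  assumes "z \<in> unit_disk" shows "continuous_on unit_disk (bkern z)"
  unfolding bkern_def
  by (intro continuous_intros) (use one_minus_cnj_mult_nonzero[OF assms] in auto)

lemma disk_change_disk_aut:
  assumes "z \<in> unit_disk" shows "disk_change (disk_aut z) (\<lambda>w. - bkern z w) (disk_aut z)"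
proof unfold_locales
  show "continuous_on unit_disk (\<lambda>w. - bkern z w)"
    by (intro continuous_intros continuous_on_bkern assms)
qed (use assms disk_aut_in_disk disk_aut_involution holomorphic_disk_aut deriv_disk_aut in
    \<open>simp_all add: bkern_def\<close>)

lemma disk_change_rotation:
  assumes "cmod c = 1" shows "disk_change (\<lambda>z. c * z) (\<lambda>_. c) (\<lambda>z. cnj c * z)"
proof -
  have "cnj c * c = 1" "c * cnj c = 1"
    using assms complex_norm_square[of c] by (simp_all add: mult.commute)
  then show ?thesis
    using assms by unfold_locales
      (auto simp: norm_mult mult.assoc[symmetric] intro!: derivative_eq_intros holomorphic_intros)
qed

lemmas measurable_disk_aut = disk_change.measurable[OF disk_change_disk_aut]

interpretation area: finite_measure area
  by (rule finite_measure_area)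

lemma measure_area_disk [simp]: "measure area unit_disk = 1"
  using prob_space_area by (simp add: measure_def)

lemma integrable_area_bounded:
  fixes f :: "complex \<Rightarrow> 'b :: {banach, second_countable_topology}"
  assumes "f \<in> borel_measurable area" "\<And>z. z \<in> unit_disk \<Longrightarrow> norm (f z) \<le> B"
  shows "integrable area f"
  by (rule area.integrable_const_bound[of _ B]) (use assms in \<open>auto intro!: AE_I2\<close>)

lemma integral_area_bound:
  fixes f :: "complex \<Rightarrow> 'b :: {banach, second_countable_topology}"
  assumes "f \<in> borel_measurable area" "\<And>z. z \<in> unit_disk \<Longrightarrow> norm (f z) \<le> B"
  shows "norm (LINT z|area. f z) \<le> B"
proof -
  have "norm (LINT z|area. f z) \<le> (LINT z|area. norm (f z))"
    by simp
  also have "\<dots> \<le> (LINT z|area. B)"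
    using assms integrable_area_bounded[OF assms] by (intro integral_mono) auto
  finally show ?thesis by simp
qed

lemma integral_rotation:
  fixes f :: "complex \<Rightarrow> 'b :: {banach, second_countable_topology}"
  assumes "cmod c = 1" "f \<in> borel_measurable area"
  shows "(LINT z|area. f (c * z)) = (LINT z|area. f z)"
  using disk_change.integral_change[OF disk_change_rotation[OF assms(1)] assms(2)] assms(1) by simp

lemma nn_integral_rotation:
  assumes "cmod c = 1" "f \<in> borel_measurable area"
  shows "(\<integral>\<^sup>+z. f (c * z) \<partial>area) = (\<integral>\<^sup>+z. f z \<partial>area)"
  using disk_change.nn_integral_change[OF disk_change_rotation[OF assms(1)] assms(2)] assms(1) by simp

section \<open>Mean values over the disk\<close>

lemma ball_sets_area [measurable]: "ball 0 r \<inter> unit_disk \<in> sets area"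
  by (auto simp: sets_area_iff)

lemma indicator_ball_measurable [measurable]:
  "(\<lambda>z. indicator (ball 0 r) z :: real) \<in> borel_measurable area"
proof -
  have "(indicator (ball 0 r) :: complex \<Rightarrow> real) \<in> borel_measurable borel"
    by (rule borel_measurable_indicator) simp
  moreover have "(\<lambda>z. z) \<in> borel_measurable area"
    by (intro continuous_imp_measurable_area continuous_intros)
  ultimately show ?thesis
    using measurable_compose by blast
qed

text \<open>Rotation by \<open>pi / n\<close> preserves the ball and changes the sign of
  \<open>z ^ n\<close>, so the integral equals its own negative.\<close>

lemma integral_power_ball:
  assumes "0 < n"
  shows "(LINT z|area. indicator (ball 0 r) z *\<^sub>R z ^ n) = (0 :: complex)"
proof -
  have [measurable]: "(\<lambda>z. z) \<in> borel_measurable area"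
    by (intro continuous_imp_measurable_area continuous_intros)
  define c where "c = cis (pi / n)"
  have c: "cmod c = 1" "c ^ n = -1"
  proof -
    have "c ^ n = cis (real n * (pi / n))"
      unfolding c_def by (rule Complex.DeMoivre)
    also have "real n * (pi / n) = pi"
      using assms by simp
    finally show "c ^ n = -1"
      by simp
  qed (simp add: c_def)
  let ?I = "LINT z|area. indicator (ball 0 r) z *\<^sub>R z ^ n :: complex"
  have "(LINT z|area. indicator (ball 0 r) (c * z) *\<^sub>R (c * z) ^ n) = ?I"
    by (rule integral_rotation[OF c(1)]) simp
  also have "(\<lambda>z. indicator (ball 0 r) (c * z) *\<^sub>R (c * z) ^ n :: complex)
      = (\<lambda>z. - (indicator (ball 0 r) z *\<^sub>R z ^ n))"
    using c by (auto simp: fun_eq_iff indicator_def norm_mult power_mult_distrib)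
  finally show ?thesis
    by simp
qed

text \<open>Of the Taylor series, integrated term by term over the ball, only the constant term
  survives. The radius below 1 supplies the absolute convergence that exchanges sum and
  integral.\<close>

lemma mean_value_ball:
  assumes f: "f holomorphic_on unit_disk" and r: "r < 1"
  shows "(LINT z|area. indicator (ball 0 r) z *\<^sub>R f z) = measure area (ball 0 r) *\<^sub>R f 0"
proof -
  define a where "a n = (deriv ^^ n) f 0 / fact n" for n
  have [measurable]: "(\<lambda>z. z) \<in> borel_measurable area"
    by (intro continuous_imp_measurable_area continuous_intros)
  have sums: "(\<lambda>n. a n * z ^ n) sums f z" if "z \<in> unit_disk" for z
    using holomorphic_power_series[OF f that] unfolding a_def by simp
  define s where "s = max r 0"
  have s: "0 \<le> s" "s < 1" "r \<le> s"
    using r by (auto simp: s_def)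
  define t where "t = (s + 1) / 2"
  have t: "s < t" "t < 1" "0 < t"
    using s by (auto simp: t_def)
  have "summable (\<lambda>n. a n * (of_real t) ^ n)"
    using sums[of "of_real t"] t by (auto simp: sums_iff)
  then have summ: "summable (\<lambda>n. cmod (a n) * s ^ n)"
    using powser_insidea[of a "of_real t" "of_real s"] s t by (simp add: norm_mult norm_power)
  let ?F = "\<lambda>n z. indicator (ball 0 r) z *\<^sub>R (a n * z ^ n)"
  have bnd: "cmod (?F n z) \<le> cmod (a n) * s ^ n" for n z
    using s by (auto simp: indicator_def norm_mult norm_power intro!: mult_left_mono power_mono)
  have intF: "integrable area (?F n)" for n
    by (rule integrable_area_bounded[OF _ bnd]) simp
  have "(\<lambda>n. LINT z|area. ?F n z) sums (LINT z|area. (\<Sum>n. ?F n z))"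
  proof (rule sums_integral[OF intF])
    show "AE z in area. summable (\<lambda>n. norm (?F n z))"
      by (intro AE_I2 summable_comparison_test'[OF summ, of 0]) (use bnd in auto)
    show "summable (\<lambda>n. LINT z|area. norm (?F n z))"
    proof (rule summable_comparison_test'[OF summ, of 0])
      show "norm (LINT z|area. norm (?F n z)) \<le> cmod (a n) * s ^ n" for n
        by (rule integral_area_bound) (use bnd in auto)
    qed
  qed
  moreover have "(LINT z|area. (\<Sum>n. ?F n z)) = (LINT z|area. indicator (ball 0 r) z *\<^sub>R f z)"
  proof (rule Bochner_Integration.integral_cong)
    show "(\<Sum>n. ?F n z) = indicator (ball 0 r) z *\<^sub>R f z" if "z \<in> space area" for z
      using sums[of z] that by (cases "z \<in> ball 0 r") (auto simp: sums_iff)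
  qed simp
  moreover have "(\<lambda>n. LINT z|area. ?F n z) = (\<lambda>n. if n = 0 then measure area (ball 0 r) *\<^sub>R f 0 else 0)"
  proof
    fix n
    show "(LINT z|area. ?F n z) = (if n = 0 then measure area (ball 0 r) *\<^sub>R f 0 else 0)"
    proof (cases "n = 0")
      case True
      have "ball 0 r \<inter> unit_disk = ball (0::complex) r"
        using r by auto
      then have "ball 0 r \<in> sets area"
        using ball_sets_area[of r] by simp
      then have "has_bochner_integral area (\<lambda>z. indicator (ball 0 r) z *\<^sub>R f 0)
          (measure area (ball 0 r) *\<^sub>R f 0)"
        by (intro has_bochner_integral_indicator) (simp_all add: less_top[symmetric])
      with True show ?thesis
        using has_bochner_integral_integral_eq by (simp add: a_def)
    next
      case False
      have "(LINT z|area. ?F n z) = (LINT z|area. a n * (indicator (ball 0 r) z *\<^sub>R z ^ n))"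
        by (simp add: algebra_simps)
      also have "\<dots> = a n * (LINT z|area. indicator (ball 0 r) z *\<^sub>R z ^ n)"
        by (rule integral_mult_right_zero)
      finally show ?thesis
        using False by (simp add: integral_power_ball)
    qed
  qed
  ultimately have "(\<lambda>n. if n = 0 then measure area (ball 0 r) *\<^sub>R f 0 else 0)
      sums (LINT z|area. indicator (ball 0 r) z *\<^sub>R f z)"
    by simp
  moreover have "(\<lambda>n. if n = 0 then measure area (ball 0 r) *\<^sub>R f 0 else 0) sums (measure area (ball 0 r) *\<^sub>R f 0)"
    using sums_single[of 0 "\<lambda>_. measure area (ball 0 r) *\<^sub>R f 0"] by (simp add: eq_commute)
  ultimately show ?thesis
    using sums_unique2 by blast
qed

lemma ball_exhaust_tendsto:
  fixes f :: "complex \<Rightarrow> 'b :: {banach, second_countable_topology}"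
  assumes f: "integrable area f"
  shows "(\<lambda>n. LINT z|area. indicator (ball 0 (1 - 1 / Suc n)) z *\<^sub>R f z) \<longlonglongrightarrow> (LINT z|area. f z)"
proof (rule integral_dominated_convergence[where w = "\<lambda>z. norm (f z)"])
  show "AE z in area. (\<lambda>n. indicator (ball 0 (1 - 1 / real (Suc n))) z *\<^sub>R f z) \<longlonglongrightarrow> f z"
  proof (intro AE_I2)
    fix z assume "z \<in> space area"
    then have "cmod z < 1" by simp
    have "(\<lambda>n. 1 - 1 / real (Suc n)) \<longlonglongrightarrow> 1 - 0"
      by (intro tendsto_intros LIMSEQ_Suc lim_1_over_n)
    then have "\<forall>\<^sub>F n in sequentially. cmod z < 1 - 1 / real (Suc n)"
      using \<open>cmod z < 1\<close> by (auto intro: order_tendstoD)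
    then have "\<forall>\<^sub>F n in sequentially. indicator (ball 0 (1 - 1 / real (Suc n))) z *\<^sub>R f z = f z"
      by eventually_elim auto
    then show "(\<lambda>n. indicator (ball 0 (1 - 1 / real (Suc n))) z *\<^sub>R f z) \<longlonglongrightarrow> f z"
      by (rule tendsto_eventually)
  qed
  show "AE z in area. norm (indicator (ball 0 (1 - 1 / real (Suc n))) z *\<^sub>R f z) \<le> norm (f z)" for n
    by (auto simp: indicator_def)
  show "(\<lambda>z. indicator (ball 0 (1 - 1 / real (Suc n))) z *\<^sub>R f z) \<in> borel_measurable area" for n
    using f by measurable
qed (use f in auto)

lemma measure_ball_exhaust: "(\<lambda>n. measure area (ball 0 (1 - 1 / Suc n))) \<longlonglongrightarrow> 1"
proof -
  have "(LINT z|area. indicator (ball 0 (1 - 1 / Suc n)) z *\<^sub>R (1 :: real)) = measure area (ball 0 (1 - 1 / Suc n))" for n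
  proof -
    have "ball 0 (1 - 1 / Suc n) \<inter> unit_disk = (ball 0 (1 - 1 / Suc n) :: complex set)"
      by auto (smt (verit) divide_nonneg_nonneg of_nat_0_le_iff)
    then show ?thesis
      using ball_sets_area[of "1 - 1 / Suc n"] by simp
  qed
  then show ?thesis
    using ball_exhaust_tendsto[of "\<lambda>_. 1 :: real"] by simp
qed

text \<open>Integrability alone gives no uniform convergence of the Taylor series, so the disk is
  exhausted by smaller disks.\<close>

lemma mean_value:
  assumes "f holomorphic_on unit_disk" "integrable area f"
  shows "(LINT z|area. f z) = f 0"
proof -
  have "(\<lambda>n. LINT z|area. indicator (ball 0 (1 - 1 / Suc n)) z *\<^sub>R f z) \<longlonglongrightarrow> 1 *\<^sub>R f 0"
  proof -
    have "(LINT z|area. indicator (ball 0 (1 - 1 / Suc n)) z *\<^sub>R f z)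
        = measure area (ball 0 (1 - 1 / Suc n)) *\<^sub>R f 0" for n
      by (rule mean_value_ball[OF assms(1)]) simp
    then show ?thesis
      using tendsto_scaleR[OF measure_ball_exhaust tendsto_const[of "f 0"]] by simp
  qed
  with ball_exhaust_tendsto[OF assms(2)] show ?thesis
    using LIMSEQ_unique by fastforce
qed

section \<open>The Bergman space and its kernels\<close>

definition berg :: "(complex \<Rightarrow> complex) \<Rightarrow> bergman" where
  "berg f = to_bergman (\<lambda>w. if w \<in> unit_disk then f w else 0)"

definition square_int :: "(complex \<Rightarrow> complex) \<Rightarrow> bool" where
  "square_int f \<longleftrightarrow> f \<in> borel_measurable area \<and> integrable area (\<lambda>z. (cmod (f z))\<^sup>2)"

lemma fun_of_berg:
  assumes "f holomorphic_on unit_disk" "integrable area (\<lambda>z. (cmod (f z))\<^sup>2)"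
  shows "fun_of (berg f) = (\<lambda>w. if w \<in> unit_disk then f w else 0)"
  unfolding berg_def
proof (rule to_bergman_inverse)
  have "integrable area (\<lambda>z. (cmod (if z \<in> unit_disk then f z else 0))\<^sup>2)
      \<longleftrightarrow> integrable area (\<lambda>z. (cmod (f z))\<^sup>2)"
    by (intro Bochner_Integration.integrable_cong) auto
  moreover have "(\<lambda>w. if w \<in> unit_disk then f w else 0) holomorphic_on unit_disk"
    by (rule holomorphic_transform[OF assms(1)]) simp
  ultimately show "(\<lambda>w. if w \<in> unit_disk then f w else 0) \<in> bergman_functions"
    using assms by (simp add: bergman_functions_def)
qed

lemma fun_of_berg_bounded:
  assumes f: "f holomorphic_on unit_disk" and B: "\<And>z. z \<in> unit_disk \<Longrightarrow> cmod (f z) \<le> B"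
  shows "fun_of (berg f) = (\<lambda>w. if w \<in> unit_disk then f w else 0)"
proof (rule fun_of_berg[OF f])
  have "f \<in> borel_measurable area"
    using f by (intro continuous_imp_measurable_area holomorphic_on_imp_continuous_on)
  then show "integrable area (\<lambda>z. (cmod (f z))\<^sup>2)"
    by (intro integrable_area_bounded[where B = "B\<^sup>2"]) (auto intro!: power_mono B)
qed

lemma fun_of_in [simp]: "fun_of f \<in> bergman_functions"
  by (rule fun_of)

lemma holomorphic_fun_of: "fun_of f holomorphic_on unit_disk"
  using fun_of_in[of f] by (simp add: bergman_functions_def)

lemma fun_of_outside: "z \<notin> unit_disk \<Longrightarrow> fun_of f z = 0"
  using fun_of_in[of f] by (simp add: bergman_functions_def)

lemma measurable_fun_of [measurable]: "fun_of f \<in> borel_measurable area"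
  by (rule bergman_measurable[OF fun_of_in])

lemma square_int_fun_of: "square_int (fun_of f)"
  using fun_of_in[of f] by (simp add: square_int_def bergman_functions_def)

lemma fun_of_eqI:
  assumes "\<And>z. z \<in> unit_disk \<Longrightarrow> fun_of f z = fun_of g z" shows "f = g"
proof -
  have "fun_of f = fun_of g"
    using assms fun_of_outside by (metis ext)
  then show ?thesis
    by (simp add: fun_of_inject)
qed

lemmas fun_of_simps = plus_bergman.rep_eq minus_bergman.rep_eq uminus_bergman.rep_eq
  scaleC.rep_eq scaleR_bergman.rep_eq zero_bergman.rep_eq

lemma square_int_mult_integrable:
  assumes "square_int f" "square_int g" shows "integrable area (\<lambda>z. f z * cnj (g z))"
  using L2_inner_integrable assms by (auto simp: square_int_def)

lemma square_int_integrable: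
  assumes "square_int f" shows "integrable area f"
proof -
  have "integrable area (\<lambda>z. f z * cnj 1)"
    by (rule square_int_mult_integrable[OF assms]) (simp add: square_int_def)
  then show ?thesis by simp
qed

lemma square_int_add:
  assumes "square_int f" "square_int g" shows "square_int (\<lambda>z. f z + g z)"
proof -
  have [measurable]: "f \<in> borel_measurable area" "g \<in> borel_measurable area"
    using assms by (auto simp: square_int_def)
  have "integrable area (\<lambda>z. (cmod (f z + g z))\<^sup>2)"
  proof (rule Bochner_Integration.integrable_bound)
    show "integrable area (\<lambda>z. 2 * (cmod (f z))\<^sup>2 + 2 * (cmod (g z))\<^sup>2)"
      using assms by (simp add: square_int_def)
    have "(cmod (f z + g z))\<^sup>2 \<le> 2 * (cmod (f z))\<^sup>2 + 2 * (cmod (g z))\<^sup>2" for z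
    proof -
      have "(cmod (f z + g z))\<^sup>2 \<le> (cmod (f z) + cmod (g z))\<^sup>2"
        by (intro power_mono norm_triangle_ineq) simp
      then show ?thesis
        using sum_squares_bound[of "cmod (f z)" "cmod (g z)"] by (simp add: power2_sum)
    qed
    then show "AE z in area. norm ((cmod (f z + g z))\<^sup>2)
        \<le> norm (2 * (cmod (f z))\<^sup>2 + 2 * (cmod (g z))\<^sup>2)"
      by auto
  qed simp
  then show ?thesis
    by (simp add: square_int_def)
qed

lemma square_int_mult:
  assumes "u \<in> borel_measurable area" "\<And>z. z \<in> unit_disk \<Longrightarrow> cmod (u z) \<le> B" "square_int f"
  shows "square_int (\<lambda>z. u z * f z)"
proof -
  have [measurable]: "f \<in> borel_measurable area" "u \<in> borel_measurable area"
    using assms by (auto simp: square_int_def)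
  have "integrable area (\<lambda>z. (cmod (u z * f z))\<^sup>2)"
  proof (rule Bochner_Integration.integrable_bound)
    show "integrable area (\<lambda>z. B\<^sup>2 * (cmod (f z))\<^sup>2)"
      using assms by (simp add: square_int_def)
    have "(cmod (u z * f z))\<^sup>2 \<le> B\<^sup>2 * (cmod (f z))\<^sup>2" if "z \<in> unit_disk" for z
      unfolding norm_mult power_mult_distrib using assms(2)[OF that]
      by (intro mult_right_mono power_mono) auto
    then show "AE z in area. norm ((cmod (u z * f z))\<^sup>2) \<le> norm (B\<^sup>2 * (cmod (f z))\<^sup>2)"
      by (intro AE_I2) auto
  qed simp
  then show ?thesis
    by (simp add: square_int_def)
qed

lemma cinner_eq: "cinner f g = (LINT z|area. fun_of f z * cnj (fun_of g z))"
  by (simp add: cinner.rep_eq L2_inner_def)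

lemma cinner_cnj: "cinner f g = cnj (cinner g f)"
  unfolding cinner_eq by (subst Bochner_Integration.integral_cnj[symmetric]) (simp add: mult.commute)

lemma norm_sq_eq: "(norm f)\<^sup>2 = (LINT z|area. (cmod (fun_of f z))\<^sup>2)"
proof -
  have "complex_of_real ((norm f)\<^sup>2) = cinner f f"
    using arg_cong[where f = Im, OF cinner_cnj[of f f]]
    by (simp add: power2_norm_eq_inner inner_bergman_def complex_eq_iff)
  also have "\<dots> = of_real (LINT z|area. (cmod (fun_of f z))\<^sup>2)"
    unfolding cinner_eq complex_norm_square[symmetric] of_real_power[symmetric]
    by (simp del: of_real_power)
  finally show ?thesis
    by (simp only: of_real_eq_iff)
qed

lemma cinner_self: "cinner f f = of_real ((norm f)\<^sup>2)"
  unfolding norm_sq_eq cinner_eq complex_norm_square[symmetric] of_real_power[symmetric]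
  by (simp del: of_real_power)

lemma cinner_add_left: "cinner (f + g) h = cinner f h + cinner g h"
  by (simp add: cinner_eq fun_of_simps distrib_right bergman_inner_integrable)

lemma cinner_scaleC_left: "cinner (scaleC c f) h = c * cinner f h"
  by (simp add: cinner_eq fun_of_simps mult.assoc)

lemma cinner_scaleC_right: "cinner f (scaleC c h) = cnj c * cinner f h"
  by (metis cinner_cnj cinner_scaleC_left complex_cnj_mult)

lemma cinner_add_right: "cinner h (f + g) = cinner h f + cinner h g"
  by (metis cinner_add_left cinner_cnj complex_cnj_add)

lemma norm_scaleC: "norm (scaleC c f) = cmod c * norm f"
proof -
  have "complex_of_real ((norm (scaleC c f))\<^sup>2) = of_real ((cmod c * norm f)\<^sup>2)"
    unfolding cinner_self[symmetric] cinner_scaleC_left cinner_scaleC_right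
    using complex_norm_square[of c] by (simp add: cinner_self power_mult_distrib)
  then show ?thesis
    by (simp only: of_real_eq_iff power2_eq_iff_nonneg norm_ge_zero mult_nonneg_nonneg)
qed

lemma norm_cinner_le: "cmod (cinner f g) \<le> norm f * norm g"
proof (cases "cinner f g = 0")
  case False
  define c where "c = cnj (cinner f g) / cmod (cinner f g)"
  have c: "cmod c = 1" "c * cinner f g = of_real (cmod (cinner f g))"
  proof -
    have "cinner f g * cnj (cinner f g) = of_real (cmod (cinner f g)) * of_real (cmod (cinner f g))"
      unfolding complex_norm_square[symmetric] by (simp add: power2_eq_square)
    then show "cmod c = 1" "c * cinner f g = of_real (cmod (cinner f g))"
      using False by (simp_all add: c_def norm_divide mult.commute)
  qed
  have "cmod (cinner f g) = inner (scaleC c f) g"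
    unfolding inner_bergman_def cinner_scaleC_left c(2) by simp
  also have "\<dots> \<le> norm (scaleC c f) * norm g"
    by (rule norm_cauchy_schwarz)
  finally show ?thesis
    by (simp add: norm_scaleC c)
qed simp

lemma scaleR_eq_scaleC: "r *\<^sub>R f = scaleC (of_real r) f" for f :: bergman
  by (rule fun_of_eqI) (simp add: fun_of_simps)

lemma bounded_bilinear_cinner: "bounded_bilinear cinner"
proof (rule bounded_bilinear.intro)
  show "\<exists>K. \<forall>a b. norm (cinner a b) \<le> norm a * norm b * K"
    by (rule exI[of _ 1]) (simp add: norm_cinner_le)
qed (simp_all add: cinner_add_left cinner_add_right scaleR_eq_scaleC cinner_scaleC_left
    cinner_scaleC_right scaleR_conv_of_real)

interpretation cinner: bounded_bilinear cinner
  by (rule bounded_bilinear_cinner)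

lemma bounded_linear_scaleC_right: "bounded_linear (scaleC c)"
proof (rule bounded_linear_intro[of _ "cmod c"])
  show "scaleC c (f + g) = scaleC c f + scaleC c g" for f g
    by (rule fun_of_eqI) (simp add: fun_of_simps distrib_left)
  show "scaleC c (r *\<^sub>R f) = r *\<^sub>R scaleC c f" for r f
    by (rule fun_of_eqI) (simp add: fun_of_simps)
qed (simp add: norm_scaleC mult.commute)

lemma bounded_bilinear_scaleC: "bounded_bilinear scaleC"
proof (rule bounded_bilinear.intro)
  show "\<exists>K. \<forall>a b. norm (scaleC a b) \<le> norm a * norm b * K"
    by (rule exI[of _ 1]) (simp add: norm_scaleC)
qed (rule fun_of_eqI, simp add: fun_of_simps algebra_simps scaleR_conv_of_real)+

lemma norm_one_minus_cnj_mult_ge: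
  assumes "z \<in> unit_disk" "w \<in> unit_disk"
  shows "1 - cmod z \<le> cmod (1 - cnj z * w)" "1 - cmod w \<le> cmod (1 - cnj z * w)"
proof -
  have "cmod (cnj z * w) \<le> cmod z * 1" "cmod (cnj z * w) \<le> 1 * cmod w"
    unfolding norm_mult using assms by (intro mult_mono; simp)+
  then show "1 - cmod z \<le> cmod (1 - cnj z * w)" "1 - cmod w \<le> cmod (1 - cnj z * w)"
    using norm_triangle_ineq2[of 1 "cnj z * w"] by auto
qed

text \<open>The i-th derivative of the reproducing kernel \<open>1 / (1 - cnj w * x) ^ 2\<close>
  with respect to \<open>cnj w\<close>; pairing with it evaluates the i-th derivative at w
  (\<open>cinner_kern_deriv\<close>).\<close>

definition kern :: "nat \<Rightarrow> complex \<Rightarrow> bergman" where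
  "kern i w = berg (\<lambda>x. fact (Suc i) * x ^ i / (1 - cnj w * x) ^ (i + 2))"

lemma kern_bound:
  assumes "w \<in> unit_disk" "x \<in> unit_disk"
  shows "cmod (fact (Suc i) * x ^ i / (1 - cnj w * x) ^ (i + 2)) \<le> fact (Suc i) / (1 - cmod w) ^ (i + 2)"
  unfolding norm_divide norm_mult norm_power norm_fact
  using assms norm_one_minus_cnj_mult_ge[OF assms]
  by (intro frac_le power_mono mult_left_le) (auto intro: power_le_one simp del: fact_Suc)

lemma fun_of_kern:
  assumes "w \<in> unit_disk"
  shows "fun_of (kern i w) = (\<lambda>x. if x \<in> unit_disk
    then fact (Suc i) * x ^ i / (1 - cnj w * x) ^ (i + 2) else 0)"
  unfolding kern_def
proof (rule fun_of_berg_bounded)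
  show "(\<lambda>x. fact (Suc i) * x ^ i / (1 - cnj w * x) ^ (i + 2)) holomorphic_on unit_disk"
    by (intro holomorphic_intros) (use one_minus_cnj_mult_nonzero[OF assms] in auto)
qed (rule kern_bound[OF assms])

lemma bkern_holomorphic: "z \<in> unit_disk \<Longrightarrow> bkern z holomorphic_on unit_disk"
  unfolding bkern_def
  by (intro holomorphic_intros) (use one_minus_cnj_mult_nonzero in auto)

lemma norm_bkern_le:
  assumes "z \<in> unit_disk" "x \<in> unit_disk"
  shows "cmod (bkern z x) \<le> (1 - (cmod z)\<^sup>2) / (1 - cmod z)\<^sup>2"
  unfolding bkern_def norm_divide norm_power norm_of_real
  using assms norm_one_minus_cnj_mult_ge[OF assms] one_minus_norm_sq_pos[OF assms(1)]
  by (intro frac_le power_mono) auto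

lemma normalized_kernel_eq: "normalized_kernel z = berg (bkern z)"
  unfolding normalized_kernel_def berg_def bkern_def ..

lemma fun_of_normalized_kernel_eq:
  assumes "z \<in> unit_disk"
  shows "fun_of (normalized_kernel z) = (\<lambda>x. if x \<in> unit_disk then bkern z x else 0)"
  unfolding normalized_kernel_eq
  by (rule fun_of_berg_bounded[OF bkern_holomorphic norm_bkern_le]) (use assms in auto)

lemma normalized_kernel_kern:
  assumes "z \<in> unit_disk"
  shows "normalized_kernel z = scaleC (of_real (1 - (cmod z)\<^sup>2)) (kern 0 z)"
  by (rule fun_of_eqI) (use assms in \<open>simp add: fun_of_normalized_kernel_eq fun_of_kern fun_of_simps
      bkern_def power2_eq_square\<close>)

section \<open>Unitary operators that implement the automorphisms\<close>

lemma bkern_mult_bkern: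
  assumes "z \<in> unit_disk" "x \<in> unit_disk"
  shows "bkern z x * bkern z (disk_aut z x) = 1"
proof -
  have "1 - cnj z * x \<noteq> 0" "complex_of_real (1 - (cmod z)\<^sup>2) \<noteq> 0"
    using one_minus_cnj_mult_nonzero[OF assms] one_minus_norm_sq_pos[OF assms(1)]
    by (auto simp del: of_real_diff)
  then show ?thesis
    unfolding bkern_def one_minus_cnj_disk_aut[OF assms]
    by (simp add: power_divide power2_eq_square del: of_real_diff)
qed

text \<open>Since \<open>bkern z\<close> is minus the derivative of \<open>disk_aut z\<close>, this
  is an isometry; by \<open>bkern_mult_bkern\<close> it is an involution, hence unitary and its own
  inverse.\<close>

definition disk_unitary :: "complex \<Rightarrow> bergman \<Rightarrow> bergman" where
  "disk_unitary z f = berg (\<lambda>x. bkern z x * fun_of f (disk_aut z x))"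

lemma square_int_transform:
  assumes z: "z \<in> unit_disk" and f: "square_int f"
  shows "square_int (\<lambda>x. bkern z x * f (disk_aut z x))"
proof -
  have [measurable]: "f \<in> borel_measurable area" "bkern z \<in> borel_measurable area"
    "disk_aut z \<in> area \<rightarrow>\<^sub>M area"
    using f z continuous_imp_measurable_area[OF continuous_on_bkern] measurable_disk_aut
    by (auto simp: square_int_def)
  have "integrable area (\<lambda>x. (cmod (f x))\<^sup>2)"
    using f by (simp add: square_int_def)
  then have "integrable area (\<lambda>x. (cmod (bkern z x * f (disk_aut z x)))\<^sup>2)"
    by (subst (asm) disk_change.integrable_change[OF disk_change_disk_aut[OF z]])
      (auto simp: norm_mult power_mult_distrib)
  then show ?thesis
    by (simp add: square_int_def)
qed

lemma fun_of_disk_unitary: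
  assumes z: "z \<in> unit_disk"
  shows "fun_of (disk_unitary z f)
    = (\<lambda>x. if x \<in> unit_disk then bkern z x * fun_of f (disk_aut z x) else 0)"
  unfolding disk_unitary_def
proof (rule fun_of_berg)
  have "(fun_of f \<circ> disk_aut z) holomorphic_on unit_disk"
    by (rule holomorphic_on_compose_gen[OF holomorphic_disk_aut holomorphic_fun_of])
      (use z disk_aut_in_disk in auto)
  then show "(\<lambda>x. bkern z x * fun_of f (disk_aut z x)) holomorphic_on unit_disk"
    by (intro holomorphic_intros bkern_holomorphic z) (simp add: o_def)
  show "integrable area (\<lambda>x. (cmod (bkern z x * fun_of f (disk_aut z x)))\<^sup>2)"
    using square_int_transform[OF z square_int_fun_of] by (simp add: square_int_def)
qed

lemma L2_inner_transform:
  assumes z: "z \<in> unit_disk" and [measurable]: "f \<in> borel_measurable area" "g \<in> borel_measurable area"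
  shows "L2_inner (\<lambda>x. bkern z x * f (disk_aut z x)) (\<lambda>x. bkern z x * g (disk_aut z x)) = L2_inner f g"
proof -
  have [measurable]: "cnj \<in> borel_measurable borel"
    by (intro borel_measurable_continuous_onI continuous_intros)
  have "L2_inner f g = (LINT x|area. (cmod (- bkern z x))\<^sup>2 *\<^sub>R (f (disk_aut z x) * cnj (g (disk_aut z x))))"
    unfolding L2_inner_def
    by (rule disk_change.integral_change[OF disk_change_disk_aut[OF z]]) simp
  also have "\<dots> = L2_inner (\<lambda>x. bkern z x * f (disk_aut z x)) (\<lambda>x. bkern z x * g (disk_aut z x))"
    unfolding L2_inner_def scaleR_conv_of_real
    by (simp del: of_real_power add: complex_norm_square algebra_simps of_real_power[symmetric])
  finally show ?thesis ..
qed

lemma cinner_disk_unitary: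
  assumes "z \<in> unit_disk" shows "cinner (disk_unitary z f) (disk_unitary z g) = cinner f g"
proof -
  have "cinner (disk_unitary z f) (disk_unitary z g)
      = L2_inner (\<lambda>x. bkern z x * fun_of f (disk_aut z x)) (\<lambda>x. bkern z x * fun_of g (disk_aut z x))"
    unfolding cinner_eq L2_inner_def fun_of_disk_unitary[OF assms]
    by (rule Bochner_Integration.integral_cong) auto
  also have "\<dots> = L2_inner (fun_of f) (fun_of g)"
    by (rule L2_inner_transform) (use assms in auto)
  finally show ?thesis
    by (simp only: cinner.rep_eq)
qed

lemma norm_disk_unitary: "z \<in> unit_disk \<Longrightarrow> norm (disk_unitary z f) = norm f"
  using cinner_disk_unitary[of z f f] by (simp add: norm_bergman_def inner_bergman_def)

lemma disk_unitary_involution: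
  assumes z: "z \<in> unit_disk" shows "disk_unitary z (disk_unitary z f) = f"
proof (rule fun_of_eqI)
  fix x assume x: "x \<in> unit_disk"
  then show "fun_of (disk_unitary z (disk_unitary z f)) x = fun_of f x"
    using bkern_mult_bkern[OF z x] disk_aut_in_disk[OF z x] disk_aut_involution[OF z x] z
    by (simp add: fun_of_disk_unitary mult.assoc[symmetric])
qed

lemma disk_unitary_one:
  assumes "z \<in> unit_disk" shows "disk_unitary z (kern 0 0) = normalized_kernel z"
  by (rule fun_of_eqI) (use assms disk_aut_in_disk in
      \<open>simp add: fun_of_disk_unitary fun_of_kern fun_of_normalized_kernel_eq\<close>)

lemma cinner_one: "cinner f (kern 0 0) = fun_of f 0"
proof -
  have "cinner f (kern 0 0) = (LINT x|area. fun_of f x)"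
    unfolding cinner_eq by (rule Bochner_Integration.integral_cong) (auto simp: fun_of_kern)
  also have "\<dots> = fun_of f 0"
    by (rule mean_value[OF holomorphic_fun_of square_int_integrable[OF square_int_fun_of]])
  finally show ?thesis .
qed

text \<open>The unitary carries the constant 1 to the normalized kernel, so evaluation at z reduces
  to evaluation at 0, which is the mean value property.\<close>

lemma cinner_normalized_kernel:
  assumes z: "z \<in> unit_disk"
  shows "cinner f (normalized_kernel z) = of_real (1 - (cmod z)\<^sup>2) * fun_of f z"
proof -
  have "cinner f (normalized_kernel z) = cinner (disk_unitary z (disk_unitary z f)) (disk_unitary z (kern 0 0))"
    by (simp only: disk_unitary_involution[OF z] disk_unitary_one[OF z])
  also have "\<dots> = fun_of (disk_unitary z f) 0"
    by (simp only: cinner_disk_unitary[OF z] cinner_one)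
  also have "\<dots> = of_real (1 - (cmod z)\<^sup>2) * fun_of f z"
    by (simp add: fun_of_disk_unitary[OF z] bkern_def)
  finally show ?thesis .
qed

lemma cinner_kern:
  assumes z: "z \<in> unit_disk" shows "cinner f (kern 0 z) = fun_of f z"
proof -
  have "complex_of_real (1 - (cmod z)\<^sup>2) \<noteq> 0"
    using one_minus_norm_sq_pos[OF z] by (simp del: of_real_diff)
  moreover have "complex_of_real (1 - (cmod z)\<^sup>2) * cinner f (kern 0 z) = of_real (1 - (cmod z)\<^sup>2) * fun_of f z"
    using cinner_normalized_kernel[OF z, of f] unfolding normalized_kernel_kern[OF z]
    by (simp add: cinner_scaleC_right)
  ultimately show ?thesis
    by (metis mult_cancel_left)
qed

lemma norm_normalized_kernel [simp]: "z \<in> unit_disk \<Longrightarrow> norm (normalized_kernel z) = 1"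
proof -
  assume z: "z \<in> unit_disk"
  have "complex_of_real ((norm (kern 0 0))\<^sup>2) = 1"
    unfolding cinner_self[symmetric] by (simp add: cinner_one fun_of_kern)
  then have "(norm (kern 0 0))\<^sup>2 = 1"
    by (simp only: of_real_eq_1_iff)
  then have "norm (kern 0 0) = 1"
    using norm_ge_zero[of "kern 0 0"] unfolding power2_eq_1_iff by linarith
  then show ?thesis
    by (simp only: disk_unitary_one[OF z, symmetric] norm_disk_unitary[OF z])
qed

lemma norm_fun_of_le:
  assumes z: "z \<in> unit_disk" shows "cmod (fun_of f z) \<le> norm f / (1 - (cmod z)\<^sup>2)"
proof -
  have "(1 - (cmod z)\<^sup>2) * cmod (fun_of f z) = cmod (cinner f (normalized_kernel z))"
    using one_minus_norm_sq_pos[OF z] unfolding cinner_normalized_kernel[OF z] norm_mult by (simp del: of_real_diff)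
  also have "\<dots> \<le> norm f"
    using norm_cinner_le[of f "normalized_kernel z"] z by simp
  finally show ?thesis
    using one_minus_norm_sq_pos[OF z] by (simp add: field_simps)
qed

text \<open>The normalized kernel is the unitary image of the constant 1, and this is the image of
  the coordinate function. The two families together express the invariant Laplacian of a Berezin
  transform (\<open>laplacian_berezin\<close>); under \<open>disk_unitary z\<close> both change only
  by moving w to \<open>disk_aut z w\<close> and by a unimodular factor.\<close>

definition aut_kernel :: "complex \<Rightarrow> bergman" where
  "aut_kernel w = disk_unitary w (berg (\<lambda>x. x))"

lemma fun_of_coord: "fun_of (berg (\<lambda>x. x)) = (\<lambda>x. if x \<in> unit_disk then x else 0)"
  by (rule fun_of_berg_bounded[where B = 1]) (auto intro: holomorphic_intros)

lemma fun_of_aut_kernel: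
  assumes "w \<in> unit_disk"
  shows "fun_of (aut_kernel w) = (\<lambda>x. if x \<in> unit_disk then bkern w x * disk_aut w x else 0)"
  unfolding aut_kernel_def fun_of_disk_unitary[OF assms]
  using disk_aut_in_disk[OF assms] by (auto simp: fun_of_coord fun_eq_iff)

text \<open>The unimodular factor by which the image of the normalized kernel at w under
  \<open>disk_unitary z\<close> differs from the kernel at \<open>disk_aut z w\<close>.\<close>

definition kern_phase :: "complex \<Rightarrow> complex \<Rightarrow> complex" where
  "kern_phase z w = (cmod (1 - cnj w * z))\<^sup>2 / (1 - cnj w * z)\<^sup>2"

lemma norm_kern_phase: "z \<in> unit_disk \<Longrightarrow> w \<in> unit_disk \<Longrightarrow> cmod (kern_phase z w) = 1"
  using one_minus_cnj_mult_nonzero[of w z] by (simp add: kern_phase_def norm_divide norm_power)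

lemma bkern_disk_aut:
  assumes z: "z \<in> unit_disk" and w: "w \<in> unit_disk" and x: "x \<in> unit_disk"
  shows "bkern z x * bkern w (disk_aut z x) = kern_phase z w * bkern (disk_aut z w) x"
proof -
  define Q where "Q = 1 - cnj w * z"
  define N :: complex where "N = of_real (cmod Q)"
  define R where "R = 1 - cnj (disk_aut z w) * x"
  have N: "N \<noteq> 0" "Q \<noteq> 0" "R \<noteq> 0"
    using one_minus_cnj_mult_nonzero[OF w z] one_minus_cnj_mult_nonzero[OF disk_aut_in_disk[OF z w] x]
    by (auto simp: N_def Q_def R_def)
  have "cmod (1 - cnj z * w) = cmod (cnj (1 - cnj w * z))"
    by (simp add: mult.commute)
  then have NN: "of_real (cmod (1 - cnj z * w)) = N"
    unfolding complex_mod_cnj N_def Q_def by simp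
  have a: "of_real (1 - (cmod (disk_aut z w))\<^sup>2) = of_real (1 - (cmod z)\<^sup>2) * of_real (1 - (cmod w)\<^sup>2) / N\<^sup>2"
    unfolding one_minus_norm_disk_aut[OF z w] of_real_divide of_real_mult of_real_power NN by simp
  have "bkern z x * bkern w (disk_aut z x) = of_real (1 - (cmod z)\<^sup>2) * of_real (1 - (cmod w)\<^sup>2) /
      ((1 - cnj w * disk_aut z x) * (1 - cnj z * x))\<^sup>2"
    unfolding bkern_def by (simp add: power_mult_distrib mult.commute)
  also have "\<dots> = of_real (1 - (cmod z)\<^sup>2) * of_real (1 - (cmod w)\<^sup>2) / (Q * R)\<^sup>2"
    unfolding one_minus_cnj_disk_aut_mult[OF z w x] Q_def R_def ..
  also have "\<dots> = kern_phase z w * bkern (disk_aut z w) x"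
    unfolding bkern_def a kern_phase_def of_real_power Q_def[symmetric] R_def[symmetric] N_def[symmetric]
    using N by (simp add: power_mult_distrib del: of_real_diff)
  finally show ?thesis .
qed

lemma disk_unitary_normalized_kernel:
  assumes z: "z \<in> unit_disk" and w: "w \<in> unit_disk"
  shows "disk_unitary z (normalized_kernel w)
    = scaleC (kern_phase z w) (normalized_kernel (disk_aut z w))"
  by (rule fun_of_eqI)
    (use z w disk_aut_in_disk[OF z] in \<open>simp add: fun_of_disk_unitary fun_of_normalized_kernel_eq
        fun_of_simps bkern_disk_aut\<close>)

lemma disk_unitary_aut_kernel:
  assumes z: "z \<in> unit_disk" and w: "w \<in> unit_disk"
  shows "disk_unitary z (aut_kernel w)
    = scaleC (- kern_phase z w * aut_phase z w) (aut_kernel (disk_aut z w))"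
  by (rule fun_of_eqI)
    (use z w disk_aut_in_disk[OF z] in \<open>simp add: fun_of_disk_unitary fun_of_aut_kernel
        fun_of_simps bkern_disk_aut disk_aut_compose mult.assoc[symmetric]\<close>)

section \<open>Forelli--Rudin estimates and the Bergman projection\<close>

text \<open>Dyadic layers: where \<open>X\<close> lies between \<open>2 powr (- n - 1)\<close> and
  \<open>2 powr (- n)\<close> the integrand is at most \<open>2 powr (g * (n + 1))\<close>, on a set
  of measure at most \<open>C * 2 powr (- n)\<close>; as \<open>g < 1\<close>, the resulting
  geometric series converges.\<close>

lemma nn_integral_inverse_powr_finite:
  fixes X :: "'a \<Rightarrow> real"
  assumes [measurable]: "X \<in> borel_measurable M" and g: "0 < g" "g < 1"
    and X: "\<And>z. z \<in> space M \<Longrightarrow> 0 \<le> X z" "\<And>z. z \<in> space M \<Longrightarrow> X z \<le> 1"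
    and C: "0 \<le> C" "\<And>t. 0 \<le> t \<Longrightarrow> t \<le> 1 \<Longrightarrow> emeasure M {z \<in> space M. X z \<le> t} \<le> ennreal (C * t)"
  shows "(\<integral>\<^sup>+z. inverse (ennreal (X z powr g)) \<partial>M) < \<infinity>"
proof -
  let ?S = "\<lambda>n. {z \<in> space M. X z \<le> (1/2) ^ n}"
  let ?c = "\<lambda>n. ennreal (2 powr (g * (real n + 1)))"
  have "inverse (ennreal (X z powr g)) \<le> (\<Sum>n. ?c n * indicator (?S n) z)" if z: "z \<in> space M" for z
  proof (cases "X z = 0")
    case True
    \<comment> \<open>At a zero of \<open>X\<close> the inverse is \<open>top\<close>, so the
      majorizing series has to diverge there.\<close>
    have "(\<Sum>n. ?c n * indicator (?S n) z) = (\<Sum>n. ?c n)"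
      using z True by simp
    also have "(\<Sum>n. ?c n) = top"
    proof (rule ccontr)
      assume "(\<Sum>n. ?c n) \<noteq> top"
      then have "summable (\<lambda>n. 2 powr (g * (real n + 1)))"
        by (intro summable_suminf_not_top) auto
      then have "\<forall>\<^sub>F n in sequentially. 2 powr (g * (real n + 1)) < 1"
        using summable_LIMSEQ_zero order_tendstoD(2) zero_less_one by blast
      moreover have "1 \<le> 2 powr (g * (real n + 1))" for n
        using g by (intro ge_one_powr_ge_zero) auto
      ultimately show False
        by (meson eventually_sequentially linorder_not_less order_refl)
    qed
    finally show ?thesis by simp
  next
    case False
    then have pos: "0 < X z"
      using X(1)[OF z] by simp
    define n where "n = nat \<lfloor>- log 2 (X z)\<rfloor>"
    have l0: "0 \<le> - log 2 (X z)"
      using pos X(2)[OF z] by simp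
    have n: "real n \<le> - log 2 (X z)" "- log 2 (X z) < real n + 1"
      unfolding n_def using l0 by linarith+
    have "X z = 2 powr (log 2 (X z))"
      using pos by simp
    also have "\<dots> \<le> 2 powr (- real n)"
      using n by (intro powr_mono) auto
    finally have "z \<in> ?S n"
      using z by (simp add: powr_minus powr_realpow power_divide field_simps)
    have "inverse (X z powr g) = (2 powr log 2 (X z)) powr (- g)"
      using pos by (simp add: powr_minus)
    also have "\<dots> = 2 powr (g * (- log 2 (X z)))"
      by (simp only: powr_powr mult_minus_right mult_minus_left mult.commute)
    also have "\<dots> \<le> 2 powr (g * (real n + 1))"
      using n g by (intro powr_mono mult_left_mono) auto
    finally have "inverse (ennreal (X z powr g)) \<le> ?c n"
      using pos by (simp add: inverse_ennreal ennreal_leI)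
    also have "\<dots> = ?c n * indicator (?S n) z"
      using \<open>z \<in> ?S n\<close> by simp
    also have "\<dots> \<le> (\<Sum>n. ?c n * indicator (?S n) z)"
    proof -
      define f where "f = (\<lambda>n. ?c n * indicator (?S n) z)"
      have "f n \<le> suminf f"
        using sum_le_suminf[of f "{n}"] by simp
      then show ?thesis
        unfolding f_def .
    qed
    finally show ?thesis .
  qed
  then have "(\<integral>\<^sup>+z. inverse (ennreal (X z powr g)) \<partial>M) \<le> (\<integral>\<^sup>+z. (\<Sum>n. ?c n * indicator (?S n) z) \<partial>M)"
    by (rule nn_integral_mono)
  also have "\<dots> = (\<Sum>n. \<integral>\<^sup>+z. ?c n * indicator (?S n) z \<partial>M)"
    by (rule nn_integral_suminf) simp
  also have "\<dots> = (\<Sum>n. ?c n * emeasure M (?S n))"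
    by (simp add: nn_integral_cmult_indicator)
  also have "\<dots> \<le> (\<Sum>n. ennreal (C * 2 powr g * (2 powr (g - 1)) ^ n))"
  proof (intro suminf_le)
    fix n
    have "?c n * emeasure M (?S n) \<le> ?c n * ennreal (C * (1/2) ^ n)"
      by (intro mult_left_mono C) (auto simp: power_le_one)
    also have "\<dots> = ennreal (C * (2 powr (g * (real n + 1)) * (1/2) ^ n))"
      using C by (simp add: ennreal_mult[symmetric] algebra_simps)
    also have "2 powr (g * (real n + 1)) * (1/2) ^ n = 2 powr g * (2 powr (g - 1)) ^ n"
      by (simp add: powr_realpow[symmetric] powr_powr powr_add[symmetric] powr_diff power_divide
          algebra_simps flip: powr_realpow)
    finally show "?c n * emeasure M (?S n) \<le> ennreal (C * 2 powr g * (2 powr (g - 1)) ^ n)"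
      by (simp add: mult.assoc)
  qed auto
  also have "\<dots> < \<infinity>"
  proof -
    have "2 powr (g - 1) < 1"
      using g by (simp add: powr_less_one)
    then have "summable (\<lambda>n. C * 2 powr g * (2 powr (g - 1)) ^ n)"
      by (intro summable_mult summable_geometric) auto
    then show ?thesis
      using C by (subst suminf_ennreal2) auto
  qed
  finally show ?thesis .
qed

lemma inverse_powr_antimono:
  assumes "0 \<le> x" "x \<le> y" "0 < g"
  shows "inverse (ennreal (y powr g)) \<le> inverse (ennreal (x powr g))"
  using assms by (cases "x = 0") (auto simp: inverse_ennreal powr_mono2 intro!: ennreal_leI le_imp_inverse_le)

text \<open>For nonzero x the left side is the distance from 1 to the real line through 0 and
  x.\<close>

lemma norm_one_minus_ge_Im_sgn: "\<bar>Im (sgn x)\<bar> \<le> cmod (1 - x)"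
proof (cases "x = 0")
  case False
  define s where "s = sgn x"
  have s: "cmod s = 1" "x = of_real (cmod x) * s"
    using False by (simp add: s_def norm_sgn, simp add: s_def sgn_div_norm scaleR_conv_of_real)
  then have "cnj s * s = 1"
    using complex_norm_square[of s] by (simp add: mult.commute)
  then have "cnj s * (1 - x) = cnj s - of_real (cmod x)"
    by (subst s(2)) (simp add: algebra_simps)
  then have "cmod (1 - x) = cmod (cnj s - of_real (cmod x))"
    using s(1) by (metis complex_mod_cnj mult_1 norm_mult)
  also have "\<bar>Im (cnj s - of_real (cmod x))\<bar> \<le> \<dots>"
    by (rule abs_Im_le_cmod)
  finally show ?thesis
    by (simp add: s_def)
qed simp

lemma measurable_id_area [measurable]: "(\<lambda>z. z) \<in> area \<rightarrow>\<^sub>M borel"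
  by (intro continuous_imp_measurable_area continuous_intros)

lemma measurable_cnj [measurable]: "cnj \<in> borel_measurable borel"
  by (intro borel_measurable_continuous_onI continuous_intros)

lemma measurable_Im [measurable]: "Im \<in> borel_measurable borel"
  by (intro borel_measurable_continuous_onI continuous_intros)

text \<open>One integrable function that dominates, after a rotation depending on z, all kernels
  \<open>(1 - |x|^2) powr (- a) * |1 - cnj z * x| powr (- b)\<close> with \<open>a + b = 7/4\<close>
  and \<open>0 \<le> a \<le> 7/8\<close>. The total exponent is split evenly between the distance to
  the circle and the angle; 7/8 is below 1, so each factor is integrable. The value 7/4 arises as
  \<open>a + (2 - 2 * a)\<close> for \<open>a = 1/4\<close> in \<open>forelli_rudin\<close> and as
  \<open>3/4 + 1\<close> in \<open>kernel_image_bound\<close>.\<close>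

definition majorant :: "complex \<Rightarrow> ennreal" where
  "majorant z = inverse (ennreal ((1 - cmod z) powr (7/8))) * inverse (ennreal (\<bar>Im (sgn z)\<bar> powr (7/8)))"

lemma measurable_majorant [measurable]: "majorant \<in> borel_measurable borel"
  unfolding majorant_def[abs_def] by measurable

lemma emeasure_area_collar:
  assumes "0 \<le> t" "t \<le> 1"
  shows "emeasure area {z \<in> space area. 1 - cmod z \<le> t} \<le> ennreal (2 * t)"
proof -
  have e: "{z \<in> space area. 1 - cmod z \<le> t} = unit_disk - ball 0 (1 - t)"
    using assms by auto
  have sub: "ball 0 (1 - t) \<subseteq> (unit_disk :: complex set)"
    using assms by auto
  have b: "emeasure area (ball 0 (1 - t)) = ennreal ((1 - t)\<^sup>2)"
  proof -
    have "emeasure lborel (ball (0::complex) (1 - t)) = ennreal (pi * (1 - t)\<^sup>2)"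
      using assms by (subst emeasure_ball) (simp_all add: unit_ball_vol_2)
    then show ?thesis
      using sub emeasure_area[of "ball 0 (1 - t)"]
      by (simp add: sets_area_iff ennreal_mult[symmetric])
  qed
  have "emeasure area (unit_disk - ball 0 (1 - t)) = emeasure area unit_disk - emeasure area (ball 0 (1 - t))"
    using sub by (intro emeasure_Diff) (auto simp: sets_area_iff b)
  also have "\<dots> = ennreal (1 - (1 - t)\<^sup>2)"
    using prob_space_area assms by (simp add: b ennreal_minus flip: ennreal_1)
  also have "\<dots> \<le> ennreal (2 * t)"
    by (intro ennreal_leI) (simp add: power2_eq_square algebra_simps)
  finally show ?thesis
    unfolding e .
qed

lemma emeasure_area_strip:
  assumes "0 \<le> t" "t \<le> 1"
  shows "emeasure area {z \<in> space area. \<bar>Im z\<bar> \<le> t} \<le> ennreal (4 / pi * t)"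
proof -
  have s: "{z \<in> space area. \<bar>Im z\<bar> \<le> t} \<in> sets area"
    by measurable
  have "emeasure lebesgue {z \<in> space area. \<bar>Im z\<bar> \<le> t} \<le> emeasure lebesgue (cbox (Complex (-1) (-t)) (Complex 1 t))"
    by (rule emeasure_mono) (auto simp: in_cbox_complex_iff abs_le_iff
        dest: order_trans[OF abs_Re_le_cmod less_imp_le] intro: order_trans[OF minus_le_iff[THEN iffD1]])
  also have "\<dots> = ennreal (4 * t)"
    using assms by (simp add: emeasure_lborel_cbox_eq Basis_complex_def inner_complex_def complex_eq_iff)
  finally have "emeasure area {z \<in> space area. \<bar>Im z\<bar> \<le> t} \<le> ennreal (1 / pi) * ennreal (4 * t)"
    unfolding emeasure_area[OF s] by (intro mult_left_mono) auto
  then show ?thesis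
    using assms by (simp add: ennreal_mult[symmetric] field_simps)
qed

interpretation area_pair: pair_sigma_finite area area ..

text \<open>The radius and the argument of a point of the disk are independent: average over the rotation
  by the argument of a second, independent point.\<close>

lemma nn_integral_radius_argument:
  assumes [measurable]: "a \<in> borel_measurable borel" "b \<in> borel_measurable borel"
  shows "(\<integral>\<^sup>+z. a (cmod z) * b (sgn z) \<partial>area) = (\<integral>\<^sup>+z. a (cmod z) \<partial>area) * (\<integral>\<^sup>+z. b (sgn z) \<partial>area)"
proof -
  have AE0: "AE y in area. y \<noteq> 0"
    unfolding AE_area_iff by (rule AE_I'[of "{0}"]) (auto simp: negligible_iff_null_sets[symmetric])
  have eq: "(\<integral>\<^sup>+z. a (cmod z) * b (sgn y * sgn z) \<partial>area) = (\<integral>\<^sup>+z. a (cmod z) * b (sgn z) \<partial>area)"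
    if "y \<noteq> 0" for y
  proof -
    have c: "cmod (sgn y) = 1"
      using that by (simp add: norm_sgn)
    have "(\<integral>\<^sup>+z. a (cmod (sgn y * z)) * b (sgn (sgn y * z)) \<partial>area) = (\<integral>\<^sup>+z. a (cmod z) * b (sgn z) \<partial>area)"
      by (rule nn_integral_rotation[OF c, of "\<lambda>z. a (cmod z) * b (sgn z)"]) measurable
    then show ?thesis
      using c by (simp add: norm_mult sgn_mult)
  qed
  have "(\<integral>\<^sup>+z. a (cmod z) * b (sgn z) \<partial>area)
      = (\<integral>\<^sup>+y. (\<integral>\<^sup>+z. a (cmod z) * b (sgn y * sgn z) \<partial>area) \<partial>area)"
  proof -
    have "(\<integral>\<^sup>+y. (\<integral>\<^sup>+z. a (cmod z) * b (sgn y * sgn z) \<partial>area) \<partial>area)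
        = (\<integral>\<^sup>+y. (\<integral>\<^sup>+z. a (cmod z) * b (sgn z) \<partial>area) \<partial>area)"
      by (rule nn_integral_cong_AE) (use AE0 in eventually_elim, use eq in auto)
    then show ?thesis
      using prob_space_area by simp
  qed
  also have "\<dots> = (\<integral>\<^sup>+z. (\<integral>\<^sup>+y. a (cmod z) * b (sgn y * sgn z) \<partial>area) \<partial>area)"
    by (rule area_pair.Fubini') measurable
  also have "\<dots> = (\<integral>\<^sup>+z. a (cmod z) * (\<integral>\<^sup>+y. b (sgn y) \<partial>area) \<partial>area)"
  proof (rule nn_integral_cong_AE, use AE0 in eventually_elim)
    fix z :: complex assume "z \<noteq> 0"
    then have c: "cmod (sgn z) = 1"
      by (simp add: norm_sgn)
    have "(\<integral>\<^sup>+y. b (sgn (sgn z * y)) \<partial>area) = (\<integral>\<^sup>+y. b (sgn y) \<partial>area)"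
      by (rule nn_integral_rotation[OF c, of "\<lambda>y. b (sgn y)"]) measurable
    then show "(\<integral>\<^sup>+y. a (cmod z) * b (sgn y * sgn z) \<partial>area) = a (cmod z) * (\<integral>\<^sup>+y. b (sgn y) \<partial>area)"
      by (subst nn_integral_cmult) (auto simp: sgn_mult mult.commute)
  qed
  also have "\<dots> = (\<integral>\<^sup>+z. a (cmod z) \<partial>area) * (\<integral>\<^sup>+z. b (sgn z) \<partial>area)"
    by (rule nn_integral_multc) measurable
  finally show ?thesis .
qed

lemma majorant_finite: "(\<integral>\<^sup>+z. majorant z \<partial>area) < \<infinity>"
proof -
  have "(\<integral>\<^sup>+z. majorant z \<partial>area)
      = (\<integral>\<^sup>+z. inverse (ennreal ((1 - cmod z) powr (7/8))) \<partial>area)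
        * (\<integral>\<^sup>+z. inverse (ennreal (\<bar>Im (sgn z)\<bar> powr (7/8))) \<partial>area)"
    unfolding majorant_def
    by (rule nn_integral_radius_argument[of "\<lambda>r. inverse (ennreal ((1 - r) powr (7/8)))"
          "\<lambda>s. inverse (ennreal (\<bar>Im s\<bar> powr (7/8)))"]) measurable
  moreover have "(\<integral>\<^sup>+z. inverse (ennreal ((1 - cmod z) powr (7/8))) \<partial>area) < \<infinity>"
    by (rule nn_integral_inverse_powr_finite[where C = 2]) (use emeasure_area_collar in auto)
  moreover have "(\<integral>\<^sup>+z. inverse (ennreal (\<bar>Im (sgn z)\<bar> powr (7/8))) \<partial>area) < \<infinity>"
  proof -
    \<comment> \<open>This bounds the angular factor by a function whose sublevel sets are strips of
      small area.\<close>
    have "\<bar>Im z\<bar> \<le> \<bar>Im (sgn z)\<bar>" if "z \<in> unit_disk" for z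
    proof -
      have "\<bar>Im z\<bar> = cmod z * \<bar>Im (sgn z)\<bar>"
        by (cases "z = 0") (simp_all add: sgn_div_norm abs_mult)
      also have "\<dots> \<le> 1 * \<bar>Im (sgn z)\<bar>"
        using that by (intro mult_right_mono) auto
      finally show ?thesis by simp
    qed
    then have "(\<integral>\<^sup>+z. inverse (ennreal (\<bar>Im (sgn z)\<bar> powr (7/8))) \<partial>area)
        \<le> (\<integral>\<^sup>+z. inverse (ennreal (\<bar>Im z\<bar> powr (7/8))) \<partial>area)"
      by (intro nn_integral_mono) (auto intro!: inverse_powr_antimono)
    also have "\<dots> < \<infinity>"
      by (rule nn_integral_inverse_powr_finite[where C = "4 / pi"])
        (use emeasure_area_strip in \<open>auto intro: order_trans[OF abs_Im_le_cmod] less_imp_le\<close>)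
    finally show ?thesis .
  qed
  ultimately show ?thesis
    by (simp add: ennreal_mult_less_top)
qed

text \<open>\<open>|1 - cnj z * x|\<close> is at least \<open>1 - |x|\<close>, and at least the
  angular quantity of x rotated by the argument of z. The exponent
  \<open>b = (7/8 - a) + 7/8\<close> is spent on the first bound and then on the second.\<close>

lemma kernel_le_majorant:
  assumes z: "z \<in> unit_disk" and ab: "0 \<le> a" "a \<le> 7/8" "a + b = 7/4"
  obtains c where "cmod c = 1" "\<And>x. x \<in> unit_disk \<Longrightarrow>
    ennreal ((1 - (cmod x)\<^sup>2) powr (- a) * cmod (1 - cnj z * x) powr (- b)) \<le> majorant (c * x)"
proof
  define c where "c = (if z = 0 then 1 else cnj (sgn z))"
  show c: "cmod c = 1"
    by (simp add: c_def norm_sgn)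
  fix x assume x: "x \<in> unit_disk"
  define p where "p = 1 - cmod x"
  define s where "s = \<bar>Im (sgn (c * x))\<bar>"
  define y where "y = cmod (1 - cnj z * x)"
  have p: "0 < p" "p \<le> 1" "p \<le> 1 - (cmod x)\<^sup>2"
    using x by (auto simp: p_def power2_eq_square mult_left_le)
  have py: "p \<le> y"
    unfolding p_def y_def by (rule norm_one_minus_cnj_mult_ge(2)[OF z x])
  have sy: "s \<le> y"
  proof (cases "z = 0")
    case True
    then show ?thesis
      using abs_Im_le_cmod[of "sgn x"] by (simp add: s_def y_def c_def norm_sgn split: if_splits)
  next
    case False
    have "sgn (c * x) = sgn (cnj z * x)"
      using False c by (simp add: sgn_mult c_def) (simp add: sgn_div_norm)
    then show ?thesis
      unfolding s_def y_def using norm_one_minus_ge_Im_sgn[of "cnj z * x"] by simp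
  qed
  have m: "majorant (c * x) = inverse (ennreal (p powr (7/8))) * inverse (ennreal (s powr (7/8)))"
    by (simp add: majorant_def p_def s_def norm_mult c)
  show "ennreal ((1 - (cmod x)\<^sup>2) powr (- a) * cmod (1 - cnj z * x) powr (- b)) \<le> majorant (c * x)"
  proof (cases "s = 0")
    case True
    then show ?thesis
      using p by (simp add: m ennreal_mult_top)
  next
    case False
    then have s: "0 < s"
      by (simp add: s_def)
    have "(1 - (cmod x)\<^sup>2) powr (- a) * y powr (- b)
        = (1 - (cmod x)\<^sup>2) powr (- a) * (y powr (- (7/8 - a)) * y powr (- (7/8)))"
    proof -
      have "b = 7/4 - a"
        using ab by simp
      then show ?thesis
        by (simp add: powr_add[symmetric])
    qed
    also have "\<dots> \<le> p powr (- a) * (p powr (- (7/8 - a)) * s powr (- (7/8)))"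
      using p py sy s ab by (intro mult_mono powr_mono2') auto
    also have "\<dots> = p powr (- (7/8)) * s powr (- (7/8))"
      by (simp add: powr_add[symmetric] mult.assoc[symmetric])
    finally show ?thesis
      using p s unfolding m y_def
      by (simp add: inverse_ennreal powr_minus ennreal_mult[symmetric] ennreal_leI)
  qed
qed

definition majorant_tail :: "real \<Rightarrow> ennreal" where
  "majorant_tail r = (\<integral>\<^sup>+x. majorant x * indicator {x. r \<le> cmod x} x \<partial>area)"

text \<open>The bound does not depend on z: the rotation supplied by
  \<open>kernel_le_majorant\<close> preserves area and the condition
  \<open>r \<le> cmod x\<close>.\<close>

lemma kernel_tail_bound:
  assumes z: "z \<in> unit_disk" and ab: "0 \<le> a" "a \<le> 7/8" "a + b = 7/4"
  shows "(\<integral>\<^sup>+x. ennreal ((1 - (cmod x)\<^sup>2) powr (- a) * cmod (1 - cnj z * x) powr (- b))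
      * indicator {x. r \<le> cmod x} x \<partial>area) \<le> majorant_tail r"
proof -
  obtain c where c: "cmod c = 1" and le: "\<And>x. x \<in> unit_disk \<Longrightarrow>
      ennreal ((1 - (cmod x)\<^sup>2) powr (- a) * cmod (1 - cnj z * x) powr (- b)) \<le> majorant (c * x)"
    by (rule kernel_le_majorant[OF assms]) blast
  have "(\<integral>\<^sup>+x. ennreal ((1 - (cmod x)\<^sup>2) powr (- a) * cmod (1 - cnj z * x) powr (- b))
      * indicator {x. r \<le> cmod x} x \<partial>area)
      \<le> (\<integral>\<^sup>+x. majorant (c * x) * indicator {x. r \<le> cmod x} (c * x) \<partial>area)"
    using le by (intro nn_integral_mono) (auto simp: indicator_def norm_mult c)
  also have "\<dots> = majorant_tail r"
    unfolding majorant_tail_def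
    by (rule nn_integral_rotation[OF c, of "\<lambda>x. majorant x * indicator {x. r \<le> cmod x} x"]) measurable
  finally show ?thesis .
qed

lemma majorant_tail_0: "majorant_tail 0 < \<infinity>"
  using majorant_finite by (simp add: majorant_tail_def)

lemma majorant_tail_small:
  assumes "0 < e" obtains r where "0 < r" "r < 1" "majorant_tail r < ennreal e"
proof -
  define r where "r n = 1 - 1 / real (Suc (Suc n))" for n
  have r: "0 < r n" "r n < 1" for n
    by (auto simp: r_def)
  have "(\<lambda>n. majorant_tail (r n)) \<longlonglongrightarrow> (\<integral>\<^sup>+x. 0 \<partial>area)"
    unfolding majorant_tail_def
  proof (rule nn_integral_dominated_convergence[where w = majorant])
    have [measurable]: "majorant \<in> borel_measurable area"
      using measurable_compose[OF measurable_id_area measurable_majorant] .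
    show "(\<lambda>x. majorant x * indicator {x. r n \<le> cmod x} x) \<in> borel_measurable area" for n
      by measurable
    show "majorant \<in> borel_measurable area" by measurable
    show "AE x in area. (\<lambda>n. majorant x * indicator {x. r n \<le> cmod x} x) \<longlonglongrightarrow> 0"
    proof (intro AE_I2)
      fix x assume "x \<in> space area"
      then have "cmod x < 1" by simp
      have "(\<lambda>n. 1 - 1 / real (Suc (Suc n))) \<longlonglongrightarrow> 1 - 0"
        by (intro tendsto_intros LIMSEQ_Suc lim_1_over_n)
      then have "\<forall>\<^sub>F n in sequentially. cmod x < r n"
        using \<open>cmod x < 1\<close> unfolding r_def by (auto intro: order_tendstoD)
      then have "\<forall>\<^sub>F n in sequentially. majorant x * indicator {x. r n \<le> cmod x} x = 0"
        by eventually_elim auto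
      then show "(\<lambda>n. majorant x * indicator {x. r n \<le> cmod x} x) \<longlonglongrightarrow> 0"
        by (rule tendsto_eventually)
    qed
    show "AE x in area. majorant x * indicator {x. r n \<le> cmod x} x \<le> majorant x" for n
      by (auto simp: indicator_def)
  qed (use majorant_finite in auto)
  then have "\<forall>\<^sub>F n in sequentially. majorant_tail (r n) < ennreal e"
    using assms by (intro order_tendstoD) auto
  then obtain n where "majorant_tail (r n) < ennreal e"
    by (auto simp: eventually_sequentially)
  with r that show ?thesis by blast
qed

text \<open>Substituting \<open>w = disk_aut z x\<close> moves the automorphism from g to the
  weight, which turns into a power of \<open>1 - |z|^2\<close>, the same weight in x and a power of
  \<open>|1 - cnj z * x|\<close>.\<close>

lemma weighted_integral_transform:
  assumes z: "z \<in> unit_disk" and [measurable]: "g \<in> borel_measurable area"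
  shows "(\<integral>\<^sup>+w. ennreal (cmod (bkern z w) * cmod (g (disk_aut z w)) * (1 - (cmod w)\<^sup>2) powr (- a)) \<partial>area)
    = ennreal ((1 - (cmod z)\<^sup>2) powr (1 - a)) * (\<integral>\<^sup>+x. ennreal (cmod (g x) *
      ((1 - (cmod x)\<^sup>2) powr (- a) * cmod (1 - cnj z * x) powr (- (2 - 2 * a)))) \<partial>area)"
proof -
  have [measurable]: "bkern z \<in> borel_measurable area" "disk_aut z \<in> area \<rightarrow>\<^sub>M area"
    using z continuous_imp_measurable_area[OF continuous_on_bkern] measurable_disk_aut by auto
  define q where "q = 1 - (cmod z)\<^sup>2"
  have q: "0 < q"
    using one_minus_norm_sq_pos[OF z] by (simp add: q_def)
  let ?F = "\<lambda>w. ennreal (cmod (bkern z w) * cmod (g (disk_aut z w)) * (1 - (cmod w)\<^sup>2) powr (- a))"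
  have "(\<integral>\<^sup>+w. ?F w \<partial>area) = (\<integral>\<^sup>+x. ennreal ((cmod (- bkern z x))\<^sup>2) * ?F (disk_aut z x) \<partial>area)"
    by (rule disk_change.nn_integral_change[OF disk_change_disk_aut[OF z]]) measurable
  also have "\<dots> = (\<integral>\<^sup>+x. ennreal (q powr (1 - a)) * ennreal (cmod (g x) *
      ((1 - (cmod x)\<^sup>2) powr (- a) * cmod (1 - cnj z * x) powr (- (2 - 2 * a)))) \<partial>area)"
  proof (rule nn_integral_cong)
    fix x assume "x \<in> space area"
    then have x: "x \<in> unit_disk" by simp
    define y where "y = cmod (1 - cnj z * x)"
    define p where "p = 1 - (cmod x)\<^sup>2"
    have y: "0 < y" "0 < p"
      using one_minus_cnj_mult_nonzero[OF z x] one_minus_norm_sq_pos[OF x] by (auto simp: y_def p_def)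
    have b: "cmod (bkern z x) = q / y\<^sup>2"
      using q unfolding bkern_def norm_divide norm_power y_def q_def by (simp del: of_real_diff)
    have "cmod (bkern z x) * cmod (bkern z (disk_aut z x)) = 1"
      using bkern_mult_bkern[OF z x] by (metis norm_mult norm_one)
    then have m1: "(cmod (bkern z x))\<^sup>2 * cmod (bkern z (disk_aut z x)) = q / y\<^sup>2"
      unfolding b[symmetric] by (simp add: power2_eq_square mult.assoc)
    have m2: "(1 - (cmod (disk_aut z x))\<^sup>2) powr (- a) = q powr (- a) * p powr (- a) * y powr (2 * a)"
      unfolding one_minus_norm_disk_aut[OF z x] q_def[symmetric] p_def[symmetric] y_def[symmetric]
    proof -
      have "(y\<^sup>2) powr (- a) = y powr (- (2 * a))"
        using y by (simp add: powr_powr flip: powr_numeral)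
      then have "(q * p / y\<^sup>2) powr (- a) = q powr (- a) * p powr (- a) / y powr (- (2 * a))"
        using q y by (simp add: powr_divide powr_mult)
      then show "(q * p / y\<^sup>2) powr (- a) = q powr (- a) * p powr (- a) * y powr (2 * a)"
        by (simp add: powr_minus divide_inverse)
    qed
    have "(cmod (bkern z x))\<^sup>2 * (cmod (bkern z (disk_aut z x)) * cmod (g x)
        * (1 - (cmod (disk_aut z x))\<^sup>2) powr (- a))
        = (cmod (bkern z x))\<^sup>2 * cmod (bkern z (disk_aut z x))
          * (1 - (cmod (disk_aut z x))\<^sup>2) powr (- a) * cmod (g x)"
      by (simp only: mult_ac)
    also have "\<dots> = q / y\<^sup>2 * (q powr (- a) * p powr (- a) * y powr (2 * a)) * cmod (g x)"
      unfolding m1 m2 ..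
    also have "\<dots> = q powr (1 - a) * (cmod (g x) * (p powr (- a) * y powr (- (2 - 2 * a))))"
    proof -
      have e: "q powr (1 - a) = q * q powr (- a)" "y powr (- (2 - 2 * a)) = y powr (2 * a) / y\<^sup>2"
        using q y by (simp_all add: powr_mult_base powr_diff)
      show ?thesis
        unfolding e by (simp only: times_divide_eq_right times_divide_eq_left mult_ac)
    qed
    finally show "ennreal ((cmod (- bkern z x))\<^sup>2) * ?F (disk_aut z x) = ennreal (q powr (1 - a)) * ennreal (cmod (g x) *
      ((1 - (cmod x)\<^sup>2) powr (- a) * cmod (1 - cnj z * x) powr (- (2 - 2 * a))))"
      unfolding y_def p_def disk_aut_involution[OF z x]
      by (simp add: ennreal_mult[symmetric] ennreal_mult'[symmetric])
  qed
  also have "\<dots> = ennreal (q powr (1 - a)) * (\<integral>\<^sup>+x. ennreal (cmod (g x) *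
      ((1 - (cmod x)\<^sup>2) powr (- a) * cmod (1 - cnj z * x) powr (- (2 - 2 * a)))) \<partial>area)"
    by (rule nn_integral_cmult) measurable
  finally show ?thesis
    unfolding q_def .
qed

text \<open>Cauchy-Schwarz for \<open>k = sqrt (k * h) * sqrt (k / h)\<close>, then Tonelli. The
  second integral bound is asked for only where g does not vanish, so that for g supported near the
  circle the constant \<open>B\<close> may be small.\<close>

lemma schur_test:
  fixes k :: "complex \<Rightarrow> complex \<Rightarrow> real" and h g :: "complex \<Rightarrow> real"
  assumes [measurable]: "(\<lambda>(x, y). k x y) \<in> borel_measurable (area \<Otimes>\<^sub>M area)"
      "h \<in> borel_measurable area" "g \<in> borel_measurable area"
    and k: "\<And>x y. 0 \<le> k x y" and h: "\<And>x. x \<in> unit_disk \<Longrightarrow> 0 < h x"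
    and AB: "0 \<le> A" "0 \<le> B"
    and A: "\<And>x. x \<in> unit_disk \<Longrightarrow> (\<integral>\<^sup>+y. ennreal (k x y * h y) \<partial>area) \<le> ennreal (A * h x)"
    and B: "\<And>y. y \<in> unit_disk \<Longrightarrow> g y \<noteq> 0 \<Longrightarrow>
      (\<integral>\<^sup>+x. ennreal (k x y * h x) \<partial>area) \<le> ennreal (B * h y)"
  shows "(\<integral>\<^sup>+x. (\<integral>\<^sup>+y. ennreal (k x y * \<bar>g y\<bar>) \<partial>area)\<^sup>2 \<partial>area)
    \<le> ennreal (A * B) * (\<integral>\<^sup>+y. ennreal ((g y)\<^sup>2) \<partial>area)"
proof -
  have m: "(\<lambda>y. k x y) \<in> borel_measurable area" if "x \<in> unit_disk" for x
    using measurable_Pair2[OF assms(1), of x] that by simp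
  have m': "(\<lambda>x. k x y) \<in> borel_measurable area" if "y \<in> unit_disk" for y
    using measurable_Pair1[OF assms(1), of y] that by simp
  have "(\<integral>\<^sup>+x. (\<integral>\<^sup>+y. ennreal (k x y * \<bar>g y\<bar>) \<partial>area)\<^sup>2 \<partial>area)
      \<le> (\<integral>\<^sup>+x. ennreal (A * h x) * (\<integral>\<^sup>+y. ennreal (k x y * ((g y)\<^sup>2 / h y)) \<partial>area) \<partial>area)"
  proof (rule nn_integral_mono)
    fix x assume "x \<in> space area"
    then have x: "x \<in> unit_disk" by simp
    note [measurable] = m[OF x]
    have "(\<integral>\<^sup>+y. ennreal (k x y * \<bar>g y\<bar>) \<partial>area)
        = (\<integral>\<^sup>+y. ennreal (sqrt (k x y * h y)) * ennreal (sqrt (k x y / h y) * \<bar>g y\<bar>) \<partial>area)"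
    proof (rule nn_integral_cong)
      fix y assume "y \<in> space area"
      then have "0 < h y"
        using h by simp
      then have "sqrt (k x y * h y) * sqrt (k x y / h y) = k x y"
        using k by (simp add: real_sqrt_mult[symmetric])
      then show "ennreal (k x y * \<bar>g y\<bar>) = ennreal (sqrt (k x y * h y)) * ennreal (sqrt (k x y / h y) * \<bar>g y\<bar>)"
        using k \<open>0 < h y\<close> by (simp add: ennreal_mult[symmetric] mult.assoc[symmetric])
    qed
    then have "(\<integral>\<^sup>+y. ennreal (k x y * \<bar>g y\<bar>) \<partial>area)\<^sup>2
        \<le> (\<integral>\<^sup>+y. (ennreal (sqrt (k x y * h y)))\<^sup>2 \<partial>area)
          * (\<integral>\<^sup>+y. (ennreal (sqrt (k x y / h y) * \<bar>g y\<bar>))\<^sup>2 \<partial>area)"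
      by (simp only:) (rule Cauchy_Schwarz_nn_integral; measurable)
    also have "(\<integral>\<^sup>+y. (ennreal (sqrt (k x y * h y)))\<^sup>2 \<partial>area) = (\<integral>\<^sup>+y. ennreal (k x y * h y) \<partial>area)"
      using h k by (intro nn_integral_cong) (simp add: ennreal_power less_imp_le)
    also have "(\<integral>\<^sup>+y. (ennreal (sqrt (k x y / h y) * \<bar>g y\<bar>))\<^sup>2 \<partial>area)
        = (\<integral>\<^sup>+y. ennreal (k x y * ((g y)\<^sup>2 / h y)) \<partial>area)"
      using h k by (intro nn_integral_cong) (simp add: ennreal_power less_imp_le power_mult_distrib)
    also have "(\<integral>\<^sup>+y. ennreal (k x y * h y) \<partial>area) * (\<integral>\<^sup>+y. ennreal (k x y * ((g y)\<^sup>2 / h y)) \<partial>area)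
        \<le> ennreal (A * h x) * (\<integral>\<^sup>+y. ennreal (k x y * ((g y)\<^sup>2 / h y)) \<partial>area)"
      by (intro mult_right_mono A x) simp
    finally show "(\<integral>\<^sup>+y. ennreal (k x y * \<bar>g y\<bar>) \<partial>area)\<^sup>2
      \<le> ennreal (A * h x) * (\<integral>\<^sup>+y. ennreal (k x y * ((g y)\<^sup>2 / h y)) \<partial>area)" .
  qed
  also have "\<dots> = (\<integral>\<^sup>+x. (\<integral>\<^sup>+y. ennreal (A * h x) * ennreal (k x y * ((g y)\<^sup>2 / h y)) \<partial>area) \<partial>area)"
    using m by (intro nn_integral_cong nn_integral_cmult[symmetric]) (auto intro!: measurable_compose[OF _ measurable_ennreal] borel_measurable_times)
  also have "\<dots> = (\<integral>\<^sup>+y. (\<integral>\<^sup>+x. ennreal (A * h x) * ennreal (k x y * ((g y)\<^sup>2 / h y)) \<partial>area) \<partial>area)"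
    by (rule area_pair.Fubini') measurable
  also have "\<dots> \<le> (\<integral>\<^sup>+y. ennreal (A * B) * ennreal ((g y)\<^sup>2) \<partial>area)"
  proof (rule nn_integral_mono)
    fix y assume "y \<in> space area"
    then have y: "y \<in> unit_disk" by simp
    note [measurable] = m'[OF y]
    have "(\<integral>\<^sup>+x. ennreal (A * h x) * ennreal (k x y * ((g y)\<^sup>2 / h y)) \<partial>area)
        = (\<integral>\<^sup>+x. ennreal (A * ((g y)\<^sup>2 / h y)) * ennreal (k x y * h x) \<partial>area)"
      using h k AB y by (intro nn_integral_cong)
        (auto simp: ennreal_mult[symmetric] less_imp_le intro!: arg_cong[where f = ennreal])
    also have "\<dots> = ennreal (A * ((g y)\<^sup>2 / h y)) * (\<integral>\<^sup>+x. ennreal (k x y * h x) \<partial>area)"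
      by (rule nn_integral_cmult) measurable
    also have "\<dots> \<le> ennreal (A * B) * ennreal ((g y)\<^sup>2)"
    proof (cases "g y = 0")
      case False
      have "ennreal (A * ((g y)\<^sup>2 / h y)) * (\<integral>\<^sup>+x. ennreal (k x y * h x) \<partial>area)
          \<le> ennreal (A * ((g y)\<^sup>2 / h y)) * ennreal (B * h y)"
        by (intro mult_left_mono B y False) simp
      also have "\<dots> = ennreal (A * B) * ennreal ((g y)\<^sup>2)"
        using h[OF y] AB by (simp add: ennreal_mult[symmetric])
      finally show ?thesis .
    qed simp
    finally show "(\<integral>\<^sup>+x. ennreal (A * h x) * ennreal (k x y * ((g y)\<^sup>2 / h y)) \<partial>area)
      \<le> ennreal (A * B) * ennreal ((g y)\<^sup>2)" .
  qed
  also have "\<dots> = ennreal (A * B) * (\<integral>\<^sup>+y. ennreal ((g y)\<^sup>2) \<partial>area)"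
    by (rule nn_integral_cmult) measurable
  finally show ?thesis .
qed

section \<open>Boundedness of the Bergman projection\<close>

definition majorant_const :: real where
  "majorant_const = enn2real (majorant_tail 0)"

lemma majorant_const: "majorant_tail 0 = ennreal majorant_const" "0 \<le> majorant_const"
  using majorant_tail_0 by (simp_all add: majorant_const_def)

text \<open>Growth of exponent 1/4 is reproduced by the positive kernel
  (\<open>forelli_rudin\<close>), and its product with \<open>schur_weight\<close> has exponent 3/4,
  still below the 7/8 of \<open>majorant\<close>.\<close>

definition kweight :: "complex \<Rightarrow> real" where
  "kweight w = (1 - (cmod w)\<^sup>2) powr (- (1/4))"

lemma kweight_pos: "w \<in> unit_disk \<Longrightarrow> 0 < kweight w"
  using one_minus_norm_sq_pos[of w] by (simp add: kweight_def)

lemma kweight_ge_1: "w \<in> unit_disk \<Longrightarrow> 1 \<le> kweight w"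
  using one_minus_norm_sq_pos[of w] powr_mono2'[of "-(1/4)" "1 - (cmod w)\<^sup>2" 1]
  by (simp add: kweight_def)

lemma measurable_kweight [measurable]: "kweight \<in> borel_measurable area"
  unfolding kweight_def[abs_def] by measurable

lemma forelli_rudin:
  assumes z: "z \<in> unit_disk"
  shows "(\<integral>\<^sup>+w. ennreal (cmod (1 / (1 - cnj z * w)\<^sup>2) * kweight w) \<partial>area)
    \<le> ennreal (majorant_const * kweight z)"
proof -
  define q where "q = 1 - (cmod z)\<^sup>2"
  have q: "0 < q"
    using one_minus_norm_sq_pos[OF z] by (simp add: q_def)
  have [measurable]: "(\<lambda>w. 1 / (1 - cnj z * w)\<^sup>2) \<in> borel_measurable area"
    by measurable
  have "ennreal q * (\<integral>\<^sup>+w. ennreal (cmod (1 / (1 - cnj z * w)\<^sup>2) * kweight w) \<partial>area)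
      = (\<integral>\<^sup>+w. ennreal q * ennreal (cmod (1 / (1 - cnj z * w)\<^sup>2) * kweight w) \<partial>area)"
    by (rule nn_integral_cmult[symmetric]) measurable
  also have "\<dots> = (\<integral>\<^sup>+w. ennreal (cmod (bkern z w) * cmod ((\<lambda>_. 1 :: complex) (disk_aut z w))
      * (1 - (cmod w)\<^sup>2) powr (- (1/4))) \<partial>area)"
  proof (rule nn_integral_cong)
    fix w :: complex
    have "cmod (bkern z w) = q * cmod (1 / (1 - cnj z * w)\<^sup>2)"
      using q unfolding bkern_def q_def[symmetric] norm_divide by simp
    then show "ennreal q * ennreal (cmod (1 / (1 - cnj z * w)\<^sup>2) * kweight w)
      = ennreal (cmod (bkern z w) * cmod ((\<lambda>_. 1 :: complex) (disk_aut z w)) * (1 - (cmod w)\<^sup>2) powr (- (1/4)))"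
      using q by (simp add: kweight_def ennreal_mult'[symmetric] mult.assoc)
  qed
  also have "\<dots> = ennreal (q powr (3/4)) * (\<integral>\<^sup>+x. ennreal ((1 - (cmod x)\<^sup>2) powr (- (1/4))
      * cmod (1 - cnj z * x) powr (- (3/2))) \<partial>area)"
    by (subst weighted_integral_transform[OF z]) (simp_all add: q_def)
  also have "\<dots> \<le> ennreal (q powr (3/4)) * majorant_tail 0"
    using kernel_tail_bound[OF z, of "1/4" "3/2" 0] by (intro mult_left_mono) auto
  also have "\<dots> = ennreal q * ennreal (majorant_const * kweight z)"
  proof -
    have "q powr (3/4) = q * q powr (- (1/4))"
      using q by (simp add: powr_mult_base)
    then show ?thesis
      using q majorant_const unfolding kweight_def q_def[symmetric]
      by (simp add: ennreal_mult[symmetric] mult_ac)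
  qed
  finally show ?thesis
    using q by (simp add: ennreal_mult_le_mult_iff)
qed

lemma square_int_nn: "square_int g \<Longrightarrow>
    (\<integral>\<^sup>+w. ennreal ((cmod (g w))\<^sup>2) \<partial>area) = ennreal (LINT w|area. (cmod (g w))\<^sup>2)"
  unfolding square_int_def by (intro nn_integral_eq_integral) auto

lemma square_int_nn_iff: "g \<in> borel_measurable area \<Longrightarrow>
    square_int g \<longleftrightarrow> (\<integral>\<^sup>+w. ennreal ((cmod (g w))\<^sup>2) \<partial>area) < \<infinity>"
  unfolding square_int_def by (auto simp: integrable_iff_bounded)

text \<open>Schur's test with \<open>kweight\<close> on both sides, the modulus of the kernel being
  symmetric. Finiteness for the kernel in absolute value is what licenses Fubini in
  \<open>cinner_proj_bergman\<close>.\<close>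

lemma bergman_positive_projection:
  assumes g: "square_int g"
  shows "(\<integral>\<^sup>+z. (\<integral>\<^sup>+w. ennreal (cmod (1 / (1 - cnj z * w)\<^sup>2) * cmod (g w)) \<partial>area)\<^sup>2 \<partial>area) < \<infinity>"
proof -
  have [measurable]: "g \<in> borel_measurable area"
    using g by (simp add: square_int_def)
  have sym: "cmod (1 / (1 - cnj z * w)\<^sup>2) = cmod (1 / (1 - cnj w * z)\<^sup>2)" for z w
  proof -
    have "cmod (1 - cnj z * w) = cmod (cnj (1 - cnj w * z))"
      by (simp add: mult.commute)
    then show ?thesis
      unfolding complex_mod_cnj by (simp add: norm_divide norm_power)
  qed
  have "(\<integral>\<^sup>+z. (\<integral>\<^sup>+w. ennreal (cmod (1 / (1 - cnj z * w)\<^sup>2) * \<bar>cmod (g w)\<bar>) \<partial>area)\<^sup>2 \<partial>area)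
      \<le> ennreal (majorant_const * majorant_const) * (\<integral>\<^sup>+w. ennreal ((cmod (g w))\<^sup>2) \<partial>area)"
  proof (rule schur_test[where h = kweight])
    show "(\<integral>\<^sup>+x. ennreal (cmod (1 / (1 - cnj x * y)\<^sup>2) * kweight x) \<partial>area) \<le> ennreal (majorant_const * kweight y)"
      if "y \<in> unit_disk" for y
      using forelli_rudin[OF that] by (subst sym) simp
  qed (use forelli_rudin majorant_const kweight_pos in auto)
  also have "\<dots> < \<infinity>"
    using g by (simp add: square_int_nn ennreal_mult_less_top)
  finally show ?thesis by simp
qed

definition proj_fun :: "(complex \<Rightarrow> complex) \<Rightarrow> complex \<Rightarrow> complex" where
  "proj_fun g z = (LINT w|area. g w * cnj (1 / (1 - cnj z * w)\<^sup>2))"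

lemma kernel_bounded:
  assumes "z \<in> unit_disk" "w \<in> unit_disk"
  shows "cmod (1 / (1 - cnj z * w)\<^sup>2) \<le> 1 / (1 - cmod z)\<^sup>2"
  unfolding norm_divide norm_power
  using norm_one_minus_cnj_mult_ge[OF assms] assms by (intro frac_le power_mono) auto

text \<open>The kernel expands as the sum of \<open>(n + 1) * (z * cnj w) ^ n\<close>; for fixed z
  the series is dominated by \<open>|g w|\<close> times a convergent numerical series, so it may be
  integrated term by term.\<close>

lemma proj_fun_holomorphic:
  assumes g: "square_int g" shows "proj_fun g holomorphic_on unit_disk"
proof -
  have [measurable]: "g \<in> borel_measurable area"
    using g by (simp add: square_int_def)
  have gi: "integrable area g"
    by (rule square_int_integrable[OF g])
  define a where "a n = of_nat (Suc n) * (LINT w|area. g w * cnj w ^ n)" for n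
  have "(\<lambda>n. a n * (z - 0) ^ n) sums proj_fun g z" if z: "z \<in> unit_disk" for z
  proof -
    define t where "t n w = g w * (of_nat (Suc n) * (z * cnj w) ^ n)" for n w
    have bnd: "cmod (t n w) \<le> cmod (g w) * (real (Suc n) * cmod z ^ n)" if "w \<in> unit_disk" for n w
    proof -
      have "cmod (z * cnj w) ^ n \<le> cmod z ^ n"
        using that by (intro power_mono) (auto simp: norm_mult mult_left_le)
      then have "cmod (of_nat (Suc n) * (z * cnj w) ^ n) \<le> real (Suc n) * cmod z ^ n"
        unfolding norm_mult[of "of_nat (Suc n)"] norm_power norm_of_nat by (intro mult_left_mono) auto
      then show ?thesis
        unfolding t_def norm_mult[of "g w"] by (intro mult_left_mono) auto
    qed
    have summ: "summable (\<lambda>n. real (Suc n) * cmod z ^ n)"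
      using geometric_deriv_sums[of "cmod z"] z by (auto simp: sums_iff)
    have ti: "integrable area (t n)" for n
    proof (rule Bochner_Integration.integrable_bound)
      show "integrable area (\<lambda>w. (real (Suc n) * cmod z ^ n) *\<^sub>R g w)"
        by (intro integrable_scaleR_right gi)
      show "AE w in area. norm (t n w) \<le> norm ((real (Suc n) * cmod z ^ n) *\<^sub>R g w)"
        using bnd by (intro AE_I2) (auto simp: mult.commute abs_mult)
    qed (unfold t_def, measurable)
    have "(\<lambda>n. LINT w|area. t n w) sums (LINT w|area. (\<Sum>n. t n w))"
    proof (rule sums_integral[OF ti])
      show "AE w in area. summable (\<lambda>n. norm (t n w))"
      proof (intro AE_I2)
        fix w assume "w \<in> space area"
        then have w: "w \<in> unit_disk" by simp
        show "summable (\<lambda>n. norm (t n w))"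
          by (rule summable_comparison_test'[OF summable_mult[OF summ, of "cmod (g w)"], of 0])
            (use bnd[OF w] in simp)
      qed
      show "summable (\<lambda>n. LINT w|area. norm (t n w))"
      proof (rule summable_comparison_test'[OF summable_mult[OF summ, of "LINT w|area. norm (g w)"], of 0])
        fix n
        have "norm (LINT w|area. norm (t n w)) = (LINT w|area. norm (t n w))"
          by simp
        also have "\<dots> \<le> (LINT w|area. norm (g w) * (real (Suc n) * cmod z ^ n))"
          using gi ti bnd by (intro integral_mono integrable_mult_left integrable_norm) auto
        finally show "norm (LINT w|area. norm (t n w)) \<le> (LINT w|area. norm (g w)) * (real (Suc n) * cmod z ^ n)"
          by simp
      qed
    qed
    moreover have "(LINT w|area. t n w) = a n * (z - 0) ^ n" for n
    proof -
      have "t n w = (of_nat (Suc n) * z ^ n) * (g w * cnj w ^ n)" for w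
        by (simp add: t_def power_mult_distrib mult_ac)
      then have "(LINT w|area. t n w) = (LINT w|area. (of_nat (Suc n) * z ^ n) * (g w * cnj w ^ n))"
        by simp
      also have "\<dots> = (of_nat (Suc n) * z ^ n) * (LINT w|area. g w * cnj w ^ n)"
        by (rule integral_mult_right_zero)
      finally show ?thesis
        by (simp only: a_def diff_0_right mult_ac)
    qed
    moreover have "(LINT w|area. (\<Sum>n. t n w)) = proj_fun g z"
      unfolding proj_fun_def
    proof (rule Bochner_Integration.integral_cong)
      fix w assume "w \<in> space area"
      then have w: "cmod (z * cnj w) < 1"
        using z by (simp add: norm_mult) (metis mult.right_neutral mult_strict_mono' norm_ge_zero)
      have "(\<lambda>n. t n w) sums (g w * (1 / (1 - z * cnj w)\<^sup>2))"
        unfolding t_def by (intro sums_mult geometric_deriv_sums w)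
      then show "(\<Sum>n. t n w) = g w * cnj (1 / (1 - cnj z * w)\<^sup>2)"
        by (simp add: sums_iff)
    qed simp
    ultimately show ?thesis by simp
  qed
  then show ?thesis
    by (rule power_series_holomorphic)
qed

lemma proj_fun_bound:
  assumes g: "square_int g" and z: "z \<in> unit_disk"
  shows "ennreal (cmod (proj_fun g z)) \<le> (\<integral>\<^sup>+w. ennreal (cmod (1 / (1 - cnj z * w)\<^sup>2) * cmod (g w)) \<partial>area)"
proof -
  have [measurable]: "g \<in> borel_measurable area"
    using g by (simp add: square_int_def)
  have "integrable area (\<lambda>w. g w * cnj (1 / (1 - cnj z * w)\<^sup>2))"
  proof (rule square_int_mult_integrable[OF g])
    show "square_int (\<lambda>w. 1 / (1 - cnj z * w)\<^sup>2)"
      unfolding square_int_def using z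
      by (auto intro!: integrable_area_bounded[where B = "(1 / (1 - cmod z)\<^sup>2)\<^sup>2"]
          simp del: norm_divide norm_power) (use kernel_bounded[OF z] in \<open>auto intro!: power_mono\<close>)
  qed
  from integral_norm_bound_ennreal[OF this] show ?thesis
    unfolding proj_fun_def by (simp only: norm_mult complex_mod_cnj mult.commute)
qed

lemma square_int_proj_fun:
  assumes g: "square_int g" shows "square_int (proj_fun g)"
proof -
  have [measurable]: "proj_fun g \<in> borel_measurable area"
    by (intro continuous_imp_measurable_area holomorphic_on_imp_continuous_on proj_fun_holomorphic g)
  have "(\<integral>\<^sup>+z. ennreal ((cmod (proj_fun g z))\<^sup>2) \<partial>area)
      \<le> (\<integral>\<^sup>+z. (\<integral>\<^sup>+w. ennreal (cmod (1 / (1 - cnj z * w)\<^sup>2) * cmod (g w)) \<partial>area)\<^sup>2 \<partial>area)"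
    using proj_fun_bound[OF g] by (intro nn_integral_mono) (auto simp: ennreal_power[symmetric] intro!: power_mono)
  also have "\<dots> < \<infinity>"
    by (rule bergman_positive_projection[OF g])
  finally show ?thesis
    by (simp add: square_int_nn_iff)
qed

definition proj_bergman :: "(complex \<Rightarrow> complex) \<Rightarrow> bergman" where
  "proj_bergman g = berg (proj_fun g)"

lemma fun_of_proj_bergman:
  assumes "square_int g"
  shows "fun_of (proj_bergman g) = (\<lambda>z. if z \<in> unit_disk then proj_fun g z else 0)"
  unfolding proj_bergman_def
  using square_int_proj_fun[OF assms] by (intro fun_of_berg proj_fun_holomorphic assms) (simp add: square_int_def)

lemma square_int_nn_mult:
  assumes f: "f \<in> borel_measurable area" "(\<integral>\<^sup>+z. (f z)\<^sup>2 \<partial>area) < \<infinity>"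
    and g: "g \<in> borel_measurable area" "(\<integral>\<^sup>+z. (g z)\<^sup>2 \<partial>area) < (\<infinity> :: ennreal)"
  shows "(\<integral>\<^sup>+z. f z * g z \<partial>area) < \<infinity>"
proof -
  have "(\<integral>\<^sup>+z. f z * g z \<partial>area)\<^sup>2 \<le> (\<integral>\<^sup>+z. (f z)\<^sup>2 \<partial>area) * (\<integral>\<^sup>+z. (g z)\<^sup>2 \<partial>area)"
    by (rule Cauchy_Schwarz_nn_integral) (use f g in auto)
  also have "\<dots> < \<infinity>"
    using f g by (simp add: ennreal_mult_less_top)
  finally show ?thesis
    by (simp add: power_less_top_ennreal)
qed

text \<open>Fubini, followed by the reproducing property of f.\<close>

lemma cinner_proj_bergman:
  assumes g: "square_int g" shows "cinner (proj_bergman g) f = L2_inner g (fun_of f)"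
proof -
  have [measurable]: "g \<in> borel_measurable area"
    using g by (simp add: square_int_def)
  let ?k = "\<lambda>z w. 1 / (1 - cnj z * w)\<^sup>2"
  let ?H = "\<lambda>(z, w). (g w * cnj (?k z w)) * cnj (fun_of f z)"
  have mpair[measurable]: "(\<lambda>z. \<integral>\<^sup>+w. ennreal (cmod (?k z w) * cmod (g w)) \<partial>area) \<in> borel_measurable area"
    by measurable
  have int: "integrable (area \<Otimes>\<^sub>M area) ?H"
  proof (rule integrableI_bounded)
    show "?H \<in> borel_measurable (area \<Otimes>\<^sub>M area)"
      by measurable
    have "(\<integral>\<^sup>+x. ennreal (norm (?H x)) \<partial>(area \<Otimes>\<^sub>M area))
        = (\<integral>\<^sup>+z. (\<integral>\<^sup>+w. ennreal (norm (?H (z, w))) \<partial>area) \<partial>area)"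
      by (rule area.nn_integral_fst[symmetric]) measurable
    also have "\<dots> = (\<integral>\<^sup>+z. (\<integral>\<^sup>+w. ennreal (cmod (?k z w) * cmod (g w)) \<partial>area) * ennreal (cmod (fun_of f z)) \<partial>area)"
    proof -
      have "norm (?H (z, w)) = cmod (?k z w) * cmod (g w) * cmod (fun_of f z)" for z w
        by (simp only: prod.case norm_mult complex_mod_cnj mult_ac)
      then show ?thesis
        by (simp add: ennreal_mult nn_integral_multc)
    qed
    also have "\<dots> < \<infinity>"
    proof (rule square_int_nn_mult[OF mpair bergman_positive_projection[OF g]])
      show "(\<integral>\<^sup>+z. (ennreal (cmod (fun_of f z)))\<^sup>2 \<partial>area) < \<infinity>"
        using square_int_nn[OF square_int_fun_of[of f]] by (simp add: ennreal_power)
    qed simp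
    finally show "(\<integral>\<^sup>+x. ennreal (norm (?H x)) \<partial>(area \<Otimes>\<^sub>M area)) < \<infinity>" .
  qed
  have "cinner (proj_bergman g) f = (LINT z|area. (LINT w|area. ?H (z, w)))"
    unfolding cinner_eq
  proof (rule Bochner_Integration.integral_cong)
    fix z assume "z \<in> space area"
    then have "fun_of (proj_bergman g) z = proj_fun g z"
      by (simp add: fun_of_proj_bergman[OF g])
    then show "fun_of (proj_bergman g) z * cnj (fun_of f z) = (LINT w|area. ?H (z, w))"
      by (simp only: proj_fun_def prod.case integral_mult_left_zero)
  qed simp
  also have "\<dots> = (LINT w|area. (LINT z|area. ?H (z, w)))"
    using area_pair.Fubini_integral[of "\<lambda>z w. ?H (z, w)"] int by simp
  also have "\<dots> = (LINT w|area. g w * cnj (fun_of f w))"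
  proof (rule Bochner_Integration.integral_cong)
    fix w assume "w \<in> space area"
    then have w: "w \<in> unit_disk" by simp
    have "(LINT z|area. ?H (z, w)) = (LINT z|area. g w * cnj (fun_of f z * cnj (fun_of (kern 0 w) z)))"
      by (rule Bochner_Integration.integral_cong)
        (auto simp: fun_of_kern[OF w] mult_ac power2_eq_square)
    also have "\<dots> = g w * cnj (cinner f (kern 0 w))"
      unfolding cinner_eq by (subst integral_mult_right_zero, subst Bochner_Integration.integral_cnj) simp
    finally show "(LINT z|area. ?H (z, w)) = g w * cnj (fun_of f w)"
      by (simp add: cinner_kern[OF w])
  qed simp
  finally show ?thesis
    by (simp add: L2_inner_def)
qed

text \<open>\<open>bergman_proj\<close> is a definite description; the integral formula supplies
  existence, testing against the kernels supplies uniqueness.\<close>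

lemma bergman_proj_eq:
  assumes g: "square_int g" shows "bergman_proj g = proj_bergman g"
  unfolding bergman_proj_def
proof (rule the_equality)
  have L2: "L2_inner (\<lambda>w. g w - fun_of h w) (fun_of f) = L2_inner g (fun_of f) - cinner h f" for h f
    unfolding cinner_eq L2_inner_def left_diff_distrib
    by (rule Bochner_Integration.integral_diff)
      (auto intro: square_int_mult_integrable square_int_fun_of g)
  show "\<forall>f. L2_inner (\<lambda>w. g w - fun_of (proj_bergman g) w) (fun_of f) = 0"
    by (simp add: L2 cinner_proj_bergman[OF g])
  fix h assume h: "\<forall>f. L2_inner (\<lambda>w. g w - fun_of h w) (fun_of f) = 0"
  show "h = proj_bergman g"
  proof (rule fun_of_eqI)
    fix z assume z: "z \<in> unit_disk"
    have "cinner h (kern 0 z) = cinner (proj_bergman g) (kern 0 z)"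
      using h unfolding L2 cinner_proj_bergman[OF g] by (metis right_minus_eq)
    then show "fun_of h z = fun_of (proj_bergman g) z"
      by (simp add: cinner_kern[OF z])
  qed
qed

lemma cinner_bergman_proj: "square_int g \<Longrightarrow> cinner (bergman_proj g) f = L2_inner g (fun_of f)"
  by (simp add: bergman_proj_eq cinner_proj_bergman)

lemma L2_inner_cauchy_schwarz:
  assumes g: "square_int g" and f: "square_int f"
  shows "(cmod (L2_inner g f))\<^sup>2 \<le> (LINT w|area. (cmod (g w))\<^sup>2) * (LINT w|area. (cmod (f w))\<^sup>2)"
proof -
  have [measurable]: "g \<in> borel_measurable area" "f \<in> borel_measurable area"
    using f g by (auto simp: square_int_def)
  have "ennreal (cmod (L2_inner g f)) \<le> (\<integral>\<^sup>+w. ennreal (cmod (g w)) * ennreal (cmod (f w)) \<partial>area)"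
    using integral_norm_bound_ennreal[OF square_int_mult_integrable[OF g f]]
    by (simp add: L2_inner_def norm_mult ennreal_mult)
  then have "(ennreal (cmod (L2_inner g f)))\<^sup>2 \<le> (\<integral>\<^sup>+w. ennreal (cmod (g w)) * ennreal (cmod (f w)) \<partial>area)\<^sup>2"
    by (rule power_mono) simp
  also have "\<dots> \<le> (\<integral>\<^sup>+w. (ennreal (cmod (g w)))\<^sup>2 \<partial>area) * (\<integral>\<^sup>+w. (ennreal (cmod (f w)))\<^sup>2 \<partial>area)"
    by (rule Cauchy_Schwarz_nn_integral) measurable
  finally show ?thesis
    using square_int_nn[OF f] square_int_nn[OF g]
    by (simp add: ennreal_power ennreal_mult[symmetric])
qed

lemma norm_bergman_proj:
  assumes g: "square_int g" shows "(norm (bergman_proj g))\<^sup>2 \<le> (LINT w|area. (cmod (g w))\<^sup>2)"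
proof (cases "norm (bergman_proj g) = 0")
  case False
  let ?p = "bergman_proj g"
  have "complex_of_real ((norm ?p)\<^sup>2) = L2_inner g (fun_of ?p)"
    unfolding cinner_self[symmetric] by (rule cinner_bergman_proj[OF g])
  then have "((norm ?p)\<^sup>2)\<^sup>2 = (cmod (L2_inner g (fun_of ?p)))\<^sup>2"
    by (metis norm_of_real power2_abs)
  also have "\<dots> \<le> (LINT w|area. (cmod (g w))\<^sup>2) * (norm ?p)\<^sup>2"
    unfolding norm_sq_eq[of ?p] by (rule L2_inner_cauchy_schwarz[OF g square_int_fun_of])
  finally have "(norm ?p)\<^sup>2 * (norm ?p)\<^sup>2 \<le> (LINT w|area. (cmod (g w))\<^sup>2) * (norm ?p)\<^sup>2"
    by (simp only: power2_eq_square[of "(norm ?p)\<^sup>2"])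
  then show ?thesis
    by (rule mult_right_le_imp_le) (use False in simp)
qed (simp add: Bochner_Integration.integral_nonneg)

section \<open>Sums of Toeplitz products\<close>

text \<open>The bound holds everywhere on the disk, not only almost everywhere, and is carried as a
  parameter because limits of operators need one bound for all symbols involved.\<close>

definition symbol :: "real \<Rightarrow> (complex \<Rightarrow> complex) \<Rightarrow> bool" where
  "symbol B u \<longleftrightarrow> u \<in> borel_measurable area \<and> (\<forall>z\<in>unit_disk. cmod (u z) \<le> B)"

lemma symbol_nonneg: "symbol B u \<Longrightarrow> 0 \<le> B"
  using norm_ge_zero[of "u 0"] unfolding symbol_def by (meson centre_in_ball order_trans zero_less_one)

lemma symbol_cnj: "symbol B u \<Longrightarrow> symbol B (\<lambda>z. cnj (u z))"
  unfolding symbol_def by (auto intro: measurable_compose[OF _ measurable_cnj])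

lemma square_int_symbol_mult: "symbol B u \<Longrightarrow> square_int f \<Longrightarrow> square_int (\<lambda>z. u z * f z)"
  unfolding symbol_def by (intro square_int_mult) auto

lemma symbol_pull:
  assumes "z \<in> unit_disk" "symbol B u" shows "symbol B (\<lambda>x. u (disk_aut z x))"
  using assms measurable_compose[OF measurable_disk_aut, of z u borel] disk_aut_in_disk
  by (auto simp: symbol_def)

lemma bergman_eqI_cinner:
  assumes "\<And>g. cinner f g = cinner h g" shows "f = h"
  by (rule fun_of_eqI) (metis assms cinner_kern)

lemma cinner_toeplitz:
  "symbol B u \<Longrightarrow> cinner (toeplitz u f) g = L2_inner (\<lambda>z. u z * fun_of f z) (fun_of g)"
  unfolding toeplitz_def
  by (rule cinner_bergman_proj) (rule square_int_symbol_mult[OF _ square_int_fun_of])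

lemma toeplitz_add:
  assumes u: "symbol B u" shows "toeplitz u (f + g) = toeplitz u f + toeplitz u g"
proof (rule bergman_eqI_cinner)
  fix h
  note i = square_int_mult_integrable[OF square_int_symbol_mult[OF u square_int_fun_of] square_int_fun_of]
  show "cinner (toeplitz u (f + g)) h = cinner (toeplitz u f + toeplitz u g) h"
    unfolding cinner_add_left cinner_toeplitz[OF u] L2_inner_def fun_of_simps
    using i by (simp add: algebra_simps)
qed

lemma toeplitz_scaleC:
  assumes u: "symbol B u" shows "toeplitz u (scaleC c f) = scaleC c (toeplitz u f)"
proof (rule bergman_eqI_cinner)
  fix g
  have "cinner (toeplitz u (scaleC c f)) g = (LINT z|area. c * (u z * fun_of f z * cnj (fun_of g z)))"
    unfolding cinner_toeplitz[OF u] L2_inner_def fun_of_simps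
    by (rule Bochner_Integration.integral_cong[OF refl]) (simp add: mult.assoc mult.left_commute)
  also have "\<dots> = c * (LINT z|area. u z * fun_of f z * cnj (fun_of g z))"
    by (rule integral_mult_right_zero)
  finally show "cinner (toeplitz u (scaleC c f)) g = cinner (scaleC c (toeplitz u f)) g"
    unfolding cinner_scaleC_left cinner_toeplitz[OF u] L2_inner_def .
qed

lemma norm_toeplitz:
  assumes u: "symbol B u" shows "norm (toeplitz u f) \<le> B * norm f"
proof -
  have B: "0 \<le> B"
    by (rule symbol_nonneg[OF u])
  have sq: "square_int (\<lambda>z. u z * fun_of f z)"
    by (rule square_int_symbol_mult[OF u square_int_fun_of])
  have "(norm (toeplitz u f))\<^sup>2 \<le> (LINT z|area. (cmod (u z * fun_of f z))\<^sup>2)"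
    unfolding toeplitz_def by (rule norm_bergman_proj[OF sq])
  also have "\<dots> \<le> (LINT z|area. B\<^sup>2 * (cmod (fun_of f z))\<^sup>2)"
  proof (rule integral_mono)
    show "(cmod (u z * fun_of f z))\<^sup>2 \<le> B\<^sup>2 * (cmod (fun_of f z))\<^sup>2" if "z \<in> space area" for z
      using u that unfolding norm_mult power_mult_distrib symbol_def
      by (intro mult_right_mono power_mono) auto
  qed (use sq square_int_fun_of[of f] in \<open>auto simp: square_int_def\<close>)
  also have "\<dots> = (B * norm f)\<^sup>2"
    by (simp add: norm_sq_eq power_mult_distrib)
  finally show ?thesis
    by (rule power2_le_imp_le) (use B in simp)
qed

lemma bounded_linear_toeplitz:
  assumes u: "symbol B u" shows "bounded_linear (toeplitz u)"
  by (rule bounded_linear_intro[of _ B])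
    (use norm_toeplitz[OF u] in \<open>simp_all add: toeplitz_add[OF u] scaleR_eq_scaleC toeplitz_scaleC[OF u] mult.commute\<close>)

lemma L2_inner_cnj: "L2_inner f g = cnj (L2_inner g f)"
  unfolding L2_inner_def by (subst Bochner_Integration.integral_cnj[symmetric]) (simp add: mult.commute)

lemma cinner_toeplitz_adjoint:
  assumes u: "symbol B u"
  shows "cinner (toeplitz u f) g = cinner f (toeplitz (\<lambda>z. cnj (u z)) g)"
proof -
  have "cinner f (toeplitz (\<lambda>z. cnj (u z)) g) = cnj (L2_inner (\<lambda>z. cnj (u z) * fun_of g z) (fun_of f))"
    by (subst cinner_cnj) (simp add: cinner_toeplitz[OF symbol_cnj[OF u]])
  also have "\<dots> = L2_inner (\<lambda>z. u z * fun_of f z) (fun_of g)"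
    by (subst L2_inner_cnj) (simp add: L2_inner_def mult_ac)
  finally show ?thesis
    by (simp add: cinner_toeplitz[OF u])
qed

lemma L2_inner_cong:
  assumes "\<And>z. z \<in> unit_disk \<Longrightarrow> f z = f' z" "\<And>z. z \<in> unit_disk \<Longrightarrow> g z = g' z"
  shows "L2_inner f g = L2_inner f' g'"
  unfolding L2_inner_def by (rule Bochner_Integration.integral_cong) (use assms in auto)

text \<open>Conjugation by the unitary composes the symbol with \<open>disk_aut z\<close>. As the
  unitary is an involution, every test vector may be taken in its range, where the change of
  variables applies.\<close>

lemma toeplitz_disk_unitary:
  assumes z: "z \<in> unit_disk" and u: "symbol B u"
  shows "toeplitz u (disk_unitary z f) = disk_unitary z (toeplitz (\<lambda>x. u (disk_aut z x)) f)"
proof (rule bergman_eqI_cinner)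
  fix h
  define g where "g = disk_unitary z h"
  have h: "h = disk_unitary z g"
    unfolding g_def disk_unitary_involution[OF z] ..
  let ?v = "\<lambda>x. u (disk_aut z x)"
  have "cinner (toeplitz u (disk_unitary z f)) (disk_unitary z g)
      = L2_inner (\<lambda>x. bkern z x * (\<lambda>x. ?v x * fun_of f x) (disk_aut z x))
          (\<lambda>x. bkern z x * fun_of g (disk_aut z x))"
    unfolding cinner_toeplitz[OF u]
    by (rule L2_inner_cong) (simp_all add: fun_of_disk_unitary[OF z] disk_aut_involution[OF z])
  also have "\<dots> = L2_inner (\<lambda>x. ?v x * fun_of f x) (fun_of g)"
    using symbol_pull[OF z u] by (intro L2_inner_transform z) (auto simp: symbol_def)
  also have "\<dots> = cinner (disk_unitary z (toeplitz ?v f)) (disk_unitary z g)"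
    by (simp only: cinner_disk_unitary[OF z] cinner_toeplitz[OF symbol_pull[OF z u]])
  finally show "cinner (toeplitz u (disk_unitary z f)) h = cinner (disk_unitary z (toeplitz ?v f)) h"
    unfolding h .
qed

lemma bergman_proj_cong:
  assumes "\<And>z. z \<in> unit_disk \<Longrightarrow> f z = g z" shows "bergman_proj f = bergman_proj g"
proof -
  have "L2_inner (\<lambda>w. f w - fun_of h w) k = L2_inner (\<lambda>w. g w - fun_of h w) k" for h k
    by (rule L2_inner_cong) (use assms in auto)
  then show ?thesis
    by (simp add: bergman_proj_def)
qed

lemma toeplitz_cong: "(\<And>z. z \<in> unit_disk \<Longrightarrow> u z = v z) \<Longrightarrow> toeplitz u = toeplitz v"
  unfolding toeplitz_def by (intro ext bergman_proj_cong) auto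

lemma norm_toeplitz_diff:
  assumes u: "symbol B u" and v: "symbol B v"
  shows "(norm (toeplitz u f - toeplitz v f))\<^sup>2 \<le> (LINT z|area. (cmod (u z - v z))\<^sup>2 * (cmod (fun_of f z))\<^sup>2)"
proof -
  let ?w = "\<lambda>z. u z - v z"
  have w: "symbol (B + B) ?w"
  proof -
    have "cmod (?w z) \<le> B + B" if "z \<in> unit_disk" for z
      using u v that by (intro order_trans[OF norm_triangle_ineq4] add_mono) (auto simp: symbol_def)
    then show ?thesis
      using u v unfolding symbol_def by (auto intro: borel_measurable_diff)
  qed
  have "toeplitz ?w f + toeplitz v f = toeplitz u f"
  proof (rule bergman_eqI_cinner)
    fix h
    note i = square_int_mult_integrable[OF square_int_symbol_mult[OF _ square_int_fun_of] square_int_fun_of]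
    show "cinner (toeplitz ?w f + toeplitz v f) h = cinner (toeplitz u f) h"
      unfolding cinner_add_left cinner_toeplitz[OF u] cinner_toeplitz[OF v] cinner_toeplitz[OF w] L2_inner_def
      by (subst Bochner_Integration.integral_add[OF i[OF w] i[OF v], symmetric]) (simp add: algebra_simps)
  qed
  then have "toeplitz u f - toeplitz v f = toeplitz ?w f"
    by (metis add_diff_cancel_right')
  then show ?thesis
    using norm_bergman_proj[OF square_int_symbol_mult[OF w square_int_fun_of[of f]]]
    by (simp add: toeplitz_def norm_mult power_mult_distrib)
qed

lemma tail_small:
  assumes f: "square_int f" and e: "0 < e"
  obtains r where "0 < r" "r < 1" "(LINT z|area. indicator (- ball 0 r) z * (cmod (f z))\<^sup>2) < e"
proof -
  let ?F = "\<lambda>z. (cmod (f z))\<^sup>2"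
  have i: "integrable area ?F"
    using f by (simp add: square_int_def)
  have ib: "integrable area (\<lambda>z. indicator (ball 0 r) z *\<^sub>R ?F z)" for r
    by (rule Bochner_Integration.integrable_bound[OF i])
      (use f in \<open>auto simp: indicator_def square_int_def\<close>)
  have "(\<lambda>n. LINT z|area. indicator (ball 0 (1 - 1 / Suc n)) z *\<^sub>R ?F z) \<longlonglongrightarrow> (LINT z|area. ?F z)"
    by (rule ball_exhaust_tendsto[OF i])
  then have "\<forall>\<^sub>F n in sequentially. (LINT z|area. ?F z) - e < (LINT z|area. indicator (ball 0 (1 - 1 / Suc n)) z *\<^sub>R ?F z)"
    by (rule order_tendstoD) (use e in simp)
  then obtain N where N: "\<And>n. n \<ge> N \<Longrightarrow> (LINT z|area. ?F z) - e < (LINT z|area. indicator (ball 0 (1 - 1 / Suc n)) z *\<^sub>R ?F z)"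
    by (auto simp: eventually_sequentially)
  define r where "r = 1 - 1 / real (Suc (Suc N))"
  have "(LINT z|area. indicator (- ball 0 r) z * ?F z) = (LINT z|area. ?F z - indicator (ball 0 r) z *\<^sub>R ?F z)"
    by (rule Bochner_Integration.integral_cong) (auto simp: indicator_def)
  also have "\<dots> = (LINT z|area. ?F z) - (LINT z|area. indicator (ball 0 r) z *\<^sub>R ?F z)"
    by (rule Bochner_Integration.integral_diff[OF i ib])
  also have "\<dots> < e"
    using N[of "Suc N"] by (simp add: r_def)
  finally show ?thesis
    by (intro that[of r]) (auto simp: r_def)
qed

text \<open>The convergence is strong, not in norm: on \<open>ball 0 r\<close> the symbols are
  uniformly close, and outside it the fixed vector f has little mass while the symbols stay
  bounded.\<close>

lemma toeplitz_tendsto: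
  assumes U: "\<forall>\<^sub>F x in F. symbol B (U x)" and v: "symbol B v"
    and lim: "\<And>r. 0 < r \<Longrightarrow> r < 1 \<Longrightarrow> uniform_limit (ball 0 r) U v F"
  shows "((\<lambda>x. toeplitz (U x) f) \<longlongrightarrow> toeplitz v f) F"
proof (rule tendstoI)
  fix e :: real assume e: "0 < e"
  have B: "0 \<le> B"
    by (rule symbol_nonneg[OF v])
  \<comment> \<open>\<open>e1\<close> bounds the mass of f outside the ball, where the symbols
    differ by at most \<open>B + B\<close>; \<open>e2\<close> bounds their difference inside. Each
    part contributes at most \<open>e^2 / 2\<close>; the summands 1 keep the denominators
    positive.\<close>
  define e1 where "e1 = e\<^sup>2 / (2 * ((B + B)\<^sup>2 + 1))"
  define e2 where "e2 = sqrt (e\<^sup>2 / (2 * ((norm f)\<^sup>2 + 1)))"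
  have e12: "0 < e1" "0 < e2" "e2\<^sup>2 = e\<^sup>2 / (2 * ((norm f)\<^sup>2 + 1))"
    using e by (auto simp: e1_def e2_def intro!: divide_pos_pos add_nonneg_pos)
  obtain r where r: "0 < r" "r < 1" and tail: "(LINT z|area. indicator (- ball 0 r) z * (cmod (fun_of f z))\<^sup>2) < e1"
    by (rule tail_small[OF square_int_fun_of \<open>0 < e1\<close>])
  have "\<forall>\<^sub>F x in F. \<forall>z\<in>ball 0 r. dist (U x z) (v z) < e2"
    using lim[OF r] e12 by (simp add: uniform_limit_iff)
  with U show "\<forall>\<^sub>F x in F. dist (toeplitz (U x) f) (toeplitz v f) < e"
  proof eventually_elim
    fix x assume u: "symbol B (U x)" and d: "\<forall>z\<in>ball 0 r. dist (U x z) (v z) < e2"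
    have [measurable]: "U x \<in> borel_measurable area" "v \<in> borel_measurable area"
      using u v by (auto simp: symbol_def)
    let ?F = "\<lambda>z. (cmod (fun_of f z))\<^sup>2"
    have iF: "integrable area ?F"
      using square_int_fun_of[of f] by (simp add: square_int_def)
    have iT: "integrable area (\<lambda>z. indicator (- ball 0 r) z * ?F z)"
    proof (rule Bochner_Integration.integrable_bound[OF iF])
      have "(\<lambda>z. indicator (- ball 0 r) z * ?F z) = (\<lambda>z. (1 - indicator (ball 0 r) z) * ?F z)"
        by (auto simp: indicator_def)
      then show "(\<lambda>z. indicator (- ball 0 r) z * ?F z) \<in> borel_measurable area"
        by simp
    qed (auto simp: indicator_def)
    have le: "(cmod (U x z - v z))\<^sup>2 * ?F z \<le> (B + B)\<^sup>2 * (indicator (- ball 0 r) z * ?F z) + e2\<^sup>2 * ?F z"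
      if z: "z \<in> unit_disk" for z
    proof (cases "z \<in> ball 0 r")
      case True
      then have "(cmod (U x z - v z))\<^sup>2 \<le> e2\<^sup>2"
        using d by (intro power_mono) (auto simp: dist_norm less_imp_le)
      then show ?thesis
        using True by (simp add: mult_right_mono)
    next
      case False
      have "cmod (U x z - v z) \<le> B + B"
        using u v z by (intro order_trans[OF norm_triangle_ineq4] add_mono) (auto simp: symbol_def)
      then have "(cmod (U x z - v z))\<^sup>2 \<le> (B + B)\<^sup>2"
        by (intro power_mono) auto
      then have "(cmod (U x z - v z))\<^sup>2 * ?F z \<le> (B + B)\<^sup>2 * ?F z"
        by (rule mult_right_mono) simp
      moreover have "0 \<le> e2\<^sup>2 * ?F z"
        by simp
      ultimately show ?thesis
        using False by (simp only: indicator_simps Compl_iff mult_1_left if_True not_False_eq_True)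
    qed
    have "(norm (toeplitz (U x) f - toeplitz v f))\<^sup>2 \<le> (LINT z|area. (cmod (U x z - v z))\<^sup>2 * ?F z)"
      by (rule norm_toeplitz_diff[OF u v])
    also have "\<dots> \<le> (LINT z|area. (B + B)\<^sup>2 * (indicator (- ball 0 r) z * ?F z) + e2\<^sup>2 * ?F z)"
    proof (rule integral_mono)
      show i: "integrable area (\<lambda>z. (B + B)\<^sup>2 * (indicator (- ball 0 r) z * ?F z) + e2\<^sup>2 * ?F z)"
        using iT iF by (intro Bochner_Integration.integrable_add integrable_mult_right)
      show "integrable area (\<lambda>z. (cmod (U x z - v z))\<^sup>2 * ?F z)"
        by (rule Bochner_Integration.integrable_bound[OF i]) (use le in \<open>auto intro!: AE_I2 order_trans[OF _ abs_ge_self]\<close>)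
    qed (use le in auto)
    also have "\<dots> = (B + B)\<^sup>2 * (LINT z|area. indicator (- ball 0 r) z * ?F z) + e2\<^sup>2 * (norm f)\<^sup>2"
      unfolding norm_sq_eq using iT iF by simp
    also have "\<dots> < e\<^sup>2"
    proof -
      have "(B + B)\<^sup>2 * (LINT z|area. indicator (- ball 0 r) z * ?F z) \<le> (B + B)\<^sup>2 * e1"
        using tail by (intro mult_left_mono) auto
      also have "\<dots> < e\<^sup>2 / 2"
        using e unfolding e1_def by (simp add: field_simps add_pos_nonneg)
      finally have 1: "(B + B)\<^sup>2 * (LINT z|area. indicator (- ball 0 r) z * ?F z) < e\<^sup>2 / 2" .
      have "e2\<^sup>2 * (norm f)\<^sup>2 \<le> e\<^sup>2 / 2"
        using e unfolding e12 by (simp add: field_simps add_pos_nonneg)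
      with 1 show ?thesis by linarith
    qed
    finally have "norm (toeplitz (U x) f - toeplitz v f) < e"
      by (rule power2_less_imp_less) (use e in simp)
    then show "dist (toeplitz (U x) f) (toeplitz v f) < e"
      by (simp add: dist_norm)
  qed
qed

section \<open>Products and sums of Toeplitz operators\<close>

definition symbols :: "real \<Rightarrow> (complex \<Rightarrow> complex) list \<Rightarrow> bool" where
  "symbols B us \<longleftrightarrow> (\<forall>u\<in>set us. symbol B u)"

lemma symbols_simps [simp]: "symbols B []" "symbols B (u # us) \<longleftrightarrow> symbol B u \<and> symbols B us"
  by (auto simp: symbols_def)

lemma bounded_linear_toeplitz_product: "symbols B us \<Longrightarrow> bounded_linear (foldr toeplitz us)"
proof (induction us)
  case (Cons u us)
  then show ?case
    using bounded_linear_compose[OF bounded_linear_toeplitz, of B u "foldr toeplitz us"] by (simp add: o_def)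
qed (simp add: id_def bounded_linear_ident)

lemma toeplitz_product_scaleC: "symbols B us \<Longrightarrow> foldr toeplitz us (scaleC c f) = scaleC c (foldr toeplitz us f)"
  by (induction us) (auto simp: toeplitz_scaleC)

lemma toeplitz_product_disk_unitary:
  assumes "z \<in> unit_disk"
  shows "symbols B us \<Longrightarrow> foldr toeplitz us (disk_unitary z f)
    = disk_unitary z (foldr toeplitz (map (\<lambda>u x. u (disk_aut z x)) us) f)"
  by (induction us) (auto simp: toeplitz_disk_unitary[OF assms])

lemma toeplitz_product_adjoint:
  "symbols B us \<Longrightarrow> cinner (foldr toeplitz us f) g
    = cinner f (foldr toeplitz (rev (map (\<lambda>u z. cnj (u z)) us)) g)"
  by (induction us arbitrary: g) (auto simp: cinner_toeplitz_adjoint)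

text \<open>Write the outer operator at \<open>?g x\<close> as its value at \<open>?g x - ?h\<close>
  plus its value at \<open>?h\<close>: the first term is small because the operators are uniformly
  bounded, the second converges by \<open>toeplitz_tendsto\<close>.\<close>

lemma toeplitz_product_tendsto:
  assumes "\<And>u. u \<in> set us \<Longrightarrow> \<forall>\<^sub>F x in F. symbol B (U x u)"
    and "\<And>u. u \<in> set us \<Longrightarrow> symbol B (v u)"
    and "\<And>u r. u \<in> set us \<Longrightarrow> 0 < r \<Longrightarrow> r < 1 \<Longrightarrow> uniform_limit (ball 0 r) (\<lambda>x. U x u) (v u) F"
  shows "((\<lambda>x. foldr toeplitz (map (U x) us) f) \<longlongrightarrow> foldr toeplitz (map v us) f) F"
  using assms
proof (induction us)
  case (Cons u us)
  let ?g = "\<lambda>x. foldr toeplitz (map (U x) us) f"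
  let ?h = "foldr toeplitz (map v us) f"
  have IH: "(?g \<longlongrightarrow> ?h) F"
    using Cons by auto
  have u: "\<forall>\<^sub>F x in F. symbol B (U x u)" and v: "symbol B (v u)"
    using Cons.prems by auto
  have "((\<lambda>x. toeplitz (U x u) (?g x - ?h)) \<longlongrightarrow> 0) F"
  proof (rule Lim_null_comparison)
    show "\<forall>\<^sub>F x in F. norm (toeplitz (U x u) (?g x - ?h)) \<le> B * norm (?g x - ?h)"
      using u by eventually_elim (rule norm_toeplitz)
    have "((\<lambda>x. B * norm (?g x - ?h)) \<longlongrightarrow> B * norm (?h - ?h)) F"
      by (intro tendsto_intros IH)
    then show "((\<lambda>x. B * norm (?g x - ?h)) \<longlongrightarrow> 0) F" by simp
  qed
  moreover have "((\<lambda>x. toeplitz (U x u) ?h) \<longlongrightarrow> toeplitz (v u) ?h) F"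
    by (rule toeplitz_tendsto[OF u v]) (use Cons.prems in auto)
  ultimately have "((\<lambda>x. toeplitz (U x u) (?g x - ?h) + toeplitz (U x u) ?h) \<longlongrightarrow> 0 + toeplitz (v u) ?h) F"
    by (rule tendsto_add)
  moreover have "\<forall>\<^sub>F x in F. toeplitz (U x u) (?g x - ?h) + toeplitz (U x u) ?h = toeplitz (U x u) (?g x)"
    using u by eventually_elim (simp flip: toeplitz_add)
  ultimately show ?case
    by (auto elim: Lim_transform_eventually)
qed simp

text \<open>By \<open>forelli_rudin\<close> a Toeplitz operator preserves growth of order
  \<open>kweight\<close> at the cost of the factor \<open>B * majorant_const\<close>. The constants
  see only the bound of the symbols, so composing the symbols with automorphisms leaves them
  unchanged.\<close>

lemma toeplitz_product_pointwise:
  assumes f: "\<And>z. z \<in> unit_disk \<Longrightarrow> cmod (fun_of f z) \<le> M * kweight z" and M: "0 \<le> M"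
  shows "symbols B us \<Longrightarrow> z \<in> unit_disk \<Longrightarrow>
    cmod (fun_of (foldr toeplitz us f) z) \<le> (B * majorant_const) ^ length us * M * kweight z"
proof (induction us arbitrary: z)
  case (Cons u us)
  define g where "g = foldr toeplitz us f"
  define N where "N = (B * majorant_const) ^ length us * M"
  have u: "symbol B u" and z: "z \<in> unit_disk"
    using Cons.prems by auto
  have B: "0 \<le> B"
    by (rule symbol_nonneg[OF u])
  have N: "0 \<le> N"
    using B M majorant_const by (simp add: N_def)
  have g: "cmod (fun_of g w) \<le> N * kweight w" if "w \<in> unit_disk" for w
    using Cons.IH[of w] Cons.prems that by (simp add: g_def N_def)
  let ?k = "\<lambda>w. 1 / (1 - cnj z * w)\<^sup>2"
  have sq: "square_int (\<lambda>w. u w * fun_of g w)"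
    by (rule square_int_symbol_mult[OF u square_int_fun_of])
  have "ennreal (cmod (fun_of (toeplitz u g) z)) = ennreal (cmod (proj_fun (\<lambda>w. u w * fun_of g w) z))"
    using z by (simp add: toeplitz_def bergman_proj_eq[OF sq] fun_of_proj_bergman[OF sq])
  also have "\<dots> \<le> (\<integral>\<^sup>+w. ennreal (cmod (?k w) * cmod (u w * fun_of g w)) \<partial>area)"
    by (rule proj_fun_bound[OF sq z])
  also have "\<dots> \<le> (\<integral>\<^sup>+w. ennreal (B * N) * ennreal (cmod (?k w) * kweight w) \<partial>area)"
  proof (rule nn_integral_mono)
    fix w assume "w \<in> space area"
    then have w: "w \<in> unit_disk" by simp
    have "cmod (u w * fun_of g w) \<le> B * (N * kweight w)"
      unfolding norm_mult using u w g[OF w] B by (intro mult_mono) (auto simp: symbol_def)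
    then have "cmod (?k w) * cmod (u w * fun_of g w) \<le> cmod (?k w) * (B * (N * kweight w))"
      by (rule mult_left_mono) simp
    then show "ennreal (cmod (?k w) * cmod (u w * fun_of g w)) \<le> ennreal (B * N) * ennreal (cmod (?k w) * kweight w)"
      using B N kweight_pos[OF w]
      by (subst ennreal_mult[symmetric]) (auto intro!: ennreal_leI simp: mult_ac less_imp_le simp del: norm_divide)
  qed
  also have "\<dots> = ennreal (B * N) * (\<integral>\<^sup>+w. ennreal (cmod (?k w) * kweight w) \<partial>area)"
    by (rule nn_integral_cmult) measurable
  also have "\<dots> \<le> ennreal (B * N) * ennreal (majorant_const * kweight z)"
    by (intro mult_left_mono forelli_rudin z) simp
  also have "\<dots> = ennreal (B * N * (majorant_const * kweight z))"
    using B N by (intro ennreal_mult'[symmetric]) simp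
  finally have "cmod (fun_of (toeplitz u g) z) \<le> B * N * (majorant_const * kweight z)"
    using B N majorant_const kweight_pos[OF z] by (simp add: ennreal_le_iff)
  also have "\<dots> = (B * majorant_const) ^ length (u # us) * M * kweight z"
    by (simp add: N_def)
  finally show ?case
    by (simp add: g_def)
qed (use f in simp)

text \<open>The operator is represented by the lists of its symbols, because pulling back and
  passing to limits act on the symbols.\<close>

definition toeplitz_sum :: "(complex \<Rightarrow> complex) list list \<Rightarrow> bergman \<Rightarrow> bergman" where
  "toeplitz_sum uss f = (\<Sum>us\<leftarrow>uss. foldr toeplitz us f)"

lemma toeplitz_sum_simps [simp]:
  "toeplitz_sum [] f = 0"
  "toeplitz_sum (us # uss) f = foldr toeplitz us f + toeplitz_sum uss f"
  "toeplitz_sum (uss @ vss) f = toeplitz_sum uss f + toeplitz_sum vss f"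
  by (simp_all add: toeplitz_sum_def)

definition symbol_lists :: "real \<Rightarrow> (complex \<Rightarrow> complex) list list \<Rightarrow> bool" where
  "symbol_lists B uss \<longleftrightarrow> (\<forall>us\<in>set uss. symbols B us)"

lemma symbol_lists_simps [simp]:
  "symbol_lists B []" "symbol_lists B (us # uss) \<longleftrightarrow> symbols B us \<and> symbol_lists B uss"
  by (auto simp: symbol_lists_def)

lemma bounded_linear_toeplitz_sum: "symbol_lists B uss \<Longrightarrow> bounded_linear (toeplitz_sum uss)"
proof (induction uss)
  case Nil
  have "toeplitz_sum [] = (\<lambda>f. 0)"
    by (simp add: fun_eq_iff)
  then show ?case
    by (simp add: bounded_linear_zero)
next
  case (Cons us uss)
  have "toeplitz_sum (us # uss) = (\<lambda>f. foldr toeplitz us f + toeplitz_sum uss f)"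
    by (simp add: fun_eq_iff)
  then show ?case
    using Cons bounded_linear_toeplitz_product by (auto intro: bounded_linear_add)
qed

lemma scaleC_add: "scaleC c (f + g) = scaleC c f + scaleC c g"
  by (rule linear_add[OF bounded_linear.linear[OF bounded_linear_scaleC_right]])

lemma scaleC_zero [simp]: "scaleC c 0 = 0"
  by (rule linear_0[OF bounded_linear.linear[OF bounded_linear_scaleC_right]])

lemma toeplitz_sum_scaleC: "symbol_lists B uss \<Longrightarrow> toeplitz_sum uss (scaleC c f) = scaleC c (toeplitz_sum uss f)"
  by (induction uss) (auto simp: toeplitz_product_scaleC scaleC_add)

lemma disk_unitary_add:
  "z \<in> unit_disk \<Longrightarrow> disk_unitary z (f + g) = disk_unitary z f + disk_unitary z g"
  by (rule fun_of_eqI) (simp add: fun_of_disk_unitary fun_of_simps distrib_left)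

lemma disk_unitary_zero: "z \<in> unit_disk \<Longrightarrow> disk_unitary z 0 = 0"
  by (rule fun_of_eqI) (simp add: fun_of_disk_unitary fun_of_simps)

definition pull_back :: "complex \<Rightarrow> (complex \<Rightarrow> complex) \<Rightarrow> complex \<Rightarrow> complex" where
  "pull_back z u = (\<lambda>x. u (disk_aut z x))"

lemma toeplitz_sum_disk_unitary:
  assumes z: "z \<in> unit_disk"
  shows "symbol_lists B uss \<Longrightarrow> toeplitz_sum uss (disk_unitary z f)
    = disk_unitary z (toeplitz_sum (map (map (pull_back z)) uss) f)"
  by (induction uss)
    (auto simp: toeplitz_product_disk_unitary[OF z] disk_unitary_add[OF z] disk_unitary_zero[OF z]
      pull_back_def[abs_def])

lemma toeplitz_sum_adjoint:
  "symbol_lists B uss \<Longrightarrow> cinner (toeplitz_sum uss f) g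
    = cinner f (toeplitz_sum (map (\<lambda>us. rev (map (\<lambda>u z. cnj (u z)) us)) uss) g)"
  by (induction uss)
    (auto simp: toeplitz_product_adjoint cinner_add_left cinner_add_right cinner.zero_left cinner.zero_right)

lemma toeplitz_sum_pointwise:
  assumes f: "\<And>z. z \<in> unit_disk \<Longrightarrow> cmod (fun_of f z) \<le> M * kweight z" and M: "0 \<le> M"
    and z: "z \<in> unit_disk"
  shows "symbol_lists B uss \<Longrightarrow> cmod (fun_of (toeplitz_sum uss f) z)
    \<le> (\<Sum>us\<leftarrow>uss. (B * majorant_const) ^ length us) * M * kweight z"
proof (induction uss)
  case (Cons us uss)
  have "cmod (fun_of (toeplitz_sum (us # uss) f) z)
      \<le> cmod (fun_of (foldr toeplitz us f) z) + cmod (fun_of (toeplitz_sum uss f) z)"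
    by (simp add: fun_of_simps norm_triangle_ineq)
  also have "\<dots> \<le> (B * majorant_const) ^ length us * M * kweight z
      + (\<Sum>us\<leftarrow>uss. (B * majorant_const) ^ length us) * M * kweight z"
    using Cons z by (intro add_mono toeplitz_product_pointwise f M) auto
  finally show ?case
    by (simp add: algebra_simps)
qed (simp add: fun_of_simps)

lemma toeplitz_sum_tendsto:
  assumes "\<And>us u. us \<in> set uss \<Longrightarrow> u \<in> set us \<Longrightarrow> \<forall>\<^sub>F x in F. symbol B (U x u)"
    and "\<And>us u. us \<in> set uss \<Longrightarrow> u \<in> set us \<Longrightarrow> symbol B (v u)"
    and "\<And>us u r. us \<in> set uss \<Longrightarrow> u \<in> set us \<Longrightarrow> 0 < r \<Longrightarrow> r < 1 \<Longrightarrow>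
      uniform_limit (ball 0 r) (\<lambda>x. U x u) (v u) F"
  shows "((\<lambda>x. toeplitz_sum (map (map (U x)) uss) f) \<longlongrightarrow> toeplitz_sum (map (map v) uss) f) F"
  using assms
proof (induction uss)
  case (Cons us uss)
  have "((\<lambda>x. foldr toeplitz (map (U x) us) f) \<longlongrightarrow> foldr toeplitz (map v us) f) F"
    by (rule toeplitz_product_tendsto)
      (use Cons.prems(1)[of us] Cons.prems(2)[of us] Cons.prems(3)[of us] in auto)
  moreover have "((\<lambda>x. toeplitz_sum (map (map (U x)) uss) f) \<longlongrightarrow> toeplitz_sum (map (map v) uss) f) F"
  proof (rule Cons.IH)
    fix us' u r assume "us' \<in> set uss" "u \<in> set us'"
    then show "\<forall>\<^sub>F x in F. symbol B (U x u)" "symbol B (v u)"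
      using Cons.prems(1,2)[of us' u] by auto
    show "uniform_limit (ball 0 r) (\<lambda>x. U x u) (v u) F" if "0 < r" "r < 1"
      using Cons.prems(3)[of us' u r] that \<open>us' \<in> set uss\<close> \<open>u \<in> set us'\<close> by auto
  qed
  ultimately show ?case
    by (auto intro: tendsto_add)
qed simp

text \<open>The unitary carries the kernel at w to the kernel at \<open>disk_aut z w\<close> up to a
  unimodular factor, which cancels in the quadratic form.\<close>

lemma berezin_toeplitz_sum_pull_back:
  assumes z: "z \<in> unit_disk" and w: "w \<in> unit_disk" and uss: "symbol_lists B uss"
  shows "berezin (toeplitz_sum uss) (disk_aut z w) = berezin (toeplitz_sum (map (map (pull_back z)) uss)) w"
proof -
  define c where "c = kern_phase z w"
  let ?a = "disk_aut z w"
  have c: "cmod c = 1"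
    using norm_kern_phase[OF z w] by (simp add: c_def)
  have "berezin (toeplitz_sum (map (map (pull_back z)) uss)) w
      = cinner (disk_unitary z (toeplitz_sum (map (map (pull_back z)) uss) (normalized_kernel w)))
          (disk_unitary z (normalized_kernel w))"
    by (simp add: berezin_def cinner_disk_unitary[OF z])
  also have "\<dots> = cinner (toeplitz_sum uss (scaleC c (normalized_kernel ?a))) (scaleC c (normalized_kernel ?a))"
    by (simp add: toeplitz_sum_disk_unitary[OF z uss, symmetric] disk_unitary_normalized_kernel[OF z w] c_def)
  also have "\<dots> = (c * cnj c) * berezin (toeplitz_sum uss) ?a"
    by (simp add: toeplitz_sum_scaleC[OF uss] cinner_scaleC_left cinner_scaleC_right berezin_def)
  also have "c * cnj c = 1"
    using c complex_norm_square[of c] by simp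
  finally show ?thesis by simp
qed

section \<open>Differentiability of the kernels in their parameter\<close>

lemma norm_le_sup:
  assumes "\<And>x. x \<in> unit_disk \<Longrightarrow> cmod (fun_of f x) \<le> C" shows "norm f \<le> C"
proof -
  have C: "0 \<le> C"
    using assms[of 0] norm_ge_zero order_trans by (metis centre_in_ball zero_less_one)
  have "(norm f)\<^sup>2 = norm (LINT z|area. (cmod (fun_of f z))\<^sup>2)"
    by (simp add: norm_sq_eq[symmetric])
  also have "\<dots> \<le> C\<^sup>2"
    by (rule integral_area_bound) (use assms in \<open>auto intro!: power_mono\<close>)
  finally show ?thesis
    by (rule power2_le_imp_le) (rule C)
qed

text \<open>Differentiability in the Hilbert space norm: by \<open>norm_le_sup\<close> it is enough
  to have a second-order Taylor estimate in \<open>a = cnj w\<close> that is uniform in x. The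
  kernel is analytic in a, so the derivative is conjugate-linear in h.\<close>

lemma kern_has_derivative:
  assumes w: "w \<in> unit_disk"
  shows "(kern i has_derivative (\<lambda>h. scaleC (cnj h) (kern (Suc i) w))) (at w)"
proof -
  define s where "s = (1 + cmod w) / 2"
  have s: "cmod w < s" "s < 1" "0 < s"
    using w by (auto simp: s_def add_pos_nonneg)
  define G where "G = (\<lambda>x i a. fact (Suc i) * x ^ i / (1 - a * x) ^ (i + 2) :: complex)"
  have nz: "1 - a * x \<noteq> 0" if "a \<in> ball 0 s" "x \<in> unit_disk" for a x
    using one_minus_cnj_mult_nonzero[of "cnj a" x] that s by auto
  have der: "(G x i has_field_derivative G x (Suc i) a) (at a within ball 0 s)"
    if "a \<in> ball 0 s" "x \<in> unit_disk" for i x a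
  proof -
    define d where "d = 1 - a * x"
    have d: "d \<noteq> 0"
      using nz[OF that] by (simp add: d_def)
    have 1: "((\<lambda>a. 1 - a * x) has_field_derivative - x) (at a within ball 0 s)"
      by (auto intro!: derivative_eq_intros)
    from DERIV_power[OF this, of "i + 2"]
    have 2: "((\<lambda>a. (1 - a * x) ^ (i + 2)) has_field_derivative of_nat (i + 2) * (- x * d ^ (i + 1))) (at a within ball 0 s)"
      by (simp add: d_def)
    have "((\<lambda>a. fact (Suc i) * x ^ i / (1 - a * x) ^ (i + 2)) has_field_derivative
        (0 * d ^ (i + 2) - fact (Suc i) * x ^ i * (of_nat (i + 2) * (- x * d ^ (i + 1)))) / (d ^ (i + 2) * d ^ (i + 2)))
        (at a within ball 0 s)"
      using d by (intro DERIV_cong[OF DERIV_divide[OF DERIV_const 2]]) (simp_all add: d_def)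
    also have "(0 * d ^ (i + 2) - fact (Suc i) * x ^ i * (of_nat (i + 2) * (- x * d ^ (i + 1)))) / (d ^ (i + 2) * d ^ (i + 2))
        = (d ^ (i + 1) * (fact (Suc (Suc i)) * x ^ Suc i)) / (d ^ (i + 1) * d ^ (Suc i + 2))"
      by (intro arg_cong2[where f = "(/)"]) (simp_all add: algebra_simps power_add)
    also have "\<dots> = G x (Suc i) a"
      using d by (simp add: G_def d_def)
    finally show ?thesis
      by (simp add: G_def)
  qed
  \<comment> \<open>Bounds the second derivative in a, uniformly for |a| < s and x in the disk, by
    \<open>kern_bound\<close> at index \<open>i + 2\<close>.\<close>
  define B where "B = fact (Suc (i + 2)) / (1 - s) ^ (i + 4)"
  have bound: "cmod (G x (Suc (Suc i)) a) \<le> B" if "a \<in> ball 0 s" "x \<in> unit_disk" for x a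
  proof -
    have a: "cnj a \<in> unit_disk"
      using that s by auto
    have "cmod (G x (Suc (Suc i)) a) \<le> fact (Suc (i + 2)) / (1 - cmod (cnj a)) ^ (i + 2 + 2)"
      using kern_bound[OF a that(2), of "i + 2"] by (simp add: G_def del: fact_Suc)
    also have "\<dots> \<le> B"
    proof -
      have "(1 - s) ^ (i + 4) \<le> (1 - cmod (cnj a)) ^ (i + 4)"
        using that s by (intro power_mono) auto
      then show ?thesis
        unfolding B_def using that s by (intro frac_le) (auto simp: numeral_eq_Suc)
    qed
    finally show ?thesis .
  qed
  have fk: "fun_of (kern i v) x = G x i (cnj v)" if "v \<in> ball 0 s" "x \<in> unit_disk" for v x i
    using that s by (simp add: fun_of_kern G_def)
  have est: "norm (kern i v - kern i w - scaleC (cnj (v - w)) (kern (Suc i) w)) \<le> B * (cmod (v - w))\<^sup>2"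
    if v: "v \<in> ball 0 s" for v
  proof (rule norm_le_sup)
    fix x assume x: "x \<in> unit_disk"
    have "cmod (G x (i + 0) (cnj v) - (\<Sum>j\<le>1. G x (i + j) (cnj w) * (cnj v - cnj w) ^ j / fact j))
        \<le> B * cmod (cnj v - cnj w) ^ Suc 1 / fact 1"
    proof (rule complex_Taylor[of "ball 0 s" 1 "\<lambda>j. G x (i + j)"])
      show "(G x (i + j) has_field_derivative G x (i + Suc j) a) (at a within ball 0 s)" if "a \<in> ball 0 s" for j a
        using der[OF that x] by simp
      show "cmod (G x (i + Suc 1) a) \<le> B" if "a \<in> ball 0 s" for a
        using bound[OF that x] by simp
    qed (use v s in auto)
    then show "cmod (fun_of (kern i v - kern i w - scaleC (cnj (v - w)) (kern (Suc i) w)) x) \<le> B * (cmod (v - w))\<^sup>2"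
      using v s x by (simp add: fun_of_simps fk power2_eq_square algebra_simps flip: complex_cnj_diff)
  qed
  have bl: "bounded_linear (\<lambda>h. scaleC (cnj h) (kern (Suc i) w))"
    by (rule bounded_linear_compose[OF bounded_bilinear.bounded_linear_left[OF bounded_bilinear_scaleC] bounded_linear_cnj])
  show ?thesis
    unfolding has_derivative_at_within
  proof (intro conjI bl)
    show "((\<lambda>v. (kern i v - kern i w - scaleC (cnj (v - w)) (kern (Suc i) w)) /\<^sub>R norm (v - w)) \<longlongrightarrow> 0) (at w)"
    proof (rule Lim_null_comparison)
      have "\<forall>\<^sub>F v in at w. v \<in> ball 0 s"
        using s by (intro eventually_at_in_open') auto
      then show "\<forall>\<^sub>F v in at w. norm ((kern i v - kern i w - scaleC (cnj (v - w)) (kern (Suc i) w)) /\<^sub>R norm (v - w))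
          \<le> B * cmod (v - w)"
      proof eventually_elim
        fix v :: complex assume "v \<in> ball 0 s"
        then have "norm (kern i v - kern i w - scaleC (cnj (v - w)) (kern (Suc i) w)) / cmod (v - w)
            \<le> B * (cmod (v - w))\<^sup>2 / cmod (v - w)"
          by (intro divide_right_mono est) auto
        then show "norm ((kern i v - kern i w - scaleC (cnj (v - w)) (kern (Suc i) w)) /\<^sub>R norm (v - w))
          \<le> B * cmod (v - w)"
        proof -
          have n: "norm (X /\<^sub>R cmod y) = norm X / cmod y" for X :: bergman and y
            by (simp add: divide_inverse mult.commute)
          assume "norm (kern i v - kern i w - scaleC (cnj (v - w)) (kern (Suc i) w)) / cmod (v - w)
            \<le> B * (cmod (v - w))\<^sup>2 / cmod (v - w)"
          then show ?thesis
            unfolding n by (cases "v = w") (simp_all add: power2_eq_square)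
        qed
      qed
      have "((\<lambda>v. B * cmod (v - w)) \<longlongrightarrow> B * cmod (w - w)) (at w)"
        by (intro tendsto_intros)
      then show "((\<lambda>v. B * cmod (v - w)) \<longlongrightarrow> 0) (at w)"
        by simp
    qed
  qed
qed

lemma continuous_on_kern: "continuous_on unit_disk (kern i)"
  using has_derivative_continuous[OF kern_has_derivative]
  by (auto intro: continuous_at_imp_continuous_on)

section \<open>The Laplacian of a Berezin transform\<close>

text \<open>The numbers a and b are the Wirtinger derivatives of f in w and in
  \<open>cnj w\<close>.\<close>

definition wirt :: "(complex \<Rightarrow> complex) \<Rightarrow> complex \<Rightarrow> complex \<Rightarrow> complex \<Rightarrow> bool" where
  "wirt f a b w \<longleftrightarrow> (f has_derivative (\<lambda>h. a * h + b * cnj h)) (at w)"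

lemma wirt_unique:
  assumes "wirt f a b w" "wirt f a' b' w" shows "a = a'" "b = b'"
proof -
  have "(\<lambda>h. a * h + b * cnj h) = (\<lambda>h. a' * h + b' * cnj h)"
    using assms has_derivative_unique unfolding wirt_def by blast
  from fun_cong[OF this, of 1] fun_cong[OF this, of \<i>] have "a + b = a' + b'" "a - b = a' - b'"
    by (simp_all add: algebra_simps complex_eq_iff)
  then show "a = a'" "b = b'"
    by (simp_all add: complex_eq_iff)
qed

lemma wirt_const: "wirt (\<lambda>w. c) 0 0 w"
  by (simp add: wirt_def)

lemma wirt_id: "wirt (\<lambda>w. w) 1 0 w"
  by (simp add: wirt_def)

lemma wirt_cnj: "wirt cnj 0 1 w"
  unfolding wirt_def using bounded_linear_imp_has_derivative[OF bounded_linear_cnj] by simp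

lemma wirt_add: "wirt f a b w \<Longrightarrow> wirt g c d w \<Longrightarrow> wirt (\<lambda>w. f w + g w) (a + c) (b + d) w"
  unfolding wirt_def by (rule has_derivative_eq_rhs, rule has_derivative_add, assumption+)
    (auto simp: algebra_simps)

lemma wirt_mult:
  "wirt f a b w \<Longrightarrow> wirt g c d w \<Longrightarrow> wirt (\<lambda>w. f w * g w) (f w * c + a * g w) (f w * d + b * g w) w"
  unfolding wirt_def by (rule has_derivative_eq_rhs, rule has_derivative_mult, assumption+)
    (auto simp: algebra_simps)

lemma wirt_cong:
  assumes "wirt f a b w" "w \<in> unit_disk" "\<And>z. z \<in> unit_disk \<Longrightarrow> f z = g z" shows "wirt g a b w"
  using has_derivative_transform_within_open[OF assms(1)[unfolded wirt_def] open_ball assms(2,3)]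
  by (simp add: wirt_def)

lemma wirt_dir:
  assumes "wirt f a b w"
  shows "((\<lambda>t. f (w + of_real t * v)) has_vector_derivative (a * v + b * cnj v)) (at (0 :: real))"
proof -
  have "((\<lambda>t. w + of_real t * v) has_derivative (\<lambda>t. of_real t * v)) (at (0::real))"
    by (auto intro!: derivative_eq_intros)
  then have "((\<lambda>t. f (w + of_real t * v)) has_derivative (\<lambda>t. a * (of_real t * v) + b * cnj (of_real t * v))) (at (0::real))"
    by (rule has_derivative_compose) (use assms in \<open>simp add: wirt_def\<close>)
  then show ?thesis
    unfolding has_vector_derivative_def
    by (rule has_derivative_eq_rhs) (auto simp: scaleR_conv_of_real algebra_simps)
qed

lemma dir_deriv_wirt: "wirt f a b w \<Longrightarrow> dir_deriv v f w = a * v + b * cnj v"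
  unfolding dir_deriv_def by (rule vector_derivative_at[OF wirt_dir])

lemma dir_differentiable_wirt: "wirt f a b w \<Longrightarrow> (\<lambda>t::real. f (w + of_real t * v)) differentiable (at 0)"
  using wirt_dir differentiableI_vector by blast

lemma wirt_scale_sum:
  assumes "wirt f a b w" "wirt g c d w"
  shows "wirt (\<lambda>w. k * f w + l * g w) (k * a + l * c) (k * b + l * d) w"
  using wirt_add[OF wirt_mult[OF wirt_const assms(1), of k] wirt_mult[OF wirt_const assms(2), of l]] by simp

text \<open>The Laplacian is four times the mixed Wirtinger derivative; the two orders of
  differentiation are kept apart, so that no symmetry of second derivatives is presupposed.\<close>

lemma laplacian_wirt:
  assumes f: "\<And>w. w \<in> unit_disk \<Longrightarrow> wirt f (a w) (b w) w" and z: "z \<in> unit_disk"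
    and a: "wirt a c d z" and b: "wirt b d' e z"
  shows "laplacian f z = 2 * d + 2 * d'"
proof -
  have *: "wirt (dir_deriv v f) (v * c + cnj v * d') (v * d + cnj v * e) z" for v
    by (rule wirt_cong[OF wirt_scale_sum[OF a b, of v "cnj v"] z])
      (simp add: dir_deriv_wirt[OF f] mult.commute)
  show ?thesis
    unfolding laplacian_def dir_deriv_wirt[OF *] by (simp add: algebra_simps)
qed

text \<open>Class C^n, phrased so that the derivatives can be exhibited by the algebraic rules for
  \<open>wirt\<close>.\<close>

primrec wsmooth :: "nat \<Rightarrow> (complex \<Rightarrow> complex) \<Rightarrow> bool" where
  "wsmooth 0 f \<longleftrightarrow> continuous_on unit_disk f"
| "wsmooth (Suc n) f \<longleftrightarrow> (\<exists>a b. (\<forall>w\<in>unit_disk. wirt f (a w) (b w) w) \<and> wsmooth n a \<and> wsmooth n b)"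

lemma wsmooth_SucI:
  assumes "\<And>w. w \<in> unit_disk \<Longrightarrow> wirt f (a w) (b w) w" "wsmooth n a" "wsmooth n b"
  shows "wsmooth (Suc n) f"
  using assms unfolding wsmooth.simps by blast

lemma wirt_continuous: "(\<And>w. w \<in> unit_disk \<Longrightarrow> wirt f (a w) (b w) w) \<Longrightarrow> continuous_on unit_disk f"
  unfolding wirt_def by (meson continuous_at_imp_continuous_on has_derivative_continuous)

lemma wsmooth_cong:
  assumes f: "wsmooth n f" and eq: "\<And>z. z \<in> unit_disk \<Longrightarrow> f z = g z" shows "wsmooth n g"
proof (cases n)
  case 0
  have "continuous_on unit_disk g"
    by (rule continuous_on_eq[of unit_disk f]) (use f eq 0 in auto)
  then show ?thesis
    by (simp add: 0)
next
  case (Suc m)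
  then obtain a b where ab: "\<forall>w\<in>unit_disk. wirt f (a w) (b w) w" "wsmooth m a" "wsmooth m b"
    using f by auto
  show ?thesis
    unfolding Suc by (rule wsmooth_SucI[OF wirt_cong ab(2,3)]) (use ab(1) eq in blast)+
qed

lemma wsmooth_Suc: "wsmooth (Suc n) f \<Longrightarrow> wsmooth n f"
proof (induction n arbitrary: f)
  case 0
  then obtain a b where "\<forall>w\<in>unit_disk. wirt f (a w) (b w) w"
    by auto
  then show ?case
    using wirt_continuous[of f a b] by simp
next
  case (Suc n)
  obtain a b where "\<forall>w\<in>unit_disk. wirt f (a w) (b w) w" "wsmooth (Suc n) a" "wsmooth (Suc n) b"
    using Suc.prems unfolding wsmooth.simps(2)[of "Suc n"] by blast
  then show ?case
    unfolding wsmooth.simps(2)[of n f] using Suc.IH by blast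
qed

lemma wsmooth_const [simp]: "wsmooth n (\<lambda>w. c)"
proof (induction n arbitrary: c)
  case (Suc n)
  show ?case
    by (rule wsmooth_SucI[OF wirt_const]) (rule Suc.IH)+
qed simp

lemma wsmooth_id: "wsmooth n (\<lambda>w. w)"
proof (cases n)
  case (Suc m)
  show ?thesis
    unfolding Suc by (rule wsmooth_SucI[OF wirt_id]) simp_all
qed simp

lemma wsmooth_cnj: "wsmooth n cnj"
proof (cases n)
  case (Suc m)
  show ?thesis
    unfolding Suc by (rule wsmooth_SucI[OF wirt_cnj]) simp_all
qed (auto intro: continuous_intros)

lemma wsmooth_add: "wsmooth n f \<Longrightarrow> wsmooth n g \<Longrightarrow> wsmooth n (\<lambda>w. f w + g w)"
proof (induction n arbitrary: f g)
  case (Suc n)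
  then obtain a b c d where "\<forall>w\<in>unit_disk. wirt f (a w) (b w) w" "\<forall>w\<in>unit_disk. wirt g (c w) (d w) w"
    and "wsmooth n a" "wsmooth n b" "wsmooth n c" "wsmooth n d"
    by auto
  then show ?case
    unfolding wsmooth.simps using Suc.IH wirt_add
    by (intro exI[of _ "\<lambda>w. a w + c w"] exI[of _ "\<lambda>w. b w + d w"]) auto
qed (auto intro: continuous_intros)

lemma wsmooth_mult: "wsmooth n f \<Longrightarrow> wsmooth n g \<Longrightarrow> wsmooth n (\<lambda>w. f w * g w)"
proof (induction n arbitrary: f g)
  case (Suc n)
  then obtain a b c d where *: "\<forall>w\<in>unit_disk. wirt f (a w) (b w) w" "\<forall>w\<in>unit_disk. wirt g (c w) (d w) w"
    and s: "wsmooth n a" "wsmooth n b" "wsmooth n c" "wsmooth n d"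
    by auto
  note fg = wsmooth_Suc[OF Suc.prems(1)] wsmooth_Suc[OF Suc.prems(2)]
  have "wsmooth n (\<lambda>w. f w * c w + a w * g w)" "wsmooth n (\<lambda>w. f w * d w + b w * g w)"
    by (intro wsmooth_add Suc.IH s fg)+
  then show ?case
    by (rule wsmooth_SucI[rotated]) (use * wirt_mult in blast)
qed (auto intro: continuous_intros)

lemma wsmooth_dir_deriv:
  assumes "wsmooth (Suc n) f" shows "wsmooth n (dir_deriv v f)"
proof -
  obtain a b where ab: "\<forall>w\<in>unit_disk. wirt f (a w) (b w) w" "wsmooth n a" "wsmooth n b"
    using assms by auto
  have "wsmooth n (\<lambda>w. a w * v + b w * cnj v)"
    by (intro wsmooth_add wsmooth_mult ab wsmooth_const)
  then show ?thesis
    by (rule wsmooth_cong) (rule dir_deriv_wirt[symmetric], use ab in blast)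
qed

lemma C1_on_wsmooth:
  assumes "wsmooth (Suc 0) f" shows "C1_on unit_disk f"
  unfolding C1_on_def
proof (intro ballI conjI)
  show "continuous_on unit_disk (dir_deriv v f)" for v
    using wsmooth_dir_deriv[OF assms] by simp
  show "(\<lambda>t::real. f (z + of_real t * v)) differentiable (at 0)" if "z \<in> unit_disk" for v z
  proof -
    obtain a b where "\<forall>w\<in>unit_disk. wirt f (a w) (b w) w"
      using assms by auto
    then show ?thesis
      using that dir_differentiable_wirt by blast
  qed
qed

lemma harmonic_on_wsmooth:
  assumes f: "wsmooth 2 f" and l: "\<And>z. z \<in> unit_disk \<Longrightarrow> laplacian f z = 0"
  shows "harmonic_on unit_disk f"
proof -
  have f': "wsmooth (Suc (Suc 0)) f"
    using f by (simp only: numeral_2_eq_2)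
  show ?thesis
    unfolding harmonic_on_def using l wsmooth_Suc[OF f'] wsmooth_dir_deriv[OF f']
    by (intro conjI C1_on_wsmooth) auto
qed

section \<open>Berezin transforms through derivatives of the kernels\<close>

definition clinear_op :: "(bergman \<Rightarrow> bergman) \<Rightarrow> bool" where
  "clinear_op A \<longleftrightarrow> bounded_linear A \<and> (\<forall>c f. A (scaleC c f) = scaleC c (A f))"

text \<open>Differentiating in w raises j and in \<open>cnj w\<close> raises i, so this family is
  closed under Wirtinger derivatives.\<close>

definition kern_entry :: "(bergman \<Rightarrow> bergman) \<Rightarrow> nat \<Rightarrow> nat \<Rightarrow> complex \<Rightarrow> complex" where
  "kern_entry A i j w = cinner (A (kern i w)) (kern j w)"

lemma wirt_kern_entry:
  assumes A: "clinear_op A" and w: "w \<in> unit_disk"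
  shows "wirt (kern_entry A i j) (kern_entry A i (Suc j) w) (kern_entry A (Suc i) j w) w"
proof -
  have "((\<lambda>w. A (kern i w)) has_derivative (\<lambda>h. A (scaleC (cnj h) (kern (Suc i) w)))) (at w)"
    using A by (intro bounded_linear.has_derivative[OF _ kern_has_derivative[OF w]]) (simp add: clinear_op_def)
  from cinner.FDERIV[OF this kern_has_derivative[OF w, of j]] show ?thesis
    unfolding wirt_def kern_entry_def[abs_def]
    by (rule has_derivative_eq_rhs)
      (use A in \<open>auto simp: clinear_op_def cinner_scaleC_left cinner_scaleC_right mult.commute\<close>)
qed

lemma wsmooth_kern_entry: "clinear_op A \<Longrightarrow> wsmooth n (kern_entry A i j)"
proof (induction n arbitrary: i j)
  case (Suc n)
  show ?case
    by (rule wsmooth_SucI[OF wirt_kern_entry[OF Suc.prems]]) (simp_all add: Suc)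
next
  case 0
  then show ?case
    using wirt_continuous[OF wirt_kern_entry] by simp
qed

text \<open>\<open>1 - |w|^2\<close> as a polynomial in w and \<open>cnj w\<close>, spelled with
  sums and products only, so that the rules for \<open>wirt\<close> and \<open>wsmooth\<close>
  apply.\<close>

definition disk_gap :: "complex \<Rightarrow> complex" where
  "disk_gap w = 1 + - 1 * (w * cnj w)"

lemma disk_gap: "disk_gap w = of_real (1 - (cmod w)\<^sup>2)"
  unfolding of_real_one_minus_norm_sq by (simp add: disk_gap_def mult.commute)

lemma wirt_disk_gap: "wirt disk_gap (- cnj w) (- w) w"
  using wirt_add[OF wirt_const wirt_mult[OF wirt_const wirt_mult[OF wirt_id wirt_cnj]], of 1 "-1" w]
  by (simp add: disk_gap_def[abs_def])

lemma wsmooth_disk_gap: "wsmooth n disk_gap"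
  unfolding disk_gap_def[abs_def]
  by (intro wsmooth_add wsmooth_mult wsmooth_const wsmooth_id wsmooth_cnj)

lemma berezin_kern_entry:
  assumes A: "clinear_op A" and w: "w \<in> unit_disk"
  shows "berezin A w = disk_gap w * disk_gap w * kern_entry A 0 0 w"
proof -
  have A': "A (scaleC c f) = scaleC c (A f)" for c f
    using A by (simp add: clinear_op_def)
  show ?thesis
    unfolding berezin_def kern_entry_def normalized_kernel_kern[OF w] A' cinner_scaleC_left cinner_scaleC_right disk_gap
    by simp
qed

lemma wsmooth_berezin: "clinear_op A \<Longrightarrow> wsmooth n (berezin A)"
  by (rule wsmooth_cong[of _ "\<lambda>w. disk_gap w * disk_gap w * kern_entry A 0 0 w"])
    (auto intro!: wsmooth_mult wsmooth_disk_gap wsmooth_kern_entry simp: berezin_kern_entry)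

text \<open>With \<open>g = disk_gap w\<close>, this rests on
  \<open>g * x = w * (1 - cnj w * x) - (w - x)\<close>: the derivative of the kernel splits into the
  kernel and the kernel times \<open>disk_aut w\<close>.\<close>

lemma aut_kernel_kern:
  assumes w: "w \<in> unit_disk"
  shows "scaleC (disk_gap w * disk_gap w) (kern 1 w)
    = scaleC (2 * w * disk_gap w) (kern 0 w) + scaleC (- 2) (aut_kernel w)"
proof (rule fun_of_eqI)
  fix x assume x: "x \<in> unit_disk"
  define d where "d = 1 - cnj w * x"
  have d: "d \<noteq> 0"
    using one_minus_cnj_mult_nonzero[OF w x] by (simp add: d_def)
  have g: "disk_gap w = 1 - w * cnj w"
    by (simp add: disk_gap_def)
  have e: "disk_gap w * x = w * d - (w - x)"
    by (simp add: g d_def algebra_simps)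
  have "fun_of (scaleC (disk_gap w * disk_gap w) (kern 1 w)) x = 2 * disk_gap w * (disk_gap w * x) / d ^ 3"
    using x by (simp add: fun_of_simps fun_of_kern[OF w] d_def eval_nat_numeral)
  also have "\<dots> = 2 * w * disk_gap w / d\<^sup>2 - 2 * (disk_gap w / d\<^sup>2 * ((w - x) / d))"
    unfolding e using d by (simp add: field_simps power2_eq_square power3_eq_cube)
  also have "\<dots> = fun_of (scaleC (2 * w * disk_gap w) (kern 0 w) + scaleC (- 2) (aut_kernel w)) x"
    using x unfolding fun_of_simps fun_of_kern[OF w] fun_of_aut_kernel[OF w] bkern_def disk_aut_def
      disk_gap[symmetric] d_def[symmetric]
    by (simp add: power2_eq_square)
  finally show "fun_of (scaleC (disk_gap w * disk_gap w) (kern 1 w)) x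
    = fun_of (scaleC (2 * w * disk_gap w) (kern 0 w) + scaleC (- 2) (aut_kernel w)) x" .
qed

text \<open>The result of differentiating
  \<open>disk_gap w * disk_gap w * kern_entry A 0 0 w\<close> once in w and once in
  \<open>cnj w\<close>.\<close>

definition mixed_deriv :: "(bergman \<Rightarrow> bergman) \<Rightarrow> complex \<Rightarrow> complex" where
  "mixed_deriv A w = disk_gap w * disk_gap w * kern_entry A 1 1 w + (- 2 * cnj w) * disk_gap w * kern_entry A 1 0 w
    + (- 2 * w) * disk_gap w * kern_entry A 0 1 w + (2 * w * cnj w - 2 * disk_gap w) * kern_entry A 0 0 w"

lemma berezin_second_derivatives:
  assumes A: "clinear_op A"
  obtains a b c e where "\<And>w. w \<in> unit_disk \<Longrightarrow> wirt (berezin A) (a w) (b w) w"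
    "\<And>w. w \<in> unit_disk \<Longrightarrow> wirt a (c w) (mixed_deriv A w) w"
    "\<And>w. w \<in> unit_disk \<Longrightarrow> wirt b (mixed_deriv A w) (e w) w"
proof -
  let ?M = "kern_entry A"
  define a where "a w = disk_gap w * (disk_gap w * ?M 0 1 w + (- 2 * cnj w) * ?M 0 0 w)" for w
  define b where "b w = disk_gap w * (disk_gap w * ?M 1 0 w + (- 2 * w) * ?M 0 0 w)" for w
  have M: "wirt (?M i j) (?M i (Suc j) w) (?M (Suc i) j w) w" if "w \<in> unit_disk" for i j w
    by (rule wirt_kern_entry[OF A that])
  have f: "wirt (berezin A) (a w) (b w) w" if "w \<in> unit_disk" for w
  proof (rule wirt_cong[OF _ that berezin_kern_entry[OF A, symmetric]])
    from wirt_mult[OF wirt_mult[OF wirt_disk_gap wirt_disk_gap] M[OF that, of 0 0]]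
    show "wirt (\<lambda>w. disk_gap w * disk_gap w * ?M 0 0 w) (a w) (b w) w"
      by (simp add: a_def b_def algebra_simps)
  qed
  have c: "wirt a (disk_gap w * (disk_gap w * ?M 0 (Suc 1) w + - cnj w * ?M 0 1 w
      + (- 2 * cnj w * ?M 0 (Suc 0) w + 0 * ?M 0 0 w)) + - cnj w * (disk_gap w * ?M 0 1 w + - 2 * cnj w * ?M 0 0 w))
      (mixed_deriv A w) w" if w: "w \<in> unit_disk" for w
  proof -
    have 1: "wirt (\<lambda>w. - 2 * cnj w) 0 (- 2) w"
      using wirt_mult[OF wirt_const[of "-2"] wirt_cnj] by simp
    from wirt_mult[OF wirt_disk_gap wirt_add[OF wirt_mult[OF wirt_disk_gap M[OF w, of 0 1]] wirt_mult[OF 1 M[OF w, of 0 0]]]]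
    show ?thesis
      unfolding a_def[abs_def] by (rule back_subst[of "\<lambda>d. wirt _ _ d w"]) (simp add: mixed_deriv_def algebra_simps)
  qed
  have e: "wirt b (mixed_deriv A w) (disk_gap w * (disk_gap w * ?M (Suc 1) 0 w + - w * ?M 1 0 w
      + (- 2 * w * ?M (Suc 0) 0 w + 0 * ?M 0 0 w)) + - w * (disk_gap w * ?M 1 0 w + - 2 * w * ?M 0 0 w)) w"
    if w: "w \<in> unit_disk" for w
  proof -
    have 1: "wirt (\<lambda>w. - 2 * w) (- 2) 0 w"
      using wirt_mult[OF wirt_const[of "-2"] wirt_id] by simp
    from wirt_mult[OF wirt_disk_gap wirt_add[OF wirt_mult[OF wirt_disk_gap M[OF w, of 1 0]] wirt_mult[OF 1 M[OF w, of 0 0]]]]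
    show ?thesis
      unfolding b_def[abs_def] by (rule back_subst[of "\<lambda>d. wirt _ d _ w"]) (simp add: mixed_deriv_def algebra_simps)
  qed
  from f c e show ?thesis by (rule that)
qed

text \<open>The left side involves derivatives, the right side only values of A on two bounded
  families of vectors. Hence the right side is stable under strong limits, and it is covariant under
  \<open>disk_unitary\<close>.\<close>

theorem laplacian_berezin:
  assumes A: "clinear_op A" and w: "w \<in> unit_disk"
  shows "of_real ((1 - (cmod w)\<^sup>2)\<^sup>2) * laplacian (berezin A) w
    = 16 * cinner (A (aut_kernel w)) (aut_kernel w) - 8 * berezin A w"
proof -
  let ?M = "kern_entry A" and ?D = "mixed_deriv A w"
  obtain a b c e where d: "\<And>w. w \<in> unit_disk \<Longrightarrow> wirt (berezin A) (a w) (b w) w"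
    "\<And>w. w \<in> unit_disk \<Longrightarrow> wirt a (c w) (mixed_deriv A w) w"
    "\<And>w. w \<in> unit_disk \<Longrightarrow> wirt b (mixed_deriv A w) (e w) w"
    using berezin_second_derivatives[OF A] by metis
  have lap: "laplacian (berezin A) w = 4 * ?D"
    using laplacian_wirt[OF d(1) w d(2)[OF w] d(3)[OF w]] by simp
  have lin: "A (f + g) = A f + A g" "A (scaleC c f) = scaleC c (A f)" for f g c
    using A bounded_linear.linear[of A] linear_add by (auto simp: clinear_op_def)
  have E: "scaleC 2 (aut_kernel w) = scaleC (2 * w * disk_gap w) (kern 0 w) + scaleC (- (disk_gap w * disk_gap w)) (kern 1 w)"
  proof (rule fun_of_eqI)
    fix x assume "x \<in> unit_disk"
    from arg_cong[OF aut_kernel_kern[OF w], of "\<lambda>f. fun_of f x"]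
    show "fun_of (scaleC 2 (aut_kernel w)) x = fun_of (scaleC (2 * w * disk_gap w) (kern 0 w) + scaleC (- (disk_gap w * disk_gap w)) (kern 1 w)) x"
      by (simp add: fun_of_simps algebra_simps)
  qed
  have cg: "cnj (disk_gap w) = disk_gap w"
    unfolding disk_gap by simp
  have "4 * cinner (A (aut_kernel w)) (aut_kernel w) = cinner (A (scaleC 2 (aut_kernel w))) (scaleC 2 (aut_kernel w))"
    by (simp add: lin cinner_scaleC_left cinner_scaleC_right)
  also have "\<dots> = 4 * w * cnj w * (disk_gap w * disk_gap w) * ?M 0 0 w
      - 2 * w * disk_gap w * (disk_gap w * disk_gap w) * ?M 0 1 w
      - 2 * cnj w * disk_gap w * (disk_gap w * disk_gap w) * ?M 1 0 w
      + (disk_gap w * disk_gap w) * (disk_gap w * disk_gap w) * ?M 1 1 w"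
    unfolding E lin cinner_add_left cinner_add_right cinner_scaleC_left cinner_scaleC_right kern_entry_def
    by (simp add: cg algebra_simps)
  also have "\<dots> = (disk_gap w * disk_gap w) * ?D + 2 * (disk_gap w + w * cnj w) * (disk_gap w * disk_gap w * ?M 0 0 w)"
    by (simp add: mixed_deriv_def algebra_simps)
  also have "disk_gap w + w * cnj w = 1"
    by (simp add: disk_gap_def)
  finally have "4 * cinner (A (aut_kernel w)) (aut_kernel w) = (disk_gap w * disk_gap w) * ?D + 2 * berezin A w"
    by (simp add: berezin_kern_entry[OF A w])
  from arg_cong[OF this, of "\<lambda>x. 4 * x"]
  have "16 * cinner (A (aut_kernel w)) (aut_kernel w) = 4 * ((disk_gap w * disk_gap w) * ?D) + 8 * berezin A w"
    by simp
  moreover have "complex_of_real ((1 - (cmod w)\<^sup>2)\<^sup>2) = disk_gap w * disk_gap w"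
    unfolding disk_gap by (simp only: power2_eq_square of_real_mult)
  ultimately show ?thesis
    unfolding lap by (simp add: algebra_simps)
qed

section \<open>Compactness\<close>

abbreviation boundary :: "complex filter" where
  "boundary \<equiv> filtercomap cmod (at_left 1)"

lemma eventually_boundary:
  "eventually P boundary \<longleftrightarrow> (\<exists>r<1. \<forall>z. r < cmod z \<and> cmod z < 1 \<longrightarrow> P z)"
proof
  assume "eventually P boundary"
  then obtain Q where Q: "eventually Q (at_left (1::real))" "\<And>z. Q (cmod z) \<Longrightarrow> P z"
    by (auto simp: eventually_filtercomap)
  then obtain r where "r < 1" "\<forall>y>r. y < 1 \<longrightarrow> Q y"
    using eventually_at_left[of 0 "1::real" Q] by auto
  then show "\<exists>r<1. \<forall>z. r < cmod z \<and> cmod z < 1 \<longrightarrow> P z"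
    using Q by blast
next
  assume "\<exists>r<1. \<forall>z. r < cmod z \<and> cmod z < 1 \<longrightarrow> P z"
  then obtain r where r: "r < 1" "\<forall>z. r < cmod z \<and> cmod z < 1 \<longrightarrow> P z"
    by auto
  have "eventually (\<lambda>y. r < y \<and> y < 1) (at_left (1::real))"
    using eventually_at_left_real[OF r(1)] by simp
  then show "eventually P boundary"
    unfolding eventually_filtercomap using r by auto
qed

lemma eventually_in_disk_boundary: "\<forall>\<^sub>F z in boundary. z \<in> unit_disk"
  unfolding eventually_boundary by (rule exI[of _ 0]) auto

text \<open>The weight in Schur's test for the kernel \<open>(S K_z) w\<close>, where
  \<open>K_z = kern 0 z\<close>. With exponent 1/2 the substitution by \<open>disk_aut z\<close>
  leaves \<open>|1 - cnj z * x|\<close> with exponent -1.\<close>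

definition schur_weight :: "complex \<Rightarrow> real" where
  "schur_weight w = (1 - (cmod w)\<^sup>2) powr (- (1/2))"

lemma schur_weight_pos: "w \<in> unit_disk \<Longrightarrow> 0 < schur_weight w"
  using one_minus_norm_sq_pos[of w] by (simp add: schur_weight_def)

lemma measurable_schur_weight [measurable]: "schur_weight \<in> borel_measurable area"
  unfolding schur_weight_def[abs_def] by measurable

lemma symbol_lists_pull_back:
  assumes "z \<in> unit_disk" "symbol_lists B uss"
  shows "symbol_lists B (map (map (pull_back z)) uss)"
  using assms symbol_pull[OF assms(1)] by (auto simp: symbol_lists_def symbols_def pull_back_def)

definition growth_const :: "real \<Rightarrow> (complex \<Rightarrow> complex) list list \<Rightarrow> real" where
  "growth_const B uss = (\<Sum>us\<leftarrow>uss. (B * majorant_const) ^ length us)"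

lemma growth_const_nonneg: "0 \<le> B \<Longrightarrow> 0 \<le> growth_const B uss"
  unfolding growth_const_def using majorant_const by (intro sum_list_nonneg) auto

lemma toeplitz_sum_one_pointwise:
  assumes "z \<in> unit_disk" "symbol_lists B uss" "x \<in> unit_disk"
  shows "cmod (fun_of (toeplitz_sum (map (map (pull_back z)) uss) (kern 0 0)) x) \<le> growth_const B uss * kweight x"
proof -
  have "cmod (fun_of (kern 0 0) x) \<le> 1 * kweight x" if "x \<in> unit_disk" for x
    using kweight_ge_1[OF that] that by (simp add: fun_of_kern)
  from toeplitz_sum_pointwise[OF this _ assms(3) symbol_lists_pull_back[OF assms(1,2)]]
  show ?thesis
    by (simp add: growth_const_def o_def)
qed

text \<open>Up to the factor \<open>1 - |z|^2\<close>, the image of \<open>kern 0 z\<close> is the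
  unitary image of the conjugated operator applied to 1. Hence
  \<open>weighted_integral_transform\<close> with \<open>a = 1/2\<close> applies, and the weight at
  z factors out.\<close>

lemma kernel_image_weighted:
  assumes z: "z \<in> unit_disk" and uss: "symbol_lists B uss"
  shows "(\<integral>\<^sup>+w. ennreal (cmod (fun_of (toeplitz_sum uss (kern 0 z)) w) * schur_weight w) \<partial>area)
    = ennreal (schur_weight z) * (\<integral>\<^sup>+x. ennreal (cmod (fun_of (toeplitz_sum (map (map (pull_back z)) uss) (kern 0 0)) x)
        * (schur_weight x * cmod (1 - cnj z * x) powr (- 1))) \<partial>area)"
    (is "?L = _ * ?R")
proof -
  let ?g = "fun_of (toeplitz_sum (map (map (pull_back z)) uss) (kern 0 0))"
  define q where "q = 1 - (cmod z)\<^sup>2"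
  have q: "0 < q"
    using one_minus_norm_sq_pos[OF z] by (simp add: q_def)
  have "ennreal q * ?L = (\<integral>\<^sup>+w. ennreal q * ennreal (cmod (fun_of (toeplitz_sum uss (kern 0 z)) w) * schur_weight w) \<partial>area)"
    by (rule nn_integral_cmult[symmetric]) measurable
  also have "\<dots> = (\<integral>\<^sup>+w. ennreal (cmod (bkern z w) * cmod (?g (disk_aut z w)) * (1 - (cmod w)\<^sup>2) powr (- (1/2))) \<partial>area)"
  proof (rule nn_integral_cong)
    fix w assume "w \<in> space area"
    then have w: "w \<in> unit_disk" by simp
    have "scaleC (of_real q) (toeplitz_sum uss (kern 0 z)) = toeplitz_sum uss (disk_unitary z (kern 0 0))"
      unfolding disk_unitary_one[OF z] normalized_kernel_kern[OF z] q_def by (simp add: toeplitz_sum_scaleC[OF uss])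
    also have "\<dots> = disk_unitary z (toeplitz_sum (map (map (pull_back z)) uss) (kern 0 0))"
      by (rule toeplitz_sum_disk_unitary[OF z uss])
    finally have "of_real q * fun_of (toeplitz_sum uss (kern 0 z)) w = bkern z w * ?g (disk_aut z w)"
      using w by (metis fun_of_disk_unitary[OF z] scaleC.rep_eq)
    then have "q * cmod (fun_of (toeplitz_sum uss (kern 0 z)) w) = cmod (bkern z w) * cmod (?g (disk_aut z w))"
      using q by (metis abs_of_pos norm_mult norm_of_real)
    then show "ennreal q * ennreal (cmod (fun_of (toeplitz_sum uss (kern 0 z)) w) * schur_weight w)
      = ennreal (cmod (bkern z w) * cmod (?g (disk_aut z w)) * (1 - (cmod w)\<^sup>2) powr (- (1/2)))"
      using q by (simp add: ennreal_mult'[symmetric] schur_weight_def mult.assoc[symmetric])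
  qed
  also have "\<dots> = ennreal (q powr (1/2)) * ?R"
    by (subst weighted_integral_transform[OF z]) (simp_all add: q_def schur_weight_def)
  also have "q powr (1/2) = q * schur_weight z"
    using q by (simp add: schur_weight_def q_def[symmetric] powr_mult_base)
  also have "ennreal (q * schur_weight z) = ennreal q * ennreal (schur_weight z)"
    using q by (simp add: ennreal_mult')
  finally show ?thesis
    using q by (simp add: mult.assoc ennreal_mult_cancel_left)
qed

text \<open>\<open>toeplitz_sum_one_pointwise\<close> bounds the conjugated operator at 1 by
  \<open>kweight\<close>, uniformly in z; together with \<open>schur_weight\<close> this makes
  exponent 3/4, and \<open>kernel_tail_bound\<close> applies with \<open>a = 3/4\<close> and
  \<open>b = 1\<close>.\<close>

lemma kernel_image_bound:
  assumes z: "z \<in> unit_disk" and uss: "symbol_lists B uss" and B: "0 \<le> B"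
  shows "(\<integral>\<^sup>+w. ennreal (cmod (fun_of (toeplitz_sum uss (kern 0 z)) w) * schur_weight w) \<partial>area)
    \<le> ennreal (growth_const B uss * majorant_const * schur_weight z)"
    and kernel_image_tail: "(\<integral>\<^sup>+x. ennreal (cmod (fun_of (toeplitz_sum (map (map (pull_back z)) uss) (kern 0 0)) x)
        * (schur_weight x * cmod (1 - cnj z * x) powr (- 1))) * indicator {x. r \<le> cmod x} x \<partial>area)
      \<le> ennreal (growth_const B uss) * majorant_tail r" 
proof -
  let ?g = "fun_of (toeplitz_sum (map (map (pull_back z)) uss) (kern 0 0))"
  let ?F = "\<lambda>x. ennreal (cmod (?g x) * (schur_weight x * cmod (1 - cnj z * x) powr (- 1)))"
  let ?J = "\<lambda>x. ennreal ((1 - (cmod x)\<^sup>2) powr (- (3/4)) * cmod (1 - cnj z * x) powr (- 1))"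
  have G: "0 \<le> growth_const B uss"
    by (rule growth_const_nonneg[OF B])
  have le: "?F x \<le> ennreal (growth_const B uss) * ?J x" if x: "x \<in> unit_disk" for x
  proof -
    have p: "0 < 1 - (cmod x)\<^sup>2"
      by (rule one_minus_norm_sq_pos[OF x])
    have "kweight x * schur_weight x = (1 - (cmod x)\<^sup>2) powr (- (3/4))"
      using p by (simp add: kweight_def schur_weight_def powr_add[symmetric])
    moreover have "cmod (?g x) * (schur_weight x * cmod (1 - cnj z * x) powr (- 1))
        \<le> growth_const B uss * kweight x * (schur_weight x * cmod (1 - cnj z * x) powr (- 1))"
      using schur_weight_pos[OF x] by (intro mult_right_mono toeplitz_sum_one_pointwise z uss x) auto
    ultimately have "cmod (?g x) * (schur_weight x * cmod (1 - cnj z * x) powr (- 1))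
        \<le> growth_const B uss * ((1 - (cmod x)\<^sup>2) powr (- (3/4)) * cmod (1 - cnj z * x) powr (- 1))"
      by (metis (no_types, opaque_lifting) mult.assoc)
    then show ?thesis
      using G by (subst ennreal_mult[symmetric]) (auto intro!: ennreal_leI)
  qed
  have tail: "(\<integral>\<^sup>+x. ?F x * indicator {x. r \<le> cmod x} x \<partial>area) \<le> ennreal (growth_const B uss) * majorant_tail r" for r
  proof -
    have "(\<integral>\<^sup>+x. ?F x * indicator {x. r \<le> cmod x} x \<partial>area)
        \<le> (\<integral>\<^sup>+x. ennreal (growth_const B uss) * (?J x * indicator {x. r \<le> cmod x} x) \<partial>area)"
      using le by (intro nn_integral_mono) (auto simp: indicator_def)
    also have "\<dots> = ennreal (growth_const B uss) * (\<integral>\<^sup>+x. ?J x * indicator {x. r \<le> cmod x} x \<partial>area)"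
      by (rule nn_integral_cmult) measurable
    also have "\<dots> \<le> ennreal (growth_const B uss) * majorant_tail r"
      by (intro mult_left_mono kernel_tail_bound z) auto
    finally show ?thesis .
  qed
  show "(\<integral>\<^sup>+x. ?F x * indicator {x. r \<le> cmod x} x \<partial>area) \<le> ennreal (growth_const B uss) * majorant_tail r"
    by (rule tail)
  have "(\<integral>\<^sup>+x. ?F x \<partial>area) \<le> ennreal (growth_const B uss * majorant_const)"
    using tail[of 0] majorant_const G by (simp add: ennreal_mult)
  then have "ennreal (schur_weight z) * (\<integral>\<^sup>+x. ?F x \<partial>area) \<le> ennreal (schur_weight z) * ennreal (growth_const B uss * majorant_const)"
    by (intro mult_left_mono) auto
  then show "(\<integral>\<^sup>+w. ennreal (cmod (fun_of (toeplitz_sum uss (kern 0 z)) w) * schur_weight w) \<partial>area)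
    \<le> ennreal (growth_const B uss * majorant_const * schur_weight z)"
    unfolding kernel_image_weighted[OF z uss] using schur_weight_pos[OF z] G majorant_const
    by (simp add: ennreal_mult[symmetric] mult.commute)
qed

text \<open>Where |x| is at least r the integral is small uniformly in z by
  \<open>kernel_image_tail\<close>; where |x| < r the weights are bounded and point evaluation is
  controlled by the norm, which tends to 0.\<close>

lemma kernel_image_small:
  assumes uss: "symbol_lists B uss" and B: "0 \<le> B" and e: "0 < e"
    and lim: "((\<lambda>z. norm (toeplitz_sum (map (map (pull_back z)) uss) (kern 0 0))) \<longlongrightarrow> 0) boundary"
  obtains R where "R < 1" "\<And>z. R < cmod z \<Longrightarrow> z \<in> unit_disk \<Longrightarrow>
    (\<integral>\<^sup>+w. ennreal (cmod (fun_of (toeplitz_sum uss (kern 0 z)) w) * schur_weight w) \<partial>area)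
      \<le> ennreal (e * schur_weight z)"
proof -
  define G where "G = growth_const B uss"
  have G: "0 \<le> G"
    using growth_const_nonneg[OF B] by (simp add: G_def)
  have "0 < e / (2 * (G + 1))"
    using e G by simp
  then obtain r where r: "0 < r" "r < 1" "majorant_tail r < ennreal (e / (2 * (G + 1)))"
    by (rule majorant_tail_small)
  \<comment> \<open>Q collects the bounds for |x| < r: the weight, the kernel, and the constant
    \<open>1 / (1 - r^2)\<close> of point evaluation.\<close>
  define Q where "Q = (1 - r\<^sup>2) powr (- (1/2)) * (1 - r) powr (- 1) / (1 - r\<^sup>2)"
  have r2: "0 < 1 - r\<^sup>2"
    using r by (simp add: power_less_one_iff abs_square_less_1)
  have Q: "0 < Q"
    using r r2 by (simp add: Q_def)
  have "\<forall>\<^sub>F z in boundary. norm (toeplitz_sum (map (map (pull_back z)) uss) (kern 0 0)) < e / (2 * Q)"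
    using lim e Q by (intro order_tendstoD) auto
  then obtain R where R: "R < 1" "\<And>z. R < cmod z \<Longrightarrow> cmod z < 1 \<Longrightarrow>
      norm (toeplitz_sum (map (map (pull_back z)) uss) (kern 0 0)) < e / (2 * Q)"
    unfolding eventually_boundary by blast
  show ?thesis
  proof (rule that[OF R(1)])
    fix z assume zR: "R < cmod z" and z: "z \<in> unit_disk"
    let ?f = "toeplitz_sum (map (map (pull_back z)) uss) (kern 0 0)"
    let ?g = "fun_of ?f"
    let ?F = "\<lambda>x. ennreal (cmod (?g x) * (schur_weight x * cmod (1 - cnj z * x) powr (- 1)))"
    have nf: "norm ?f < e / (2 * Q)"
      using R(2)[OF zR] z by simp
    have in1: "?F x \<le> ennreal (e / 2) + ?F x * indicator {x. r \<le> cmod x} x" if x: "x \<in> unit_disk" for x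
    proof (cases "r \<le> cmod x")
      case False
      then have xr: "cmod x < r" by simp
      then have "(cmod x)\<^sup>2 \<le> r\<^sup>2"
        by (intro power_mono) auto
      then have 1: "1 - r\<^sup>2 \<le> 1 - (cmod x)\<^sup>2"
        by simp
      have 2: "1 - r \<le> cmod (1 - cnj z * x)"
        using norm_one_minus_cnj_mult_ge(2)[OF z x] xr by simp
      have "cmod (?g x) \<le> norm ?f / (1 - r\<^sup>2)"
        using norm_fun_of_le[OF x, of ?f] 1 r2 by (smt (verit) divide_left_mono mult_pos_pos norm_ge_zero)
      then have "cmod (?g x) * (schur_weight x * cmod (1 - cnj z * x) powr (- 1))
          \<le> norm ?f / (1 - r\<^sup>2) * ((1 - r\<^sup>2) powr (- (1/2)) * (1 - r) powr (- 1))"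
        unfolding schur_weight_def using 1 2 r r2
        by (intro mult_mono powr_mono2') auto
      also have "\<dots> = norm ?f * Q"
        by (simp add: Q_def)
      also have "\<dots> \<le> e / 2"
        using nf Q by (simp add: field_simps)
      finally show ?thesis
        using xr e by (simp add: ennreal_leI)
    qed auto
    have [measurable]: "?F \<in> borel_measurable area"
      by measurable
    have "(\<integral>\<^sup>+x. ?F x \<partial>area) \<le> (\<integral>\<^sup>+x. ennreal (e / 2) + ?F x * indicator {x. r \<le> cmod x} x \<partial>area)"
      using in1 by (intro nn_integral_mono) auto
    also have "\<dots> = ennreal (e / 2) + (\<integral>\<^sup>+x. ?F x * indicator {x. r \<le> cmod x} x \<partial>area)"
      using prob_space_area by (subst nn_integral_add) auto
    also have "\<dots> \<le> ennreal (e / 2) + ennreal G * ennreal (e / (2 * (G + 1)))"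
      using kernel_image_tail[OF z uss B, of r] r(3) unfolding G_def[symmetric]
      by (intro add_left_mono) (meson less_imp_le mult_left_mono order_trans zero_le)
    also have "\<dots> \<le> ennreal e"
    proof -
      have "G * (e / (2 * (G + 1))) \<le> e / 2"
        using e G by (simp add: field_simps)
      then have le: "e / 2 + G * (e / (2 * (G + 1))) \<le> e"
        by linarith
      have "ennreal (e / 2) + ennreal G * ennreal X = ennreal (e / 2 + G * X)" if "0 \<le> X" for X
        using e G that by (simp add: ennreal_mult)
      from this[of "e / (2 * (G + 1))"] show ?thesis
        using ennreal_leI[OF le] e G by simp
    qed
    finally have "ennreal (schur_weight z) * (\<integral>\<^sup>+x. ?F x \<partial>area) \<le> ennreal (schur_weight z) * ennreal e"
      by (intro mult_left_mono) auto
    then show "(\<integral>\<^sup>+w. ennreal (cmod (fun_of (toeplitz_sum uss (kern 0 z)) w) * schur_weight w) \<partial>area)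
      \<le> ennreal (e * schur_weight z)"
      unfolding kernel_image_weighted[OF z uss] using schur_weight_pos[OF z] e
      by (simp add: ennreal_mult[symmetric] mult.commute)
  qed
qed

text \<open>Joint measurability, which Schur's test takes for Tonelli, comes from joint continuity:
  the kernels depend continuously on z in norm.\<close>

lemma measurable_kernel_image_pair:
  assumes uss: "symbol_lists B uss"
  shows "(\<lambda>(w, z). cmod (fun_of (toeplitz_sum uss (kern 0 z)) w)) \<in> borel_measurable (area \<Otimes>\<^sub>M area)"
proof -
  let ?D = "unit_disk \<times> unit_disk :: (complex \<times> complex) set"
  let ?c = "\<lambda>p. cinner (toeplitz_sum uss (kern 0 (snd p))) (kern 0 (fst p))"
  have "continuous_on ?D ?c"
    by (intro cinner.continuous_on continuous_on_compose2[OF continuous_on_kern]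
        bounded_linear.continuous_on[OF bounded_linear_toeplitz_sum[OF uss]] continuous_intros) auto
  then have "(\<lambda>p. if p \<in> ?D then ?c p else 0) \<in> borel_measurable borel"
    by (intro borel_measurable_continuous_on_if continuous_intros)
      (auto simp flip: borel_prod intro!: pair_measureI)
  moreover have "(\<lambda>p. p) \<in> (area \<Otimes>\<^sub>M area) \<rightarrow>\<^sub>M (borel \<Otimes>\<^sub>M borel :: (complex \<times> complex) measure)"
    using measurable_Pair[OF measurable_compose[OF measurable_fst measurable_id_area]
        measurable_compose[OF measurable_snd measurable_id_area]] by simp
  ultimately have m: "(\<lambda>p. if p \<in> ?D then ?c p else 0) \<in> borel_measurable (area \<Otimes>\<^sub>M area)"
    using measurable_compose unfolding borel_prod by blast
  have "(\<lambda>p. cmod (if p \<in> ?D then ?c p else 0)) \<in> borel_measurable (area \<Otimes>\<^sub>M area)"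
    by (rule measurable_compose[OF m borel_measurable_norm])
  then show ?thesis
    by (rule measurable_cong[THEN iffD1, rotated]) (auto simp: space_pair_measure cinner_kern)
qed

text \<open>Composed with the projection, the sum is an integral operator with kernel
  \<open>(S K_z) w\<close>; up to conjugation this is the value at z of the adjoint applied to
  \<open>kern 0 w\<close>.\<close>

lemma fun_of_toeplitz_sum_proj_bound:
  assumes uss: "symbol_lists B uss" and g: "square_int g" and w: "w \<in> unit_disk"
  shows "ennreal (cmod (fun_of (toeplitz_sum uss (bergman_proj g)) w))
    \<le> (\<integral>\<^sup>+z. ennreal (cmod (fun_of (toeplitz_sum uss (kern 0 z)) w) * cmod (g z)) \<partial>area)"
proof -
  define uss' where "uss' = map (\<lambda>us. rev (map (\<lambda>u z. cnj (u z)) us)) uss"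
  have adj: "cinner (toeplitz_sum uss f) h = cinner f (toeplitz_sum uss' h)" for f h
    using toeplitz_sum_adjoint[OF uss] by (simp add: uss'_def)
  let ?k = "toeplitz_sum uss' (kern 0 w)"
  have k: "cmod (fun_of ?k z) = cmod (fun_of (toeplitz_sum uss (kern 0 z)) w)" if z: "z \<in> unit_disk" for z
  proof -
    have "fun_of ?k z = cnj (cinner (kern 0 z) ?k)"
      by (metis cinner_cnj cinner_kern[OF z])
    also have "\<dots> = cnj (fun_of (toeplitz_sum uss (kern 0 z)) w)"
      by (simp only: adj[symmetric] cinner_kern[OF w])
    finally show ?thesis by simp
  qed
  have "fun_of (toeplitz_sum uss (bergman_proj g)) w = L2_inner g (fun_of ?k)"
    by (metis adj cinner_kern[OF w] cinner_bergman_proj[OF g])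
  then have "ennreal (cmod (fun_of (toeplitz_sum uss (bergman_proj g)) w))
      \<le> (\<integral>\<^sup>+z. ennreal (norm (g z * cnj (fun_of ?k z))) \<partial>area)"
    using integral_norm_bound_ennreal[OF square_int_mult_integrable[OF g square_int_fun_of[of ?k]]]
    by (simp add: L2_inner_def)
  also have "\<dots> = (\<integral>\<^sup>+z. ennreal (cmod (fun_of (toeplitz_sum uss (kern 0 z)) w) * cmod (g z)) \<partial>area)"
    using k by (intro nn_integral_cong) (simp add: norm_mult mult.commute)
  finally show ?thesis .
qed

lemma symbols_adjoint: "symbols B us \<Longrightarrow> symbols B (rev (map (\<lambda>u z. cnj (u z)) us))"
  by (auto simp: symbols_def intro: symbol_cnj)

lemma norm_sq_nn: "ennreal ((norm f)\<^sup>2) = (\<integral>\<^sup>+z. (ennreal (cmod (fun_of f z)))\<^sup>2 \<partial>area)"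
  using square_int_nn[OF square_int_fun_of[of f]] by (simp add: norm_sq_eq ennreal_power)

text \<open>Schur's test shows that the part of the operator coming from functions supported near the
  boundary is small.\<close>

lemma toeplitz_sum_boundary_part_small:
  assumes uss: "symbol_lists B uss" and B: "0 \<le> B" and e: "0 < e"
    and lim: "((\<lambda>z. norm (toeplitz_sum (map (map (pull_back z)) uss) (kern 0 0))) \<longlongrightarrow> 0) boundary"
  obtains R where "R < 1" "\<And>f. norm (toeplitz_sum uss (bergman_proj (\<lambda>z. if cmod z \<le> R then 0 else fun_of f z)))
    \<le> e * norm f"
proof -
  define uss' where "uss' = map (\<lambda>us. rev (map (\<lambda>u z. cnj (u z)) us)) uss"
  have uss': "symbol_lists B uss'"
    using uss symbols_adjoint unfolding symbol_lists_def uss'_def by auto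
  \<comment> \<open>A bounds the integrals over z through the adjoint operator, with 1 added to make
    it positive; d will bound the integrals over w, so that Schur's constant is
    \<open>A * d = e^2\<close>.\<close>
  define A where "A = growth_const B uss' * majorant_const + 1"
  have A: "0 < A" "growth_const B uss' * majorant_const \<le> A"
    using growth_const_nonneg[OF B, of uss'] majorant_const by (auto simp: A_def add_nonneg_pos)
  define d where "d = e\<^sup>2 / A"
  have d: "0 < d" "A * d = e\<^sup>2"
    using e A by (auto simp: d_def)
  obtain R where R: "R < 1" and small: "\<And>z. R < cmod z \<Longrightarrow> z \<in> unit_disk \<Longrightarrow>
    (\<integral>\<^sup>+w. ennreal (cmod (fun_of (toeplitz_sum uss (kern 0 z)) w) * schur_weight w) \<partial>area)
      \<le> ennreal (d * schur_weight z)"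
    by (rule kernel_image_small[OF uss B d(1) lim]) blast
  show ?thesis
  proof (rule that[OF R])
    fix f
    let ?g = "\<lambda>z. if cmod z \<le> R then 0 else fun_of f z"
    let ?k = "\<lambda>w z. cmod (fun_of (toeplitz_sum uss (kern 0 z)) w)"
    have ind: "symbol 1 (\<lambda>z. if cmod z \<le> R then 0 else 1)"
      unfolding symbol_def by auto
    have "square_int (\<lambda>z. (if cmod z \<le> R then 0 else 1) * fun_of f z)"
      by (rule square_int_symbol_mult[OF ind square_int_fun_of])
    also have "(\<lambda>z. (if cmod z \<le> R then 0 else 1) * fun_of f z) = ?g"
      by auto
    finally have g: "square_int ?g" .
    then have [measurable]: "?g \<in> borel_measurable area"
      by (simp add: square_int_def)
    have "ennreal ((norm (toeplitz_sum uss (bergman_proj ?g)))\<^sup>2)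
        = (\<integral>\<^sup>+w. (ennreal (cmod (fun_of (toeplitz_sum uss (bergman_proj ?g)) w)))\<^sup>2 \<partial>area)"
      by (rule norm_sq_nn)
    also have "\<dots> \<le> (\<integral>\<^sup>+w. (\<integral>\<^sup>+z. ennreal (?k w z * \<bar>cmod (?g z)\<bar>) \<partial>area)\<^sup>2 \<partial>area)"
      using fun_of_toeplitz_sum_proj_bound[OF uss g]
      by (intro nn_integral_mono power_mono) auto
    also have "\<dots> \<le> ennreal (A * d) * (\<integral>\<^sup>+z. ennreal ((cmod (?g z))\<^sup>2) \<partial>area)"
    proof (rule schur_test[where h = schur_weight])
      show "(\<lambda>(w, z). ?k w z) \<in> borel_measurable (area \<Otimes>\<^sub>M area)"
        by (rule measurable_kernel_image_pair[OF uss])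
      show "(\<integral>\<^sup>+z. ennreal (?k w z * schur_weight z) \<partial>area) \<le> ennreal (A * schur_weight w)"
        if w: "w \<in> unit_disk" for w
      proof -
        have k: "?k w z = cmod (fun_of (toeplitz_sum uss' (kern 0 w)) z)" if z: "z \<in> unit_disk" for z
        proof -
          have "fun_of (toeplitz_sum uss (kern 0 z)) w = cinner (kern 0 z) (toeplitz_sum uss' (kern 0 w))"
            by (metis cinner_kern[OF w] toeplitz_sum_adjoint[OF uss] uss'_def)
          also have "\<dots> = cnj (fun_of (toeplitz_sum uss' (kern 0 w)) z)"
            by (metis cinner_cnj cinner_kern[OF z])
          finally show ?thesis by simp
        qed
        have "(\<integral>\<^sup>+z. ennreal (?k w z * schur_weight z) \<partial>area)
            = (\<integral>\<^sup>+z. ennreal (cmod (fun_of (toeplitz_sum uss' (kern 0 w)) z) * schur_weight z) \<partial>area)"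
          using k by (intro nn_integral_cong) simp
        also have "\<dots> \<le> ennreal (growth_const B uss' * majorant_const * schur_weight w)"
          by (rule kernel_image_bound[OF w uss' B])
        also have "\<dots> \<le> ennreal (A * schur_weight w)"
          using A schur_weight_pos[OF w] by (intro ennreal_leI mult_right_mono) auto
        finally show ?thesis .
      qed
      show "(\<integral>\<^sup>+w. ennreal (?k w z * schur_weight w) \<partial>area) \<le> ennreal (d * schur_weight z)"
        if "z \<in> unit_disk" "cmod (?g z) \<noteq> 0" for z
        \<comment> \<open>Where the cut-off function does not vanish, z lies outside the disk of
          radius R.\<close>
        using small[of z] that by (cases "cmod z \<le> R") auto
    qed (use A d schur_weight_pos in auto)
    also have "\<dots> \<le> ennreal (A * d) * ennreal ((norm f)\<^sup>2)"
      unfolding norm_sq_nn by (intro mult_left_mono nn_integral_mono) (auto simp: ennreal_power)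
    also have "\<dots> = ennreal ((e * norm f)\<^sup>2)"
      by (simp add: d ennreal_mult power_mult_distrib)
    finally have "(norm (toeplitz_sum uss (bergman_proj ?g)))\<^sup>2 \<le> (e * norm f)\<^sup>2"
      by simp
    then show "norm (toeplitz_sum uss (bergman_proj ?g)) \<le> e * norm f"
      by (rule power2_le_imp_le) (use e in simp)
  qed
qed

section \<open>Compactness criteria\<close>

lemma bergman_proj_fun_of: "bergman_proj (fun_of f) = f"
  by (rule bergman_eqI_cinner) (unfold cinner_bergman_proj[OF square_int_fun_of], simp only: cinner.rep_eq)

lemma bergman_proj_add:
  assumes "square_int f" "square_int g"
  shows "bergman_proj (\<lambda>z. f z + g z) = bergman_proj f + bergman_proj g"
proof (rule bergman_eqI_cinner)
  fix h
  show "cinner (bergman_proj (\<lambda>z. f z + g z)) h = cinner (bergman_proj f + bergman_proj g) h"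
    unfolding cinner_add_left cinner_bergman_proj[OF square_int_add[OF assms]]
      cinner_bergman_proj[OF assms(1)] cinner_bergman_proj[OF assms(2)] L2_inner_def
    using square_int_mult_integrable[OF _ square_int_fun_of] assms
    by (simp add: distrib_right)
qed

lemma bergman_locally_bounded:
  assumes "compact K" "K \<subseteq> unit_disk"
  shows "\<exists>C. \<forall>f\<in>cball 0 1. \<forall>z\<in>K. cmod (fun_of f z) \<le> C"
proof -
  have "continuous_on K (\<lambda>z. 1 / (1 - (cmod z)\<^sup>2))"
    by (intro continuous_intros) (use assms one_minus_norm_sq_pos in force)
  then have "bounded ((\<lambda>z. 1 / (1 - (cmod z)\<^sup>2)) ` K)"
    using assms compact_continuous_image compact_imp_bounded by blast
  then obtain C where C: "\<And>z. z \<in> K \<Longrightarrow> \<bar>1 / (1 - (cmod z)\<^sup>2)\<bar> \<le> C"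
    by (auto simp: bounded_iff)
  have "cmod (fun_of f z) \<le> C" if "f \<in> cball 0 1" "z \<in> K" for f z
  proof -
    have z: "z \<in> unit_disk" using that assms by auto
    have "cmod (fun_of f z) \<le> norm f / (1 - (cmod z)\<^sup>2)"
      by (rule norm_fun_of_le[OF z])
    also have "\<dots> \<le> 1 / (1 - (cmod z)\<^sup>2)"
      using that one_minus_norm_sq_pos[OF z] by (intro divide_right_mono) auto
    also have "\<dots> \<le> C"
      using C[OF that(2)] by linarith
    finally show ?thesis .
  qed
  then show ?thesis by blast
qed

text \<open>Montel's theorem together with Fatou's lemma: the locally uniform limit again has norm
  at most 1. This is weak compactness of the unit ball in concrete form.\<close>

lemma bergman_unit_ball_normal:
  assumes F: "\<And>n. norm (F n) \<le> 1"
  obtains r :: "nat \<Rightarrow> nat" and f where "strict_mono r" "norm f \<le> 1"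
    "\<And>R. 0 < R \<Longrightarrow> R < 1 \<Longrightarrow> uniform_limit (cball 0 R) (\<lambda>n. fun_of (F (r n))) (fun_of f) sequentially"
proof -
  have bnd: "\<exists>C. \<forall>h\<in>fun_of ` cball 0 1. \<forall>z\<in>K. cmod (h z) \<le> C" if "compact K" "K \<subseteq> unit_disk" for K
    using bergman_locally_bounded[OF that] by auto
  have hol: "h holomorphic_on unit_disk" if "h \<in> fun_of ` cball 0 1" for h
    using that holomorphic_fun_of by blast
  have rng: "range (\<lambda>n. fun_of (F n)) \<subseteq> fun_of ` cball 0 1"
    using F by auto
  obtain g r where g: "g holomorphic_on unit_disk" and r: "strict_mono (r :: nat \<Rightarrow> nat)"
    and pw: "\<And>x. x \<in> unit_disk \<Longrightarrow> (\<lambda>n. fun_of (F (r n)) x) \<longlonglongrightarrow> g x"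
    and ul: "\<And>K. compact K \<Longrightarrow> K \<subseteq> unit_disk \<Longrightarrow> uniform_limit K ((\<lambda>n. fun_of (F n)) \<circ> r) g sequentially"
    using Montel[OF open_ball hol bnd rng] by blast
  have [measurable]: "g \<in> borel_measurable area"
    by (intro continuous_imp_measurable_area holomorphic_on_imp_continuous_on g)
  have "(\<integral>\<^sup>+z. ennreal ((cmod (g z))\<^sup>2) \<partial>area) = (\<integral>\<^sup>+z. liminf (\<lambda>n. ennreal ((cmod (fun_of (F (r n)) z))\<^sup>2)) \<partial>area)"
  proof (rule nn_integral_cong)
    fix z assume "z \<in> space area"
    then have "(\<lambda>n. ennreal ((cmod (fun_of (F (r n)) z))\<^sup>2)) \<longlonglongrightarrow> ennreal ((cmod (g z))\<^sup>2)"
      by (intro tendsto_ennrealI tendsto_intros pw) simp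
    then show "ennreal ((cmod (g z))\<^sup>2) = liminf (\<lambda>n. ennreal ((cmod (fun_of (F (r n)) z))\<^sup>2))"
      by (rule lim_imp_Liminf[OF sequentially_bot, symmetric])
  qed
  also have "\<dots> \<le> liminf (\<lambda>n. \<integral>\<^sup>+z. ennreal ((cmod (fun_of (F (r n)) z))\<^sup>2) \<partial>area)"
    by (rule nn_integral_liminf) measurable
  also have "\<dots> \<le> liminf (\<lambda>n. 1)"
  proof (rule Liminf_mono, intro always_eventually allI)
    fix n
    have "(norm (F (r n)))\<^sup>2 \<le> 1"
      using F by (simp add: power_le_one)
    then show "(\<integral>\<^sup>+z. ennreal ((cmod (fun_of (F (r n)) z))\<^sup>2) \<partial>area) \<le> 1"
      using norm_sq_nn[of "F (r n)"] ennreal_leI[of "(norm (F (r n)))\<^sup>2" 1] by (simp add: ennreal_power)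
  qed
  also have "\<dots> = (1 :: ennreal)"
    by (simp add: Liminf_const)
  finally have le1: "(\<integral>\<^sup>+z. ennreal ((cmod (g z))\<^sup>2) \<partial>area) \<le> 1" .
  then have sq: "square_int g"
    by (simp add: square_int_nn_iff order.strict_trans1)
  define f where "f = berg g"
  have fg: "fun_of f z = g z" if "z \<in> unit_disk" for z
    using that sq unfolding f_def by (subst fun_of_berg[OF g]) (auto simp: square_int_def)
  have "ennreal ((norm f)\<^sup>2) = (\<integral>\<^sup>+z. ennreal ((cmod (g z))\<^sup>2) \<partial>area)"
    unfolding norm_sq_nn using fg by (intro nn_integral_cong) (simp add: ennreal_power)
  with le1 have "ennreal ((norm f)\<^sup>2) \<le> ennreal 1"
    by simp
  then have "(norm f)\<^sup>2 \<le> 1\<^sup>2"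
    by (subst (asm) ennreal_le_iff) simp_all
  then have "norm f \<le> 1"
    by (rule power2_le_imp_le) simp
  moreover have "uniform_limit (cball 0 R) (\<lambda>n. fun_of (F (r n))) (fun_of f) sequentially" if "0 < R" "R < 1" for R
  proof -
    have "uniform_limit (cball 0 R) (\<lambda>n. fun_of (F (r n))) g sequentially"
    proof -
      have "cball 0 R \<subseteq> (unit_disk :: complex set)"
        using that by auto
      then show ?thesis
        using ul[of "cball 0 R"] by (simp add: o_def)
    qed
    then show ?thesis
      by (rule uniform_limit_cong'[THEN iffD1, rotated -1]) (use that fg in auto)
  qed
  ultimately show ?thesis
    using that r by blast
qed

text \<open>A subsequence from the unit ball converges locally uniformly. Its difference from the
  limit is cut at radius \<open>R0\<close>: the inner part is small in norm, and on the outer part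
  the operator is small. The limit stays in the unit ball, so the image itself is compact, not only
  its closure.\<close>

theorem compact_toeplitz_sum:
  assumes uss: "symbol_lists B uss" and B: "0 \<le> B"
    and lim: "((\<lambda>z. norm (toeplitz_sum (map (map (pull_back z)) uss) (kern 0 0))) \<longlongrightarrow> 0) boundary"
  shows "compact (toeplitz_sum uss ` cball 0 1)"
  unfolding compact_eq_seq_compact_metric seq_compact_def
proof (intro allI impI)
  fix G assume "\<forall>n::nat. G n \<in> toeplitz_sum uss ` cball 0 1"
  then obtain F where F: "\<And>n. G n = toeplitz_sum uss (F n)" "\<And>n. norm (F n) \<le> 1"
    unfolding image_iff by (metis mem_cball_0)
  obtain r f where r: "strict_mono (r :: nat \<Rightarrow> nat)" and f: "norm f \<le> 1"
    and ul: "\<And>R. 0 < R \<Longrightarrow> R < 1 \<Longrightarrow> uniform_limit (cball 0 R) (\<lambda>n. fun_of (F (r n))) (fun_of f) sequentially"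
    by (rule bergman_unit_ball_normal[of F, OF F(2)]) blast
  have lin: "bounded_linear (toeplitz_sum uss)"
    by (rule bounded_linear_toeplitz_sum[OF uss])
  obtain C where C: "0 < C" "\<And>g. norm (toeplitz_sum uss g) \<le> norm g * C"
    using bounded_linear.pos_bounded[OF lin] by blast
  have "(\<lambda>n. toeplitz_sum uss (F (r n))) \<longlonglongrightarrow> toeplitz_sum uss f"
  proof (rule tendstoI)
    fix e :: real assume e: "0 < e"
    obtain R0 where R0: "R0 < 1" "\<And>g. norm (toeplitz_sum uss (bergman_proj (\<lambda>z. if cmod z \<le> R0 then 0 else fun_of g z)))
        \<le> e / 4 * norm g"
      by (rule toeplitz_sum_boundary_part_small[OF uss B _ lim, of "e / 4"]) (use e in auto)
    define R where "R = max R0 (1/2)"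
    have R: "0 < R" "R < 1" "R0 \<le> R"
      using R0 by (auto simp: R_def)
    \<comment> \<open>Makes the inner part contribute \<open>d / 2 * C = e / 4\<close>; the outer
      part contributes at most \<open>e / 4 * 2\<close>, the difference having norm at most
      2.\<close>
    define d where "d = e / (2 * C)"
    have d: "0 < d"
      using e C by (simp add: d_def)
    have "\<forall>\<^sub>F n in sequentially. \<forall>z\<in>cball 0 R. dist (fun_of (F (r n)) z) (fun_of f z) < d / 2"
      using uniform_limitD[OF ul[OF R(1,2)], of "d / 2"] d by simp
    then show "\<forall>\<^sub>F n in sequentially. dist (toeplitz_sum uss (F (r n))) (toeplitz_sum uss f) < e"
    proof eventually_elim
      fix n assume n: "\<forall>z\<in>cball 0 R. dist (fun_of (F (r n)) z) (fun_of f z) < d / 2"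
      define g where "g = F (r n) - f"
      let ?g1 = "\<lambda>z. if cmod z \<le> R0 then fun_of g z else 0"
      let ?g2 = "\<lambda>z. if cmod z \<le> R0 then 0 else fun_of g z"
      have "symbol 1 (\<lambda>z. if cmod z \<le> R0 then 1 else 0)" "symbol 1 (\<lambda>z. if cmod z \<le> R0 then 0 else 1)"
        unfolding symbol_def by auto
      from this[THEN square_int_symbol_mult, OF square_int_fun_of[of g]]
      have sq: "square_int ?g1" "square_int ?g2"
        by (simp_all add: if_distrib[of "\<lambda>x. x * _"] cong: if_cong)
      have "norm g \<le> 2"
        using norm_triangle_ineq4[of "F (r n)" f] F(2)[of "r n"] f unfolding g_def by linarith
      have "g = bergman_proj (\<lambda>z. ?g1 z + ?g2 z)"
        by (simp add: bergman_proj_fun_of if_distrib[of "\<lambda>x. x + _"] cong: if_cong)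
      then have g: "g = bergman_proj ?g1 + bergman_proj ?g2"
        unfolding bergman_proj_add[OF sq] .
      have "(norm (bergman_proj ?g1))\<^sup>2 \<le> (LINT z|area. (cmod (?g1 z))\<^sup>2)"
        by (rule norm_bergman_proj[OF sq(1)])
      also have "\<dots> \<le> norm (LINT z|area. (cmod (?g1 z))\<^sup>2)"
        by simp
      also have "\<dots> \<le> (d / 2)\<^sup>2"
      proof (rule integral_area_bound)
        show "(\<lambda>z. (cmod (?g1 z))\<^sup>2) \<in> borel_measurable area"
          using sq(1) by (auto simp: square_int_def)
        show "norm ((cmod (?g1 z))\<^sup>2) \<le> (d / 2)\<^sup>2" for z
          using n R d by (auto simp: g_def fun_of_simps dist_norm intro!: power_mono less_imp_le)
      qed
      finally have "norm (bergman_proj ?g1) \<le> d / 2"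
        by (rule power2_le_imp_le) (use d in simp)
      then have "norm (toeplitz_sum uss (bergman_proj ?g1)) \<le> d / 2 * C"
        using C by (intro order_trans[OF C(2)] mult_right_mono) auto
      moreover have "d / 2 * C = e / 4"
        using C by (simp add: d_def)
      moreover have "norm (toeplitz_sum uss (bergman_proj ?g2)) \<le> e / 4 * norm g"
        by (rule R0(2))
      moreover have "e / 4 * norm g \<le> e / 4 * 2"
        using e \<open>norm g \<le> 2\<close> by (intro mult_left_mono) auto
      moreover have "norm (toeplitz_sum uss g) \<le> norm (toeplitz_sum uss (bergman_proj ?g1)) + norm (toeplitz_sum uss (bergman_proj ?g2))"
        by (subst g) (simp add: linear_add[OF bounded_linear.linear[OF lin]] norm_triangle_ineq)
      ultimately have "norm (toeplitz_sum uss g) < e"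
        using e by linarith
      then show "dist (toeplitz_sum uss (F (r n))) (toeplitz_sum uss f) < e"
        by (simp add: dist_norm g_def linear_diff[OF bounded_linear.linear[OF lin]])
    qed
  qed
  then show "\<exists>l\<in>toeplitz_sum uss ` cball 0 1. \<exists>r. strict_mono r \<and> (G \<circ> r) \<longlonglongrightarrow> l"
    using f r F(1) by (intro bexI[of _ "toeplitz_sum uss f"] exI[of _ r]) (auto simp: o_def)
qed

text \<open>The normalized kernels tend weakly to 0: on \<open>ball 0 r\<close> they are of size
  \<open>1 - |z|^2\<close>, and outside it f has little mass.\<close>

lemma normalized_kernel_boundary:
  "((\<lambda>z. cinner f (normalized_kernel z)) \<longlongrightarrow> 0) boundary"
proof (rule tendstoI)
  fix e :: real assume e: "0 < e"
  obtain r where r: "0 < r" "r < 1" and tail: "(LINT z|area. indicator (- ball 0 r) z * (cmod (fun_of f z))\<^sup>2) < (e / 2)\<^sup>2"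
    by (rule tail_small[OF square_int_fun_of, of "(e / 2)\<^sup>2" f]) (use e in auto)
  have "((\<lambda>x::real. norm f * ((1 - x\<^sup>2) / (1 - r)\<^sup>2)) \<longlongrightarrow> norm f * ((1 - 1\<^sup>2) / (1 - r)\<^sup>2)) (at_left 1)"
    using r by (intro tendsto_intros) auto
  then have "\<forall>\<^sub>F x in at_left 1. norm f * ((1 - x\<^sup>2) / (1 - r)\<^sup>2) < e / 2"
    using e by (intro order_tendstoD) auto
  then have "\<forall>\<^sub>F z in boundary. norm f * ((1 - (cmod z)\<^sup>2) / (1 - r)\<^sup>2) < e / 2"
    by (rule eventually_filtercomapI)
  with eventually_in_disk_boundary show "\<forall>\<^sub>F z in boundary. dist (cinner f (normalized_kernel z)) 0 < e"
  proof eventually_elim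
    fix z assume z: "z \<in> unit_disk" and z1: "norm f * ((1 - (cmod z)\<^sup>2) / (1 - r)\<^sup>2) < e / 2"
    let ?k = "fun_of (normalized_kernel z)" and ?q = "(1 - (cmod z)\<^sup>2) / (1 - r)\<^sup>2"
    let ?k1 = "\<lambda>w. of_bool (w \<in> ball 0 r) * ?k w" and ?f2 = "\<lambda>w. of_bool (w \<notin> ball 0 r) * fun_of f w"
    have "symbol 1 (\<lambda>w. of_bool (w \<in> ball 0 r))" "symbol 1 (\<lambda>w. of_bool (w \<notin> ball 0 r))"
      unfolding symbol_def by auto
    then have sq: "square_int ?k1" "square_int ?f2"
      by (auto intro: square_int_symbol_mult square_int_fun_of)
    have q: "0 \<le> ?q"
      using one_minus_norm_sq_pos[OF z] by simp
    have split: "cinner f (normalized_kernel z) = L2_inner (fun_of f) ?k1 + L2_inner ?f2 ?k"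
      unfolding cinner_eq L2_inner_def
        Bochner_Integration.integral_add[OF square_int_mult_integrable[OF square_int_fun_of sq(1)]
          square_int_mult_integrable[OF sq(2) square_int_fun_of], symmetric]
      by (rule Bochner_Integration.integral_cong) auto
    have "(cmod (L2_inner (fun_of f) ?k1))\<^sup>2 \<le> (norm f)\<^sup>2 * (LINT w|area. (cmod (?k1 w))\<^sup>2)"
      unfolding norm_sq_eq by (rule L2_inner_cauchy_schwarz[OF square_int_fun_of sq(1)])
    also have "\<dots> \<le> (norm f)\<^sup>2 * ?q\<^sup>2"
    proof (rule mult_left_mono[OF order_trans[of _ "norm (LINT w|area. (cmod (?k1 w))\<^sup>2)", OF _ integral_area_bound]])
      show "(\<lambda>w. (cmod (?k1 w))\<^sup>2) \<in> borel_measurable area"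
        using sq(1) by (auto simp: square_int_def)
      show "norm ((cmod (?k1 w))\<^sup>2) \<le> ?q\<^sup>2" if w: "w \<in> unit_disk" for w
      proof (cases "w \<in> ball 0 r")
        case True
        then have "1 - r \<le> cmod (1 - cnj z * w)"
          using norm_one_minus_cnj_mult_ge(2)[OF z w] by simp
        then have "cmod (?k w) \<le> ?q"
          using w r one_minus_norm_sq_pos[OF z] unfolding fun_of_normalized_kernel_eq[OF z]
          by (simp add: bkern_def norm_divide norm_power del: of_real_diff) (intro frac_le power_mono, auto)
        then show ?thesis
          using True by (simp add: power_mono)
      qed simp
    qed simp_all
    finally have "(cmod (L2_inner (fun_of f) ?k1))\<^sup>2 \<le> (norm f * ?q)\<^sup>2"
      by (simp only: power_mult_distrib)
    then have "cmod (L2_inner (fun_of f) ?k1) \<le> norm f * ?q"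
      by (rule power2_le_imp_le) (rule mult_nonneg_nonneg[OF norm_ge_zero q])
    moreover have "(cmod (L2_inner ?f2 ?k))\<^sup>2 < (e / 2)\<^sup>2"
    proof -
      have "(cmod (L2_inner ?f2 ?k))\<^sup>2 \<le> (LINT w|area. (cmod (?f2 w))\<^sup>2) * (LINT w|area. (cmod (?k w))\<^sup>2)"
        by (rule L2_inner_cauchy_schwarz[OF sq(2) square_int_fun_of])
      also have "(LINT w|area. (cmod (?k w))\<^sup>2) = 1"
        by (simp add: norm_sq_eq[symmetric] z[simplified])
      also have "(LINT w|area. (cmod (?f2 w))\<^sup>2) = (LINT z|area. indicator (- ball 0 r) z * (cmod (fun_of f z))\<^sup>2)"
        by (rule Bochner_Integration.integral_cong) (auto simp: indicator_def norm_mult)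
      finally show ?thesis
        using tail by simp
    qed
    then have "cmod (L2_inner ?f2 ?k) < e / 2"
      by (rule power2_less_imp_less) (use e in simp)
    ultimately show "dist (cinner f (normalized_kernel z)) 0 < e"
      unfolding split dist_norm diff_zero
      using z1 norm_triangle_ineq[of "L2_inner (fun_of f) ?k1" "L2_inner ?f2 ?k"] by linarith
  qed
qed

text \<open>On a relatively compact set the weak convergence of the kernels is uniform, by a finite
  net.\<close>

lemma berezin_compact_boundary:
  assumes "compact (closure (K ` cball 0 1))"
  shows "(berezin K \<longlongrightarrow> 0) boundary"
proof (rule tendstoI)
  fix e :: real assume e: "0 < e"
  then obtain G where G: "finite G" "closure (K ` cball 0 1) \<subseteq> (\<Union>g\<in>G. ball g (e / 2))"
    using assms half_gt_zero unfolding compact_eq_totally_bounded by meson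
  have "\<forall>\<^sub>F z in boundary. \<forall>g\<in>G. dist (cinner g (normalized_kernel z)) 0 < e / 2"
    using e by (intro eventually_ball_finite G(1) ballI tendstoD[OF normalized_kernel_boundary]) simp
  with eventually_in_disk_boundary show "\<forall>\<^sub>F z in boundary. dist (berezin K z) 0 < e"
  proof eventually_elim
    fix z assume z: "z \<in> unit_disk" and small: "\<forall>g\<in>G. dist (cinner g (normalized_kernel z)) 0 < e / 2"
    let ?k = "normalized_kernel z"
    have "K ?k \<in> closure (K ` cball 0 1)"
      using z by (intro subsetD[OF closure_subset] imageI) simp
    then obtain g where g: "g \<in> G" "norm (K ?k - g) < e / 2"
      using G(2) by (auto simp: dist_norm norm_minus_commute)
    have "berezin K z = cinner (K ?k - g) ?k + cinner g ?k"
      by (simp add: berezin_def cinner.diff_left)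
    moreover have "cmod (cinner (K ?k - g) ?k) \<le> norm (K ?k - g)"
      using norm_cinner_le[of "K ?k - g" ?k] z by simp
    moreover have "cmod (cinner g ?k) < e / 2"
      using small g(1) by simp
    ultimately show "dist (berezin K z) 0 < e"
      using g(2) norm_triangle_ineq[of "cinner (K ?k - g) ?k" "cinner g ?k"] by simp
  qed
qed

section \<open>Operators with vanishing Berezin transform\<close>

lemma cinner_kern_deriv:
  "w \<in> unit_disk \<Longrightarrow> cinner f (kern j w) = (deriv ^^ j) (fun_of f) w"
proof (induction j arbitrary: w)
  case 0
  then show ?case by (simp add: cinner_kern)
next
  case (Suc j)
  have "((\<lambda>w. cinner f (kern j w)) has_derivative (\<lambda>h. cinner f (scaleC (cnj h) (kern (Suc j) w)))) (at w)"
    by (rule bounded_linear.has_derivative[OF cinner.bounded_linear_right kern_has_derivative[OF Suc.prems]])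
  then have "((\<lambda>w. cinner f (kern j w)) has_field_derivative cinner f (kern (Suc j) w)) (at w)"
    unfolding has_field_derivative_def by (simp add: cinner_scaleC_right mult.commute[of _ "cinner f (kern (Suc j) w)"])
  then have "((deriv ^^ j) (fun_of f) has_field_derivative cinner f (kern (Suc j) w)) (at w)"
    by (rule has_field_derivative_transform_within_open[OF _ open_ball Suc.prems]) (use Suc.IH in auto)
  from DERIV_imp_deriv[OF this] show ?case
    by simp
qed

text \<open>A vanishing Berezin transform can be differentiated in \<open>w\<close> alone, which yields all Taylor
  coefficients of \<open>A 1\<close>.\<close>

lemma berezin_zero_imp:
  assumes A: "clinear_op A" and z: "\<And>w. w \<in> unit_disk \<Longrightarrow> berezin A w = 0"
  shows "A (kern 0 0) = 0"
proof -
  have M: "kern_entry A 0 j w = 0" if "w \<in> unit_disk" for j w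
    using that
  proof (induction j arbitrary: w)
    case 0
    have "disk_gap w \<noteq> 0"
      using one_minus_norm_sq_pos[OF 0] unfolding disk_gap by (simp del: of_real_diff)
    then show ?case
      using z[OF 0] berezin_kern_entry[OF A 0] by simp
  next
    case (Suc j)
    have "wirt (kern_entry A 0 j) 0 0 w"
      by (rule wirt_cong[OF wirt_const Suc.prems]) (simp add: Suc.IH)
    then show ?case
      using wirt_unique(1)[OF wirt_kern_entry[OF A Suc.prems]] by blast
  qed
  show ?thesis
  proof (rule fun_of_eqI)
    fix x assume x: "x \<in> unit_disk"
    have "(deriv ^^ j) (fun_of (A (kern 0 0))) 0 = 0" for j
      using M[of 0 j] by (simp add: kern_entry_def cinner_kern_deriv)
    then have "(\<lambda>n. 0) sums fun_of (A (kern 0 0)) x"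
      using holomorphic_power_series[OF holomorphic_fun_of x, of "A (kern 0 0)"] by simp
    then show "fun_of (A (kern 0 0)) x = fun_of 0 x"
      by (simp add: fun_of_simps sums_iff)
  qed
qed

section \<open>Functions annihilated by the Laplacian\<close>

lemma wirt_holomorphic:
  assumes "\<And>w. w \<in> unit_disk \<Longrightarrow> wirt f (a w) 0 w" shows "f holomorphic_on unit_disk"
  unfolding holomorphic_on_def field_differentiable_def
proof
  fix w assume w: "w \<in> unit_disk"
  have "(f has_field_derivative a w) (at w)"
    using assms[OF w] by (simp add: wirt_def has_field_derivative_def)
  then show "\<exists>f'. (f has_field_derivative f') (at w within unit_disk)"
    using has_field_derivative_at_within by blast
qed

lemma wirt_of_holomorphic: "(f has_field_derivative d) (at w) \<Longrightarrow> wirt f d 0 w"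
  by (simp add: wirt_def has_field_derivative_def)

lemma wirt_cnj_comp: "wirt f a b w \<Longrightarrow> wirt (\<lambda>w. cnj (f w)) (cnj b) (cnj a) w"
  unfolding wirt_def
  by (drule bounded_linear.has_derivative[OF bounded_linear_cnj]) (simp add: add.commute)

text \<open>The derivative a of f in w is analytic; with a primitive F of a, the remainder
  \<open>f - F\<close> is conjugate analytic, so \<open>f = F + cnj G\<close>. F and G need not be
  integrable over the disk, so the mean value property is applied to them on smaller disks and the
  limit is taken for f only.\<close>

lemma laplacian_zero_mean_value:
  assumes f: "\<And>w. w \<in> unit_disk \<Longrightarrow> wirt f (a w) (b w) w"
    and a: "\<And>w. w \<in> unit_disk \<Longrightarrow> wirt a (c w) 0 w"
    and int: "integrable area f"
  shows "(LINT z|area. f z) = f 0"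
proof -
  have "a holomorphic_on unit_disk"
    by (rule wirt_holomorphic[OF a])
  then obtain F where F: "\<And>w. w \<in> unit_disk \<Longrightarrow> (F has_field_derivative a w) (at w)"
    using holomorphic_convex_primitive'[of unit_disk a] by (metis at_within_open convex_ball open_ball)
  have Fh: "F holomorphic_on unit_disk"
    using F by (meson field_differentiable_at_within field_differentiable_def holomorphic_onI)
  define G where "G w = cnj (f w - F w)" for w
  have "wirt G (cnj (b w)) 0 w" if "w \<in> unit_disk" for w
  proof -
    have "wirt (\<lambda>w. 1 * f w + (-1) * F w) (1 * a w + (-1) * a w) (1 * b w + (-1) * 0) w"
      by (rule wirt_scale_sum[OF f[OF that] wirt_of_holomorphic[OF F[OF that]]])
    from wirt_cnj_comp[OF this] show ?thesis
      by (simp add: G_def[abs_def])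
  qed
  then have Gh: "G holomorphic_on unit_disk"
    by (rule wirt_holomorphic)
  have fFG: "f w = F w + cnj (G w)" for w
    by (simp add: G_def)
  have "(LINT z|area. indicator (ball 0 r) z *\<^sub>R f z) = measure area (ball 0 r) *\<^sub>R f 0" if r: "r < 1" for r
  proof -
    have i: "integrable area (\<lambda>z. indicator (ball 0 r) z *\<^sub>R H z)" if "H holomorphic_on unit_disk" for H :: "complex \<Rightarrow> complex"
    proof -
      have "continuous_on (cball 0 (max r 0)) H"
        using r by (intro holomorphic_on_imp_continuous_on holomorphic_on_subset[OF that]) auto
      then have "bounded (H ` cball 0 (max r 0))"
        by (intro compact_imp_bounded compact_continuous_image) auto
      then obtain C where C: "\<And>z. z \<in> cball 0 (max r 0) \<Longrightarrow> cmod (H z) \<le> C"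
        unfolding bounded_iff by blast
      have C0: "0 \<le> C"
        using C[of 0] norm_ge_zero order_trans by (metis centre_in_cball max.cobounded2)
      have [measurable]: "H \<in> borel_measurable area"
        by (intro continuous_imp_measurable_area holomorphic_on_imp_continuous_on that)
      show ?thesis
        by (rule integrable_area_bounded[where B = C]) (use C C0 in \<open>auto simp: indicator_def\<close>)
    qed
    have "(LINT z|area. indicator (ball 0 r) z *\<^sub>R f z)
        = (LINT z|area. indicator (ball 0 r) z *\<^sub>R F z + cnj (indicator (ball 0 r) z *\<^sub>R G z))"
      by (simp add: fFG scaleR_add_right)
    also have "\<dots> = (LINT z|area. indicator (ball 0 r) z *\<^sub>R F z) + cnj (LINT z|area. indicator (ball 0 r) z *\<^sub>R G z)"
      by (subst Bochner_Integration.integral_add[OF i[OF Fh]]) (use i[OF Gh] in \<open>simp_all del: complex_cnj_scaleR\<close>)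
    also have "\<dots> = measure area (ball 0 r) *\<^sub>R f 0"
      unfolding mean_value_ball[OF Fh r] mean_value_ball[OF Gh r] by (simp add: fFG scaleR_add_right)
    finally show ?thesis .
  qed
  then have "(\<lambda>n. LINT z|area. indicator (ball 0 (1 - 1 / Suc n)) z *\<^sub>R f z) \<longlonglongrightarrow> 1 *\<^sub>R f 0"
    using tendsto_scaleR[OF measure_ball_exhaust tendsto_const[of "f 0"]] by simp
  with ball_exhaust_tendsto[OF int] show ?thesis
    using LIMSEQ_unique by fastforce
qed

section \<open>Interpolation by bounded analytic functions\<close>

text \<open>A lower Riemann sum for the integral of \<open>exp (- t)\<close> from 0 to the total of
  the \<open>x k\<close>. Elements are inserted in order of decreasing r, so the new one carries the
  full sum in its exponent; ties only enlarge the other exponents, which helps.\<close>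

lemma sum_exp_rank_le:
  fixes x :: "'a \<Rightarrow> real" and r :: "'a \<Rightarrow> real"
  assumes "finite F" "\<And>k. 0 \<le> x k"
  shows "(\<Sum>j\<in>F. x j * exp (- (\<Sum>k\<in>{k\<in>F. r j \<le> r k}. x k))) \<le> 1 - exp (- (\<Sum>k\<in>F. x k))"
  using assms(1)
proof (induction F rule: finite_ranking_induct[where f = "\<lambda>k. - r k"])
  case (insert l F)
  show ?case
  proof (cases "l \<in> F")
    case False
    let ?T = "\<Sum>k\<in>F. x k"
    have "{k \<in> insert l F. r l \<le> r k} = insert l F"
      using insert by auto
    then have l: "(\<Sum>k\<in>{k\<in>insert l F. r l \<le> r k}. x k) = x l + ?T"
      using insert False by simp
    have "(\<Sum>j\<in>F. x j * exp (- (\<Sum>k\<in>{k\<in>insert l F. r j \<le> r k}. x k)))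
        \<le> (\<Sum>j\<in>F. x j * exp (- (\<Sum>k\<in>{k\<in>F. r j \<le> r k}. x k)))"
      using insert assms(2) by (intro sum_mono mult_left_mono) (auto intro!: sum_mono2)
    also have "\<dots> \<le> 1 - exp (- ?T)"
      by (rule insert.IH)
    finally have 1: "(\<Sum>j\<in>F. x j * exp (- (\<Sum>k\<in>{k\<in>insert l F. r j \<le> r k}. x k))) \<le> 1 - exp (- ?T)" .
    have "x l * exp (- (x l + ?T)) \<le> (exp (x l) - 1) * exp (- (x l + ?T))"
    proof (rule mult_right_mono)
      show "x l \<le> exp (x l) - 1"
        using exp_ge_add_one_self[of "x l"] by linarith
    qed simp
    also have "\<dots> = exp (- ?T) - exp (- (x l + ?T))"
      by (simp add: algebra_simps exp_add[symmetric])
    finally show ?thesis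
      using 1 insert False by (simp add: l[simplified] l)
  qed (use insert in \<open>simp add: insert_absorb\<close>)
qed simp

text \<open>Carleson's condition for a finite set; holding with one d for all finite subsets, it
  defines \<open>interpolating\<close>.\<close>

definition separated :: "real \<Rightarrow> complex set \<Rightarrow> bool" where
  "separated d F \<longleftrightarrow> F \<subseteq> unit_disk \<and> (\<forall>j\<in>F. d \<le> (\<Prod>k\<in>F - {j}. pdist k j))"

text \<open>A Blaschke product without the usual unimodular normalization: only zeros and moduli
  enter, and limits are taken along subsequences.\<close>

definition blaschke :: "complex set \<Rightarrow> complex \<Rightarrow> complex" where
  "blaschke F z = (\<Prod>k\<in>F. disk_aut k z)"

lemma holomorphic_blaschke: "F \<subseteq> unit_disk \<Longrightarrow> blaschke F holomorphic_on unit_disk"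
  unfolding blaschke_def[abs_def] by (intro holomorphic_on_prod holomorphic_disk_aut) auto

lemma norm_blaschke: "cmod (blaschke F z) = (\<Prod>k\<in>F. pdist k z)"
  by (simp add: blaschke_def pdist_def prod_norm)

lemma norm_blaschke_le_1: "F \<subseteq> unit_disk \<Longrightarrow> z \<in> unit_disk \<Longrightarrow> cmod (blaschke F z) \<le> 1"
  unfolding norm_blaschke using pdist_less_one by (intro prod_le_1) (metis less_imp_le pdist_nonneg subsetD)

lemma blaschke_zero: "finite F \<Longrightarrow> z \<in> F \<Longrightarrow> blaschke F z = 0"
  by (auto simp: blaschke_def intro!: prod_zero bexI[of _ z])

text \<open>\<open>1 - x^2 \<le> - 2 * ln x\<close> turns the product in \<open>separated\<close>
  into a sum; the summand 1 is the term \<open>k = j\<close>.\<close>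

lemma separated_sum_bound:
  assumes F: "finite F" "separated d F" and d: "0 < d" and j: "j \<in> F"
  shows "(\<Sum>k\<in>F. 1 - (pdist k j)\<^sup>2) \<le> 1 + 2 * ln (1 / d)"
proof -
  have pos: "0 < (\<Prod>k\<in>F - {j}. pdist k j)"
    using F d j unfolding separated_def by force
  then have p: "0 < pdist k j" if "k \<in> F - {j}" for k
    using F(1) that pdist_nonneg[of k j] by (metis finite_Diff less_eq_real_def less_irrefl prod_zero_iff)
  have "(\<Sum>k\<in>F - {j}. 1 - (pdist k j)\<^sup>2) \<le> (\<Sum>k\<in>F - {j}. - 2 * ln (pdist k j))"
  proof (rule sum_mono)
    fix k assume k: "k \<in> F - {j}"
    have "ln ((pdist k j)\<^sup>2) \<le> (pdist k j)\<^sup>2 - 1"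
      using p[OF k] by (intro ln_le_minus_one) simp
    then show "1 - (pdist k j)\<^sup>2 \<le> - 2 * ln (pdist k j)"
      using p[OF k] by (simp add: ln_realpow)
  qed
  also have "\<dots> = - 2 * ln (\<Prod>k\<in>F - {j}. pdist k j)"
  proof -
    have "ln (\<Prod>k\<in>F - {j}. pdist k j) = (\<Sum>k\<in>F - {j}. ln (pdist k j))"
    proof (rule ln_prod)
      show "pdist i j \<noteq> 0" if "i \<in> F - {j}" for i
        using p[OF that] by simp
    qed (use F in simp)
    then show ?thesis
      by (simp add: sum_distrib_left)
  qed
  also have "\<dots> \<le> 2 * ln (1 / d)"
    using F d j pos by (simp add: separated_def ln_div)
  also have "(\<Sum>k\<in>F - {j}. 1 - (pdist k j)\<^sup>2) = (\<Sum>k\<in>F. 1 - (pdist k j)\<^sup>2) - 1"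
    using F(1) j by (simp add: sum_diff1 pdist_def)
  finally show ?thesis by simp
qed

lemma Re_cayley: "Re ((1 + u) / (1 - u)) = (1 - (cmod u)\<^sup>2) / (cmod (1 - u))\<^sup>2"
  unfolding cmod_power2 by (simp add: Re_divide power2_eq_square algebra_simps)

text \<open>The exponential comes from \<open>separated_sum_bound\<close>, which controls the
  normalization of the j-th summand at j; the factor \<open>1 / d\<close> comes from dividing by the
  Blaschke product at j.\<close>

definition jones_const :: "real \<Rightarrow> real" where
  "jones_const d = exp (2 * (1 + 2 * ln (1 / d))) / d"

text \<open>P. Jones' explicit interpolating function.\<close>

lemma finite_interpolation:
  assumes F: "finite F" "separated d F" and d: "0 < d"
    and c: "\<And>k. k \<in> F \<Longrightarrow> cmod (c k) \<le> 1"
  obtains h where "h holomorphic_on unit_disk" "\<And>z. z \<in> unit_disk \<Longrightarrow> cmod (h z) \<le> jones_const d"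
    "\<And>k. k \<in> F \<Longrightarrow> h k = c k"
proof -
  have FD: "F \<subseteq> unit_disk"
    using F by (simp add: separated_def)
  \<comment> \<open>The real part of \<open>al k z\<close> is at least \<open>x k\<close> below,
    while for k in \<open>G j\<close> its value at j is at most
    \<open>2 * (1 - (pdist k j)^2)\<close>, which sums to a bound in terms of d.\<close>
  define al where "al k z = of_real (1 - (cmod k)\<^sup>2) * ((1 + cnj k * z) / (1 - cnj k * z))" for k z
  \<comment> \<open>Restricting to k at least as far out as j serves twice: it gives
    \<open>al_le\<close>, and it is the ranking in \<open>sum_exp_rank_le\<close>.\<close>
  define G where "G j = {k \<in> F. cmod j \<le> cmod k}" for j
  define B where "B j = blaschke (F - {j})" for j
  \<comment> \<open>Equal to 1 at j and of modulus exactly \<open>x j\<close>, so that the sum of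
    the moduli has the shape bounded by \<open>sum_exp_rank_le\<close>.\<close>
  define w where "w j z = (of_real (1 - (cmod j)\<^sup>2) / (1 - cnj j * z))\<^sup>2" for j z
  define t where "t j z = c j / B j j * (B j z * w j z * exp (- (\<Sum>k\<in>G j. al k z - al k j)))" for j z
  define h where "h z = (\<Sum>j\<in>F. t j z)" for z
  have nz: "1 - cnj k * z \<noteq> 0" if "k \<in> F" "z \<in> unit_disk" for k z
    using one_minus_cnj_mult_nonzero that FD by auto
  have Bj: "d \<le> cmod (B j j)" if "j \<in> F" for j
    using F that by (simp add: B_def norm_blaschke separated_def)
  have Re_al: "Re (al k z) = (1 - (cmod k)\<^sup>2) * (1 - (cmod (cnj k * z))\<^sup>2) / (cmod (1 - cnj k * z))\<^sup>2" for k z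
  proof -
    have r: "Re (of_real a * u) = a * Re u" for a u
      by simp
    show ?thesis
      unfolding al_def r Re_cayley by simp
  qed
  have "h holomorphic_on unit_disk"
    unfolding h_def t_def w_def al_def
    by (intro holomorphic_intros)
      (use nz FD in \<open>auto simp: G_def B_def intro!: holomorphic_blaschke\<close>)
  moreover have "cmod (h z) \<le> jones_const d" if z: "z \<in> unit_disk" for z
  proof -
    define x where "x k = (1 - (cmod k)\<^sup>2)\<^sup>2 / (cmod (1 - cnj k * z))\<^sup>2" for k
    have "cmod (t j z) \<le> jones_const d * (x j * exp (- (\<Sum>k\<in>{k\<in>F. cmod j \<le> cmod k}. x k)))" if j: "j \<in> F" for j
    proof -
      have jD: "j \<in> unit_disk" using j FD by auto
      have x_le: "x k \<le> Re (al k z)" if "k \<in> F" for k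
      proof -
        have k: "k \<in> unit_disk" using that FD by auto
        have "cmod (cnj k * z) \<le> cmod k"
          using z by (simp add: norm_mult mult_left_le)
        then have "(cmod (cnj k * z))\<^sup>2 \<le> (cmod k)\<^sup>2"
          by (intro power_mono) auto
        then show ?thesis
          unfolding x_def Re_al power2_eq_square[of "1 - (cmod k)\<^sup>2"] using one_minus_norm_sq_pos[OF k]
          by (intro divide_right_mono mult_left_mono) auto
      qed
      have al_le: "Re (al k j) \<le> 2 * (1 - (pdist k j)\<^sup>2)" if "k \<in> G j" for k
      proof -
        have k: "k \<in> unit_disk" "cmod j \<le> cmod k" using that FD by (auto simp: G_def)
        have "(cmod j)\<^sup>2 \<le> (cmod k)\<^sup>2"
          using k by (intro power_mono) auto
        then have "(cmod j)\<^sup>2 * (cmod j)\<^sup>2 \<le> (cmod k)\<^sup>2 * (cmod j)\<^sup>2"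
          by (rule mult_right_mono) simp
        moreover have "(1 - (cmod j)\<^sup>2) * (1 + (cmod j)\<^sup>2) \<le> (1 - (cmod j)\<^sup>2) * 2"
          using norm_sq_less_one[OF jD] by (intro mult_left_mono) auto
        ultimately have "1 - (cmod (cnj k * j))\<^sup>2 \<le> 2 * (1 - (cmod j)\<^sup>2)"
          by (simp add: norm_mult power_mult_distrib algebra_simps)
        then have "(1 - (cmod k)\<^sup>2) * (1 - (cmod (cnj k * j))\<^sup>2) \<le> (1 - (cmod k)\<^sup>2) * (2 * (1 - (cmod j)\<^sup>2))"
          using one_minus_norm_sq_pos[OF k(1)] by (intro mult_left_mono) auto
        then have "Re (al k j) \<le> (1 - (cmod k)\<^sup>2) * (2 * (1 - (cmod j)\<^sup>2)) / (cmod (1 - cnj k * j))\<^sup>2"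
          unfolding Re_al by (rule divide_right_mono) simp
        also have "\<dots> = 2 * (1 - (pdist k j)\<^sup>2)"
          unfolding pdist_def one_minus_norm_disk_aut[OF k(1) jD] by simp
        finally show ?thesis .
      qed
      have "(\<Sum>k\<in>G j. Re (al k j)) \<le> (\<Sum>k\<in>G j. 2 * (1 - (pdist k j)\<^sup>2))"
        by (rule sum_mono) (rule al_le)
      also have "\<dots> \<le> (\<Sum>k\<in>F. 2 * (1 - (pdist k j)\<^sup>2))"
      proof (rule sum_mono2[OF F(1)])
        fix k assume "k \<in> F - G j"
        then have "pdist k j \<le> 1"
          using pdist_less_one FD jD by (intro less_imp_le) auto
        then show "0 \<le> 2 * (1 - (pdist k j)\<^sup>2)"
          by (simp add: power_le_one)
      qed (auto simp: G_def)
      also have "\<dots> = 2 * (\<Sum>k\<in>F. 1 - (pdist k j)\<^sup>2)"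
        by (simp add: sum_distrib_left)
      also have "\<dots> \<le> 2 * (1 + 2 * ln (1 / d))"
        using separated_sum_bound[OF F d j] by simp
      finally have e1: "(\<Sum>k\<in>G j. Re (al k j)) \<le> 2 * (1 + 2 * ln (1 / d))" .
      have e2: "(\<Sum>k\<in>G j. x k) \<le> (\<Sum>k\<in>G j. Re (al k z))"
        using x_le by (intro sum_mono) (auto simp: G_def)
      have "cmod (exp (- (\<Sum>k\<in>G j. al k z - al k j))) = exp ((\<Sum>k\<in>G j. Re (al k j)) - (\<Sum>k\<in>G j. Re (al k z)))"
        by (simp add: norm_exp_eq_Re sum_subtractf)
      also have "\<dots> \<le> exp (2 * (1 + 2 * ln (1 / d)) - (\<Sum>k\<in>G j. x k))"
        using e1 e2 by simp
      also have "\<dots> = exp (2 * (1 + 2 * ln (1 / d))) * exp (- (\<Sum>k\<in>G j. x k))"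
        by (simp add: exp_add[symmetric])
      finally have E: "cmod (exp (- (\<Sum>k\<in>G j. al k z - al k j))) \<le> exp (2 * (1 + 2 * ln (1 / d))) * exp (- (\<Sum>k\<in>G j. x k))" .
      have W: "cmod (w j z) = x j"
        using one_minus_norm_sq_pos[OF jD]
        unfolding w_def x_def norm_power norm_divide norm_of_real by (simp add: power_divide)
      have "cmod (c j) / cmod (B j j) \<le> 1 / d"
        using c[OF j] Bj[OF j] d by (intro frac_le) auto
      moreover have "cmod (B j z) \<le> 1"
        unfolding B_def using FD z by (intro norm_blaschke_le_1) auto
      ultimately have "cmod (t j z) \<le> 1 / d * (1 * x j * (exp (2 * (1 + 2 * ln (1 / d))) * exp (- (\<Sum>k\<in>G j. x k))))"
        unfolding t_def norm_mult norm_divide W using E d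
        by (intro mult_mono) (auto simp: x_def)
      then show ?thesis
        by (simp add: jones_const_def G_def algebra_simps)
    qed
    then have "cmod (h z) \<le> (\<Sum>j\<in>F. jones_const d * (x j * exp (- (\<Sum>k\<in>{k\<in>F. cmod j \<le> cmod k}. x k))))"
      unfolding h_def by (intro sum_norm_le) auto
    also have "\<dots> = jones_const d * (\<Sum>j\<in>F. x j * exp (- (\<Sum>k\<in>{k\<in>F. cmod j \<le> cmod k}. x k)))"
      by (simp add: sum_distrib_left)
    also have "\<dots> \<le> jones_const d * (1 - exp (- (\<Sum>k\<in>F. x k)))"
      using d by (intro mult_left_mono sum_exp_rank_le F) (auto simp: x_def jones_const_def)
    also have "\<dots> \<le> jones_const d * 1"
      using d by (intro mult_left_mono) (auto simp: jones_const_def)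
    finally show ?thesis by simp
  qed
  moreover have "h k = c k" if k: "k \<in> F" for k
  proof -
    have "t j k = 0" if "j \<in> F - {k}" for j
      using that k F(1) blaschke_zero[of "F - {j}" k] by (auto simp: t_def B_def)
    then have "h k = t k k"
      unfolding h_def using F(1) k by (subst sum.remove[of F k]) auto
    also have "\<dots> = c k"
    proof -
      have kD: "k \<in> unit_disk" using k FD by auto
      have "w k k = 1"
        unfolding w_def of_real_one_minus_norm_sq using nz[OF k kD] by simp
      moreover have "B k k \<noteq> 0"
        using Bj[OF k] d by auto
      ultimately show ?thesis
        by (simp add: t_def)
    qed
    finally show ?thesis .
  qed
  ultimately show ?thesis
    by (rule that)
qed

section \<open>Lower bounds for Blaschke products and division by zeros\<close>

lemma norm_disk_aut_circle:
  assumes k: "k \<in> unit_disk" and z: "cmod z = 1" shows "cmod (disk_aut k z) = 1"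
proof -
  have "1 - cnj k * z \<noteq> 0"
    by (rule kernel_denominator_nonzero) (use assms in auto)
  moreover have "(cmod (1 - cnj k * z))\<^sup>2 = (cmod (k - z))\<^sup>2"
    using disk_aut_identity[of k z] z by simp
  then have "cmod (k - z) = cmod (1 - cnj k * z)"
    by (simp add: power2_eq_iff_nonneg)
  ultimately show ?thesis
    unfolding disk_aut_def norm_divide by simp
qed

lemma continuous_on_disk_aut_cball: "k \<in> unit_disk \<Longrightarrow> continuous_on (cball 0 1) (disk_aut k)"
  unfolding disk_aut_def[abs_def]
  by (intro continuous_intros) (use kernel_denominator_nonzero in auto)

text \<open>Maximum modulus for \<open>1 / blaschke F\<close> on the disk with the pseudohyperbolic
  s-disks around the zeros removed. On the unit circle the product has modulus 1; on the circle
  around k the factor of k has modulus s, and the others have product at least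
  \<open>d - 2 * s \<ge> d / 2\<close> by Schwarz-Pick.\<close>

lemma blaschke_lower_bound:
  assumes F: "finite F" "separated d F" and s: "0 < s" "s \<le> d / 4" "d \<le> 1" and z: "z \<in> unit_disk"
    and far: "\<And>k. k \<in> F \<Longrightarrow> s \<le> pdist k z"
  shows "s * d / 2 \<le> cmod (blaschke F z)"
proof -
  have FD: "F \<subseteq> unit_disk"
    using F by (simp add: separated_def)
  define S where "S = cball 0 1 \<inter> (\<Inter>k\<in>F. {z \<in> cball 0 1. s \<le> cmod (disk_aut k z)})"
  have cont: "continuous_on (cball 0 1) (disk_aut k)" if "k \<in> F" for k
    using continuous_on_disk_aut_cball FD that by auto
  have "closed {z \<in> cball 0 1. s \<le> cmod (disk_aut k z)}" if "k \<in> F" for k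
    by (rule continuous_on_closed_Collect_le) (intro continuous_intros cont that | simp)+
  then have clS: "closed S"
    unfolding S_def by (intro closed_Int closed_INT) auto
  have SD: "S \<subseteq> cball 0 1" and Sk: "\<And>k w. k \<in> F \<Longrightarrow> w \<in> S \<Longrightarrow> s \<le> cmod (disk_aut k w)"
    by (auto simp: S_def)
  have nz: "blaschke F w \<noteq> 0" if "w \<in> S" for w
    using F(1) Sk[OF _ that] s by (force simp: blaschke_def)
  have contB: "continuous_on S (\<lambda>w. inverse (blaschke F w))"
    unfolding blaschke_def[abs_def]
    by (intro continuous_intros continuous_on_subset[OF cont SD]) (use nz in \<open>auto simp: blaschke_def\<close>)
  have "interior S \<subseteq> unit_disk"
    using interior_mono[OF SD] by simp
  then have holB: "(\<lambda>w. inverse (blaschke F w)) holomorphic_on interior S"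
    using nz interior_subset by (intro holomorphic_intros holomorphic_on_subset[OF holomorphic_blaschke[OF FD]]) auto
  have bound: "s * d / 2 \<le> cmod (blaschke F w)" if w: "w \<in> S - interior S" for w
  proof (cases "cmod w = 1")
    case True
    have "cmod (blaschke F w) = 1"
      unfolding norm_blaschke pdist_def using norm_disk_aut_circle[OF _ True] FD by (intro prod.neutral) auto
    moreover have "s * d \<le> 1 * 1"
      using s by (intro mult_mono) auto
    ultimately show ?thesis by simp
  next
    case False
    then have wD: "w \<in> unit_disk"
      using w SD by force
    have "\<exists>k\<in>F. cmod (disk_aut k w) = s"
    proof (rule ccontr)
      assume "\<not> ?thesis"
      then have gt: "s < cmod (disk_aut k w)" if "k \<in> F" for k
        using Sk[of k w] w that by force
      define U where "U = unit_disk \<inter> (\<Inter>k\<in>F. {z \<in> unit_disk. s < cmod (disk_aut k z)})"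
      have "open {z \<in> unit_disk. s < cmod (disk_aut k z)}" if "k \<in> F" for k
      proof -
        have "open (unit_disk \<inter> disk_aut k -` {w. s < cmod w})"
          using that FD by (intro continuous_open_preimage holomorphic_on_imp_continuous_on
              holomorphic_disk_aut open_Collect_less continuous_intros) auto
        also have "unit_disk \<inter> disk_aut k -` {w. s < cmod w} = {z \<in> unit_disk. s < cmod (disk_aut k z)}"
          by auto
        finally show ?thesis .
      qed
      then have "open U"
        unfolding U_def using F(1) by (intro open_Int open_INT) auto
      moreover have "w \<in> U"
        using wD gt by (auto simp: U_def)
      moreover have "U \<subseteq> S"
        by (auto simp: U_def S_def intro: less_imp_le)
      ultimately have "w \<in> interior S"
        by (meson interiorI)
      then show False
        using w by simp
    qed
    then obtain k where k: "k \<in> F" "pdist k w = s"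
      by (auto simp: pdist_def)
    have kD: "k \<in> unit_disk" using k FD by auto
    let ?B = "blaschke (F - {k})"
    have "cmod (?B k - ?B w) \<le> 2 * 1 * pdist k w"
      by (intro schwarz_pick_bound holomorphic_blaschke norm_blaschke_le_1 kD wD) (use FD in auto)
    moreover have "d \<le> cmod (?B k)"
      using F k by (simp add: norm_blaschke separated_def)
    ultimately have "d / 2 \<le> cmod (?B w)"
      using k s norm_triangle_ineq2[of "?B k" "?B w"] by linarith
    moreover have "cmod (blaschke F w) = s * cmod (?B w)"
      unfolding norm_blaschke using F(1) k by (subst prod.remove[of F k]) auto
    ultimately show ?thesis
      using s by (simp add: mult_left_mono)
  qed
  have "norm (inverse (blaschke F z)) \<le> 2 / (s * d)"
  proof (rule maximum_modulus_frontier[OF holB])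
    show "continuous_on (closure S) (\<lambda>w. inverse (blaschke F w))"
      using contB clS by simp
    show "bounded S"
      using SD bounded_cball bounded_subset by blast
    show "norm (inverse (blaschke F w)) \<le> 2 / (s * d)" if "w \<in> frontier S" for w
    proof -
      have "w \<in> S - interior S"
        using that clS by (simp add: frontier_def)
      from bound[OF this] show ?thesis
        using le_imp_inverse_le[of "s * d / 2" "cmod (blaschke F w)"] s by (simp add: norm_inverse)
    qed
    show "z \<in> S"
      using z far by (auto simp: S_def pdist_def less_imp_le)
  qed
  then have "inverse (cmod (blaschke F z)) \<le> inverse (s * d / 2)"
    by (simp add: norm_inverse)
  moreover have "0 < cmod (blaschke F z)"
    using nz[of z] z far by (auto simp: S_def pdist_def less_imp_le)
  ultimately show ?thesis
    by (rule inverse_le_imp_le)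
qed

lemma holomorphic_comp_disk_aut:
  assumes "k \<in> unit_disk" "G holomorphic_on unit_disk"
  shows "(\<lambda>w. G (disk_aut k w)) holomorphic_on unit_disk"
  using holomorphic_on_compose_gen[OF holomorphic_disk_aut[OF assms(1)] assms(2)] disk_aut_image[OF assms(1)]
  by (simp add: o_def)

text \<open>The zeros are divided out one at a time: moving k to 0 and dividing by the coordinate
  keeps the bound C, by Schwarz's lemma away from 0 and by continuity at 0.\<close>

lemma zero_factor_bound:
  assumes "finite F" and "F \<subseteq> unit_disk"
    and "G holomorphic_on unit_disk" "\<And>z. z \<in> unit_disk \<Longrightarrow> cmod (G z) \<le> C" "\<And>k. k \<in> F \<Longrightarrow> G k = 0"
    and "z \<in> unit_disk"
  shows "cmod (G z) \<le> C * (\<Prod>k\<in>F. pdist k z)"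
  using assms
proof (induction F arbitrary: G z rule: finite_induct)
  case (insert k F)
  have k: "k \<in> unit_disk" using insert.prems by auto
  have "(\<lambda>w. G (disk_aut k w)) holomorphic_on unit_disk"
    by (rule holomorphic_comp_disk_aut[OF k insert.prems(2)])
  moreover have "G (disk_aut k 0) = 0"
    using insert.prems by simp
  ultimately obtain h where h: "h holomorphic_on unit_disk" "\<And>w. cmod w < 1 \<Longrightarrow> G (disk_aut k w) = w * h w"
    by (rule Schwarz3) blast
  have hb: "cmod (h w) \<le> C" if w: "w \<in> unit_disk - {0}" for w
  proof -
    have "cmod (G (disk_aut k w)) \<le> C * cmod w"
      by (rule schwarz_bound[of "\<lambda>w. G (disk_aut k w)"])
        (use insert.prems k w disk_aut_in_disk \<open>(\<lambda>w. G (disk_aut k w)) holomorphic_on unit_disk\<close> in auto)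
    then show ?thesis
      using w h(2)[of w] by (simp add: norm_mult mult.commute)
  qed
  have h0: "cmod (h 0) \<le> C"
  proof (rule tendsto_upperbound)
    have "isCont h 0"
      using holomorphic_on_imp_continuous_on[OF h(1)] by (simp add: continuous_on_eq_continuous_at)
    then show "((\<lambda>w. cmod (h w)) \<longlongrightarrow> cmod (h 0)) (at 0)"
      by (intro tendsto_norm) (simp add: isCont_def)
    show "\<forall>\<^sub>F w in at 0. cmod (h w) \<le> C"
      using hb eventually_at_in_open[of unit_disk 0] by (auto elim: eventually_mono)
  qed simp
  let ?H = "\<lambda>z. h (disk_aut k z)"
  have G: "G z = disk_aut k z * ?H z" if "z \<in> unit_disk" for z
    using h(2)[of "disk_aut k z"] disk_aut_in_disk[OF k that] disk_aut_involution[OF k that] by simp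
  have "cmod (?H z) \<le> C * (\<Prod>k\<in>F. pdist k z)"
  proof (rule insert.IH)
    show "?H holomorphic_on unit_disk"
      by (rule holomorphic_comp_disk_aut[OF k h(1)])
    show "cmod (?H z) \<le> C" if "z \<in> unit_disk" for z
      using hb[of "disk_aut k z"] h0 disk_aut_in_disk[OF k that] by (cases "disk_aut k z = 0") auto
    show "?H j = 0" if "j \<in> F" for j
    proof -
      have j: "j \<in> unit_disk" "j \<noteq> k" using that insert by auto
      then have "disk_aut k j \<noteq> 0"
        using pdist_eq_0_iff[OF k j(1)] by (simp add: pdist_def)
      then show ?thesis
        using G[OF j(1)] insert.prems(4)[of j] that by simp
    qed
  qed (use insert.prems in auto)
  then have "cmod (disk_aut k z) * cmod (?H z) \<le> cmod (disk_aut k z) * (C * (\<Prod>k\<in>F. pdist k z))"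
    by (intro mult_left_mono) auto
  then show ?case
    using G[OF insert.prems(5)] insert.hyps by (simp add: norm_mult pdist_def mult_ac)
qed simp

section \<open>Passage to infinite interpolating sets\<close>

lemma montel_disk:
  assumes h: "\<And>n. h n holomorphic_on unit_disk" "\<And>n z. z \<in> unit_disk \<Longrightarrow> cmod (h n z) \<le> M"
  obtains g r where "g holomorphic_on unit_disk" "strict_mono (r :: nat \<Rightarrow> nat)"
    "\<And>z. z \<in> unit_disk \<Longrightarrow> (\<lambda>n. h (r n) z) \<longlonglongrightarrow> g z" "\<And>z. z \<in> unit_disk \<Longrightarrow> cmod (g z) \<le> M"
proof -
  obtain g r where g: "g holomorphic_on unit_disk" "strict_mono (r :: nat \<Rightarrow> nat)"
      "\<And>z. z \<in> unit_disk \<Longrightarrow> (\<lambda>n. h (r n) z) \<longlonglongrightarrow> g z"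
  proof (rule Montel[of unit_disk "range h" h])
    show "\<exists>B. \<forall>h\<in>range h. \<forall>z\<in>K. cmod (h z) \<le> B" if "K \<subseteq> unit_disk" for K
      using h(2) that by blast
  qed (use h(1) in auto)
  moreover have "cmod (g z) \<le> M" if z: "z \<in> unit_disk" for z
    by (rule tendsto_upperbound[OF tendsto_norm[OF g(3)[OF z]]]) (use h(2)[OF z] in auto)
  ultimately show ?thesis
    by (rule that)
qed

definition interpolating :: "real \<Rightarrow> complex set \<Rightarrow> bool" where
  "interpolating d E \<longleftrightarrow> countable E \<and> (\<forall>F. finite F \<longrightarrow> F \<subseteq> E \<longrightarrow> separated d F)"

lemma interpolating_exhaustion:
  assumes "interpolating d E"
  obtains F :: "nat \<Rightarrow> complex set" where "\<And>n. finite (F n)" "\<And>n. F n \<subseteq> E" "\<And>n. separated d (F n)"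
    "\<And>k. k \<in> E \<Longrightarrow> \<forall>\<^sub>F n in sequentially. k \<in> F n"
proof (cases "E = {}")
  case True
  then show ?thesis
    using assms that[of "\<lambda>_. {}"] by (auto simp: interpolating_def)
next
  case False
  then obtain e :: "nat \<Rightarrow> complex" where e: "range e = E"
    using assms by (metis interpolating_def uncountable_def)
  show ?thesis
  proof (rule that[of "\<lambda>n. e ` {..n}"])
    show "\<forall>\<^sub>F n in sequentially. k \<in> e ` {..n}" if k: "k \<in> E" for k
    proof -
      obtain m where "k = e m"
        using k e by auto
      then show ?thesis
        unfolding eventually_sequentially by (intro exI[of _ m]) auto
    qed
  qed (use assms e in \<open>auto simp: interpolating_def\<close>)
qed

lemma interpolation:
  assumes E: "interpolating d E" and d: "0 < d" and c: "\<And>k. k \<in> E \<Longrightarrow> cmod (c k) \<le> 1"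
  obtains h where "h holomorphic_on unit_disk" "\<And>z. z \<in> unit_disk \<Longrightarrow> cmod (h z) \<le> jones_const d"
    "\<And>k. k \<in> E \<Longrightarrow> h k = c k"
proof -
  obtain F :: "nat \<Rightarrow> complex set" where F: "\<And>n. finite (F n)" "\<And>n. F n \<subseteq> E" "\<And>n. separated d (F n)"
    "\<And>k. k \<in> E \<Longrightarrow> \<forall>\<^sub>F n in sequentially. k \<in> F n"
    by (rule interpolating_exhaustion[OF E]) blast
  have "\<exists>h. h holomorphic_on unit_disk \<and> (\<forall>z\<in>unit_disk. cmod (h z) \<le> jones_const d) \<and> (\<forall>k\<in>F n. h k = c k)" for n
    by (rule finite_interpolation[OF F(1) F(3) d, of n c]) (use c F(2) in blast)+
  then obtain h where h: "\<And>n. h n holomorphic_on unit_disk" "\<And>n z. z \<in> unit_disk \<Longrightarrow> cmod (h n z) \<le> jones_const d"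
    "\<And>n k. k \<in> F n \<Longrightarrow> h n k = c k"
    by metis
  obtain g r where g: "g holomorphic_on unit_disk" and r: "strict_mono (r :: nat \<Rightarrow> nat)"
    and lim: "\<And>z. z \<in> unit_disk \<Longrightarrow> (\<lambda>n. h (r n) z) \<longlonglongrightarrow> g z"
    and b: "\<And>z. z \<in> unit_disk \<Longrightarrow> cmod (g z) \<le> jones_const d"
    by (rule montel_disk[of h, OF h(1,2)]) blast+
  have "g k = c k" if k: "k \<in> E" for k
  proof -
    have "{k} \<subseteq> unit_disk"
      using E k unfolding interpolating_def separated_def by (metis empty_subsetI finite.intros insert_subset)
    moreover have "\<forall>\<^sub>F n in sequentially. k \<in> F (r n)"
      using F(4)[OF k] r eventually_subseq by blast
    then have "\<forall>\<^sub>F n in sequentially. h (r n) k = c k"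
      by eventually_elim (rule h(3))
    then have "(\<lambda>n. h (r n) k) \<longlonglongrightarrow> c k"
      by (rule tendsto_eventually)
    ultimately show ?thesis
      using lim[of k] LIMSEQ_unique by auto
  qed
  with g b that show ?thesis by blast
qed

text \<open>A limit of finite Blaschke products along a subsequence serves as the infinite product:
  zeros, upper bound and lower bound all survive pointwise limits.\<close>

lemma infinite_blaschke:
  assumes E: "interpolating d E" and s: "0 < s" "s \<le> d / 4" "d \<le> 1"
  obtains b where "b holomorphic_on unit_disk" "\<And>z. z \<in> unit_disk \<Longrightarrow> cmod (b z) \<le> 1"
    "\<And>k. k \<in> E \<Longrightarrow> b k = 0"
    "\<And>z. z \<in> unit_disk \<Longrightarrow> (\<And>k. k \<in> E \<Longrightarrow> s \<le> pdist k z) \<Longrightarrow> s * d / 2 \<le> cmod (b z)"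
proof -
  obtain F :: "nat \<Rightarrow> complex set" where F: "\<And>n. finite (F n)" "\<And>n. F n \<subseteq> E" "\<And>n. separated d (F n)"
    "\<And>k. k \<in> E \<Longrightarrow> \<forall>\<^sub>F n in sequentially. k \<in> F n"
    by (rule interpolating_exhaustion[OF E]) blast
  have FD: "F n \<subseteq> unit_disk" for n
    using F(3) by (simp add: separated_def)
  have ED: "E \<subseteq> unit_disk"
  proof
    fix k assume "k \<in> E"
    then have "separated d {k}"
      using E by (simp add: interpolating_def)
    then show "k \<in> unit_disk"
      by (simp add: separated_def)
  qed
  obtain g r where g: "g holomorphic_on unit_disk" and r: "strict_mono (r :: nat \<Rightarrow> nat)"
    and lim: "\<And>z. z \<in> unit_disk \<Longrightarrow> (\<lambda>n. blaschke (F (r n)) z) \<longlonglongrightarrow> g z"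
    and b: "\<And>z. z \<in> unit_disk \<Longrightarrow> cmod (g z) \<le> 1"
    by (rule montel_disk[of "\<lambda>n. blaschke (F n)", OF holomorphic_blaschke[OF FD] norm_blaschke_le_1[OF FD]]) blast+
  show ?thesis
  proof (rule that[OF g b])
    show "g k = 0" if k: "k \<in> E" for k
    proof -
      have "\<forall>\<^sub>F n in sequentially. k \<in> F (r n)"
        using F(4)[OF k] r eventually_subseq by blast
      then have "\<forall>\<^sub>F n in sequentially. blaschke (F (r n)) k = 0"
        by eventually_elim (rule blaschke_zero[OF F(1)])
      then have "(\<lambda>n. blaschke (F (r n)) k) \<longlonglongrightarrow> 0"
        by (rule tendsto_eventually)
      then show ?thesis
        using lim[of k] k ED LIMSEQ_unique by blast
    qed
    show "s * d / 2 \<le> cmod (g z)" if z: "z \<in> unit_disk" and far: "\<And>k. k \<in> E \<Longrightarrow> s \<le> pdist k z" for z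
    proof (rule tendsto_lowerbound[OF tendsto_norm[OF lim[OF z]]])
      show "\<forall>\<^sub>F n in sequentially. s * d / 2 \<le> cmod (blaschke (F (r n)) z)"
        by (intro always_eventually allI blaschke_lower_bound[OF F(1,3) s z]) (use far F(2) in blast)
    qed simp
  qed
qed

section \<open>Limits along Hoffman maps\<close>

definition taylor_coeff :: "nat \<Rightarrow> (complex \<Rightarrow> complex) \<Rightarrow> complex" where
  "taylor_coeff n F = (deriv ^^ n) F 0 / fact n"

lemma taylor_coeff_bound:
  assumes F: "F holomorphic_on unit_disk" and b: "\<And>z. z \<in> unit_disk \<Longrightarrow> cmod (F z) \<le> 1"
  shows "cmod (taylor_coeff n F) \<le> 1"
proof -
  have "cmod (taylor_coeff n F) * r ^ n \<le> 1" if r: "0 < r" "r < 1" for r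
  proof -
    have sub: "cball 0 r \<subseteq> (unit_disk :: complex set)"
      using r by auto
    have "norm ((deriv ^^ n) F 0) \<le> fact n * 1 / r ^ n"
    proof (rule Cauchy_inequality)
      show "F holomorphic_on ball 0 r" "continuous_on (cball 0 r) F"
        using holomorphic_on_subset[OF F order_trans[OF ball_subset_cball sub]]
          holomorphic_on_imp_continuous_on[OF holomorphic_on_subset[OF F sub]]
        by auto
      show "norm (F x) \<le> 1" if "norm (0 - x) = r" for x
        using that r by (intro b) simp
    qed (use r in simp)
    then show ?thesis
      using r by (simp add: taylor_coeff_def norm_divide field_simps)
  qed
  then have ev: "\<forall>\<^sub>F r in at_left 1. cmod (taylor_coeff n F) * r ^ n \<le> 1"
    using eventually_at_left_real[of 0 1] by (auto elim: eventually_mono)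
  have "((\<lambda>r::real. cmod (taylor_coeff n F) * r ^ n) \<longlongrightarrow> cmod (taylor_coeff n F) * 1 ^ n) (at_left 1)"
    by (intro tendsto_intros)
  from tendsto_upperbound[OF this ev] show ?thesis
    by simp
qed

lemma taylor_remainder:
  assumes F: "F holomorphic_on unit_disk" and b: "\<And>z. z \<in> unit_disk \<Longrightarrow> cmod (F z) \<le> 1"
    and w: "w \<in> unit_disk"
  shows "cmod (F w - (\<Sum>n<N. taylor_coeff n F * w ^ n)) \<le> cmod w ^ N / (1 - cmod w)"
proof -
  let ?a = "\<lambda>n. taylor_coeff n F * w ^ n"
  have s: "?a sums F w"
    using holomorphic_power_series[OF F w] by (simp add: taylor_coeff_def)
  have bn: "norm (?a (n + N)) \<le> cmod w ^ N * cmod w ^ n" for n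
    using mult_right_mono[OF taylor_coeff_bound[OF F b, of "n + N"], of "cmod w ^ (n + N)"]
    by (simp add: norm_mult norm_power power_add mult.commute)
  have sg: "(\<lambda>n. cmod w ^ N * cmod w ^ n) sums (cmod w ^ N * (1 / (1 - cmod w)))"
    using w by (intro sums_mult geometric_sums) simp
  have "F w - (\<Sum>n<N. ?a n) = (\<Sum>n. ?a (n + N))"
    using suminf_minus_initial_segment[of ?a N] s by (simp add: sums_iff)
  also have "norm \<dots> \<le> (\<Sum>n. cmod w ^ N * cmod w ^ n)"
    by (rule norm_suminf_le[OF bn sums_summable[OF sg]])
  also have "\<dots> = cmod w ^ N / (1 - cmod w)"
    using sums_unique[OF sg] by simp
  finally show ?thesis .
qed

lemma cauchy_filter_limit:
  fixes u :: "'a \<Rightarrow> complex"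
  assumes F: "F \<noteq> bot" and c: "\<And>e. 0 < e \<Longrightarrow> \<exists>l. \<forall>\<^sub>F z in F. dist (u z) l < e"
  shows "\<exists>l. (u \<longlongrightarrow> l) F"
proof -
  have "cauchy_filter (filtermap u F)"
    unfolding cauchy_filter_metric
  proof (intro allI impI)
    fix e :: real assume "0 < e"
    then obtain l where l: "\<forall>\<^sub>F z in F. dist (u z) l < e / 2"
      using c[of "e / 2"] by auto
    then show "\<exists>P. eventually P (filtermap u F) \<and> (\<forall>x y. P x \<and> P y \<longrightarrow> dist x y < e)"
      by (intro exI[of _ "\<lambda>x. dist x l < e / 2"]) (auto simp: eventually_filtermap intro: dist_triangle_half_l)
  qed
  then show ?thesis
    using F complete_UNIV[where 'a = complex]
    unfolding complete_uniform filterlim_def by (auto simp: filtermap_bot_iff)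
qed

text \<open>One has \<open>disk_aut k w = disk_aut z w'\<close>, where
  \<open>w' = disk_aut z (disk_aut k w) = disk_aut y (- c * w)\<close> and |y| is
  \<open>pdist z k\<close>. For small y this automorphism is close to the identity, so w' is close
  to w, and Schwarz-Pick for \<open>f \<circ> disk_aut z\<close> finishes.\<close>

lemma pull_back_lipschitz:
  assumes f: "f holomorphic_on unit_disk" and b: "\<And>z. z \<in> unit_disk \<Longrightarrow> cmod (f z) \<le> 1"
    and z: "z \<in> unit_disk" and k: "k \<in> unit_disk" and w: "w \<in> unit_disk" and zk: "pdist z k \<le> 1 / 2"
  shows "cmod (f (disk_aut z w) - f (disk_aut k w)) \<le> 24 / (1 - cmod w) * pdist z k"
proof -
  define y where "y = disk_aut z k"
  have y: "y \<in> unit_disk" "cmod y = pdist z k" "disk_aut z y = k"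
    using z k disk_aut_in_disk disk_aut_involution by (auto simp: y_def pdist_def)
  define c where "c = aut_phase z y"
  have c: "cmod c = 1"
    using norm_aut_phase[OF z y(1)] by (simp add: c_def)
  define w' where "w' = disk_aut y (- c * w)"
  have cw: "- c * w \<in> unit_disk"
    using w c by (simp add: norm_mult)
  have w': "w' \<in> unit_disk"
    unfolding w'_def by (rule disk_aut_in_disk[OF y(1) cw])
  have kw: "disk_aut k w \<in> unit_disk"
    by (rule disk_aut_in_disk[OF k w])
  have "disk_aut y (disk_aut z (disk_aut k w)) = - c * w"
    using disk_aut_compose[OF z y(1) kw] disk_aut_involution[OF k w] by (simp add: c_def y(3))
  then have "disk_aut z (disk_aut k w) = w'"
    unfolding w'_def using disk_aut_involution[OF y(1) disk_aut_in_disk[OF z kw]] by simp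
  then have fk: "f (disk_aut k w) = f (disk_aut z w')"
    using disk_aut_involution[OF z kw] by simp
  have half: "cmod y \<le> 1 / 2"
    using y zk by simp
  have n1: "1 / 2 \<le> cmod (1 - cnj y * x)" if "x \<in> unit_disk" for x
    using norm_one_minus_cnj_mult_ge(1)[OF y(1) that] half by linarith
  have c1: "cmod (c - 1) \<le> 4 * cmod y"
  proof -
    have nz: "1 - cnj y * z \<noteq> 0"
      using n1[OF z] by auto
    have "c - 1 = (cnj y * z - y * cnj z) / (1 - cnj y * z)"
      unfolding c_def aut_phase_def using nz by (simp add: field_simps)
    moreover have "cmod (cnj y * z - y * cnj z) / cmod (1 - cnj y * z) \<le> 2 * cmod y / (1 / 2)"
    proof -
      have "cmod (cnj y * z) \<le> cmod y" "cmod (y * cnj z) \<le> cmod y"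
        using z by (auto simp: norm_mult intro!: mult_left_le)
      then have "cmod (cnj y * z - y * cnj z) \<le> 2 * cmod y"
        using norm_triangle_ineq4[of "cnj y * z" "y * cnj z"] by linarith
      then show ?thesis
        using n1[OF z] by (intro frac_le) auto
    qed
    ultimately have "cmod (c - 1) \<le> 2 * cmod y / (1 / 2)"
      by (simp only: norm_divide)
    then show ?thesis by simp
  qed
  have "w' - w = (y + (c - 1) * w + cnj y * (- c * w) * w) / (1 - cnj y * (- c * w))"
  proof -
    have "1 - cnj y * (- c * w) \<noteq> 0"
      using n1[OF cw] by auto
    then show ?thesis
      unfolding w'_def disk_aut_def by (simp add: field_simps)
  qed
  \<comment> \<open>6 is 1 + 4 + 1: for y, for the deviation of the phase c from 1, and for the
    product term; the denominator is at least 1/2.\<close>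
  moreover have "cmod (y + (c - 1) * w + cnj y * (- c * w) * w) / cmod (1 - cnj y * (- c * w)) \<le> 6 * cmod y / (1 / 2)"
  proof -
    have "cmod ((c - 1) * w) \<le> 4 * cmod y * 1"
      unfolding norm_mult using c1 w by (intro mult_mono) auto
    moreover have "cmod (cnj y * (- c * w) * w) \<le> cmod y * (1 * 1) * 1"
      unfolding norm_mult using c w by (intro mult_mono) auto
    ultimately have "cmod (y + (c - 1) * w + cnj y * (- c * w) * w) \<le> 6 * cmod y"
      using norm_triangle_ineq[of "y + (c - 1) * w" "cnj y * (- c * w) * w"] norm_triangle_ineq[of y "(c - 1) * w"]
      by simp
    then show ?thesis
      using n1[OF cw] by (intro frac_le) auto
  qed
  ultimately have "cmod (w' - w) \<le> 6 * cmod y / (1 / 2)"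
    by (simp only: norm_divide)
  then have d: "dist w w' \<le> 12 * pdist z k"
    by (simp add: dist_norm norm_minus_commute y)
  have "cmod ((\<lambda>x. f (disk_aut z x)) w - (\<lambda>x. f (disk_aut z x)) w') \<le> 2 * 1 * pdist w w'"
    by (rule schwarz_pick_bound[OF holomorphic_comp_disk_aut[OF z f] _ w w'])
      (use b disk_aut_in_disk[OF z] in auto)
  also have "\<dots> \<le> 2 * (dist w w' / (1 - cmod w))"
    using pdist_le_euclidean[OF w w'] by simp
  also have "\<dots> \<le> 2 * (12 * pdist z k / (1 - cmod w))"
    using d w by (intro mult_left_mono divide_right_mono) auto
  finally show ?thesis
    by (simp add: fk)
qed

text \<open>The zeros of \<open>f - l\<close> near \<open>P\<close> occur in clusters of pseudohyperbolic diameter \<open>O(r)\<close>, separated by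
  annuli of outer radius \<open>r1\<close>; one zero from each cluster gives an interpolating set whose
  constant does not depend on \<open>r\<close>.\<close>

lemma cluster_interpolating:
  assumes f: "f holomorphic_on unit_disk" and b: "\<And>z. z \<in> unit_disk \<Longrightarrow> cmod (f z - l) \<le> 2"
    and nc: "\<not> f constant_on unit_disk"
    and P: "P \<subseteq> unit_disk" and r: "0 < r" "21 * r \<le> r1" "r1 < 1" and et: "0 < et"
    and annulus: "\<And>z w. z \<in> P \<Longrightarrow> r \<le> cmod w \<Longrightarrow> cmod w \<le> r1 \<Longrightarrow> f (disk_aut z w) \<noteq> l"
    and circle: "\<And>z w. z \<in> P \<Longrightarrow> cmod w = r1 \<Longrightarrow> et \<le> cmod (f (disk_aut z w) - l)"
    and zero: "\<And>z. z \<in> P \<Longrightarrow> \<exists>w. cmod w < r \<and> f (disk_aut z w) = l"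
  obtains E where "E \<subseteq> unit_disk" "interpolating (et / 2) E" "\<And>z. z \<in> P \<Longrightarrow> \<exists>e\<in>E. pdist z e \<le> 7 * r"
proof -
  define Z where "Z = {y \<in> unit_disk. f y = l \<and> (\<exists>z\<in>P. pdist z y < r)}"
  have ZD: "Z \<subseteq> unit_disk" by (auto simp: Z_def)
  \<comment> \<open>The annulus contains no zero, so a zero within r1 of z is within r of
    it.\<close>
  have gap: "pdist z y < r" if z: "z \<in> P" and y: "y \<in> unit_disk" "f y = l" "pdist z y \<le> r1" for z y
  proof (rule ccontr)
    assume "\<not> pdist z y < r"
    then have "f (disk_aut z (disk_aut z y)) \<noteq> l"
      using annulus[OF z, of "disk_aut z y"] y by (simp add: pdist_def)
    then show False
      using y disk_aut_involution[of z y] z P by auto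
  qed
  \<comment> \<open>\<open>r + 2 * (10 * r) = 21 * r\<close> stays within r1; once the gap brings y
    back to within r of z, \<open>r + 2 * r = 3 * r\<close>.\<close>
  have close: "pdist x y < 3 * r" if x: "x \<in> Z" and y: "y \<in> Z" and xy: "pdist x y < 10 * r" for x y
  proof -
    obtain z where z: "z \<in> P" "pdist z x < r"
      using x by (auto simp: Z_def)
    have D: "x \<in> unit_disk" "y \<in> unit_disk" "z \<in> unit_disk"
      using x y ZD z P by auto
    have "pdist z y \<le> pdist z x + 2 * pdist x y"
      by (rule pdist_triangle_weak) (use D in auto)
    then have "pdist z y \<le> r1"
      using z xy r by linarith
    then have "pdist z y < r"
      using gap[OF z(1) D(2)] y by (auto simp: Z_def)
    then show ?thesis
      using pdist_triangle_weak[OF D(1,3,2)] z pdist_commute[of x z] by linarith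
  qed
  \<comment> \<open>\<open>3 * r + 2 * (3 * r) = 9 * r\<close> is below \<open>10 * r\<close>, so
    \<open>close\<close> applies. Distance below \<open>3 * r\<close> is thus an equivalence
    relation on the zeros in spite of the weak triangle inequality.\<close>
  have trans: "pdist x y < 3 * r" if "x \<in> Z" "y \<in> Z" "w \<in> Z" "pdist x w < 3 * r" "pdist w y < 3 * r" for x y w
  proof (rule close[OF that(1,2)])
    have "pdist x y \<le> pdist x w + 2 * pdist w y"
      by (rule pdist_triangle_weak) (use that ZD in auto)
    then show "pdist x y < 10 * r"
      using that(4,5) r by linarith
  qed
  define cl where "cl x = {y \<in> Z. pdist x y < 3 * r}" for x
  have cl_eq: "cl x = cl y" if "x \<in> Z" "y \<in> Z" "pdist x y < 3 * r" for x y
  proof -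
    have "pdist y x < 3 * r"
      using that(3) by (simp add: pdist_commute)
    then have "pdist x w < 3 * r \<longleftrightarrow> pdist y w < 3 * r" if "w \<in> Z" for w
      using trans[of x w y] trans[of y w x] \<open>x \<in> Z\<close> \<open>y \<in> Z\<close> \<open>pdist x y < 3 * r\<close> that by blast
    then show ?thesis
      unfolding cl_def by blast
  qed
  \<comment> \<open>The choice depends on x only through the set \<open>cl x\<close>, so all members
    of a cluster get the same representative.\<close>
  define rep where "rep x = (SOME y. y \<in> cl x)" for x
  have rep: "rep x \<in> Z" "pdist x (rep x) < 3 * r" if "x \<in> Z" for x
  proof -
    have "x \<in> cl x"
      using that r by (simp add: cl_def pdist_def)
    then have "rep x \<in> cl x"
      unfolding rep_def by (rule someI)
    then show "rep x \<in> Z" "pdist x (rep x) < 3 * r"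
      by (auto simp: cl_def)
  qed
  define E where "E = rep ` Z"
  have EZ: "E \<subseteq> Z"
    using rep by (auto simp: E_def)
  have E_sep: "x = y" if xyE: "x \<in> E" "y \<in> E" "pdist x y < 10 * r" for x y
  proof -
    obtain x' y' where xy: "x' \<in> Z" "y' \<in> Z" "x = rep x'" "y = rep y'"
      using xyE(1,2) by (auto simp: E_def)
    have "cl x' = cl x" "cl x = cl y" "cl y' = cl y"
      using cl_eq rep xy close[of x y] that by (auto simp: xy)
    then show ?thesis
      unfolding xy rep_def by simp
  qed
  have "countable {z \<in> unit_disk. f z - l = 0}"
  proof (rule holomorphic_countable_zeros)
    show "\<not> (\<lambda>z. f z - l) constant_on unit_disk"
      using nc unfolding constant_on_def by (metis diff_eq_eq)
    show "fsigma unit_disk"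
    proof -
      obtain F :: "nat \<Rightarrow> complex set" where "\<And>n. compact (F n)" "\<Union>(range F) = unit_disk"
        by (rule open_Union_compact_subsets[OF open_ball[of "0::complex" 1]]) blast
      then show ?thesis
        unfolding fsigma_Union_compact by blast
    qed
  qed (use f in \<open>auto intro: holomorphic_intros\<close>)
  then have "countable E"
    by (rule countable_subset[rotated]) (use EZ in \<open>auto simp: Z_def\<close>)
  moreover have "separated (et / 2) F" if F: "finite F" "F \<subseteq> E" for F
    unfolding separated_def
  proof (intro conjI ballI)
    show FD: "F \<subseteq> unit_disk"
      using F EZ ZD by auto
    fix j assume j: "j \<in> F"
    then have "j \<in> Z"
      using F EZ by auto
    then obtain z where z: "z \<in> P" "pdist z j < r"
      by (auto simp: Z_def)
    have zD: "z \<in> unit_disk" using z P by auto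
    have jD: "j \<in> unit_disk" using \<open>j \<in> Z\<close> ZD by auto
    define K where "K = F - {j}"
    have K: "finite K" "K \<subseteq> unit_disk"
      using F FD by (auto simp: K_def)
    define C where "C w = blaschke K (disk_aut z w)" for w
    \<comment> \<open>A zero of C within r1 would be a representative other than j within r of z,
      hence in the cluster of j.\<close>
    have Cnz: "C w \<noteq> 0" if w: "w \<in> cball 0 r1" for w
    proof
      assume "C w = 0"
      have wD: "w \<in> unit_disk" using w r by auto
      obtain k where k: "k \<in> K" "disk_aut k (disk_aut z w) = 0"
        using \<open>C w = 0\<close> K(1) by (auto simp: C_def blaschke_def)
      have kD: "k \<in> unit_disk" using k K by auto
      have "disk_aut z w = k"
        using k pdist_eq_0_iff[OF kD disk_aut_in_disk[OF zD wD]] by (simp add: pdist_def)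
      then have "pdist z k = cmod w"
        using disk_aut_involution[OF zD wD] by (simp add: pdist_def)
      moreover have "k \<in> Z"
        using k F EZ by (auto simp: K_def)
      ultimately have "pdist z k < r"
        using gap[OF z(1) kD] w by (auto simp: Z_def)
      then have "pdist j k < 10 * r"
        using pdist_triangle_weak[OF jD zD kD] z r pdist_commute[of j z] by linarith
      then show False
        using E_sep[of j k] j k F by (auto simp: K_def)
    qed
    have r1: "0 < r1" using r by linarith
    have sub: "cball 0 r1 \<subseteq> (unit_disk :: complex set)" using r by auto
    have holC: "C holomorphic_on unit_disk"
      unfolding C_def[abs_def] by (rule holomorphic_comp_disk_aut[OF zD holomorphic_blaschke[OF K(2)]])
    \<comment> \<open>Dividing the zeros K out of \<open>f - l\<close>, which is bounded by 2, gives
      \<open>et \<le> 2 * |C w|\<close> on the circle. The maximum principle for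
      \<open>1 / C\<close> then carries the bound inside.\<close>
    have bound: "et / 2 \<le> cmod (C w)" if w: "cmod w = r1" for w
    proof -
      have wD: "w \<in> unit_disk" using w r by auto
      have "cmod ((\<lambda>x. f x - l) (disk_aut z w)) \<le> 2 * (\<Prod>k\<in>K. pdist k (disk_aut z w))"
      proof (rule zero_factor_bound[OF K])
        show "f k - l = 0" if "k \<in> K" for k
          using that F EZ by (auto simp: K_def Z_def)
      qed (use f b disk_aut_in_disk[OF zD wD] in \<open>auto intro: holomorphic_intros\<close>)
      then show ?thesis
        using circle[OF z(1) w] by (simp add: C_def norm_blaschke)
    qed
    have "norm (inverse (C (disk_aut z j))) \<le> 2 / et"
    proof (rule maximum_modulus_frontier[of "\<lambda>w. inverse (C w)" "cball 0 r1"])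
      show "(\<lambda>w. inverse (C w)) holomorphic_on interior (cball 0 r1)"
        using Cnz sub by (intro holomorphic_intros holomorphic_on_subset[OF holC]) auto
      show "continuous_on (closure (cball 0 r1)) (\<lambda>w. inverse (C w))"
        using Cnz sub by (intro continuous_intros holomorphic_on_imp_continuous_on holomorphic_on_subset[OF holC]) auto
      show "norm (inverse (C w)) \<le> 2 / et" if "w \<in> frontier (cball 0 r1)" for w
        using le_imp_inverse_le[OF bound, of w] that et by (simp add: norm_inverse)
      show "disk_aut z j \<in> cball 0 r1"
        using z r by (simp add: pdist_def)
    qed simp
    then have "inverse (cmod (C (disk_aut z j))) \<le> inverse (et / 2)"
      by (simp add: norm_inverse)
    moreover have "0 < cmod (C (disk_aut z j))"
      using Cnz[of "disk_aut z j"] z r by (simp add: pdist_def)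
    ultimately have "et / 2 \<le> cmod (C (disk_aut z j))"
      by (rule inverse_le_imp_le)
    then show "et / 2 \<le> (\<Prod>k\<in>F - {j}. pdist k j)"
      by (simp add: C_def disk_aut_involution[OF zD jD] norm_blaschke K_def)
  qed
  ultimately have "interpolating (et / 2) E"
    by (simp add: interpolating_def)
  moreover have "\<exists>e\<in>E. pdist z e \<le> 7 * r" if z: "z \<in> P" for z
  proof -
    have zD: "z \<in> unit_disk" using z P by auto
    obtain w where w: "cmod w < r" "f (disk_aut z w) = l"
      using zero[OF z] by auto
    have wD: "w \<in> unit_disk" using w r by auto
    define y where "y = disk_aut z w"
    have "pdist z y < r"
      using w disk_aut_involution[OF zD wD] by (simp add: y_def pdist_def)
    moreover have "y \<in> Z"
      using w z calculation disk_aut_in_disk[OF zD wD] unfolding Z_def y_def by blast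
    ultimately have y: "y \<in> Z" "pdist z y < r" by auto
    have "pdist z (rep y) \<le> pdist z y + 2 * pdist y (rep y)"
      by (rule pdist_triangle_weak) (use zD subsetD[OF ZD y(1)] subsetD[OF ZD rep(1)[OF y(1)]] in auto)
    also have "\<dots> \<le> 7 * r"
      using y rep(2)[OF y(1)] by linarith
    finally show ?thesis
      using y by (auto simp: E_def)
  qed
  ultimately show ?thesis
    using that EZ ZD by (meson order_trans)
qed

text \<open>Let \<open>a\<^sub>N\<close> be the first Taylor coefficient of positive order of \<open>f \<circ> \<phi>\<^sub>z\<close> at \<open>0\<close> that does not
  tend to \<open>0\<close>. Wherever \<open>a\<^sub>N\<close> is large, \<open>f - l\<close> has zeros near \<open>z\<close>, and interpolation on representatives
  of these zeros gives a bounded analytic \<open>h\<close> with \<open>h k = f (\<phi>\<^sub>k w)\<close> there. The Blaschke product of the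
  representatives is small along the filter, so \<open>z\<close> eventually is close to one of them, and
  \<open>f (\<phi>\<^sub>z w)\<close> is close to \<open>h z\<close>, which converges.\<close>

theorem hoffman_limit_bounded:
  fixes Fm :: "complex filter"
  assumes Fm: "Fm \<noteq> bot" "\<forall>\<^sub>F z in Fm. z \<in> unit_disk"
    and lim: "\<And>g C. g holomorphic_on unit_disk \<Longrightarrow> (\<And>z. z \<in> unit_disk \<Longrightarrow> cmod (g z) \<le> C) \<Longrightarrow> \<exists>l. (g \<longlongrightarrow> l) Fm"
    and f: "f holomorphic_on unit_disk" and b: "\<And>z. z \<in> unit_disk \<Longrightarrow> cmod (f z) \<le> 1"
    and w: "w \<in> unit_disk"
  shows "\<exists>l. ((\<lambda>z. f (disk_aut z w)) \<longlongrightarrow> l) Fm"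
proof -
  obtain l where l: "(f \<longlongrightarrow> l) Fm"
    using lim[OF f b] by auto
  define a where "a n z = taylor_coeff n (\<lambda>x. f (disk_aut z x))" for n z
  have hol: "(\<lambda>x. f (disk_aut z x)) holomorphic_on unit_disk" if "z \<in> unit_disk" for z
    by (rule holomorphic_comp_disk_aut[OF that f])
  have bd: "cmod (f (disk_aut z x)) \<le> 1" if "z \<in> unit_disk" "x \<in> unit_disk" for z x
    using b disk_aut_in_disk[OF that] by simp
  have a1: "cmod (a n z) \<le> 1" if "z \<in> unit_disk" for n z
    unfolding a_def by (rule taylor_coeff_bound[OF hol bd]) (use that in auto)
  have a0: "a 0 z = f z" for z
    by (simp add: a_def taylor_coeff_def)
  have rem: "cmod (f (disk_aut z x) - (\<Sum>n<N. a n z * x ^ n)) \<le> cmod x ^ N / (1 - cmod x)"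
    if "z \<in> unit_disk" "x \<in> unit_disk" for z x N
    unfolding a_def by (rule taylor_remainder[OF hol bd]) (use that in auto)
  show ?thesis
  proof (cases "\<forall>n\<ge>1. (a n \<longlongrightarrow> 0) Fm")
    case True
    \<comment> \<open>If all coefficients of positive order vanish in the limit, the functions
      \<open>f \<circ> disk_aut z\<close> tend to the constant l.\<close>
    have "((\<lambda>z. f (disk_aut z w)) \<longlongrightarrow> l) Fm"
    proof (rule tendstoI)
      fix e :: real assume e: "0 < e"
      have "(\<lambda>N. cmod w ^ N / (1 - cmod w)) \<longlonglongrightarrow> 0 / (1 - cmod w)"
        using w by (intro tendsto_intros LIMSEQ_power_zero) auto
      then have "\<forall>\<^sub>F N in sequentially. cmod w ^ N / (1 - cmod w) < e / 2"
        using e by (intro order_tendstoD) auto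
      then obtain N0 where "\<forall>n\<ge>N0. cmod w ^ n / (1 - cmod w) < e / 2"
        by (auto simp: eventually_sequentially)
      then obtain N where N: "cmod w ^ Suc N / (1 - cmod w) < e / 2"
        by (meson le_SucI order_refl)
      have "((\<lambda>z. \<Sum>n<Suc N. a n z * w ^ n) \<longlongrightarrow> (\<Sum>n<Suc N. (if n = 0 then l else 0) * w ^ n)) Fm"
      proof (intro tendsto_sum tendsto_mult tendsto_const)
        show "((\<lambda>z. a n z) \<longlongrightarrow> (if n = 0 then l else 0)) Fm" for n
          using True l by (cases "n = 0") (auto simp: a0)
      qed
      also have "(\<Sum>n<Suc N. (if n = 0 then l else 0) * w ^ n) = l"
        by (subst sum.lessThan_Suc_shift) simp
      finally have "\<forall>\<^sub>F z in Fm. dist (\<Sum>n<Suc N. a n z * w ^ n) l < e / 2"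
        using e by (intro tendstoD) auto
      with Fm(2) show "\<forall>\<^sub>F z in Fm. dist (f (disk_aut z w)) l < e"
      proof eventually_elim
        case (elim z)
        have "dist (f (disk_aut z w)) (\<Sum>n<Suc N. a n z * w ^ n) < e / 2"
          using rem[OF elim(1) w, of "Suc N"] N unfolding dist_norm by linarith
        then show ?case
          using elim(2) dist_triangle[of "f (disk_aut z w)" l "\<Sum>n<Suc N. a n z * w ^ n"] by linarith
      qed
    qed
    then show ?thesis by blast
  next
    case False
    define N where "N = (LEAST n. n \<ge> 1 \<and> \<not> (a n \<longlongrightarrow> 0) Fm)"
    have "N \<ge> 1 \<and> \<not> (a N \<longlongrightarrow> 0) Fm"
      unfolding N_def by (rule LeastI_ex) (use False in blast)
    then have N: "N \<ge> 1" "\<not> (a N \<longlongrightarrow> 0) Fm" by auto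
    have small: "(a n \<longlongrightarrow> 0) Fm" if "1 \<le> n" "n < N" for n
      using not_less_Least[of n "\<lambda>n. n \<ge> 1 \<and> \<not> (a n \<longlongrightarrow> 0) Fm"] that by (auto simp: N_def)
    \<comment> \<open>Only frequently, not eventually, since the coefficient need not converge along
      the filter at this stage. The Blaschke product below turns this into an eventual
      statement.\<close>
    obtain d0 where d0: "0 < d0" and fr: "\<exists>\<^sub>F z in Fm. d0 \<le> cmod (a N z)"
      using N(2) unfolding tendsto_iff frequently_def by (auto simp: not_le)
    have "\<exists>\<^sub>F z in Fm. d0 \<le> cmod (a N z) \<and> z \<in> unit_disk"
      using fr Fm(2) by (rule frequently_eventually_frequently)
    then obtain z where "d0 \<le> cmod (a N z)" "z \<in> unit_disk"
      by (auto dest!: frequently_ex)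
    then have d01: "d0 \<le> 1"
      using a1[of z N] by linarith
    have l1: "cmod l \<le> 1"
      by (rule tendsto_upperbound[OF tendsto_norm[OF l] _ Fm(1)]) (use Fm(2) b in \<open>auto elim: eventually_mono\<close>)
    have b2: "cmod (f z - l) \<le> 2" if "z \<in> unit_disk" for z
      using b[OF that] l1 norm_triangle_ineq4[of "f z" l] by linarith
    \<comment> \<open>Makes the Taylor remainder \<open>2 * |x| * |x| ^ N\<close> at most
      \<open>d0 / 4 * |x| ^ N\<close>.\<close>
    define r1 where "r1 = d0 / 8"
    have r1: "0 < r1" "r1 \<le> 1 / 8"
      using d0 d01 by (auto simp: r1_def)
    \<comment> \<open>The lower bound of \<open>|f - l|\<close> on the circle of radius r1. Neither
      it nor d and M derived from it depend on e or r, which allows s and r to be chosen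
      afterwards.\<close>
    define et where "et = d0 / 2 * r1 ^ N"
    have et: "0 < et"
      using d0 r1 by (simp add: et_def)
    define d where "d = et / 2"
    have d: "0 < d"
      using et by (simp add: d_def)
    have d1: "d \<le> 1"
    proof -
      have "d0 / 2 * r1 ^ N \<le> 1 / 2 * 1"
        using d0 d01 r1 by (intro mult_mono power_le_one) auto
      then show ?thesis by (simp add: d_def et_def)
    qed
    define M where "M = jones_const d"
    have M: "0 \<le> M"
      using d by (simp add: M_def jones_const_def)
    define L where "L = 24 / (1 - cmod w)"
    have L: "0 \<le> L"
      using w by (simp add: L_def)
    show ?thesis
    proof (rule cauchy_filter_limit[OF Fm(1)])
      fix e :: real assume e: "0 < e"
      \<comment> \<open>The allowed distance from z to a representative: small enough for
        \<open>infinite_blaschke\<close>, for \<open>pull_back_lipschitz\<close> and for the final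
        estimate \<open>(L + 2 * M) * s \<le> e / 2\<close>.\<close>
      define s where "s = min (d / 4) (min (1 / 2) (e / (2 * (L + 2 * M + 1))))"
      have s: "0 < s" "s \<le> d / 4" "s \<le> 1 / 2"
      proof -
        show "0 < s"
          using d e L M by (auto simp: s_def)
        show "s \<le> d / 4"
          unfolding s_def by (rule min.cobounded1)
        show "s \<le> 1 / 2"
          unfolding s_def by (rule min.coboundedI2, rule min.cobounded1)
      qed
      have "s \<le> e / (2 * (L + 2 * M + 1))"
        unfolding s_def by (rule min.coboundedI2, rule min.cobounded2)
      then have "s * (2 * (L + 2 * M + 1)) \<le> e"
        using L M by (simp add: field_simps)
      then have sLM: "(L + 2 * M) * s \<le> e / 2"
        using s by (simp add: algebra_simps)
      \<comment> \<open>Points of P will be within \<open>7 * r\<close> of a representative, so by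
        Schwarz-Pick the Blaschke product is at most \<open>14 * r \<le> s * d / 4\<close> on
        P.\<close>
      define r where "r = min (r1 / 21) (s * d / 56)"
      have r: "0 < r" "21 * r \<le> r1" "14 * r \<le> s * d / 4"
      proof -
        show "0 < r"
          using r1 s d by (auto simp: r_def)
        have "r \<le> r1 / 21"
          unfolding r_def by (rule min.cobounded1)
        then show "21 * r \<le> r1" by simp
        have "r \<le> s * d / 56"
          unfolding r_def by (rule min.cobounded2)
        then show "14 * r \<le> s * d / 4" by simp
      qed
      \<comment> \<open>N terms of size kap, namely the \<open>N - 1\<close> lower coefficients and
        \<open>f z - l\<close>, add up to \<open>d0 * r ^ N / 16\<close>.\<close>
      define kap where "kap = d0 * r ^ N / (16 * real N)"
      have kap: "0 < kap" "real N * kap = d0 * r ^ N / 16" "kap \<le> d0 * r ^ N / 16"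
        using d0 r N by (auto simp: kap_def field_simps)
      define P where "P = {z \<in> unit_disk. d0 \<le> cmod (a N z) \<and> (\<forall>n\<in>{1..<N}. cmod (a n z) \<le> kap) \<and> cmod (f z - l) \<le> kap}"
      have freqP: "\<exists>\<^sub>F z in Fm. z \<in> P"
      proof -
        have "\<forall>\<^sub>F z in Fm. \<forall>n\<in>{1..<N}. cmod (a n z) \<le> kap"
        proof (rule eventually_ball_finite)
          show "\<forall>n\<in>{1..<N}. \<forall>\<^sub>F z in Fm. cmod (a n z) \<le> kap"
          proof
            fix n assume "n \<in> {1..<N}"
            then have "\<forall>\<^sub>F z in Fm. dist (a n z) 0 < kap"
              using small[of n] kap by (intro tendstoD) auto
            then show "\<forall>\<^sub>F z in Fm. cmod (a n z) \<le> kap"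
              by eventually_elim simp
          qed
        qed simp
        moreover have "\<forall>\<^sub>F z in Fm. dist (f z) l < kap"
          using l kap by (intro tendstoD) auto
        ultimately have "\<forall>\<^sub>F z in Fm. z \<in> unit_disk \<and> (\<forall>n\<in>{1..<N}. cmod (a n z) \<le> kap) \<and> cmod (f z - l) \<le> kap"
          using Fm(2) by eventually_elim (auto simp: dist_norm)
        from frequently_eventually_frequently[OF fr this] show ?thesis
          by (rule frequently_elim1) (auto simp: P_def)
      qed
      have PD: "P \<subseteq> unit_disk" by (auto simp: P_def)
      \<comment> \<open>The N-th Taylor term dominates on the annulus: of
        \<open>d0 * |x| ^ N\<close> the remainder costs a quarter and the lower terms a
        sixteenth.\<close>
      have lower: "d0 / 2 * cmod x ^ N \<le> cmod (f (disk_aut z x) - l)"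
        if z: "z \<in> P" and x: "r \<le> cmod x" "cmod x \<le> r1" for z x
      proof -
        have zD: "z \<in> unit_disk" using z PD by auto
        have xD: "x \<in> unit_disk" using x r1 by auto
        let ?S = "\<Sum>n\<in>{1..<N}. a n z * x ^ n"
        have split: "(\<Sum>n<Suc N. a n z * x ^ n) = f z + ?S + a N z * x ^ N"
          using N by (simp add: sum.lessThan_Suc atLeast0LessThan[symmetric] sum.atLeast_Suc_lessThan a0)
        have "cmod ?S \<le> (\<Sum>n\<in>{1..<N}. kap)"
        proof (rule sum_norm_le)
          fix n assume n: "n \<in> {1..<N}"
          have "cmod (a n z * x ^ n) \<le> kap * 1"
            unfolding norm_mult norm_power using n z xD kap
            by (intro mult_mono power_le_one) (auto simp: P_def)
          then show "cmod (a n z * x ^ n) \<le> kap" by simp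
        qed
        also have "\<dots> = (real N - 1) * kap"
          using N by (simp add: of_nat_diff)
        finally have S: "cmod ?S \<le> (real N - 1) * kap" .
        have "cmod (f (disk_aut z x) - (\<Sum>n<Suc N. a n z * x ^ n)) \<le> cmod x ^ Suc N / (1 - cmod x)"
          by (rule rem[OF zD xD])
        also have "\<dots> \<le> cmod x ^ Suc N / (1 / 2)"
          using x r1 by (intro divide_left_mono) auto
        also have "\<dots> = 2 * cmod x * cmod x ^ N"
          by simp
        also have "\<dots> \<le> d0 / 4 * cmod x ^ N"
          using x by (intro mult_right_mono) (auto simp: r1_def)
        finally have R: "cmod (f (disk_aut z x) - (\<Sum>n<Suc N. a n z * x ^ n)) \<le> d0 / 4 * cmod x ^ N" .
        have "d0 * cmod x ^ N \<le> cmod (a N z * x ^ N)"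
          unfolding norm_mult norm_power using z by (intro mult_right_mono) (auto simp: P_def)
        also have "a N z * x ^ N = (f (disk_aut z x) - l) - (f (disk_aut z x) - (\<Sum>n<Suc N. a n z * x ^ n)) - (f z - l) - ?S"
          unfolding split by simp
        also have "cmod \<dots> \<le> cmod (f (disk_aut z x) - l) + d0 / 4 * cmod x ^ N + kap + (real N - 1) * kap"
        proof -
          have tri: "cmod (p - q - t - v) \<le> cmod p + cmod q + cmod t + cmod v" for p q t v :: complex
            using norm_triangle_ineq4[of "p - q - t" v] norm_triangle_ineq4[of "p - q" t] norm_triangle_ineq4[of p q]
            by linarith
          have "cmod (f z - l) \<le> kap"
            using z by (simp add: P_def)
          then show ?thesis
            using S R by (intro order_trans[OF tri] add_mono order_refl)
        qed
        also have "\<dots> = cmod (f (disk_aut z x) - l) + d0 / 4 * cmod x ^ N + d0 * r ^ N / 16"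
          using kap(2) by (simp add: algebra_simps)
        also have "\<dots> \<le> cmod (f (disk_aut z x) - l) + d0 / 4 * cmod x ^ N + d0 * cmod x ^ N / 16"
          using x r d0 by (intro add_left_mono divide_right_mono mult_left_mono power_mono) auto
        finally have "d0 * cmod x ^ N \<le> cmod (f (disk_aut z x) - l) + d0 / 4 * cmod x ^ N + d0 * cmod x ^ N / 16" .
        moreover have "0 \<le> d0 * cmod x ^ N"
          using d0 by simp
        ultimately show ?thesis by linarith
      qed
      have annulus: "f (disk_aut z x) \<noteq> l" if "z \<in> P" "r \<le> cmod x" "cmod x \<le> r1" for z x
      proof
        assume "f (disk_aut z x) = l"
        then have "d0 / 2 * cmod x ^ N \<le> 0"
          using lower[OF that] by simp
        moreover have "0 < d0 / 2 * cmod x ^ N"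
          using d0 r that by (intro mult_pos_pos zero_less_power) auto
        ultimately show False by linarith
      qed
      \<comment> \<open>Otherwise the maximum principle for \<open>1 / (f - l)\<close> on
        \<open>cball 0 r\<close> would contradict the smallness of \<open>f z - l\<close> at the
        centre.\<close>
      have zero: "\<exists>x. cmod x < r \<and> f (disk_aut z x) = l" if z: "z \<in> P" for z
      proof (rule ccontr)
        assume no: "\<not> ?thesis"
        have zD: "z \<in> unit_disk" using z PD by auto
        have nz: "f (disk_aut z x) - l \<noteq> 0" if "x \<in> cball 0 r" for x
          using no annulus[OF z, of x] that r by (cases "cmod x < r") auto
        have sub: "cball 0 r \<subseteq> (unit_disk :: complex set)"
          using r r1 by auto
        have hl: "(\<lambda>x. f (disk_aut z x) - l) holomorphic_on unit_disk"
          by (intro holomorphic_intros hol[OF zD])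
        have "norm (inverse (f (disk_aut z 0) - l)) \<le> inverse (d0 / 2 * r ^ N)"
        proof (rule maximum_modulus_frontier[of "\<lambda>x. inverse (f (disk_aut z x) - l)" "cball 0 r"])
          show "(\<lambda>x. inverse (f (disk_aut z x) - l)) holomorphic_on interior (cball 0 r)"
            using nz by (intro holomorphic_on_inverse holomorphic_on_subset[OF hl] order_trans[OF interior_subset sub])
              (auto dest: subsetD[OF interior_subset])
          show "continuous_on (closure (cball 0 r)) (\<lambda>x. inverse (f (disk_aut z x) - l))"
            using nz by (intro continuous_on_inverse holomorphic_on_imp_continuous_on holomorphic_on_subset[OF hl]) (use sub in auto)
          show "norm (inverse (f (disk_aut z x) - l)) \<le> inverse (d0 / 2 * r ^ N)" if "x \<in> frontier (cball 0 r)" for x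
            using lower[OF z, of x] that r d0 le_imp_inverse_le[of "d0 / 2 * r ^ N" "cmod (f (disk_aut z x) - l)"]
            by (simp add: norm_inverse)
        qed (use r in auto)
        then have "inverse (cmod (f z - l)) \<le> inverse (d0 / 2 * r ^ N)"
          by (simp add: norm_inverse)
        moreover have "0 < cmod (f z - l)"
          using nz[of 0] r by simp
        ultimately have "d0 / 2 * r ^ N \<le> cmod (f z - l)"
          by (rule inverse_le_imp_le)
        also have "\<dots> \<le> d0 * r ^ N / 16"
          using z kap(3) by (auto simp: P_def)
        finally have "d0 * r ^ N \<le> 0" by simp
        moreover have "0 < d0 * r ^ N"
          using d0 r by simp
        ultimately show False by linarith
      qed
      have nc: "\<not> f constant_on unit_disk"
      proof
        assume "f constant_on unit_disk"
        then obtain c where c: "\<And>x. x \<in> unit_disk \<Longrightarrow> f x = c"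
          by (auto simp: constant_on_def)
        obtain z where z: "z \<in> P"
          using frequently_ex[OF freqP] by auto
        then have zD: "z \<in> unit_disk" using PD by auto
        obtain x where "cmod x < r" "f (disk_aut z x) = l"
          using zero[OF z] by auto
        then have "c = l"
          using c disk_aut_in_disk[OF zD, of x] r r1 by auto
        moreover have "f (disk_aut z (of_real r)) \<noteq> l"
          by (rule annulus[OF z]) (use r r1 in auto)
        ultimately show False
          using c disk_aut_in_disk[OF zD, of "of_real r"] r r1 by auto
      qed
      obtain E where E: "E \<subseteq> unit_disk" "interpolating d E" "\<And>z. z \<in> P \<Longrightarrow> \<exists>k\<in>E. pdist z k \<le> 7 * r"
        unfolding d_def
      proof (rule cluster_interpolating[OF f b2 nc PD r(1,2) _ et annulus _ zero])
        show "r1 < 1" using r1 by simp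
        show "et \<le> cmod (f (disk_aut z x) - l)" if "z \<in> P" "cmod x = r1" for z x
          using lower[OF that(1), of x] that r by (simp add: et_def)
      qed auto
      obtain h where h: "h holomorphic_on unit_disk" "\<And>z. z \<in> unit_disk \<Longrightarrow> cmod (h z) \<le> M"
        "\<And>k. k \<in> E \<Longrightarrow> h k = f (disk_aut k w)"
        unfolding M_def
        by (rule interpolation[OF E(2) d, of "\<lambda>k. f (disk_aut k w)"]) (use bd E(1) w in auto)
      obtain B where B: "B holomorphic_on unit_disk" "\<And>z. z \<in> unit_disk \<Longrightarrow> cmod (B z) \<le> 1"
        "\<And>k. k \<in> E \<Longrightarrow> B k = 0"
        "\<And>z. z \<in> unit_disk \<Longrightarrow> (\<And>k. k \<in> E \<Longrightarrow> s \<le> pdist k z) \<Longrightarrow> s * d / 2 \<le> cmod (B z)"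
        by (rule infinite_blaschke[OF E(2) s(1,2) d1]) blast
      obtain lB where lB: "(B \<longlongrightarrow> lB) Fm"
        using lim[OF B(1,2)] by auto
      \<comment> \<open>B converges along the filter and is small on P, which is met frequently; so
        its limit is small, and B is small eventually. Being within s of a representative thus
        becomes an eventual property of z.\<close>
      have "cmod lB \<le> s * d / 4"
      proof (rule ccontr)
        assume "\<not> ?thesis"
        then have "\<forall>\<^sub>F z in Fm. s * d / 4 < cmod (B z)"
          using tendsto_norm[OF lB] by (intro order_tendstoD) auto
        from frequently_eventually_frequently[OF freqP this]
        obtain z where z: "z \<in> P" "s * d / 4 < cmod (B z)"
          by (auto dest!: frequently_ex)
        obtain k where k: "k \<in> E" "pdist z k \<le> 7 * r"
          using E(3)[OF z(1)] by auto
        have "cmod (B z - B k) \<le> 2 * 1 * pdist z k"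
          by (rule schwarz_pick_bound[OF B(1,2)]) (use z PD k E in auto)
        then show False
          using B(3)[OF k(1)] k z r by simp
      qed
      then have "cmod lB < s * d / 2"
        using s d by (smt (verit) divide_strict_left_mono mult_pos_pos)
      then have evB: "\<forall>\<^sub>F z in Fm. cmod (B z) < s * d / 2"
        using tendsto_norm[OF lB] by (intro order_tendstoD) auto
      obtain lh where lh: "(h \<longlongrightarrow> lh) Fm"
        using lim[OF h(1,2)] by auto
      then have evh: "\<forall>\<^sub>F z in Fm. dist (h z) lh < e / 2"
        using e by (intro tendstoD) auto
      show "\<exists>l. \<forall>\<^sub>F z in Fm. dist (f (disk_aut z w)) l < e"
      proof (rule exI[of _ lh])
        show "\<forall>\<^sub>F z in Fm. dist (f (disk_aut z w)) lh < e"
          using Fm(2) evB evh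
        proof eventually_elim
          case (elim z)
          then obtain k where k: "k \<in> E" "pdist k z < s"
            using B(4)[OF elim(1)] by (meson not_le)
          have kD: "k \<in> unit_disk" using k E by auto
          have zk: "pdist z k \<le> s" "pdist z k \<le> 1 / 2"
            using k s pdist_commute[of z k] by auto
          have "cmod (f (disk_aut z w) - f (disk_aut k w)) \<le> L * pdist z k"
            unfolding L_def by (rule pull_back_lipschitz[OF f b elim(1) kD w zk(2)])
          also have "\<dots> \<le> L * s"
            using L zk by (intro mult_left_mono) auto
          finally have 1: "dist (f (disk_aut z w)) (h k) \<le> L * s"
            using h(3)[OF k(1)] by (simp add: dist_norm)
          have "cmod (h k - h z) \<le> 2 * M * pdist k z"
            by (rule schwarz_pick_bound[OF h(1,2) kD elim(1)])
          also have "\<dots> \<le> 2 * M * s"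
            using M k by (intro mult_left_mono) auto
          finally have 2: "dist (h k) (h z) \<le> 2 * M * s"
            by (simp add: dist_norm)
          have "L * s + 2 * M * s \<le> e / 2"
            using sLM by (simp add: algebra_simps)
          then show ?case
            using 1 2 elim(3) dist_triangle[of "f (disk_aut z w)" lh "h k"] dist_triangle[of "h k" lh "h z"] by linarith
        qed
      qed
    qed
  qed
qed

section \<open>The closure of the disk in the maximal ideal space\<close>

lemma open_coordinate_vimage: "open W \<Longrightarrow> open ((\<lambda>h::'a \<Rightarrow> 'b::topological_space. h i) -` W)"
  by (rule open_vimage[OF _ continuous_on_product_coordinates])

text \<open>The maximal ideal space carries the topology of the function type; its Hausdorff
  property, reached through these instances, makes limits there unique and compact sets
  closed.\<close>

instance "fun" :: (type, t0_space) t0_space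
proof
  fix f g :: "'a \<Rightarrow> 'b"
  assume "f \<noteq> g"
  then obtain i where "f i \<noteq> g i" by auto
  then obtain U where "open U" "\<not> (f i \<in> U \<longleftrightarrow> g i \<in> U)"
    using separation_t0[of "f i" "g i"] by auto
  then show "\<exists>U. open U \<and> \<not> (f \<in> U \<longleftrightarrow> g \<in> U)"
    by (intro exI[of _ "(\<lambda>h. h i) -` U"]) (auto intro: open_coordinate_vimage)
qed

instance "fun" :: (type, t1_space) t1_space
proof
  fix f g :: "'a \<Rightarrow> 'b"
  assume "f \<noteq> g"
  then obtain i where "f i \<noteq> g i" by auto
  then obtain U where "open U" "f i \<in> U" "g i \<notin> U"
    using separation_t1[of "f i" "g i"] by auto
  then show "\<exists>U. open U \<and> f \<in> U \<and> g \<notin> U"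
    by (intro exI[of _ "(\<lambda>h. h i) -` U"]) (auto intro: open_coordinate_vimage)
qed

instance "fun" :: (type, t2_space) t2_space
proof
  fix f g :: "'a \<Rightarrow> 'b"
  assume "f \<noteq> g"
  then obtain i where "f i \<noteq> g i" by auto
  then obtain U V where UV: "open U" "open V" "f i \<in> U" "g i \<in> V" "U \<inter> V = {}"
    using hausdorff[of "f i" "g i"] by auto
  then show "\<exists>U V. open U \<and> open V \<and> f \<in> U \<and> g \<in> V \<and> U \<inter> V = {}"
    by (intro exI[of _ "(\<lambda>h. h i) -` U"] exI[of _ "(\<lambda>h. h i) -` V"]) (auto intro: open_coordinate_vimage)
qed

lemma tendsto_fun_iff:
  fixes f :: "'c \<Rightarrow> 'a \<Rightarrow> 'b::topological_space"
  shows "(f \<longlongrightarrow> l) F \<longleftrightarrow> (\<forall>i. ((\<lambda>x. f x i) \<longlongrightarrow> l i) F)"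
  using limitin_componentwise[of "\<lambda>i::'a. euclidean :: 'b topology" UNIV f l F]
  unfolding euclidean_product_topology limitin_canonical_iff by simp

text \<open>Exactly at these points is \<open>disk_to m\<close> a proper filter
  (\<open>disk_to_nontrivial\<close>).\<close>

definition disk_closure :: "((complex \<Rightarrow> complex) \<Rightarrow> complex) set" where
  "disk_closure = closure (point_eval ` unit_disk)"

lemma point_eval_apply: "f \<in> Hinf \<Longrightarrow> point_eval z f = f z"
  by (simp add: point_eval_def)

lemma point_eval_in_closure: "z \<in> unit_disk \<Longrightarrow> point_eval z \<in> disk_closure"
  unfolding disk_closure_def by (rule subsetD[OF closure_subset]) (rule imageI)

lemma closed_disk_closure: "closed disk_closure"
  by (simp add: disk_closure_def)

lemma Hinf_bound: "f \<in> Hinf \<Longrightarrow> \<exists>B. \<forall>z\<in>unit_disk. cmod (f z) \<le> B"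
  unfolding Hinf_def bounded_iff by auto

text \<open>Tychonoff: boundedness of each f in \<open>Hinf\<close> confines the closure to a
  product of compact disks. At arguments outside \<open>Hinf\<close> the evaluations are
  \<open>undefined\<close>, so those factors are singletons.\<close>

lemma compact_disk_closure: "compact disk_closure"
proof -
  obtain B where B: "\<And>f z. f \<in> Hinf \<Longrightarrow> z \<in> unit_disk \<Longrightarrow> cmod (f z) \<le> B f"
    using Hinf_bound by metis
  let ?C = "\<lambda>f. if f \<in> Hinf then cball 0 (B f) else {undefined} :: complex set"
  have "compactin (product_topology (\<lambda>f. euclidean) UNIV) (PiE UNIV ?C)"
    unfolding compactin_PiE by auto
  then have K: "compact (PiE UNIV ?C)"
    by (simp add: euclidean_product_topology)
  have "point_eval ` unit_disk \<subseteq> PiE UNIV ?C"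
    using B by (auto simp: point_eval_def)
  moreover have "closed (PiE UNIV ?C)"
    by (rule compact_imp_closed[OF K])
  ultimately have "disk_closure \<subseteq> PiE UNIV ?C"
    unfolding disk_closure_def by (rule closure_minimal)
  then show ?thesis
    using K closed_disk_closure by (metis compact_Int_closed inf.absorb_iff2)
qed

section \<open>Filters of points of the disk tending to m\<close>

lemma eventually_in_disk_to: "\<forall>\<^sub>F z in disk_to m. z \<in> unit_disk"
  unfolding disk_to_def eventually_inf_principal by auto

lemma disk_to_point_eval: "(point_eval \<longlongrightarrow> m) (disk_to m)"
  unfolding disk_to_def by (rule filterlim_mono[OF filterlim_filtercomap order_refl inf_le1])

lemma disk_to_nontrivial: "disk_to m \<noteq> bot \<longleftrightarrow> m \<in> disk_closure"
proof -
  show ?thesis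
  proof
    assume "m \<in> disk_closure"
    show "disk_to m \<noteq> bot"
    proof
      assume "disk_to m = bot"
      then have "eventually (\<lambda>z. False) (disk_to m)" by simp
      then obtain U where U: "open U" "m \<in> U" "\<And>z. point_eval z \<in> U \<Longrightarrow> z \<notin> unit_disk"
        unfolding disk_to_def eventually_inf_principal eventually_filtercomap eventually_nhds by blast
      then have "point_eval ` unit_disk \<inter> U \<noteq> {}"
        using \<open>m \<in> disk_closure\<close> unfolding disk_closure_def closure_iff_nhds_not_empty by blast
      then show False
        using U by auto
    qed
  next
    assume "disk_to m \<noteq> bot"
    moreover have "\<forall>\<^sub>F z in disk_to m. point_eval z \<in> disk_closure"
      using eventually_in_disk_to by eventually_elim (rule point_eval_in_closure)
    ultimately show "m \<in> disk_closure"
      using Lim_in_closed_set[OF closed_disk_closure _ _ disk_to_point_eval] by blast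
  qed
qed

lemma disk_to_Hinf: "f \<in> Hinf \<Longrightarrow> (f \<longlongrightarrow> m f) (disk_to m)"
  using spec[OF disk_to_point_eval[of m, unfolded tendsto_fun_iff], of f] by (simp add: point_eval_apply)

lemma Hinf_restrict:
  assumes "f holomorphic_on unit_disk" "\<And>z. z \<in> unit_disk \<Longrightarrow> cmod (f z) \<le> B"
  shows "(\<lambda>z. if z \<in> unit_disk then f z else 0) \<in> Hinf"
proof -
  have "\<forall>z\<in>(\<lambda>z. if z \<in> unit_disk then f z else 0) ` unit_disk. cmod z \<le> B"
    using assms(2) by auto
  then show ?thesis
    unfolding Hinf_def bounded_iff by (auto intro: holomorphic_transform[OF assms(1)])
qed

lemma disk_to_bounded_holomorphic:
  assumes "f holomorphic_on unit_disk" "\<And>z. z \<in> unit_disk \<Longrightarrow> cmod (f z) \<le> B"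
  shows "\<exists>l. (f \<longlongrightarrow> l) (disk_to m)"
proof -
  let ?g = "\<lambda>z. if z \<in> unit_disk then f z else 0"
  have "(?g \<longlongrightarrow> m ?g) (disk_to m)"
    by (rule disk_to_Hinf[OF Hinf_restrict[OF assms]])
  moreover have "\<forall>\<^sub>F z in disk_to m. ?g z = f z"
    using eventually_in_disk_to by eventually_elim simp
  ultimately show ?thesis
    by (intro exI) (rule tendsto_cong[THEN iffD1])
qed

lemma Hinf_add: "f \<in> Hinf \<Longrightarrow> g \<in> Hinf \<Longrightarrow> (\<lambda>z. f z + g z) \<in> Hinf"
  unfolding Hinf_def by (auto intro: holomorphic_intros bounded_plus_comp)

lemma Hinf_mult:
  assumes "f \<in> Hinf" "g \<in> Hinf" shows "(\<lambda>z. f z * g z) \<in> Hinf"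
proof -
  obtain B C where "\<And>z. z \<in> unit_disk \<Longrightarrow> cmod (f z) \<le> B" "\<And>z. z \<in> unit_disk \<Longrightarrow> cmod (g z) \<le> C"
    using assms Hinf_bound by metis
  then have "\<And>z. z \<in> unit_disk \<Longrightarrow> cmod (f z * g z) \<le> B * C"
    unfolding norm_mult by (meson mult_mono norm_ge_zero order_trans)
  then have "bounded ((\<lambda>z. f z * g z) ` unit_disk)"
    unfolding bounded_iff by (intro exI[of _ "B * C"]) auto
  then show ?thesis
    using assms unfolding Hinf_def by (auto intro: holomorphic_intros)
qed

lemma Hinf_const: "(\<lambda>z. if z \<in> unit_disk then c else 0) \<in> Hinf"
  by (rule Hinf_restrict[where B = "cmod c"]) auto

lemma Hinf_scale: "f \<in> Hinf \<Longrightarrow> (\<lambda>z. c * f z) \<in> Hinf"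
  using Hinf_mult[OF Hinf_const[of c]] by (rule back_subst[of "\<lambda>f. f \<in> Hinf"]) (auto simp: Hinf_def fun_eq_iff)

lemma Hinf_id: "(\<lambda>z. if z \<in> unit_disk then z else 0) \<in> Hinf"
  by (rule Hinf_restrict[where B = 1]) auto

lemma disk_closure_subset: "disk_closure \<subseteq> maximal_ideals"
proof
  fix m assume m: "m \<in> disk_closure"
  then have nb: "disk_to m \<noteq> bot"
    by (simp add: disk_to_nontrivial)
  note uniq = tendsto_unique[OF nb disk_to_Hinf]
  have "m f = undefined" if "f \<notin> Hinf" for f
  proof (rule tendsto_unique[OF nb])
    show "((\<lambda>z. point_eval z f) \<longlongrightarrow> m f) (disk_to m)"
      using disk_to_point_eval[of m] unfolding tendsto_fun_iff by blast
    show "((\<lambda>z. point_eval z f) \<longlongrightarrow> undefined) (disk_to m)"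
      using that by (simp add: point_eval_def)
  qed
  then have "m \<in> extensional Hinf"
    by (auto simp: extensional_def)
  moreover have "m (\<lambda>z. f z + g z) = m f + m g" if "f \<in> Hinf" "g \<in> Hinf" for f g
    using that by (intro uniq Hinf_add tendsto_intros disk_to_Hinf)
  moreover have "m (\<lambda>z. f z * g z) = m f * m g" if "f \<in> Hinf" "g \<in> Hinf" for f g
    using that by (intro uniq Hinf_mult tendsto_intros disk_to_Hinf)
  moreover have "m (\<lambda>z. c * f z) = c * m f" if "f \<in> Hinf" for f c
    using that by (intro uniq Hinf_scale tendsto_intros disk_to_Hinf)
  moreover have "c \<in> m ` Hinf" for c
  proof
    show "c = m (\<lambda>z. if z \<in> unit_disk then c else 0)"
    proof (rule uniq[OF Hinf_const, symmetric])
      have "\<forall>\<^sub>F z in disk_to m. (if z \<in> unit_disk then c else 0) = c"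
        using eventually_in_disk_to by eventually_elim simp
      then show "((\<lambda>z. if z \<in> unit_disk then c else 0) \<longlongrightarrow> c) (disk_to m)"
        by (rule tendsto_eventually)
    qed
  qed (rule Hinf_const)
  ultimately show "m \<in> maximal_ideals"
    unfolding maximal_ideals_def by blast
qed

text \<open>Compactness of the closure provides a cluster point of any proper filter on the disk;
  the refinement \<open>inf F (disk_to m)\<close> takes the place of a convergent subnet.\<close>

lemma cluster_point_in_closure:
  assumes "F \<noteq> bot" "\<forall>\<^sub>F z in F. z \<in> unit_disk"
  obtains m where "m \<in> disk_closure" "inf F (disk_to m) \<noteq> bot"
proof -
  have "filtermap point_eval F \<noteq> bot"
    using assms(1) by (simp add: filtermap_bot_iff)
  moreover have "eventually (\<lambda>m. m \<in> disk_closure) (filtermap point_eval F)"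
    unfolding eventually_filtermap using assms(2) by eventually_elim (rule point_eval_in_closure)
  ultimately obtain m where m: "m \<in> disk_closure" "inf (nhds m) (filtermap point_eval F) \<noteq> bot"
    using compact_disk_closure unfolding compact_filter by blast
  have "inf F (disk_to m) \<noteq> bot"
  proof
    assume "inf F (disk_to m) = bot"
    then have "eventually (\<lambda>z. False) (inf F (disk_to m))" by simp
    then obtain P Q where PQ: "eventually P F" "eventually Q (disk_to m)" "\<And>z. P z \<Longrightarrow> Q z \<Longrightarrow> False"
      unfolding eventually_inf by blast
    then obtain R where R: "eventually R (nhds m)" "\<And>z. R (point_eval z) \<Longrightarrow> z \<in> unit_disk \<Longrightarrow> Q z"
      unfolding disk_to_def eventually_inf_principal eventually_filtercomap by blast
    have "eventually (\<lambda>p. \<not> R p) (filtermap point_eval F)"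
      unfolding eventually_filtermap using PQ(1) assms(2) by eventually_elim (use PQ(3) R(2) in blast)
    then have "eventually (\<lambda>p. False) (inf (nhds m) (filtermap point_eval F))"
      unfolding eventually_inf using R(1) by blast
    then show False
      using m(2) by (simp add: eventually_False)
  qed
  with m(1) show ?thesis by (rule that)
qed

lemma disk_to_point:
  assumes "w \<in> unit_disk" shows "disk_to (point_eval w) \<le> nhds w"
proof -
  let ?i = "\<lambda>z. if z \<in> unit_disk then z else 0"
  have "point_eval w ?i = w"
    using assms by (subst point_eval_apply[OF Hinf_id]) simp
  then have i: "(?i \<longlongrightarrow> w) (disk_to (point_eval w))"
    using disk_to_Hinf[OF Hinf_id, of "point_eval w"] by simp
  have "\<forall>\<^sub>F z in disk_to (point_eval w). ?i z = z"
    using eventually_in_disk_to by eventually_elim simp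
  then have "((\<lambda>z. z) \<longlongrightarrow> w) (disk_to (point_eval w))"
    using i by (rule tendsto_cong[THEN iffD1])
  then show ?thesis
    by (simp add: filterlim_def filtermap_ident)
qed

text \<open>Along \<open>disk_to m\<close> the coordinate function has a limit l. If |l| < 1,
  continuity at l of all functions in \<open>Hinf\<close> makes m the evaluation at l; so |l| =
  1.\<close>

lemma disk_to_boundary:
  assumes m: "m \<in> disk_closure" "m \<notin> point_eval ` unit_disk"
  shows "disk_to m \<le> boundary"
proof -
  have nb: "disk_to m \<noteq> bot"
    using m by (simp add: disk_to_nontrivial)
  let ?i = "\<lambda>z. if z \<in> unit_disk then z else 0"
  define l where "l = m ?i"
  have "\<forall>\<^sub>F z in disk_to m. ?i z = z"
    using eventually_in_disk_to by eventually_elim simp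
  then have l: "((\<lambda>z. z) \<longlongrightarrow> l) (disk_to m)"
    using disk_to_Hinf[OF Hinf_id, of m] unfolding l_def by (rule tendsto_cong[THEN iffD1])
  have "cmod l \<le> 1"
    by (rule tendsto_upperbound[OF tendsto_norm[OF l] _ nb]) (rule eventually_mono[OF eventually_in_disk_to], simp)
  moreover have "\<not> cmod l < 1"
  proof
    assume "cmod l < 1"
    then have lD: "l \<in> unit_disk" by simp
    have "m = point_eval l"
    proof (rule tendsto_unique[OF nb disk_to_point_eval])
      show "(point_eval \<longlongrightarrow> point_eval l) (disk_to m)"
        unfolding tendsto_fun_iff
      proof
        fix f
        show "((\<lambda>z. point_eval z f) \<longlongrightarrow> point_eval l f) (disk_to m)"
        proof (cases "f \<in> Hinf")
          case True
          then have "isCont f l"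
            using lD continuous_on_eq_continuous_at[of unit_disk f] holomorphic_on_imp_continuous_on
            by (auto simp: Hinf_def)
          then show ?thesis
            using isCont_tendsto_compose[OF _ l] True by (simp add: point_eval_def)
        qed (simp add: point_eval_def)
      qed
    qed
    then show False
      using m(2) lD by blast
  qed
  ultimately have "cmod l = 1" by simp
  then have "((\<lambda>z. cmod z) \<longlongrightarrow> 1) (disk_to m)"
    using tendsto_norm[OF l] by simp
  moreover have "\<forall>\<^sub>F z in disk_to m. cmod z \<in> {..<1} \<and> cmod z \<noteq> 1"
    using eventually_in_disk_to by eventually_elim auto
  ultimately have "filterlim cmod (at_left 1) (disk_to m)"
    unfolding filterlim_at by auto
  then show ?thesis
    by (simp add: filterlim_iff_le_filtercomap)
qed

text \<open>If convergence at the boundary fails, the points where g avoids a neighbourhood of l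
  carry a proper filter tending to the boundary. A cluster point m of it in the closure cannot lie
  in the disk, and convergence along \<open>disk_to m\<close> is contradicted.\<close>

lemma tendsto_boundary_iff:
  "(g \<longlongrightarrow> l) boundary \<longleftrightarrow> (\<forall>m \<in> disk_closure - point_eval ` unit_disk. (g \<longlongrightarrow> l) (disk_to m))"
proof
  assume "(g \<longlongrightarrow> l) boundary"
  then show "\<forall>m \<in> disk_closure - point_eval ` unit_disk. (g \<longlongrightarrow> l) (disk_to m)"
    using disk_to_boundary tendsto_mono by blast
next
  assume R: "\<forall>m \<in> disk_closure - point_eval ` unit_disk. (g \<longlongrightarrow> l) (disk_to m)"
  show "(g \<longlongrightarrow> l) boundary"
    unfolding tendsto_def
  proof (intro allI impI)
    fix U assume U: "open U" "l \<in> U"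
    let ?F = "inf boundary (principal {z. g z \<notin> U})"
    show "\<forall>\<^sub>F z in boundary. g z \<in> U"
    proof (rule ccontr)
      assume "\<not> (\<forall>\<^sub>F z in boundary. g z \<in> U)"
      then have "?F \<noteq> bot"
        by (simp add: trivial_limit_def eventually_inf_principal)
      moreover have "\<forall>\<^sub>F z in ?F. z \<in> unit_disk"
        by (rule filter_leD[OF inf_le1 eventually_in_disk_boundary])
      ultimately obtain m where m: "m \<in> disk_closure" "inf ?F (disk_to m) \<noteq> bot"
        by (rule cluster_point_in_closure)
      have "m \<notin> point_eval ` unit_disk"
      proof
        assume "m \<in> point_eval ` unit_disk"
        then obtain w where w: "w \<in> unit_disk" "m = point_eval w" by auto
        obtain r where r: "cmod w < r" "r < 1"
          using w dense[of "cmod w" 1] by auto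
        have "\<forall>\<^sub>F z in nhds w. cmod z < r"
          by (intro order_tendstoD[OF tendsto_norm[OF filterlim_ident]] r)
        then have "\<forall>\<^sub>F z in disk_to m. cmod z < r"
          using disk_to_point[OF w(1)] w(2) filter_leD by blast
        moreover have "\<forall>\<^sub>F z in boundary. r < cmod z"
          unfolding eventually_boundary using r by blast
        then have "\<forall>\<^sub>F z in ?F. r < cmod z"
          by (rule filter_leD[OF inf_le1])
        ultimately have "\<forall>\<^sub>F z in inf ?F (disk_to m). cmod z < r \<and> r < cmod z"
          by (intro eventually_conj filter_leD[OF inf_le2, of _ "disk_to m"] filter_leD[OF inf_le1, of _ ?F])
        then have "\<forall>\<^sub>F z in inf ?F (disk_to m). False"
          by (rule eventually_mono) linarith
        then show False
          using m(2) by (simp add: eventually_False)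
      qed
      then have "\<forall>\<^sub>F z in disk_to m. g z \<in> U"
        using R m(1) U topological_tendstoD by blast
      moreover have "\<forall>\<^sub>F z in ?F. g z \<notin> U"
        by (simp add: eventually_inf_principal)
      ultimately have "\<forall>\<^sub>F z in inf ?F (disk_to m). g z \<in> U \<and> g z \<notin> U"
        by (intro eventually_conj filter_leD[OF inf_le2, of _ "disk_to m"] filter_leD[OF inf_le1, of _ ?F])
      then have "\<forall>\<^sub>F z in inf ?F (disk_to m). False"
        by (rule eventually_mono) blast
      then show False
        using m(2) by (simp add: eventually_False)
    qed
  qed
qed

section \<open>Functions extending to the closure of the disk\<close>

text \<open>The functions singled out here are exactly those in \<open>UU\<close>. Uniform continuity in the
  pseudohyperbolic distance makes the functions \<open>u \<circ> \<phi>\<^sub>z\<close> equicontinuous.\<close>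

definition disk_regular :: "(complex \<Rightarrow> complex) \<Rightarrow> bool" where
  "disk_regular u \<longleftrightarrow> bounded (u ` unit_disk) \<and>
     (\<forall>e>0. \<exists>d>0. \<forall>z\<in>unit_disk. \<forall>w\<in>unit_disk. pdist z w < d \<longrightarrow> dist (u z) (u w) < e) \<and>
     (\<forall>m\<in>disk_closure. \<exists>l. (u \<longlongrightarrow> l) (disk_to m))"

lemma disk_regularD:
  assumes "disk_regular u"
  shows "\<exists>B. \<forall>z\<in>unit_disk. cmod (u z) \<le> B"
    and "0 < e \<Longrightarrow> \<exists>d>0. \<forall>z\<in>unit_disk. \<forall>w\<in>unit_disk. pdist z w < d \<longrightarrow> dist (u z) (u w) < e"
    and "m \<in> disk_closure \<Longrightarrow> \<exists>l. (u \<longlongrightarrow> l) (disk_to m)"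
  using assms unfolding disk_regular_def bounded_iff by auto

lemma disk_regular_pos_bound:
  assumes "disk_regular u"
  obtains B where "0 < B" "\<And>z. z \<in> unit_disk \<Longrightarrow> cmod (u z) \<le> B"
proof -
  obtain B where B: "\<And>z. z \<in> unit_disk \<Longrightarrow> cmod (u z) \<le> B"
    using disk_regularD(1)[OF assms] by blast
  then have "cmod (u z) \<le> max 1 B" if "z \<in> unit_disk" for z
    using that by (meson max.coboundedI2)
  then show ?thesis
    using that[of "max 1 B"] by auto
qed

lemma disk_regular_Hinf:
  assumes f: "f \<in> Hinf" shows "disk_regular f"
  unfolding disk_regular_def
proof (intro conjI allI impI ballI)
  show "bounded (f ` unit_disk)"
    using f by (simp add: Hinf_def)
  show "\<exists>l. (f \<longlongrightarrow> l) (disk_to m)" for m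
    using disk_to_Hinf[OF f] by blast
  obtain B where B: "\<And>z. z \<in> unit_disk \<Longrightarrow> cmod (f z) \<le> B"
    using Hinf_bound[OF f] by blast
  have "0 \<le> cmod (f 0)" by simp
  also have "\<dots> \<le> B" by (rule B) simp
  finally have B0: "0 \<le> B" .
  fix e :: real assume e: "0 < e"
  have "dist (f z) (f w) < e" if "z \<in> unit_disk" "w \<in> unit_disk" "pdist z w < e / (2 * B + 1)" for z w
  proof -
    have "dist (f z) (f w) \<le> 2 * B * pdist z w"
      unfolding dist_norm by (rule schwarz_pick_bound[OF _ B]) (use f that in \<open>auto simp: Hinf_def\<close>)
    also have "\<dots> \<le> (2 * B + 1) * pdist z w"
      by (intro mult_right_mono) auto
    also have "\<dots> < e"
      using that B0 by (simp add: field_simps)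
    finally show ?thesis .
  qed
  then show "\<exists>d>0. \<forall>z\<in>unit_disk. \<forall>w\<in>unit_disk. pdist z w < d \<longrightarrow> dist (f z) (f w) < e"
    using e B0 by (intro exI[of _ "e / (2 * B + 1)"]) auto
qed

lemma disk_regular_uniform_limit:
  assumes "\<And>e. 0 < e \<Longrightarrow> \<exists>v. disk_regular v \<and> (\<forall>z\<in>unit_disk. cmod (u z - v z) \<le> e)"
  shows "disk_regular u"
  unfolding disk_regular_def
proof (intro conjI allI impI ballI)
  obtain v where v: "disk_regular v" "\<And>z. z \<in> unit_disk \<Longrightarrow> cmod (u z - v z) \<le> 1"
    using assms[of 1] by auto
  obtain B where B: "\<And>z. z \<in> unit_disk \<Longrightarrow> cmod (v z) \<le> B"
    using disk_regularD(1)[OF v(1)] by blast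
  have "cmod (u z) \<le> 1 + B" if "z \<in> unit_disk" for z
    using v(2)[OF that] B[OF that] norm_triangle_ineq2[of "u z" "v z"] by linarith
  then show "bounded (u ` unit_disk)"
    unfolding bounded_iff by blast
next
  fix e :: real assume e: "0 < e"
  obtain v where v: "disk_regular v" "\<And>z. z \<in> unit_disk \<Longrightarrow> dist (u z) (v z) \<le> e / 4"
    using assms[of "e / 4"] e by (auto simp: dist_norm)
  obtain d where d: "d > 0" "\<And>z w. z \<in> unit_disk \<Longrightarrow> w \<in> unit_disk \<Longrightarrow> pdist z w < d \<Longrightarrow> dist (v z) (v w) < e / 2"
    using disk_regularD(2)[OF v(1), of "e / 2"] e by auto
  have "dist (u z) (u w) < e" if "z \<in> unit_disk" "w \<in> unit_disk" "pdist z w < d" for z w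
    using v(2)[OF that(1)] v(2)[OF that(2)] d(2)[OF that] dist_triangle[of "u z" "u w" "v z"]
      dist_triangle[of "v z" "u w" "v w"] dist_commute[of "u w" "v w"] by linarith
  then show "\<exists>d>0. \<forall>z\<in>unit_disk. \<forall>w\<in>unit_disk. pdist z w < d \<longrightarrow> dist (u z) (u w) < e"
    using d(1) by blast
next
  fix m assume m: "m \<in> disk_closure"
  show "\<exists>l. (u \<longlongrightarrow> l) (disk_to m)"
  proof (rule cauchy_filter_limit)
    show "disk_to m \<noteq> bot"
      using m by (simp add: disk_to_nontrivial)
    fix e :: real assume e: "0 < e"
    obtain v where v: "disk_regular v" "\<And>z. z \<in> unit_disk \<Longrightarrow> dist (u z) (v z) \<le> e / 2"
      using assms[of "e / 2"] e by (auto simp: dist_norm)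
    obtain l where "(v \<longlongrightarrow> l) (disk_to m)"
      using disk_regularD(3)[OF v(1) m] by auto
    then have "\<forall>\<^sub>F z in disk_to m. dist (v z) l < e / 2"
      using e by (intro tendstoD) auto
    then have "\<forall>\<^sub>F z in disk_to m. dist (u z) l < e"
      using eventually_in_disk_to
    proof eventually_elim
      case (elim z)
      then show ?case
        using v(2)[of z] dist_triangle[of "u z" l "v z"] by linarith
    qed
    then show "\<exists>l. \<forall>\<^sub>F z in disk_to m. dist (u z) l < e"
      by blast
  qed
qed

lemma disk_regular_add:
  assumes u: "disk_regular u" and v: "disk_regular v"
  shows "disk_regular (\<lambda>z. u z + v z)"
  unfolding disk_regular_def
proof (intro conjI allI impI ballI)
  show "bounded ((\<lambda>z. u z + v z) ` unit_disk)"
    using u v unfolding disk_regular_def by (intro bounded_plus_comp) auto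
  show "\<exists>l. ((\<lambda>z. u z + v z) \<longlongrightarrow> l) (disk_to m)" if "m \<in> disk_closure" for m
    using disk_regularD(3)[OF u that] disk_regularD(3)[OF v that] by (auto intro: tendsto_add)
  fix e :: real assume e: "0 < e"
  obtain d where d: "d > 0" "\<And>z w. z \<in> unit_disk \<Longrightarrow> w \<in> unit_disk \<Longrightarrow> pdist z w < d \<Longrightarrow> dist (u z) (u w) < e / 2"
    using disk_regularD(2)[OF u, of "e / 2"] e by auto
  obtain d' where d': "d' > 0" "\<And>z w. z \<in> unit_disk \<Longrightarrow> w \<in> unit_disk \<Longrightarrow> pdist z w < d' \<Longrightarrow> dist (v z) (v w) < e / 2"
    using disk_regularD(2)[OF v, of "e / 2"] e by auto
  have "dist (u z + v z) (u w + v w) < e" if "z \<in> unit_disk" "w \<in> unit_disk" "pdist z w < min d d'" for z w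
    using d(2)[OF that(1,2)] d'(2)[OF that(1,2)] that(3) dist_triangle_add[of "u z" "v z" "u w" "v w"] by simp
  then show "\<exists>d>0. \<forall>z\<in>unit_disk. \<forall>w\<in>unit_disk. pdist z w < d \<longrightarrow> dist (u z + v z) (u w + v w) < e"
    using d(1) d'(1) by (intro exI[of _ "min d d'"]) auto
qed

lemma norm_mult_diff_le:
  fixes a b c d :: complex
  assumes "cmod (a - b) \<le> s" "cmod (c - d) \<le> t" "cmod b \<le> B" "cmod c \<le> C"
  shows "cmod (a * c - b * d) \<le> s * C + B * t"
proof -
  have "a * c - b * d = (a - b) * c + b * (c - d)"
    by (simp add: algebra_simps)
  also have "cmod \<dots> \<le> cmod (a - b) * cmod c + cmod b * cmod (c - d)"
    by (rule order_trans[OF norm_triangle_ineq]) (simp add: norm_mult)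
  also have "\<dots> \<le> s * C + B * t"
    using assms by (intro add_mono mult_mono) (auto intro: order_trans[OF norm_ge_zero])
  finally show ?thesis .
qed

lemma disk_regular_mult:
  assumes u: "disk_regular u" and v: "disk_regular v"
  shows "disk_regular (\<lambda>z. u z * v z)"
proof -
  obtain B where B: "0 < B" "\<And>z. z \<in> unit_disk \<Longrightarrow> cmod (u z) \<le> B"
    using disk_regular_pos_bound[OF u] by blast
  obtain C where C: "0 < C" "\<And>z. z \<in> unit_disk \<Longrightarrow> cmod (v z) \<le> C"
    using disk_regular_pos_bound[OF v] by blast
  show ?thesis
    unfolding disk_regular_def
  proof (intro conjI allI impI ballI)
    have "cmod (u z * v z) \<le> B * C" if "z \<in> unit_disk" for z
      unfolding norm_mult using B C that by (intro mult_mono) auto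
    then show "bounded ((\<lambda>z. u z * v z) ` unit_disk)"
      unfolding bounded_iff by blast
    show "\<exists>l. ((\<lambda>z. u z * v z) \<longlongrightarrow> l) (disk_to m)" if "m \<in> disk_closure" for m
      using disk_regularD(3)[OF u that] disk_regularD(3)[OF v that] by (auto intro: tendsto_mult)
    fix e :: real assume e: "0 < e"
    obtain d where d: "d > 0" "\<And>z w. z \<in> unit_disk \<Longrightarrow> w \<in> unit_disk \<Longrightarrow> pdist z w < d \<Longrightarrow> dist (u z) (u w) < e / (3 * C)"
      using disk_regularD(2)[OF u, of "e / (3 * C)"] e C(1) by auto
    obtain d' where d': "d' > 0" "\<And>z w. z \<in> unit_disk \<Longrightarrow> w \<in> unit_disk \<Longrightarrow> pdist z w < d' \<Longrightarrow> dist (v z) (v w) < e / (3 * B)"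
      using disk_regularD(2)[OF v, of "e / (3 * B)"] e B(1) by auto
    have "dist (u z * v z) (u w * v w) < e" if "z \<in> unit_disk" "w \<in> unit_disk" "pdist z w < min d d'" for z w
    proof -
      have "dist (u z * v z) (u w * v w) \<le> e / (3 * C) * C + B * (e / (3 * B))"
        unfolding dist_norm
        by (rule norm_mult_diff_le)
          (use B(2)[OF that(2)] C(2)[OF that(1)] d(2)[OF that(1,2)] d'(2)[OF that(1,2)] that(3) in \<open>auto simp: dist_norm\<close>)
      also have "\<dots> < e"
        using B(1) C(1) e by simp
      finally show ?thesis .
    qed
    then show "\<exists>d>0. \<forall>z\<in>unit_disk. \<forall>w\<in>unit_disk. pdist z w < d \<longrightarrow> dist (u z * v z) (u w * v w) < e"
      using d(1) d'(1) by (intro exI[of _ "min d d'"]) auto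
  qed
qed

lemma disk_regular_cnj:
  assumes u: "disk_regular u" shows "disk_regular (\<lambda>z. cnj (u z))"
  unfolding disk_regular_def
proof (intro conjI allI impI ballI)
  show "bounded ((\<lambda>z. cnj (u z)) ` unit_disk)"
    using u unfolding disk_regular_def bounded_iff by auto
  show "\<exists>l. ((\<lambda>z. cnj (u z)) \<longlongrightarrow> l) (disk_to m)" if "m \<in> disk_closure" for m
    using disk_regularD(3)[OF u that] by (auto intro: tendsto_cnj)
  show "\<exists>d>0. \<forall>z\<in>unit_disk. \<forall>w\<in>unit_disk. pdist z w < d \<longrightarrow> dist (cnj (u z)) (cnj (u w)) < e" if "0 < e" for e
    using disk_regularD(2)[OF u that] unfolding dist_norm complex_cnj_diff[symmetric] complex_mod_cnj .
qed

lemma disk_regular_cong: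
  assumes "disk_regular u" "\<And>z. z \<in> unit_disk \<Longrightarrow> v z = u z" shows "disk_regular v"
  by (rule disk_regular_uniform_limit) (use assms in auto)

lemma disk_regular_scale: "disk_regular u \<Longrightarrow> disk_regular (\<lambda>z. c * u z)"
  by (rule disk_regular_cong[OF disk_regular_mult[OF disk_regular_Hinf[OF Hinf_const[of c]]]]) auto

lemma disk_regular_continuous:
  assumes u: "disk_regular u" shows "continuous_on unit_disk u"
  unfolding continuous_on_iff
proof (intro ballI allI impI)
  fix z :: complex and e :: real assume z: "z \<in> unit_disk" and e: "0 < e"
  obtain d where d: "d > 0" "\<And>z w. z \<in> unit_disk \<Longrightarrow> w \<in> unit_disk \<Longrightarrow> pdist z w < d \<Longrightarrow> dist (u z) (u w) < e"
    using disk_regularD(2)[OF u e] by auto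
  have "dist (u w) (u z) < e" if "w \<in> unit_disk" "dist w z < d * (1 - cmod z)" for w
  proof -
    have "pdist z w \<le> dist z w / (1 - cmod z)"
      by (rule pdist_le_euclidean[OF z that(1)])
    also have "\<dots> < d"
      using that z by (simp add: field_simps dist_commute)
    finally show ?thesis
      using d(2)[OF z that(1)] by (simp add: dist_commute)
  qed
  then show "\<exists>d>0. \<forall>w\<in>unit_disk. dist w z < d \<longrightarrow> dist (u w) (u z) < e"
    using d(1) z by (intro exI[of _ "d * (1 - cmod z)"]) auto
qed

lemma continuous_AE_le:
  assumes f: "continuous_on unit_disk f" and ae: "AE z in area. cmod (f z) \<le> e" and z: "z \<in> unit_disk"
  shows "cmod (f z) \<le> e"
proof -
  have "(\<lambda>z. complex_of_real (max 0 (cmod (f z) - e))) z = 0"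
  proof (rule continuous_AE_zero[OF _ _ z])
    show "continuous_on unit_disk (\<lambda>z. complex_of_real (max 0 (cmod (f z) - e)))"
      by (intro continuous_intros f)
    show "AE z in area. complex_of_real (max 0 (cmod (f z) - e)) = 0"
      using ae by eventually_elim simp
  qed
  then show ?thesis by simp
qed

lemma Linf_disk_regular: "disk_regular u \<Longrightarrow> u \<in> Linf"
  unfolding Linf_def using continuous_imp_measurable_area[OF disk_regular_continuous] disk_regularD(1)
  by (fastforce intro!: AE_I2)

section \<open>Regular functions and C-star subalgebras\<close>

lemma Linf_add: 
  assumes "u \<in> Linf" "v \<in> Linf" shows "(\<lambda>z. u z + v z) \<in> Linf"
proof -
  obtain B C where "AE z in area. cmod (u z) \<le> B" "AE z in area. cmod (v z) \<le> C"
    using assms by (auto simp: Linf_def)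
  then have "AE z in area. cmod (u z + v z) \<le> B + C"
    by eventually_elim (rule norm_triangle_mono)
  then show ?thesis
    using assms by (auto simp: Linf_def)
qed

lemma Linf_mult: 
  assumes "u \<in> Linf" "v \<in> Linf" shows "(\<lambda>z. u z * v z) \<in> Linf"
proof -
  obtain B C where "AE z in area. cmod (u z) \<le> B" "AE z in area. cmod (v z) \<le> C"
    using assms by (auto simp: Linf_def)
  then have "AE z in area. cmod (u z * v z) \<le> B * C"
    by eventually_elim (auto simp: norm_mult intro!: mult_mono intro: order_trans[OF norm_ge_zero])
  then show ?thesis
    using assms by (auto simp: Linf_def)
qed

lemma Linf_cnj: "u \<in> Linf \<Longrightarrow> (\<lambda>z. cnj (u z)) \<in> Linf"
  by (auto simp: Linf_def intro: measurable_compose[OF _ measurable_cnj])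

text \<open>Membership in a C-star subalgebra sees functions only up to null sets, so the regular
  functions are replaced by their essentially uniform limits. As this algebra contains
  \<open>Hinf\<close>, it contains \<open>UU\<close>.\<close>

lemma cstar_disk_regular:
  "cstar_subalgebra {u \<in> Linf. \<forall>e>0. \<exists>v. disk_regular v \<and> (AE z in area. cmod (u z - v z) \<le> e)}"
  (is "cstar_subalgebra ?A")
  unfolding cstar_subalgebra_def
proof (intro conjI ballI impI allI)
  have reg: "u \<in> ?A" if "disk_regular u" for u
    using Linf_disk_regular[OF that] that by (auto intro!: exI[of _ u])
  show "?A \<subseteq> Linf" by auto
  show "(\<lambda>z. 0) \<in> ?A"
    by (rule reg) (use disk_regular_scale[OF disk_regular_Hinf[OF Hinf_id], of 0] in simp)
  have mult: "(\<lambda>z. u z * v z) \<in> ?A" if u: "u \<in> ?A" and v: "v \<in> ?A" for u v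
  proof -
    obtain B where B: "AE z in area. cmod (u z) \<le> B"
      using u by (auto simp: Linf_def)
    have "\<exists>w. disk_regular w \<and> (AE z in area. cmod (u z * v z - w z) \<le> e)" if e: "0 < e" for e
    proof -
      have "0 < e / (2 * (\<bar>B\<bar> + 1))" using e by simp
      then obtain v' where v': "disk_regular v'" "AE z in area. cmod (v z - v' z) \<le> e / (2 * (\<bar>B\<bar> + 1))"
        using v by blast
      obtain C where C: "0 < C" "\<And>z. z \<in> unit_disk \<Longrightarrow> cmod (v' z) \<le> C"
        using disk_regular_pos_bound[OF v'(1)] by blast
      have "0 < e / (2 * C)" using e C by simp
      then obtain u' where u': "disk_regular u'" "AE z in area. cmod (u z - u' z) \<le> e / (2 * C)"
        using u by blast
      have "AE z in area. cmod (u z * v z - u' z * v' z) \<le> e"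
        using v'(2) u'(2) B AE_space
      proof eventually_elim
        case (elim z)
        have "cmod (v z * u z - v' z * u' z) \<le> e / (2 * (\<bar>B\<bar> + 1)) * (\<bar>B\<bar> + 1) + C * (e / (2 * C))"
          by (rule norm_mult_diff_le) (use elim C(2)[of z] in auto)
        also have "\<dots> \<le> e"
          using C(1) by (simp add: field_simps)
        finally show ?case by (simp add: mult.commute)
      qed
      then show ?thesis
        using disk_regular_mult[OF u'(1) v'(1)] by blast
    qed
    then show ?thesis
      using u v Linf_mult by auto
  qed
  fix u assume u: "u \<in> ?A"
  show "(\<lambda>z. c * u z) \<in> ?A" for c
  proof -
    have "(\<lambda>z. (if z \<in> unit_disk then c else 0) * u z) \<in> ?A"
      by (rule mult[OF reg[OF disk_regular_Hinf[OF Hinf_const]] u])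
    moreover have "(\<lambda>z. c * u z) \<in> Linf"
      by (rule Linf_mult) (use u in \<open>auto simp: Linf_def\<close>)
    moreover have "(AE z in area. cmod (c * u z - w z) \<le> e)
        \<longleftrightarrow> (AE z in area. cmod ((if z \<in> unit_disk then c else 0) * u z - w z) \<le> e)" for w e
      by (rule AE_cong) simp
    ultimately show ?thesis by simp
  qed
  show "(\<lambda>z. cnj (u z)) \<in> ?A"
  proof -
    have "\<exists>w. disk_regular w \<and> (AE z in area. cmod (cnj (u z) - w z) \<le> e)" if e: "0 < e" for e
    proof -
      obtain v where v: "disk_regular v" "AE z in area. cmod (u z - v z) \<le> e"
        using u e by blast
      then have "AE z in area. cmod (cnj (u z) - cnj (v z)) \<le> e"
        unfolding complex_cnj_diff[symmetric] complex_mod_cnj by simp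
      then show ?thesis
        using disk_regular_cnj[OF v(1)] by blast
    qed
    then show ?thesis
      using u Linf_cnj by auto
  qed
  fix v assume v: "v \<in> ?A"
  show "(\<lambda>z. u z * v z) \<in> ?A"
    by (rule mult[OF u v])
  show "(\<lambda>z. u z + v z) \<in> ?A"
  proof -
    have "\<exists>w. disk_regular w \<and> (AE z in area. cmod (u z + v z - w z) \<le> e)" if e: "0 < e" for e
    proof -
      have e2: "0 < e / 2" using e by simp
      obtain u' where u': "disk_regular u'" "AE z in area. cmod (u z - u' z) \<le> e / 2"
        using u e2 by blast
      obtain v' where v': "disk_regular v'" "AE z in area. cmod (v z - v' z) \<le> e / 2"
        using v e2 by blast
      have "AE z in area. cmod (u z + v z - (u' z + v' z)) \<le> e"
        using u'(2) v'(2)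
      proof eventually_elim
        case (elim z)
        then show ?case
          using norm_triangle_ineq[of "u z - u' z" "v z - v' z"] by (simp add: algebra_simps)
      qed
      then show ?thesis
        using disk_regular_add[OF u'(1) v'(1)] by blast
    qed
    then show ?thesis
      using u v Linf_add by auto
  qed
next
  fix u assume "u \<in> Linf" and app: "\<forall>e>0. \<exists>v\<in>?A. AE z in area. cmod (u z - v z) \<le> e"
  have "\<exists>w. disk_regular w \<and> (AE z in area. cmod (u z - w z) \<le> e)" if e: "0 < e" for e
  proof -
    have e2: "0 < e / 2" using e by simp
    obtain v where v: "v \<in> ?A" "AE z in area. cmod (u z - v z) \<le> e / 2"
      using app e2 by blast
    obtain w where w: "disk_regular w" "AE z in area. cmod (v z - w z) \<le> e / 2"
      using v(1) e2 by blast
    have "AE z in area. cmod (u z - w z) \<le> e"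
      using v(2) w(2)
    proof eventually_elim
      case (elim z)
      then show ?case
        using norm_triangle_ineq[of "u z - v z" "v z - w z"] by simp
    qed
    then show ?thesis
      using w(1) by blast
  qed
  then show "u \<in> ?A"
    using \<open>u \<in> Linf\<close> by blast
qed

lemma UU_disk_regular:
  assumes u: "u \<in> UU" shows "disk_regular u"
proof (rule disk_regular_uniform_limit)
  let ?A = "{u \<in> Linf. \<forall>e>0. \<exists>v. disk_regular v \<and> (AE z in area. cmod (u z - v z) \<le> e)}"
  have "Hinf \<subseteq> ?A"
    using disk_regular_Hinf Linf_disk_regular by (auto intro!: exI)
  then have uA: "u \<in> ?A"
    using u cstar_disk_regular unfolding UU_def by blast
  fix e :: real assume "0 < e"
  then obtain v where v: "disk_regular v" "AE z in area. cmod (u z - v z) \<le> e"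
    using uA by blast
  \<comment> \<open>For continuous functions an almost everywhere bound holds everywhere, so u is a
    genuine uniform limit of regular functions.\<close>
  have "cmod (u z - v z) \<le> e" if "z \<in> unit_disk" for z
    by (rule continuous_AE_le[OF _ v(2) that])
      (use u disk_regular_continuous[OF v(1)] in \<open>auto simp: UU_def intro!: continuous_on_diff\<close>)
  then show "\<exists>v. disk_regular v \<and> (\<forall>z\<in>unit_disk. cmod (u z - v z) \<le> e)"
    using v(1) by blast
qed

section \<open>Continuous extension to the closure of the disk\<close>

lemma max_ext_tendsto:
  assumes m: "m \<in> disk_closure" and "\<exists>l. (u \<longlongrightarrow> l) (disk_to m)"
  shows "(u \<longlongrightarrow> max_ext u m) (disk_to m)"
  using assms unfolding max_ext_def by (metis disk_to_nontrivial tendsto_Lim)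

lemma max_ext_eqI: "m \<in> disk_closure \<Longrightarrow> (u \<longlongrightarrow> l) (disk_to m) \<Longrightarrow> max_ext u m = l"
  unfolding max_ext_def by (simp add: disk_to_nontrivial tendsto_Lim)

lemma max_ext_point_eval:
  assumes u: "continuous_on unit_disk u" and w: "w \<in> unit_disk"
  shows "max_ext u (point_eval w) = u w"
proof (rule max_ext_eqI[OF point_eval_in_closure[OF w]])
  have "isCont u w"
    using u w by (simp add: continuous_on_eq_continuous_at)
  then have "(u \<longlongrightarrow> u w) (nhds w)"
    by (simp add: isCont_def tendsto_at_iff_tendsto_nhds)
  then show "(u \<longlongrightarrow> u w) (disk_to (point_eval w))"
    by (rule tendsto_mono[OF disk_to_point[OF w]])
qed

text \<open>An open U around m on whose disk points u is within \<open>e / 2\<close> of its limit is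
  also a neighbourhood of every p in U, so the limits at such p are within \<open>e / 2\<close> as
  well.\<close>

lemma continuous_max_ext:
  assumes lim: "\<And>m. m \<in> disk_closure \<Longrightarrow> \<exists>l. (u \<longlongrightarrow> l) (disk_to m)"
  shows "continuous_on disk_closure (max_ext u)"
  unfolding continuous_on_def
proof (intro ballI tendstoI)
  fix m :: "(complex \<Rightarrow> complex) \<Rightarrow> complex" and e :: real
  assume m: "m \<in> disk_closure" and e: "0 < e"
  have "\<forall>\<^sub>F z in disk_to m. dist (u z) (max_ext u m) < e / 2"
    using max_ext_tendsto[OF m lim[OF m]] e by (intro tendstoD) auto
  then obtain U where U: "open U" "m \<in> U"
      "\<And>z. point_eval z \<in> U \<Longrightarrow> z \<in> unit_disk \<Longrightarrow> dist (u z) (max_ext u m) < e / 2"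
    unfolding disk_to_def eventually_inf_principal eventually_filtercomap eventually_nhds by blast
  have "dist (max_ext u p) (max_ext u m) < e" if p: "p \<in> disk_closure" "p \<in> U" for p
  proof -
    have "\<forall>\<^sub>F z in disk_to p. dist (u z) (max_ext u m) \<le> e / 2"
      using topological_tendstoD[OF disk_to_point_eval U(1) p(2)] eventually_in_disk_to
      by eventually_elim (use U(3) in \<open>simp add: less_imp_le\<close>)
    then have "dist (max_ext u p) (max_ext u m) \<le> e / 2"
      using p(1) max_ext_tendsto[OF p(1) lim[OF p(1)]]
      by (intro tendsto_upperbound[OF tendsto_dist[OF _ tendsto_const]]) (auto simp: disk_to_nontrivial[symmetric])
    then show ?thesis
      using e by linarith
  qed
  then show "\<forall>\<^sub>F p in at m within disk_closure. dist (max_ext u p) (max_ext u m) < e"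
    unfolding eventually_at_topological using U by blast
qed

lemma cstar_subalgebra_AE:
  assumes "cstar_subalgebra A" "v \<in> A" "u \<in> Linf" "AE z in area. u z = v z"
  shows "u \<in> A"
proof -
  have "AE z in area. cmod (u z - v z) \<le> e" if "0 < e" for e :: real
    using assms(4) by eventually_elim (use that in simp)
  then show ?thesis
    using assms(1-3) unfolding cstar_subalgebra_def by blast
qed

text \<open>Stone-Weierstrass on the compact \<open>disk_closure\<close>: by extensionality two
  distinct points differ at some f in \<open>Hinf\<close>, so real and imaginary parts of the
  coordinates separate points, and on the disk these real functions are \<open>Re (f z)\<close> and
  \<open>Im (f z)\<close>, which lie in every such algebra.\<close>

lemma UU_I:
  assumes u: "continuous_on unit_disk u" and lim: "\<And>m. m \<in> disk_closure \<Longrightarrow> \<exists>l. (u \<longlongrightarrow> l) (disk_to m)"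
  shows "u \<in> UU"
proof -
  note cont = continuous_max_ext[OF lim]
  note ext = max_ext_point_eval[OF u]
  have "bounded (max_ext u ` disk_closure)"
    by (intro compact_imp_bounded compact_continuous_image cont compact_disk_closure)
  then obtain B where B: "\<And>m. m \<in> disk_closure \<Longrightarrow> cmod (max_ext u m) \<le> B"
    unfolding bounded_iff by blast
  have "cmod (u z) \<le> B" if "z \<in> unit_disk" for z
    using B[OF point_eval_in_closure[OF that]] ext[OF that] by simp
  then have uL: "u \<in> Linf"
    unfolding Linf_def using continuous_imp_measurable_area[OF u] by (auto intro!: AE_I2 exI[of _ B])
  have "u \<in> A" if A: "cstar_subalgebra A" and H: "Hinf \<subseteq> A" for A
  proof -
    have sub: "A \<subseteq> Linf" and add: "\<And>u v. u \<in> A \<Longrightarrow> v \<in> A \<Longrightarrow> (\<lambda>z. u z + v z) \<in> A"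
      and mult: "\<And>u v. u \<in> A \<Longrightarrow> v \<in> A \<Longrightarrow> (\<lambda>z. u z * v z) \<in> A"
      and scale: "\<And>c u. u \<in> A \<Longrightarrow> (\<lambda>z. c * u z) \<in> A" and cnj: "\<And>u. u \<in> A \<Longrightarrow> (\<lambda>z. cnj (u z)) \<in> A"
      and clos: "\<And>u. u \<in> Linf \<Longrightarrow> (\<And>e. e > 0 \<Longrightarrow> \<exists>v\<in>A. AE z in area. cmod (u z - v z) \<le> e) \<Longrightarrow> u \<in> A"
      using A unfolding cstar_subalgebra_def by auto
    define P where "P g \<longleftrightarrow> continuous_on disk_closure g \<and> (\<lambda>z. complex_of_real (g (point_eval z))) \<in> A" for g
    have approx: "\<exists>g. P g \<and> (\<forall>m\<in>disk_closure. \<bar>h m - g m\<bar> < e)"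
      if h: "continuous_on disk_closure h" and e: "0 < e" for h and e :: real
    proof (rule Stone_Weierstrass_HOL[of disk_closure P h e])
      show "P (\<lambda>m. c)" for c
      proof -
        have "(\<lambda>z. complex_of_real c) \<in> A"
        proof (rule cstar_subalgebra_AE[OF A subsetD[OF H Hinf_const[of "of_real c"]]])
          show "AE z in area. complex_of_real c = (if z \<in> unit_disk then of_real c else 0)"
            by (rule AE_I2) simp
        qed (auto simp: Linf_def)
        then show ?thesis
          by (simp add: P_def)
      qed
      show "P (\<lambda>x. f x + g x)" if "P f \<and> P g" for f g
        using that add by (auto simp: P_def intro: continuous_on_add)
      show "P (\<lambda>x. f x * g x)" if "P f \<and> P g" for f g
        using that mult by (auto simp: P_def intro: continuous_on_mult)
      fix p q assume pq: "p \<in> disk_closure \<and> q \<in> disk_closure \<and> p \<noteq> q"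
      then obtain f where pqf: "p f \<noteq> q f" by auto
      have "p \<in> extensional Hinf" "q \<in> extensional Hinf"
        using pq disk_closure_subset by (auto simp: maximal_ideals_def)
      then have f: "f \<in> Hinf"
        using pqf by (metis extensional_arb)
      have c: "continuous_on disk_closure (\<lambda>m. m f)"
        by (rule continuous_on_subset[OF continuous_on_product_coordinates]) simp
      have re: "(\<lambda>z. complex_of_real (Re (f z))) \<in> A"
      proof -
        have "(\<lambda>z. 1 / 2 * (f z + cnj (f z))) \<in> A"
          using f H by (intro scale add cnj) auto
        then show ?thesis
          by (simp add: complex_add_cnj)
      qed
      have im: "(\<lambda>z. complex_of_real (Im (f z))) \<in> A"
      proof -
        have "(\<lambda>z. - \<i> / 2 * (f z + - 1 * cnj (f z))) \<in> A"
          using f H by (intro scale add cnj) auto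
        moreover have "- \<i> / 2 * (f z + - 1 * cnj (f z)) = complex_of_real (Im (f z))" for z
          by (simp add: complex_eq_iff)
        ultimately show ?thesis by simp
      qed
      have "P (\<lambda>m. Re (m f))" "P (\<lambda>m. Im (m f))"
        using c re im f by (auto simp: P_def point_eval_apply intro!: continuous_intros)
      then show "\<exists>g. P g \<and> g p \<noteq> g q"
        using pqf by (meson complex_eqI)
    qed (use h e in \<open>auto simp: P_def compact_disk_closure\<close>)
    show "u \<in> A"
    proof (rule clos[OF uL])
      fix e :: real assume e: "0 < e"
      obtain g1 where g1: "P g1" "\<And>m. m \<in> disk_closure \<Longrightarrow> \<bar>Re (max_ext u m) - g1 m\<bar> < e / 2"
        using approx[of "\<lambda>m. Re (max_ext u m)" "e / 2"] e cont by (auto intro: continuous_on_Re)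
      obtain g2 where g2: "P g2" "\<And>m. m \<in> disk_closure \<Longrightarrow> \<bar>Im (max_ext u m) - g2 m\<bar> < e / 2"
        using approx[of "\<lambda>m. Im (max_ext u m)" "e / 2"] e cont by (auto intro: continuous_on_Im)
      let ?v = "\<lambda>z. complex_of_real (g1 (point_eval z)) + \<i> * complex_of_real (g2 (point_eval z))"
      have "?v \<in> A"
        using g1(1) g2(1) by (intro add scale) (auto simp: P_def)
      moreover have "cmod (u z - ?v z) \<le> e" if "z \<in> unit_disk" for z
      proof -
        note pz = point_eval_in_closure[OF that]
        have "cmod (u z - ?v z) \<le> \<bar>Re (u z - ?v z)\<bar> + \<bar>Im (u z - ?v z)\<bar>"
          by (rule cmod_le)
        also have "\<dots> \<le> e / 2 + e / 2"
          using g1(2)[OF pz] g2(2)[OF pz] by (intro add_mono) (simp_all add: ext[OF that])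
        finally show ?thesis by simp
      qed
      ultimately show "\<exists>v\<in>A. AE z in area. cmod (u z - v z) \<le> e"
        by (intro bexI[of _ ?v] AE_I2) auto
    qed
  qed
  then show ?thesis
    using u by (auto simp: UU_def)
qed

text \<open>The limits supplied by \<open>hoffman_limit_bounded\<close>, with each f scaled to bound
  1, assemble to a point of the product space. Coordinatewise convergence is convergence there, and
  uniqueness of limits makes the description in \<open>hoffman_map\<close> well defined.\<close>

theorem hoffman_map_tendsto:
  assumes m: "m \<in> disk_closure" and w: "w \<in> unit_disk"
  shows "hoffman_map m w \<in> disk_closure"
    and "((\<lambda>z. point_eval (disk_aut z w)) \<longlongrightarrow> hoffman_map m w) (disk_to m)"
proof -
  have nb: "disk_to m \<noteq> bot"
    using m by (simp add: disk_to_nontrivial)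
  have lim: "\<exists>l. ((\<lambda>z. f (disk_aut z w)) \<longlongrightarrow> l) (disk_to m)" if f: "f \<in> Hinf" for f
  proof -
    obtain B where B: "0 < B" "\<And>z. z \<in> unit_disk \<Longrightarrow> cmod (f z) \<le> B"
      using disk_regular_pos_bound[OF disk_regular_Hinf[OF f]] by blast
    have "\<exists>l. ((\<lambda>z. f (disk_aut z w) / of_real B) \<longlongrightarrow> l) (disk_to m)"
    proof (rule hoffman_limit_bounded[OF nb eventually_in_disk_to, of "\<lambda>z. f z / of_real B" w])
      show "(\<lambda>z. f z / of_real B) holomorphic_on unit_disk"
        using f B by (auto simp: Hinf_def intro!: holomorphic_intros)
      show "cmod (f z / of_real B) \<le> 1" if "z \<in> unit_disk" for z
        using B(1) B(2)[OF that] by (simp add: norm_divide)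
      show "\<exists>l. (g \<longlongrightarrow> l) (disk_to m)"
        if "g holomorphic_on unit_disk" "\<And>z. z \<in> unit_disk \<Longrightarrow> cmod (g z) \<le> C" for g C
        using that by (rule disk_to_bounded_holomorphic)
    qed (rule w)
    then obtain l where "((\<lambda>z. f (disk_aut z w) / of_real B) \<longlongrightarrow> l) (disk_to m)" by blast
    then have "((\<lambda>z. of_real B * (f (disk_aut z w) / of_real B)) \<longlongrightarrow> of_real B * l) (disk_to m)"
      by (intro tendsto_intros)
    then show ?thesis
      using B(1) by auto
  qed
  then obtain L where L: "\<And>f. f \<in> Hinf \<Longrightarrow> ((\<lambda>z. f (disk_aut z w)) \<longlongrightarrow> L f) (disk_to m)"
    by metis
  let ?p = "restrict L Hinf"
  have p: "((\<lambda>z. point_eval (disk_aut z w)) \<longlongrightarrow> ?p) (disk_to m)"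
    unfolding tendsto_fun_iff
  proof
    show "((\<lambda>z. point_eval (disk_aut z w) f) \<longlongrightarrow> ?p f) (disk_to m)" for f
      using L by (cases "f \<in> Hinf") (simp_all add: point_eval_def)
  qed
  have "\<forall>\<^sub>F z in disk_to m. point_eval (disk_aut z w) \<in> disk_closure"
    using eventually_in_disk_to by eventually_elim (intro point_eval_in_closure disk_aut_in_disk w)
  then have pX: "?p \<in> disk_closure"
    by (rule Lim_in_closed_set[OF closed_disk_closure _ nb p])
  have "hoffman_map m w = ?p"
    unfolding hoffman_map_def
  proof (rule the_equality)
    show "?p \<in> maximal_ideals \<and> ((\<lambda>z. point_eval (disk_aut z w)) \<longlongrightarrow> ?p) (disk_to m)"
      using p pX disk_closure_subset by blast
    show "q = ?p" if "q \<in> maximal_ideals \<and> ((\<lambda>z. point_eval (disk_aut z w)) \<longlongrightarrow> q) (disk_to m)" for q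
      using that p tendsto_unique[OF nb] by blast
  qed
  then show "hoffman_map m w \<in> disk_closure"
    and "((\<lambda>z. point_eval (disk_aut z w)) \<longlongrightarrow> hoffman_map m w) (disk_to m)"
    using p pX by auto
qed

lemma filterlim_disk_aut:
  assumes m: "m \<in> disk_closure" and w: "w \<in> unit_disk"
  shows "filterlim (\<lambda>z. disk_aut z w) (disk_to (hoffman_map m w)) (disk_to m)"
proof -
  have "\<forall>\<^sub>F z in disk_to m. disk_aut z w \<in> unit_disk"
    using eventually_in_disk_to by eventually_elim (intro disk_aut_in_disk w)
  moreover have "filterlim (\<lambda>z. disk_aut z w) (filtercomap point_eval (nhds (hoffman_map m w))) (disk_to m)"
    using hoffman_map_tendsto(2)[OF m w] by (simp add: filterlim_filtercomap_iff o_def)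
  ultimately show ?thesis
    unfolding disk_to_def[of "hoffman_map m w"] filterlim_inf filterlim_principal by blast
qed

section \<open>Compositions with Hoffman maps\<close>

definition hoffman_pull :: "((complex \<Rightarrow> complex) \<Rightarrow> complex) \<Rightarrow> (complex \<Rightarrow> complex) \<Rightarrow> complex \<Rightarrow> complex" where
  "hoffman_pull m u = (\<lambda>w. max_ext u (hoffman_map m w))"

lemma hoffman_pull_tendsto:
  assumes m: "m \<in> disk_closure" and w: "w \<in> unit_disk" and lim: "\<And>p. p \<in> disk_closure \<Longrightarrow> \<exists>l. (u \<longlongrightarrow> l) (disk_to p)"
  shows "((\<lambda>z. pull_back z u w) \<longlongrightarrow> hoffman_pull m u w) (disk_to m)"
  unfolding pull_back_def hoffman_pull_def
  by (rule filterlim_compose[OF max_ext_tendsto[OF _ lim] filterlim_disk_aut[OF m w]])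
    (use hoffman_map_tendsto(1)[OF m w] in auto)

text \<open>Here \<open>disk_to m\<close> is \<open>bot\<close>, every point is a limit, and the
  description no longer depends on w.\<close>

lemma hoffman_map_trivial: "m \<notin> disk_closure \<Longrightarrow> hoffman_map m w = hoffman_map m 0"
  by (simp add: hoffman_map_def disk_to_nontrivial[symmetric])

text \<open>Arzela-Ascoli in filter form: invariance of \<open>pdist\<close> gives the functions
  \<open>pull_back z u\<close> one modulus of continuity for all z, so pointwise convergence on a
  finite net is enough.\<close>

lemma hoffman_pull_uniform_limit:
  assumes m: "m \<in> disk_closure" and u: "disk_regular u" and r: "0 < r" "r < 1"
  shows "uniform_limit (ball 0 r) (\<lambda>z. pull_back z u) (hoffman_pull m u) (disk_to m)"
proof (rule uniform_limitI)
  fix e :: real assume e: "0 < e"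
  obtain d where d: "d > 0" "\<And>z w. z \<in> unit_disk \<Longrightarrow> w \<in> unit_disk \<Longrightarrow> pdist z w < d \<Longrightarrow> dist (u z) (u w) < e / 4"
    using disk_regularD(2)[OF u, of "e / 4"] e by auto
  note lim = hoffman_pull_tendsto[OF m _ disk_regularD(3)[OF u]]
  have nb: "disk_to m \<noteq> bot"
    using m by (simp add: disk_to_nontrivial)
  have near: "dist (pull_back z u x) (pull_back z u y) < e / 4"
    if "z \<in> unit_disk" "x \<in> unit_disk" "y \<in> unit_disk" "pdist x y < d" for z x y
    unfolding pull_back_def
    by (rule d(2)) (use that disk_aut_in_disk in \<open>simp_all add: pdist_invariant\<close>)
  have near': "dist (hoffman_pull m u x) (hoffman_pull m u y) \<le> e / 4"
    if "x \<in> unit_disk" "y \<in> unit_disk" "pdist x y < d" for x y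
  proof (rule tendsto_upperbound[OF tendsto_dist[OF lim[OF that(1)] lim[OF that(2)]] _ nb])
    show "\<forall>\<^sub>F z in disk_to m. dist (pull_back z u x) (pull_back z u y) \<le> e / 4"
      using eventually_in_disk_to by eventually_elim (use near that in \<open>blast intro: less_imp_le\<close>)
  qed
  \<comment> \<open>A Euclidean net of mesh \<open>d * (1 - r)\<close> in \<open>cball 0 r\<close>
    has pseudohyperbolic mesh d, by \<open>pdist_le_euclidean\<close>.\<close>
  have dr: "0 < d * (1 - r)" using d(1) r by simp
  have "seq_compact (cball (0::complex) r)"
    using compact_cball[of "0::complex" r] unfolding compact_eq_seq_compact_metric .
  note mp[OF spec[OF seq_compact_imp_totally_bounded[OF this]] dr]
  then obtain K :: "complex set" where K: "finite K" "K \<subseteq> cball 0 r" "cball 0 r \<subseteq> (\<Union>x\<in>K. ball x (d * (1 - r)))"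
    by blast
  have KD: "x \<in> unit_disk" if "x \<in> K" for x
    using subsetD[OF K(2) that] r by simp
  have "\<forall>\<^sub>F z in disk_to m. \<forall>x\<in>K. dist (pull_back z u x) (hoffman_pull m u x) < e / 4"
    using lim[OF KD] e by (intro eventually_ball_finite[OF K(1)] ballI tendstoD) auto
  then show "\<forall>\<^sub>F z in disk_to m. \<forall>y\<in>ball 0 r. dist (pull_back z u y) (hoffman_pull m u y) < e"
    using eventually_in_disk_to
  proof eventually_elim
    case (elim z)
    show ?case
    proof
      fix y :: complex assume y: "y \<in> ball 0 r"
      then have yD: "y \<in> unit_disk" using r by auto
      obtain x where x: "x \<in> K" "dist x y < d * (1 - r)"
        using subsetD[OF K(3), of y] y by auto
      have "pdist x y \<le> dist x y / (1 - cmod x)"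
        by (rule pdist_le_euclidean[OF KD[OF x(1)] yD])
      also have "\<dots> \<le> dist x y / (1 - r)"
        using subsetD[OF K(2) x(1)] r KD[OF x(1)] by (intro divide_left_mono) auto
      also have "\<dots> < d"
        using x(2) r by (simp add: field_simps)
      finally have xy: "pdist x y < d" .
      have 1: "dist (pull_back z u x) (pull_back z u y) < e / 4"
        by (rule near[OF elim(2) KD[OF x(1)] yD xy])
      have 2: "dist (hoffman_pull m u x) (hoffman_pull m u y) \<le> e / 4"
        by (rule near'[OF KD[OF x(1)] yD xy])
      have 3: "dist (pull_back z u x) (hoffman_pull m u x) < e / 4"
        using elim(1) x(1) by blast
      show "dist (pull_back z u y) (hoffman_pull m u y) < e"
        using 1 2 3 e dist_triangle[of "pull_back z u y" "hoffman_pull m u y" "pull_back z u x"]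
          dist_triangle[of "pull_back z u x" "hoffman_pull m u y" "hoffman_pull m u x"]
          dist_commute[of "pull_back z u x" "pull_back z u y"] by linarith
    qed
  qed
qed

lemma hoffman_pull_continuous:
  assumes m: "m \<in> disk_closure" and u: "disk_regular u"
  shows "continuous_on unit_disk (hoffman_pull m u)"
proof -
  have c: "continuous_on (ball 0 r) (hoffman_pull m u)" if r: "0 < r" "r < 1" for r
  proof (rule uniform_limit_theorem[OF _ hoffman_pull_uniform_limit[OF m u r]])
    show "\<forall>\<^sub>F z in disk_to m. continuous_on (ball 0 r) (pull_back z u)"
      using eventually_in_disk_to
    proof eventually_elim
      case (elim z)
      have D: "x \<in> unit_disk" if "x \<in> ball 0 r" for x :: complex
        using that r by auto
      have "continuous_on (ball 0 r) (\<lambda>x. disk_aut z x)"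
        using elim D by (intro continuous_intros) auto
      then show ?case
        unfolding pull_back_def
        by (rule continuous_on_compose2[OF disk_regular_continuous[OF u]]) (rule image_subsetI, rule disk_aut_in_disk[OF elim(1) D])
    qed
    show "disk_to m \<noteq> bot"
      using m by (simp add: disk_to_nontrivial)
  qed
  have "isCont (hoffman_pull m u) w" if wD: "w \<in> unit_disk" for w
  proof -
    obtain r where r: "cmod w < r" "r < 1"
      using wD dense[of "cmod w" 1] by auto
    have "0 < r"
      using r norm_ge_zero[of w] by linarith
    from c[OF this r(2)] show ?thesis
      using r by (simp add: continuous_on_eq_continuous_at)
  qed
  then show ?thesis
    by (simp add: continuous_on_eq_continuous_at)
qed

lemma hoffman_pull_bound:
  assumes m: "m \<in> disk_closure" and u: "disk_regular u" and w: "w \<in> unit_disk"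
    and B: "\<And>z. z \<in> unit_disk \<Longrightarrow> cmod (u z) \<le> B"
  shows "cmod (hoffman_pull m u w) \<le> B"
proof (rule tendsto_upperbound[OF tendsto_norm[OF hoffman_pull_tendsto[OF m w disk_regularD(3)[OF u]]]])
  show "\<forall>\<^sub>F z in disk_to m. cmod (pull_back z u w) \<le> B"
    using eventually_in_disk_to by eventually_elim (use B disk_aut_in_disk w in \<open>simp add: pull_back_def\<close>)
qed (use m in \<open>simp_all add: disk_to_nontrivial\<close>)

lemma symbol_hoffman_pull:
  assumes m: "m \<in> disk_closure" and u: "disk_regular u"
    and B: "\<And>z. z \<in> unit_disk \<Longrightarrow> cmod (u z) \<le> B"
  shows "symbol B (hoffman_pull m u)"
  unfolding symbol_def using continuous_imp_measurable_area[OF hoffman_pull_continuous[OF m u]]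
    hoffman_pull_bound[OF m u _ B] by auto

section \<open>Mean values\<close>

lemma laplacian_mixed_deriv:
  assumes A: "clinear_op A" and w: "w \<in> unit_disk" and g: "\<And>z. z \<in> unit_disk \<Longrightarrow> g z = berezin A z"
  shows "laplacian g w = 4 * mixed_deriv A w"
proof -
  obtain a b c e where d: "\<And>w. w \<in> unit_disk \<Longrightarrow> wirt (berezin A) (a w) (b w) w"
    "\<And>w. w \<in> unit_disk \<Longrightarrow> wirt a (c w) (mixed_deriv A w) w"
    "\<And>w. w \<in> unit_disk \<Longrightarrow> wirt b (mixed_deriv A w) (e w) w"
    using berezin_second_derivatives[OF A] by metis
  have "wirt g (a z) (b z) z" if "z \<in> unit_disk" for z
    by (rule wirt_cong[OF d(1)[OF that] that]) (simp add: g)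
  from laplacian_wirt[OF this w d(2)[OF w] d(3)[OF w]] show ?thesis by simp
qed

text \<open>The invariant Laplacian of the Berezin transform in the shape given by
  \<open>laplacian_berezin\<close>; free of derivatives, it converges when the operators converge
  strongly.\<close>

definition lap_form :: "(bergman \<Rightarrow> bergman) \<Rightarrow> complex \<Rightarrow> complex" where
  "lap_form A w = 16 * cinner (A (aut_kernel w)) (aut_kernel w) - 8 * berezin A w"

lemma lap_form_laplacian:
  assumes "clinear_op A" "w \<in> unit_disk" "\<And>z. z \<in> unit_disk \<Longrightarrow> g z = berezin A z"
  shows "of_real ((1 - (cmod w)\<^sup>2)\<^sup>2) * laplacian g w = lap_form A w"
proof -
  have "laplacian g w = laplacian (berezin A) w"
    using laplacian_mixed_deriv[OF assms] laplacian_mixed_deriv[OF assms(1,2) refl] by simp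
  then show ?thesis
    unfolding lap_form_def by (simp only: laplacian_berezin[OF assms(1,2)])
qed

lemma lap_form_mixed_deriv:
  assumes "clinear_op A" "w \<in> unit_disk"
  shows "lap_form A w = 4 * (disk_gap w)\<^sup>2 * mixed_deriv A w"
  using lap_form_laplacian[OF assms refl] laplacian_mixed_deriv[OF assms refl]
  by (simp add: disk_gap power2_eq_square mult_ac)

lemma harmonic_iff_lap_form:
  assumes A: "clinear_op A" and f: "\<And>z. z \<in> unit_disk \<Longrightarrow> f z = berezin A z"
  shows "harmonic_on unit_disk f \<longleftrightarrow> (\<forall>w\<in>unit_disk. lap_form A w = 0)"
proof -
  have z: "laplacian f w = 0 \<longleftrightarrow> lap_form A w = 0" if w: "w \<in> unit_disk" for w
    using lap_form_laplacian[OF A w f] one_minus_norm_sq_pos[OF w] by (metis less_irrefl mult_eq_0_iff of_real_eq_0_iff power_eq_0_iff)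
  have s: "wsmooth 2 f"
    by (rule wsmooth_cong[OF wsmooth_berezin[OF A]]) (simp add: f)
  show ?thesis
    using harmonic_on_wsmooth[OF s] z unfolding harmonic_on_def by blast
qed

lemma toeplitz_uminus:
  assumes u: "symbol B u" shows "toeplitz (\<lambda>z. - u z) f = - toeplitz u f"
proof (rule bergman_eqI_cinner)
  fix g
  have u': "symbol B (\<lambda>z. - u z)"
    using u by (auto simp: symbol_def)
  show "cinner (toeplitz (\<lambda>z. - u z) f) g = cinner (- toeplitz u f) g"
    unfolding cinner.minus_left cinner_toeplitz[OF u] cinner_toeplitz[OF u'] by (simp add: L2_inner_def)
qed

lemma cinner_toeplitz_same:
  assumes u: "symbol B u"
  shows "cinner (toeplitz u f) f = (LINT x|area. u x * of_real ((cmod (fun_of f x))\<^sup>2))"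
  unfolding cinner_toeplitz[OF u] L2_inner_def complex_norm_square by (simp add: mult.assoc)

lemma symbol_mult_square_integrable:
  assumes u: "symbol B u"
  shows "integrable area (\<lambda>x. u x * of_real ((cmod (fun_of f x))\<^sup>2))"
  using square_int_mult_integrable[OF square_int_symbol_mult[OF u square_int_fun_of] square_int_fun_of, of f f]
  unfolding complex_norm_square by (simp add: mult.assoc)

lemma berezin_toeplitz:
  assumes u: "symbol B u" and w: "w \<in> unit_disk"
  shows "berezin (toeplitz u) w = (LINT x|area. u x * of_real ((cmod (bkern w x))\<^sup>2))"
  unfolding berezin_def cinner_toeplitz_same[OF u]
  by (rule Bochner_Integration.integral_cong) (simp_all add: fun_of_normalized_kernel_eq[OF w])

lemma bkern_zero [simp]: "bkern 0 x = 1"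
  by (simp add: bkern_def)

lemma berezin_toeplitz_zero: "symbol B u \<Longrightarrow> berezin (toeplitz u) 0 = (LINT x|area. u x)"
  by (simp add: berezin_toeplitz)

lemma lap_form_toeplitz:
  assumes u: "symbol B u" and w: "w \<in> unit_disk"
  shows "lap_form (toeplitz u) w
    = (LINT x|area. u x * of_real ((16 * (cmod (disk_aut w x))\<^sup>2 - 8) * (cmod (bkern w x))\<^sup>2))"
proof -
  have "lap_form (toeplitz u) w = (LINT x|area. 16 * (u x * of_real ((cmod (fun_of (aut_kernel w) x))\<^sup>2))
      - 8 * (u x * of_real ((cmod (fun_of (normalized_kernel w) x))\<^sup>2)))"
    unfolding lap_form_def berezin_def cinner_toeplitz_same[OF u]
    by (simp only: Bochner_Integration.integral_diff integral_mult_right_zero integrable_mult_right symbol_mult_square_integrable[OF u])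
  also have "\<dots> = (LINT x|area. u x * of_real ((16 * (cmod (disk_aut w x))\<^sup>2 - 8) * (cmod (bkern w x))\<^sup>2))"
    by (rule Bochner_Integration.integral_cong)
      (simp_all add: fun_of_normalized_kernel_eq[OF w] fun_of_aut_kernel[OF w] norm_mult power_mult_distrib algebra_simps)
  finally show ?thesis .
qed

text \<open>The Jacobian identity behind the substitution by \<open>disk_aut x\<close> in
  \<open>lap_form_mean_value\<close>, which removes the automorphism from the integrand.\<close>

lemma bkern_disk_aut_same:
  assumes x: "x \<in> unit_disk" and z: "z \<in> unit_disk"
  shows "cmod (bkern (disk_aut x z) x) * cmod (bkern x z) = cmod (bkern z x)"
proof -
  have px: "0 < 1 - (cmod x)\<^sup>2" and pz: "0 < 1 - (cmod z)\<^sup>2"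
    using one_minus_norm_sq_pos x z by auto
  have "bkern x x * bkern z (disk_aut x x) = kern_phase x z * bkern (disk_aut x z) x"
    by (rule bkern_disk_aut[OF x z x])
  then have "cmod (bkern x x) * cmod (bkern z 0) = cmod (bkern (disk_aut x z) x)"
    using norm_kern_phase[OF x z] by (metis disk_aut_self mult_1 norm_mult)
  moreover have "cmod (bkern x x) = 1 / (1 - (cmod x)\<^sup>2)"
    unfolding bkern_def of_real_one_minus_norm_sq[symmetric] norm_divide norm_power norm_of_real
    using px by (simp add: power2_eq_square)
  moreover have "cmod (bkern z 0) = 1 - (cmod z)\<^sup>2"
    using pz unfolding bkern_def by (simp del: of_real_diff)
  ultimately have 1: "cmod (bkern (disk_aut x z) x) = (1 - (cmod z)\<^sup>2) / (1 - (cmod x)\<^sup>2)"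
    by simp
  have "cmod (1 - cnj x * z) = cmod (cnj (1 - cnj z * x))"
    by (simp add: mult.commute)
  then have 2: "cmod (1 - cnj x * z) = cmod (1 - cnj z * x)"
    by (simp only: complex_mod_cnj)
  show ?thesis
    unfolding 1 unfolding bkern_def norm_divide norm_power norm_of_real 2
    using px pz by simp
qed

lemma integral_norm_bkern_sq:
  assumes w: "w \<in> unit_disk" shows "(LINT x|area. (cmod (bkern w x))\<^sup>2) = 1"
proof -
  have "(LINT x|area. (cmod (bkern w x))\<^sup>2) = (LINT x|area. (cmod (fun_of (normalized_kernel w) x))\<^sup>2)"
    by (rule Bochner_Integration.integral_cong) (simp_all add: fun_of_normalized_kernel_eq[OF w])
  then show ?thesis
    using norm_sq_eq[of "normalized_kernel w"] w by simp
qed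

lemma measurable_bkern_pair [measurable]: "(\<lambda>(w, x). bkern w x) \<in> borel_measurable (area \<Otimes>\<^sub>M area)"
  unfolding bkern_def by measurable

lemma measurable_disk_aut_pair [measurable]: "(\<lambda>(w, x). disk_aut w x) \<in> borel_measurable (area \<Otimes>\<^sub>M area)"
  unfolding disk_aut_def by measurable

text \<open>The squared modulus of \<open>bkern w\<close> has mass 1 for every w, so integrating
  over x first gives a finite dominating integral.\<close>

lemma integrable_symbol_bkern_pair:
  assumes u: "symbol B u" and h: "(\<lambda>(w, x). h w x) \<in> borel_measurable (area \<Otimes>\<^sub>M area)"
    and H: "\<And>w x. w \<in> unit_disk \<Longrightarrow> x \<in> unit_disk \<Longrightarrow> \<bar>h w x\<bar> \<le> H"
  shows "integrable (area \<Otimes>\<^sub>M area) (\<lambda>(w, x). u x * complex_of_real (h w x * (cmod (bkern w x))\<^sup>2))"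
proof -
  note [measurable] = h measurable_compose[OF measurable_snd, of u area borel area]
  have [measurable]: "u \<in> borel_measurable area"
    using u by (simp add: symbol_def)
  have B: "0 \<le> B" by (rule symbol_nonneg[OF u])
  have H0: "0 \<le> H"
    using H[of 0 0] by simp
  have ib: "integrable area (\<lambda>x. (cmod (bkern w x))\<^sup>2)" if "w \<in> unit_disk" for w
    using integral_norm_bkern_sq[OF that] not_integrable_integral_eq by fastforce
  have "integrable (area \<Otimes>\<^sub>M area) (\<lambda>(w, x). (cmod (bkern w x))\<^sup>2)"
  proof (rule area_pair.Fubini_integrable)
    show "(\<lambda>(w, x). (cmod (bkern w x))\<^sup>2) \<in> borel_measurable (area \<Otimes>\<^sub>M area)"
      by measurable
    have "integrable area (\<lambda>w. 1 :: real)" by simp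
    then show "integrable area (\<lambda>w. LINT x|area. norm (case (w, x) of (w, x) \<Rightarrow> (cmod (bkern w x))\<^sup>2))"
      by (rule Bochner_Integration.integrable_cong[THEN iffD1, rotated 2]) (simp_all add: integral_norm_bkern_sq)
    show "AE w in area. integrable area (\<lambda>x. case (w, x) of (w, x) \<Rightarrow> (cmod (bkern w x))\<^sup>2)"
      by (rule AE_I2) (simp add: ib)
  qed
  then have i: "integrable (area \<Otimes>\<^sub>M area) (\<lambda>p. (B * H) * (case p of (w, x) \<Rightarrow> (cmod (bkern w x))\<^sup>2))"
    by (rule integrable_mult_right)
  show ?thesis
  proof (rule Bochner_Integration.integrable_bound[OF i])
    show "(\<lambda>(w, x). u x * complex_of_real (h w x * (cmod (bkern w x))\<^sup>2)) \<in> borel_measurable (area \<Otimes>\<^sub>M area)"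
      by measurable
    show "AE p in area \<Otimes>\<^sub>M area. norm (case p of (w, x) \<Rightarrow> u x * complex_of_real (h w x * (cmod (bkern w x))\<^sup>2))
        \<le> norm ((B * H) * (case p of (w, x) \<Rightarrow> (cmod (bkern w x))\<^sup>2))"
    proof (rule AE_I2)
      fix p assume "p \<in> space (area \<Otimes>\<^sub>M area)"
      then obtain w x where p: "p = (w, x)" "w \<in> unit_disk" "x \<in> unit_disk"
        by (auto simp: space_pair_measure)
      have "cmod (u x) * (\<bar>h w x\<bar> * (cmod (bkern w x))\<^sup>2) \<le> B * (H * (cmod (bkern w x))\<^sup>2)"
        using u p H[OF p(2,3)] B H0 by (intro mult_mono) (auto simp: symbol_def)
      then show "norm (case p of (w, x) \<Rightarrow> u x * complex_of_real (h w x * (cmod (bkern w x))\<^sup>2))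
        \<le> norm ((B * H) * (case p of (w, x) \<Rightarrow> (cmod (bkern w x))\<^sup>2))"
        using B H0 by (simp add: p(1) norm_mult norm_power abs_mult mult.assoc)
    qed
  qed
qed

text \<open>The form at w averages u against \<open>h (disk_aut w x) * |bkern w x|^2\<close>. After
  integration over w the automorphism can be removed from h, and then the hypothesis that u is its
  own Berezin transform collapses the integral over x. In effect two invariant averaging operators
  commute.\<close>

lemma lap_form_mean_value:
  assumes u: "symbol B u" and fix_u: "\<And>w. w \<in> unit_disk \<Longrightarrow> u w = berezin (toeplitz u) w"
  shows "(LINT w|area. lap_form (toeplitz u) w) = lap_form (toeplitz u) 0"
proof -
  define h where "h z = 16 * (cmod z)\<^sup>2 - 8" for z :: complex
  have hb: "\<bar>h z\<bar> \<le> 24" if "z \<in> unit_disk" for z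
    using norm_sq_less_one[OF that] zero_le_power2[of "cmod z"] unfolding h_def abs_le_iff by linarith
  have [measurable]: "h \<in> borel_measurable borel"
    unfolding h_def[abs_def] by measurable
  have "(LINT w|area. lap_form (toeplitz u) w)
      = (LINT w|area. LINT x|area. u x * of_real (h (disk_aut w x) * (cmod (bkern w x))\<^sup>2))"
    by (rule Bochner_Integration.integral_cong) (simp_all add: lap_form_toeplitz[OF u] h_def)
  also have "\<dots> = (LINT x|area. LINT w|area. u x * of_real (h (disk_aut w x) * (cmod (bkern w x))\<^sup>2))"
    by (rule area_pair.Fubini_integral[symmetric], rule integrable_symbol_bkern_pair[OF u, of "\<lambda>w x. h (disk_aut w x)" 24])
      (use hb disk_aut_in_disk in measurable)
  \<comment> \<open>For fixed x substitute \<open>w = disk_aut x z\<close>: then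
    \<open>|disk_aut w x| = |z|\<close>, and the Jacobian combines with the kernel by
    \<open>bkern_disk_aut_same\<close>.\<close>
  also have "\<dots> = (LINT x|area. LINT w|area. u x * of_real (h w * (cmod (bkern w x))\<^sup>2))"
  proof (rule Bochner_Integration.integral_cong[OF refl])
    fix x assume "x \<in> space area"
    then have x: "x \<in> unit_disk" by simp
    interpret disk_change "disk_aut x" "\<lambda>w. - bkern x w" "disk_aut x"
      by (rule disk_change_disk_aut[OF x])
    have [measurable]: "(\<lambda>w. bkern w x) \<in> borel_measurable area" "(\<lambda>w. disk_aut w x) \<in> borel_measurable area"
      unfolding bkern_def disk_aut_def by measurable
    have "(LINT w|area. complex_of_real (h (disk_aut w x) * (cmod (bkern w x))\<^sup>2))
        = (LINT z|area. (cmod (- bkern x z))\<^sup>2 *\<^sub>R complex_of_real (h (disk_aut (disk_aut x z) x) * (cmod (bkern (disk_aut x z) x))\<^sup>2))"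
      by (rule integral_change) measurable
    also have "\<dots> = (LINT z|area. complex_of_real (h z * (cmod (bkern z x))\<^sup>2))"
    proof (rule Bochner_Integration.integral_cong[OF refl])
      fix z assume "z \<in> space area"
      then have z: "z \<in> unit_disk" by simp
      have "cmod (disk_aut (disk_aut x z) x) = cmod z"
        using pdist_commute[of "disk_aut x z" x] disk_aut_involution[OF x z] by (simp add: pdist_def)
      then have "h (disk_aut (disk_aut x z) x) = h z"
        by (simp add: h_def)
      then show "(cmod (- bkern x z))\<^sup>2 *\<^sub>R complex_of_real (h (disk_aut (disk_aut x z) x) * (cmod (bkern (disk_aut x z) x))\<^sup>2)
          = complex_of_real (h z * (cmod (bkern z x))\<^sup>2)"
        unfolding bkern_disk_aut_same[OF x z, symmetric] power_mult_distrib
        by (simp add: scaleR_conv_of_real)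
    qed
    finally show "(LINT w|area. u x * complex_of_real (h (disk_aut w x) * (cmod (bkern w x))\<^sup>2))
        = (LINT w|area. u x * complex_of_real (h w * (cmod (bkern w x))\<^sup>2))"
      by (simp only: integral_mult_right_zero)
  qed
  also have "\<dots> = (LINT w|area. LINT x|area. u x * of_real (h w * (cmod (bkern w x))\<^sup>2))"
    by (rule area_pair.Fubini_integral, rule integrable_symbol_bkern_pair[OF u, of "\<lambda>w x. h w" 24])
      (use hb in measurable)
  also have "\<dots> = (LINT w|area. u w * of_real (h w))"
  proof (rule Bochner_Integration.integral_cong[OF refl])
    fix w assume "w \<in> space area"
    then have w: "w \<in> unit_disk" by simp
    have "(LINT x|area. u x * of_real (h w * (cmod (bkern w x))\<^sup>2))
        = (LINT x|area. of_real (h w) * (u x * of_real ((cmod (bkern w x))\<^sup>2)))"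
      by (simp add: mult_ac)
    also have "\<dots> = of_real (h w) * berezin (toeplitz u) w"
      unfolding berezin_toeplitz[OF u w] by (rule integral_mult_right_zero)
    finally show "(LINT x|area. u x * of_real (h w * (cmod (bkern w x))\<^sup>2)) = u w * of_real (h w)"
      using fix_u[OF w] by (simp add: mult.commute)
  qed
  also have "\<dots> = lap_form (toeplitz u) 0"
    by (simp add: lap_form_toeplitz[OF u] h_def)
  finally show ?thesis .
qed

section \<open>The function ln (1 - |w|^2)\<close>

lemma continuous_on_disk_gap: "continuous_on unit_disk (\<lambda>w. ln (1 - (cmod w)\<^sup>2))"
  by (intro continuous_intros) (use one_minus_norm_sq_pos in force)

lemma ln_one_minus_norm_sq_bound:
  assumes w: "w \<in> unit_disk" shows "\<bar>ln (1 - (cmod w)\<^sup>2)\<bar> \<le> 4 * kweight w"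
proof -
  let ?x = "1 - (cmod w)\<^sup>2"
  have x: "0 < ?x" "?x \<le> 1"
    using one_minus_norm_sq_pos[OF w] by auto
  have "ln (1 / ?x) \<le> (1 / ?x) powr (1/4) / (1/4)"
    by (rule ln_powr_bound) (use x in auto)
  moreover have "(1 / ?x) powr (1/4) = kweight w"
    using x by (simp add: kweight_def powr_divide powr_minus_divide)
  moreover have "ln (1 / ?x) = - ln ?x" "ln ?x \<le> 0"
    using x by (auto simp: ln_div)
  ultimately show ?thesis by simp
qed

text \<open>The logarithm is dominated by a multiple of \<open>kweight\<close>, which is integrable
  by \<open>forelli_rudin\<close> at 0.\<close>

lemma integrable_ln_one_minus_norm_sq: "integrable area (\<lambda>w. ln (1 - (cmod w)\<^sup>2))"
proof (rule integrableI_bounded)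
  show m: "(\<lambda>w. ln (1 - (cmod w)\<^sup>2)) \<in> borel_measurable area"
    by measurable
  have "(\<integral>\<^sup>+w. ennreal (norm (ln (1 - (cmod w)\<^sup>2))) \<partial>area) \<le> (\<integral>\<^sup>+w. ennreal 4 * ennreal (cmod (1 / (1 - cnj 0 * w)\<^sup>2) * kweight w) \<partial>area)"
  proof (rule nn_integral_mono)
    fix w assume "w \<in> space area"
    then have w: "w \<in> unit_disk" by simp
    have "ennreal (norm (ln (1 - (cmod w)\<^sup>2))) \<le> ennreal (4 * kweight w)"
      using ln_one_minus_norm_sq_bound[OF w] by (intro ennreal_leI) simp
    also have "\<dots> = ennreal 4 * ennreal (kweight w)"
      by (rule ennreal_mult) (use kweight_pos[OF w] in auto)
    finally show "ennreal (norm (ln (1 - (cmod w)\<^sup>2))) \<le> ennreal 4 * ennreal (cmod (1 / (1 - cnj 0 * w)\<^sup>2) * kweight w)"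
      by simp
  qed
  also have "\<dots> = ennreal 4 * (\<integral>\<^sup>+w. ennreal (cmod (1 / (1 - cnj 0 * w)\<^sup>2) * kweight w) \<partial>area)"
    by (rule nn_integral_cmult) measurable
  also have "\<dots> \<le> ennreal 4 * ennreal (majorant_const * kweight 0)"
    by (intro mult_left_mono forelli_rudin) auto
  also have "\<dots> < \<infinity>"
    by (simp add: ennreal_mult_less_top)
  finally show "(\<integral>\<^sup>+w. ennreal (norm (ln (1 - (cmod w)\<^sup>2))) \<partial>area) < \<infinity>" .
qed

lemma integral_ln_one_minus_norm_sq_nonzero: "(LINT w|area. ln (1 - (cmod w)\<^sup>2)) \<noteq> 0"
proof
  assume 0: "(LINT w|area. ln (1 - (cmod w)\<^sup>2)) = 0"
  have "AE w in area. - ln (1 - (cmod w)\<^sup>2) = 0"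
  proof (subst integral_nonneg_eq_0_iff_AE[symmetric])
    show "AE w in area. 0 \<le> - ln (1 - (cmod w)\<^sup>2)"
      by (rule AE_I2) (use one_minus_norm_sq_pos in auto)
  qed (use integrable_ln_one_minus_norm_sq 0 in simp_all)
  then have ae: "AE w in area. complex_of_real (ln (1 - (cmod w)\<^sup>2)) = 0"
    by eventually_elim simp
  have "complex_of_real (ln (1 - (cmod (1/2 :: complex))\<^sup>2)) = 0"
    by (rule continuous_AE_zero[OF _ ae]) (auto intro!: continuous_on_of_real continuous_on_disk_gap)
  then show False by (simp add: power2_eq_square)
qed

text \<open>Thus \<open>(1 - |w|^2)^2\<close> times the Laplacian of \<open>ln (1 - |w|^2)\<close>
  is the constant -4. On the disk \<open>disk_gap\<close> is a positive real, so the complex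
  logarithm is analytic there and the chain rule for \<open>wirt\<close> applies.\<close>

lemma wirt_Ln_disk_gap:
  assumes w: "w \<in> unit_disk"
  shows "wirt (\<lambda>w. Ln (disk_gap w)) (- cnj w / disk_gap w) (- w / disk_gap w) w"
    and "\<exists>c. wirt (\<lambda>w. - cnj w / disk_gap w) c (- 1 / (disk_gap w)\<^sup>2) w"
proof -
  let ?g = "disk_gap w"
  have pos: "0 < 1 - (cmod w)\<^sup>2" by (rule one_minus_norm_sq_pos[OF w])
  then have g0: "?g \<noteq> 0"
    unfolding disk_gap by (metis less_irrefl of_real_eq_0_iff)
  have gn: "?g \<notin> \<real>\<^sub>\<le>\<^sub>0"
    using pos unfolding disk_gap complex_nonpos_Reals_iff by (simp del: of_real_diff)
  have gd: "(disk_gap has_derivative (\<lambda>h. - cnj w * h + - w * cnj h)) (at w)"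
    using wirt_disk_gap[of w] by (simp add: wirt_def)
  have chain: "wirt (\<lambda>w. F (disk_gap w)) (D * - cnj w) (D * - w) w" if "(F has_field_derivative D) (at ?g)" for F D
    unfolding wirt_def
    by (rule has_derivative_eq_rhs[OF diff_chain_at[OF gd that[unfolded has_field_derivative_def], unfolded o_def]])
      (simp add: fun_eq_iff algebra_simps)
  show "wirt (\<lambda>w. Ln (disk_gap w)) (- cnj w / ?g) (- w / ?g) w"
    using chain[OF has_field_derivative_Ln[OF gn]] by (simp add: field_simps)
  have "wirt (\<lambda>w. inverse (disk_gap w)) (- (inverse ?g)\<^sup>2 * - cnj w) (- (inverse ?g)\<^sup>2 * - w) w"
    by (rule chain) (use DERIV_inverse[OF g0, of UNIV] in \<open>simp add: numeral_2_eq_2\<close>)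
  moreover have "wirt (\<lambda>w. - cnj w) 0 (- 1) w"
    using wirt_mult[OF wirt_const[of "-1"] wirt_cnj] by simp
  ultimately have "wirt (\<lambda>w. - cnj w * inverse (disk_gap w))
      (- cnj w * (- (inverse ?g)\<^sup>2 * - cnj w) + 0 * inverse ?g)
      (- cnj w * (- (inverse ?g)\<^sup>2 * - w) + - 1 * inverse ?g) w"
    by (intro wirt_mult)
  moreover have "- cnj w * (- (inverse ?g)\<^sup>2 * - w) + - 1 * inverse ?g = - 1 / ?g\<^sup>2"
  proof -
    have "- cnj w * (- (inverse ?g)\<^sup>2 * - w) + - 1 * inverse ?g = - (w * cnj w) * (inverse ?g)\<^sup>2 - inverse ?g"
      by simp
    also have "w * cnj w = 1 - ?g" by (simp add: disk_gap_def)
    also have "- (1 - ?g) * (inverse ?g)\<^sup>2 - inverse ?g = - 1 / ?g\<^sup>2"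
      using g0 by (simp add: field_simps power2_eq_square)
    finally show ?thesis .
  qed
  ultimately show "\<exists>c. wirt (\<lambda>w. - cnj w / disk_gap w) c (- 1 / ?g\<^sup>2) w"
    unfolding divide_inverse by metis
qed

text \<open>Subtracting the solution of \<open>(1 - \<bar>w\<bar>\<^sup>2)\<^sup>2 \<Delta>g = s\<close> given by a multiple of \<open>ln (1 - \<bar>w\<bar>\<^sup>2)\<close> leaves a
  harmonic function, so the mean value over the disk exceeds the central value strictly.\<close>

lemma constant_lap_form_no_mean_value:
  assumes A: "clinear_op A" and s: "s \<noteq> 0"
    and lap: "\<And>w. w \<in> unit_disk \<Longrightarrow> Re (t * lap_form A w) = s"
    and int: "integrable area (berezin A)" and mean: "(LINT w|area. berezin A w) = berezin A 0"
  shows False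
proof -
  let ?V = "berezin A" and ?D = "mixed_deriv A"
  obtain a b c e where d: "\<And>w. w \<in> unit_disk \<Longrightarrow> wirt ?V (a w) (b w) w"
    "\<And>w. w \<in> unit_disk \<Longrightarrow> wirt a (c w) (?D w) w"
    "\<And>w. w \<in> unit_disk \<Longrightarrow> wirt b (?D w) (e w) w"
    using berezin_second_derivatives[OF A] by metis
  \<comment> \<open>The mixed derivative of \<open>2 * Re (t * V)\<close> is
    \<open>s / (2 * (1 - |w|^2)^2)\<close> and that of the logarithm is
    \<open>- 1 / (1 - |w|^2)^2\<close>; with this k they cancel.\<close>
  define k where "k = complex_of_real (s / 2)"
  define f where "f w = 1 * (t * ?V w + cnj t * cnj (?V w)) + k * Ln (disk_gap w)" for w
  have f: "wirt f (1 * (t * a w + cnj t * cnj (b w)) + k * (- cnj w / disk_gap w))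
      (1 * (t * b w + cnj t * cnj (a w)) + k * (- w / disk_gap w)) w" if w: "w \<in> unit_disk" for w
    unfolding f_def[abs_def]
    by (intro wirt_scale_sum wirt_cnj_comp d(1) wirt_Ln_disk_gap(1) w)
  have "\<exists>c. wirt (\<lambda>w. 1 * (t * a w + cnj t * cnj (b w)) + k * (- cnj w / disk_gap w)) c 0 w"
    if w: "w \<in> unit_disk" for w
  proof -
    have g0: "disk_gap w \<noteq> 0"
      using one_minus_norm_sq_pos[OF w] unfolding disk_gap by (metis less_irrefl of_real_eq_0_iff)
    obtain l where l: "wirt (\<lambda>w. - cnj w / disk_gap w) l (- 1 / (disk_gap w)\<^sup>2) w"
      using wirt_Ln_disk_gap(2)[OF w] by blast
    have "wirt (\<lambda>w. 1 * (t * a w + cnj t * cnj (b w)) + k * (- cnj w / disk_gap w))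
       (1 * (t * c w + cnj t * cnj (e w)) + k * l) (1 * (t * ?D w + cnj t * cnj (?D w)) + k * (- 1 / (disk_gap w)\<^sup>2)) w"
      by (intro wirt_scale_sum wirt_cnj_comp d(2,3) l w)
    moreover have "1 * (t * ?D w + cnj t * cnj (?D w)) + k * (- 1 / (disk_gap w)\<^sup>2) = 0"
    proof -
      have gr: "(disk_gap w)\<^sup>2 = of_real ((1 - (cmod w)\<^sup>2)\<^sup>2)"
        by (simp add: disk_gap)
      have "t * lap_form A w = of_real (4 * (1 - (cmod w)\<^sup>2)\<^sup>2) * (t * ?D w)"
        unfolding lap_form_mixed_deriv[OF A w] gr by simp
      then have "Re (t * lap_form A w) = Re (of_real (4 * (1 - (cmod w)\<^sup>2)\<^sup>2) * (t * ?D w))"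
        by (rule arg_cong)
      moreover have "Re (of_real x * y) = x * Re y" for x y
        by simp
      ultimately have "4 * (1 - (cmod w)\<^sup>2)\<^sup>2 * Re (t * ?D w) = s"
        using lap[OF w] by metis
      then have "complex_of_real s = 4 * (disk_gap w)\<^sup>2 * of_real (Re (t * ?D w))"
        unfolding gr by (metis of_real_mult of_real_numeral)
      moreover have "t * ?D w + cnj t * cnj (?D w) = 2 * of_real (Re (t * ?D w))"
        using complex_add_cnj[of "t * ?D w"] by simp
      ultimately show ?thesis
        using g0 by (simp add: k_def)
    qed
    ultimately show ?thesis by metis
  qed
  then obtain c' where c': "\<And>w. w \<in> unit_disk \<Longrightarrow>
      wirt (\<lambda>w. 1 * (t * a w + cnj t * cnj (b w)) + k * (- cnj w / disk_gap w)) (c' w) 0 w"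
    by metis
  have Ln: "Ln (disk_gap w) = of_real (ln (1 - (cmod w)\<^sup>2))" if "w \<in> unit_disk" for w
    unfolding disk_gap by (rule Ln_of_real) (rule one_minus_norm_sq_pos[OF that])
  have iL: "integrable area (\<lambda>w. complex_of_real (ln (1 - (cmod w)\<^sup>2)))"
    by (rule integrable_of_real) (rule integrable_ln_one_minus_norm_sq)
  have iV: "integrable area (\<lambda>w. t * ?V w + cnj t * cnj (?V w))"
    using int by (intro Bochner_Integration.integrable_add integrable_mult_right) simp_all
  have i: "integrable area (\<lambda>w. (t * ?V w + cnj t * cnj (?V w)) + k * of_real (ln (1 - (cmod w)\<^sup>2)))"
    by (rule Bochner_Integration.integrable_add[OF iV integrable_mult_right[OF iL]])
  have if': "integrable area f"
    by (rule Bochner_Integration.integrable_cong[THEN iffD1, OF refl _ i]) (simp add: f_def Ln)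
  have "(LINT w|area. f w) = f 0"
    by (rule laplacian_zero_mean_value[OF f c' if'])
  also have "f 0 = t * ?V 0 + cnj t * cnj (?V 0)"
    by (simp add: f_def disk_gap_def)
  also have "(LINT w|area. f w) = (LINT w|area. (t * ?V w + cnj t * cnj (?V w)) + k * of_real (ln (1 - (cmod w)\<^sup>2)))"
    by (rule Bochner_Integration.integral_cong) (simp_all add: f_def Ln)
  also have "\<dots> = (LINT w|area. t * ?V w + cnj t * cnj (?V w)) + (LINT w|area. k * of_real (ln (1 - (cmod w)\<^sup>2)))"
    by (rule Bochner_Integration.integral_add[OF iV]) (rule integrable_mult_right[OF iL])
  also have "(LINT w|area. t * ?V w + cnj t * cnj (?V w)) = t * ?V 0 + cnj t * cnj (?V 0)"
    using int by (subst Bochner_Integration.integral_add) (simp_all add: mean)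
  finally have "k * (LINT w|area. complex_of_real (ln (1 - (cmod w)\<^sup>2))) = 0"
    by simp
  then have "(LINT w|area. complex_of_real (ln (1 - (cmod w)\<^sup>2))) = 0"
    using s by (simp add: k_def)
  then show False
    using integral_ln_one_minus_norm_sq_nonzero by (simp only: integral_complex_of_real of_real_eq_0_iff)
qed

section \<open>Limit operators\<close>

lemma clinear_op_toeplitz_sum: "symbol_lists B uss \<Longrightarrow> clinear_op (toeplitz_sum uss)"
  unfolding clinear_op_def using bounded_linear_toeplitz_sum toeplitz_sum_scaleC by blast

lemma clinear_op_toeplitz: "symbol B u \<Longrightarrow> clinear_op (toeplitz u)"
  unfolding clinear_op_def using bounded_linear_toeplitz toeplitz_scaleC by blast

abbreviation corona :: "((complex \<Rightarrow> complex) \<Rightarrow> complex) set" where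
  "corona \<equiv> disk_closure - point_eval ` unit_disk"

text \<open>For fixed w one has
  \<open>1 - |disk_aut z w|^2 \<le> (1 - |z|^2) / (1 - |w|)^2\<close>.\<close>

lemma filterlim_disk_aut_boundary:
  assumes w: "w \<in> unit_disk" shows "filterlim (\<lambda>z. disk_aut z w) boundary boundary"
  unfolding filterlim_def le_filter_def eventually_filtermap
proof (intro allI impI)
  fix P assume "eventually P boundary"
  then obtain r where r: "r < 1" "\<And>z. r < cmod z \<Longrightarrow> cmod z < 1 \<Longrightarrow> P z"
    unfolding eventually_boundary by blast
  define p where "p = max r 0"
  have p: "0 \<le> p" "p < 1" "r \<le> p" using r(1) by (auto simp: p_def)
  define d where "d = (1 - p\<^sup>2) * (1 - cmod w)\<^sup>2"
  have "p\<^sup>2 < 1" using p by (simp add: abs_square_less_1)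
  then have d: "0 < d" using w by (simp add: d_def)
  have "((\<lambda>z. 1 - (cmod z)\<^sup>2) \<longlongrightarrow> 1 - 1\<^sup>2) boundary"
  proof (intro tendsto_intros)
    show "(cmod \<longlongrightarrow> 1) boundary"
      by (rule filterlim_mono[OF filterlim_filtercomap _ order_refl]) (simp add: at_within_def)
  qed
  then have "\<forall>\<^sub>F z in boundary. 1 - (cmod z)\<^sup>2 < d"
    using d by (intro order_tendstoD) auto
  with eventually_in_disk_boundary show "\<forall>\<^sub>F z in boundary. P (disk_aut z w)"
  proof eventually_elim
    case (elim z)
    note zD = elim(1)
    have b: "1 - cmod w \<le> cmod (1 - cnj z * w)"
      by (rule norm_one_minus_cnj_mult_ge(2)[OF zD w])
    have "1 - (cmod (disk_aut z w))\<^sup>2 = (1 - (cmod z)\<^sup>2) * (1 - (cmod w)\<^sup>2) / (cmod (1 - cnj z * w))\<^sup>2"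
      by (rule one_minus_norm_disk_aut[OF zD w])
    also have "\<dots> \<le> (1 - (cmod z)\<^sup>2) * 1 / (1 - cmod w)\<^sup>2"
      using b w one_minus_norm_sq_pos[OF zD] by (intro frac_le mult_left_mono mult_nonneg_nonneg power_mono zero_less_power) (auto simp: norm_sq_less_one less_imp_le)
    also have "\<dots> < 1 - p\<^sup>2"
      using elim(2) w by (simp add: d_def field_simps)
    finally have "p\<^sup>2 < (cmod (disk_aut z w))\<^sup>2"
      by simp
    then have "p < cmod (disk_aut z w)"
      by (rule power_less_imp_less_base) simp
    then show ?case
      using r(2) p disk_aut_in_disk[OF zD w] by simp
  qed
qed

text \<open>\<open>|disk_aut z w|\<close> tends to 1 along the filter, so Hoffman maps do not lead
  back into the disk. Any property assumed at all m off the disk may therefore be applied at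
  \<open>hoffman_map m w\<close>.\<close>

lemma hoffman_map_corona:
  assumes m: "m \<in> corona" and w: "w \<in> unit_disk" shows "hoffman_map m w \<in> corona"
proof -
  have mX: "m \<in> disk_closure" using m by simp
  have "hoffman_map m w \<notin> point_eval ` unit_disk"
  proof
    assume "hoffman_map m w \<in> point_eval ` unit_disk"
    then obtain x where x: "x \<in> unit_disk" "hoffman_map m w = point_eval x" by auto
    have "filterlim (\<lambda>z. disk_aut z w) (nhds x) (disk_to m)"
      using filterlim_disk_aut[OF mX w] disk_to_point[OF x(1)] unfolding x(2)
      by (rule filterlim_mono) simp
    then have 1: "((\<lambda>z. cmod (disk_aut z w)) \<longlongrightarrow> cmod x) (disk_to m)"
      by (rule tendsto_norm)
    have "filterlim (\<lambda>z. disk_aut z w) boundary (disk_to m)"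
      by (rule filterlim_mono[OF filterlim_disk_aut_boundary[OF w] order_refl disk_to_boundary]) (use m in auto)
    then have "filterlim (\<lambda>z. cmod (disk_aut z w)) (at_left 1) (disk_to m)"
      by (rule filterlim_compose[OF filterlim_filtercomap])
    then have "((\<lambda>z. cmod (disk_aut z w)) \<longlongrightarrow> 1) (disk_to m)"
      by (rule filterlim_mono) (simp_all add: at_within_def)
    with 1 have "cmod x = 1"
      using mX tendsto_unique disk_to_nontrivial by blast
    then show False using x by simp
  qed
  then show ?thesis
    using hoffman_map_tendsto(1)[OF mX w] by blast
qed

text \<open>The coordinate function has modulus below 1 at the points of the disk and modulus 1
  elsewhere in the closure, so the disk is removed by a closed condition. Compactness supplies the
  maximum in \<open>fixed_lap_form_zero\<close>.\<close>

lemma compact_corona: "compact corona"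
proof -
  let ?i = "\<lambda>z. if z \<in> unit_disk then z else 0 :: complex"
  have "corona = disk_closure \<inter> {m. cmod (m ?i) \<ge> 1}"
  proof (intro equalityI subsetI)
    fix m assume m: "m \<in> corona"
    have nb: "disk_to m \<noteq> bot" using m by (simp add: disk_to_nontrivial)
    have "\<forall>\<^sub>F z in disk_to m. cmod z = cmod (?i z)"
      using eventually_in_disk_to by eventually_elim simp
    moreover have "filterlim cmod (at_left 1) (disk_to m)"
      by (rule filterlim_mono[OF filterlim_filtercomap order_refl disk_to_boundary]) (use m in auto)
    then have "(cmod \<longlongrightarrow> 1) (disk_to m)"
      by (rule filterlim_mono) (simp_all add: at_within_def)
    ultimately have "((\<lambda>z. cmod (?i z)) \<longlongrightarrow> 1) (disk_to m)"
      by (rule tendsto_cong[THEN iffD1])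
    then have "cmod (m ?i) = 1"
      using tendsto_unique[OF nb tendsto_norm[OF disk_to_Hinf[OF Hinf_id]]] by blast
    with m show "m \<in> disk_closure \<inter> {m. cmod (m ?i) \<ge> 1}" by simp
  next
    fix m assume m: "m \<in> disk_closure \<inter> {m. cmod (m ?i) \<ge> 1}"
    have "cmod (point_eval w ?i) < 1" if "w \<in> unit_disk" for w
      using that unfolding point_eval_apply[OF Hinf_id] by simp
    with m show "m \<in> corona" by force
  qed
  moreover have "closed {m. cmod (m ?i) \<ge> 1}"
    by (intro closed_Collect_le continuous_intros continuous_on_product_coordinates)
  ultimately show ?thesis
    using compact_disk_closure by (simp add: compact_Int_closed)
qed

text \<open>Instantiated twice: for S, and for S minus the Toeplitz operator of its Berezin
  transform, whose symbols are again regular.\<close>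

locale regular_symbols =
  fixes uss :: "(complex \<Rightarrow> complex) list list" and B :: real
  assumes regular: "us \<in> set uss \<Longrightarrow> u \<in> set us \<Longrightarrow> disk_regular u"
    and bound: "us \<in> set uss \<Longrightarrow> u \<in> set us \<Longrightarrow> z \<in> unit_disk \<Longrightarrow> cmod (u z) \<le> B"
    and B: "0 \<le> B"
begin

abbreviation op :: "bergman \<Rightarrow> bergman" where
  "op \<equiv> toeplitz_sum uss"

abbreviation pulled :: "complex \<Rightarrow> bergman \<Rightarrow> bergman" where
  "pulled z \<equiv> toeplitz_sum (map (map (pull_back z)) uss)"

abbreviation limit_op :: "((complex \<Rightarrow> complex) \<Rightarrow> complex) \<Rightarrow> bergman \<Rightarrow> bergman" where
  "limit_op m \<equiv> toeplitz_sum (map (map (hoffman_pull m)) uss)"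

lemma symbol: "us \<in> set uss \<Longrightarrow> u \<in> set us \<Longrightarrow> symbol B u"
  unfolding symbol_def using bound continuous_imp_measurable_area[OF disk_regular_continuous[OF regular]] by blast

lemma symbol_lists: "symbol_lists B uss"
  unfolding symbol_lists_def symbols_def using symbol by blast

lemma symbol_lists_limit: "m \<in> disk_closure \<Longrightarrow> symbol_lists B (map (map (hoffman_pull m)) uss)"
  unfolding symbol_lists_def symbols_def using symbol_hoffman_pull[OF _ regular bound] by auto

lemmas clinear_op = clinear_op_toeplitz_sum[OF symbol_lists]
lemmas clinear_limit_op = clinear_op_toeplitz_sum[OF symbol_lists_limit]

lemma pulled_tendsto:
  assumes m: "m \<in> disk_closure" shows "((\<lambda>z. pulled z f) \<longlongrightarrow> limit_op m f) (disk_to m)"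
proof (rule toeplitz_sum_tendsto[where B = B])
  fix us u assume u: "us \<in> set uss" "u \<in> set us"
  show "\<forall>\<^sub>F z in disk_to m. symbol B (pull_back z u)"
    using eventually_in_disk_to by eventually_elim (unfold pull_back_def, rule symbol_pull[OF _ symbol[OF u]])
  show "symbol B (hoffman_pull m u)"
    by (rule symbol_hoffman_pull[OF m regular[OF u] bound[OF u]])
  show "uniform_limit (ball 0 r) (\<lambda>z. pull_back z u) (hoffman_pull m u) (disk_to m)" if "0 < r" "r < 1" for r
    by (rule hoffman_pull_uniform_limit[OF m regular[OF u] that])
qed

text \<open>As for the Berezin transform, the unimodular factor from
  \<open>disk_unitary_aut_kernel\<close> cancels in the quadratic form.\<close>

lemma lap_form_pulled:
  assumes z: "z \<in> unit_disk" and w: "w \<in> unit_disk"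
  shows "lap_form op (disk_aut z w) = lap_form (pulled z) w"
proof -
  define k where "k = - kern_phase z w * aut_phase z w"
  have k: "cmod k = 1"
    by (simp add: k_def norm_mult norm_kern_phase[OF z w] norm_aut_phase[OF z w])
  let ?e = "aut_kernel (disk_aut z w)"
  have "cinner (pulled z (aut_kernel w)) (aut_kernel w)
      = cinner (op (disk_unitary z (aut_kernel w))) (disk_unitary z (aut_kernel w))"
    unfolding toeplitz_sum_disk_unitary[OF z symbol_lists] cinner_disk_unitary[OF z] ..
  also have "\<dots> = cinner (op (scaleC k ?e)) (scaleC k ?e)"
    unfolding disk_unitary_aut_kernel[OF z w] k_def ..
  also have "\<dots> = (k * cnj k) * cinner (op ?e) ?e"
    unfolding toeplitz_sum_scaleC[OF symbol_lists] cinner_scaleC_left cinner_scaleC_right by simp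
  also have "k * cnj k = 1"
    using k complex_norm_square[of k] by simp
  finally show ?thesis
    unfolding lap_form_def berezin_toeplitz_sum_pull_back[OF z w symbol_lists] by simp
qed

lemma berezin_pulled_tendsto:
  assumes m: "m \<in> disk_closure" and w: "w \<in> unit_disk"
  shows "((\<lambda>z. berezin op (disk_aut z w)) \<longlongrightarrow> berezin (limit_op m) w) (disk_to m)"
proof -
  have lim: "((\<lambda>z. berezin (pulled z) w) \<longlongrightarrow> berezin (limit_op m) w) (disk_to m)"
    unfolding berezin_def by (intro cinner.tendsto pulled_tendsto[OF m] tendsto_const)
  have "\<forall>\<^sub>F z in disk_to m. berezin (pulled z) w = berezin op (disk_aut z w)"
    using eventually_in_disk_to by eventually_elim (rule berezin_toeplitz_sum_pull_back[OF _ w symbol_lists, symmetric])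
  from tendsto_cong[OF this, THEN iffD1, OF lim] show ?thesis .
qed

lemma lap_form_pulled_tendsto:
  assumes m: "m \<in> disk_closure" and w: "w \<in> unit_disk"
  shows "((\<lambda>z. lap_form op (disk_aut z w)) \<longlongrightarrow> lap_form (limit_op m) w) (disk_to m)"
proof -
  have lim: "((\<lambda>z. lap_form (pulled z) w) \<longlongrightarrow> lap_form (limit_op m) w) (disk_to m)"
    unfolding lap_form_def berezin_def by (intro tendsto_intros cinner.tendsto pulled_tendsto[OF m])
  have "\<forall>\<^sub>F z in disk_to m. lap_form (pulled z) w = lap_form op (disk_aut z w)"
    using eventually_in_disk_to by eventually_elim (rule lap_form_pulled[OF _ w, symmetric])
  from tendsto_cong[OF this, THEN iffD1, OF lim] show ?thesis .
qed

lemma berezin_tendsto: "m \<in> disk_closure \<Longrightarrow> (berezin op \<longlongrightarrow> berezin (limit_op m) 0) (disk_to m)"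
  using berezin_pulled_tendsto[of m 0] by simp

lemma lap_form_tendsto: "m \<in> disk_closure \<Longrightarrow> (lap_form op \<longlongrightarrow> lap_form (limit_op m) 0) (disk_to m)"
  using lap_form_pulled_tendsto[of m 0] by simp

lemma berezin_UU: "berezin op \<in> UU"
  using wsmooth_berezin[OF clinear_op, of 0] berezin_tendsto by (intro UU_I) auto

lemma hoffman_pull_berezin:
  assumes m: "m \<in> disk_closure" and w: "w \<in> unit_disk"
  shows "hoffman_pull m (berezin op) w = berezin (limit_op m) w"
proof (rule tendsto_unique)
  show "disk_to m \<noteq> bot" using m by (simp add: disk_to_nontrivial)
  show "((\<lambda>z. pull_back z (berezin op) w) \<longlongrightarrow> hoffman_pull m (berezin op) w) (disk_to m)"
    by (rule hoffman_pull_tendsto[OF m w]) (use berezin_tendsto in blast)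
  show "((\<lambda>z. pull_back z (berezin op) w) \<longlongrightarrow> berezin (limit_op m) w) (disk_to m)"
    unfolding pull_back_def by (rule berezin_pulled_tendsto[OF m w])
qed

lemma hoffman_pull_lap_form:
  assumes m: "m \<in> disk_closure" and w: "w \<in> unit_disk"
  shows "max_ext (lap_form op) (hoffman_map m w) = lap_form (limit_op m) w"
proof (rule tendsto_unique)
  show "disk_to m \<noteq> bot" using m by (simp add: disk_to_nontrivial)
  show "((\<lambda>z. pull_back z (lap_form op) w) \<longlongrightarrow> max_ext (lap_form op) (hoffman_map m w)) (disk_to m)"
    unfolding hoffman_pull_def[symmetric]
    by (rule hoffman_pull_tendsto[OF m w, unfolded hoffman_pull_def]) (use lap_form_tendsto in blast)
  show "((\<lambda>z. pull_back z (lap_form op) w) \<longlongrightarrow> lap_form (limit_op m) w) (disk_to m)"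
    unfolding pull_back_def by (rule lap_form_pulled_tendsto[OF m w])
qed

lemma max_ext_lap_form: "m \<in> disk_closure \<Longrightarrow> max_ext (lap_form op) m = lap_form (limit_op m) 0"
  by (rule max_ext_eqI[OF _ lap_form_tendsto])

lemma berezin_HOP_iff: "berezin op \<in> HOP \<longleftrightarrow> (\<forall>m\<in>corona. \<forall>w\<in>unit_disk. lap_form (limit_op m) w = 0)"
proof -
  let ?h = "\<lambda>m. harmonic_on unit_disk (\<lambda>w. max_ext (berezin op) (hoffman_map m w))"
  have h: "?h m \<longleftrightarrow>
      (\<forall>w\<in>unit_disk. lap_form (limit_op m) w = 0)" if m: "m \<in> disk_closure" for m
    by (rule harmonic_iff_lap_form[OF clinear_limit_op[OF m]])
      (use hoffman_pull_berezin[OF m] in \<open>simp add: hoffman_pull_def\<close>)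
  \<comment> \<open>By the corona theorem there is no such \<open>m\<close>; without it, \<open>hoffman_map m w\<close> is a junk value, but
    the same one for all \<open>w\<close>.\<close>
  have triv: "?h m" if "m \<notin> disk_closure" for m
  proof -
    have "(\<lambda>w. max_ext (berezin op) (hoffman_map m w)) = (\<lambda>w. max_ext (berezin op) (hoffman_map m 0))"
      using hoffman_map_trivial[OF that] by metis
    moreover have "harmonic_on unit_disk (\<lambda>w. c)" for c
      by (rule harmonic_on_wsmooth) (use laplacian_wirt[OF wirt_const _ wirt_const wirt_const] in auto)
    ultimately show ?thesis by metis
  qed
  have "berezin op \<in> HOP \<longleftrightarrow> (\<forall>m \<in> maximal_ideals - point_eval ` unit_disk. ?h m)"
    by (simp add: HOP_def berezin_UU)
  also have "\<dots> \<longleftrightarrow> (\<forall>m\<in>corona. ?h m)"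
  proof (intro iffI ballI)
    fix m assume L: "\<forall>m \<in> maximal_ideals - point_eval ` unit_disk. ?h m" and "m \<in> corona"
    then show "?h m"
      by (intro bspec[OF L]) (use disk_closure_subset in auto)
  next
    fix m assume R: "\<forall>m\<in>corona. ?h m" and m: "m \<in> maximal_ideals - point_eval ` unit_disk"
    show "?h m"
    proof (cases "m \<in> disk_closure")
      case True
      show ?thesis
        by (rule bspec[OF R]) (use True m in simp)
    qed (rule triv)
  qed
  also have "\<dots> \<longleftrightarrow> (\<forall>m\<in>corona. \<forall>w\<in>unit_disk. lap_form (limit_op m) w = 0)"
    by (rule ball_cong[OF refl h]) simp
  finally show ?thesis .
qed

text \<open>Convergence along every \<open>disk_to m\<close> off the disk only concerns the limit
  form at 0. For other w the boundary limit is taken along \<open>disk_aut z w\<close>, which tends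
  to the boundary together with z.\<close>

lemma laplacian_boundary_iff:
  "((\<lambda>z. of_real ((1 - (cmod z)\<^sup>2)\<^sup>2) * laplacian (berezin op) z) \<longlongrightarrow> 0) boundary
    \<longleftrightarrow> (\<forall>m\<in>corona. \<forall>w\<in>unit_disk. lap_form (limit_op m) w = 0)" (is "?L \<longleftrightarrow> ?R")
proof -
  have "\<forall>\<^sub>F z in boundary. of_real ((1 - (cmod z)\<^sup>2)\<^sup>2) * laplacian (berezin op) z = lap_form op z"
    using eventually_in_disk_boundary by eventually_elim (rule lap_form_laplacian[OF clinear_op _ refl])
  then have "?L \<longleftrightarrow> (lap_form op \<longlongrightarrow> 0) boundary"
    by (rule tendsto_cong)
  also have "\<dots> \<longleftrightarrow> ?R"
  proof
    assume L: "(lap_form op \<longlongrightarrow> 0) boundary"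
    show ?R
    proof (intro ballI)
      fix m w assume m: "m \<in> corona" and w: "w \<in> unit_disk"
      have "filterlim (\<lambda>z. disk_aut z w) boundary (disk_to m)"
        by (rule filterlim_mono[OF filterlim_disk_aut_boundary[OF w] order_refl disk_to_boundary]) (use m in auto)
      then have "((\<lambda>z. lap_form op (disk_aut z w)) \<longlongrightarrow> 0) (disk_to m)"
        by (rule filterlim_compose[OF L])
      then show "lap_form (limit_op m) w = 0"
        using m lap_form_pulled_tendsto[of m w] w disk_to_nontrivial tendsto_unique by blast
    qed
  next
    assume R: ?R
    show "(lap_form op \<longlongrightarrow> 0) boundary"
      unfolding tendsto_boundary_iff
    proof
      fix m assume m: "m \<in> corona"
      have "lap_form (limit_op m) 0 = 0"
        using R m by auto
      then show "(lap_form op \<longlongrightarrow> 0) (disk_to m)"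
        using lap_form_tendsto[of m] m by simp
    qed
  qed
  finally show ?thesis .
qed

text \<open>The Berezin transforms of the limit operators obey \<open>V_m w = V_p 0\<close> with
  \<open>p = hoffman_map m w\<close>, so their values at 0 determine them.\<close>

lemma berezin_limit_zero:
  assumes z: "\<And>m. m \<in> corona \<Longrightarrow> berezin (limit_op m) 0 = 0" and m: "m \<in> corona" and w: "w \<in> unit_disk"
  shows "berezin (limit_op m) w = 0"
proof -
  have "berezin (limit_op m) w = max_ext (berezin op) (hoffman_map m w)"
    using hoffman_pull_berezin[of m w] m w by (simp add: hoffman_pull_def)
  also have "\<dots> = berezin (limit_op (hoffman_map m w)) 0"
    by (rule max_ext_eqI[OF _ berezin_tendsto]) (use hoffman_map_corona[OF m w] in auto)
  also have "\<dots> = 0"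
    by (rule z[OF hoffman_map_corona[OF m w]])
  finally show ?thesis .
qed

text \<open>Necessity is the weak convergence of the kernels. Conversely, if all these values
  vanish, every limit operator kills the constant 1 by \<open>berezin_zero_imp\<close>; so the
  conjugated operators at 1 tend to 0 in norm at the boundary, which is what
  \<open>compact_toeplitz_sum\<close> takes.\<close>

theorem compact_operator_iff:
  "compact_operator op \<longleftrightarrow> (\<forall>m\<in>corona. berezin (limit_op m) 0 = 0)"
proof
  assume "compact_operator op"
  then have "(berezin op \<longlongrightarrow> 0) boundary"
    by (intro berezin_compact_boundary) (simp add: compact_operator_def)
  then show "\<forall>m\<in>corona. berezin (limit_op m) 0 = 0"
    unfolding tendsto_boundary_iff using berezin_tendsto disk_to_nontrivial tendsto_unique by blast
next
  assume z: "\<forall>m\<in>corona. berezin (limit_op m) 0 = 0"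
  have "compact (op ` cball 0 1)"
  proof (rule compact_toeplitz_sum[OF symbol_lists B])
    show "((\<lambda>z. norm (pulled z (kern 0 0))) \<longlongrightarrow> 0) boundary"
      unfolding tendsto_boundary_iff
    proof
      fix m assume m: "m \<in> corona"
      then have mX: "m \<in> disk_closure" by simp
      have "limit_op m (kern 0 0) = 0"
        by (rule berezin_zero_imp[OF clinear_limit_op[OF mX]]) (rule berezin_limit_zero, use z m in auto)
      then show "((\<lambda>z. norm (pulled z (kern 0 0))) \<longlongrightarrow> 0) (disk_to m)"
        using tendsto_norm[OF pulled_tendsto[OF mX, of "kern 0 0"]] by simp
    qed
  qed
  then have "compact (closure (op ` cball 0 1))"
    by (simp add: compact_imp_closed)
  then show "compact_operator op"
    unfolding compact_operator_def using bounded_linear_toeplitz_sum[OF symbol_lists] toeplitz_sum_scaleC[OF symbol_lists]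
    by (simp add: linear_add[OF bounded_linear.linear])
qed

lemma fixed_lap_form_zero:
  assumes fix_V: "\<And>m w. m \<in> corona \<Longrightarrow> w \<in> unit_disk \<Longrightarrow>
      berezin (toeplitz (hoffman_pull m (berezin op))) w = berezin (limit_op m) w"
    and m0: "m0 \<in> corona"
  shows "lap_form (limit_op m0) 0 = 0"
proof (rule ccontr)
  assume nz: "lap_form (limit_op m0) 0 \<noteq> 0"
  \<comment> \<open>Makes \<open>Re (t * ?Q m0)\<close> the squared modulus of \<open>?Q m0\<close>,
    hence positive.\<close>
  define t where "t = cnj (lap_form (limit_op m0) 0)"
  let ?Q = "max_ext (lap_form op)"
  have Q: "continuous_on disk_closure ?Q"
    by (rule continuous_max_ext, rule exI, rule lap_form_tendsto)
  have "continuous_on corona (\<lambda>m. Re (t * ?Q m))"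
    by (intro continuous_on_Re continuous_on_mult_left continuous_on_subset[OF Q Diff_subset])
  then have "\<exists>m\<in>corona. \<forall>p\<in>corona. Re (t * ?Q p) \<le> Re (t * ?Q m)"
    by (rule continuous_attains_sup[OF compact_corona, rotated]) (use m0 in auto)
  then obtain m where m: "m \<in> corona" and max': "\<forall>p\<in>corona. Re (t * ?Q p) \<le> Re (t * ?Q m)"
    by (rule bexE)
  note max = bspec[OF max']
  from m have mX: "m \<in> disk_closure" by simp
  define s where "s = Re (t * ?Q m)"
  have "0 < Re (t * ?Q m0)"
    using m0 nz unfolding t_def max_ext_lap_form[OF DiffD1[OF m0]] by (auto simp: power2_eq_square[symmetric] sum_power2_gt_zero_iff complex_eq_iff)
  then have s: "0 < s"
    using max[OF m0] by (simp add: s_def)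
  let ?A = "limit_op m"
  note A = clinear_limit_op[OF mX]
  obtain C where C: "\<And>z. z \<in> unit_disk \<Longrightarrow> cmod (berezin op z) \<le> C"
    using disk_regularD(1)[OF UU_disk_regular[OF berezin_UU]] by blast
  let ?V = "hoffman_pull m (berezin op)"
  have V: "symbol C ?V"
    by (rule symbol_hoffman_pull[OF mX UU_disk_regular[OF berezin_UU] C])
  have VA: "?V w = berezin ?A w" if "w \<in> unit_disk" for w
    by (rule hoffman_pull_berezin[OF mX that])
  have VT: "berezin (toeplitz ?V) w = berezin ?A w" if "w \<in> unit_disk" for w
    by (rule fix_V[OF m that])
  \<comment> \<open>Both operators have the same Berezin transform, and the form depends on nothing
    else. So \<open>lap_form_mean_value\<close>, a statement about Toeplitz operators, becomes
    available for the limit operator.\<close>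
  have q: "lap_form (toeplitz ?V) w = lap_form ?A w" if w: "w \<in> unit_disk" for w
    using lap_form_laplacian[OF clinear_op_toeplitz[OF V] w VT[symmetric]] lap_form_laplacian[OF A w refl] by simp
  have int: "integrable area (berezin ?A)"
    by (rule integrable_area_bounded[where B = C])
      (use continuous_imp_measurable_area wsmooth_berezin[OF A, of 0] V VA in \<open>auto simp: symbol_def\<close>)
  have "(LINT w|area. berezin ?A w) = (LINT w|area. ?V w)"
    by (rule Bochner_Integration.integral_cong) (simp_all add: VA)
  also have "\<dots> = berezin (toeplitz ?V) 0"
    by (rule berezin_toeplitz_zero[OF V, symmetric])
  also have "\<dots> = berezin ?A 0"
    by (rule VT) simp
  finally have mean: "(LINT w|area. berezin ?A w) = berezin ?A 0" .
  have le: "Re (t * lap_form ?A w) \<le> s" if w: "w \<in> unit_disk" for w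
    using max[OF hoffman_map_corona[OF m w]] by (simp add: hoffman_pull_lap_form[OF mX w] s_def)
  have s0: "s = Re (t * lap_form ?A 0)"
    by (simp add: s_def max_ext_lap_form[OF mX])
  have contq: "continuous_on unit_disk (lap_form ?A)"
  proof (rule continuous_on_eq[of unit_disk "\<lambda>w. 4 * (disk_gap w)\<^sup>2 * mixed_deriv ?A w"])
    have k: "continuous_on unit_disk (kern_entry ?A i j)" for i j
      using wsmooth_kern_entry[OF A, of 0 i j] by simp
    have g: "continuous_on unit_disk disk_gap"
      using wsmooth_disk_gap[of 0] by simp
    show "continuous_on unit_disk (\<lambda>w. 4 * (disk_gap w)\<^sup>2 * mixed_deriv ?A w)"
      unfolding mixed_deriv_def by (intro continuous_intros k g)
  qed (simp add: lap_form_mixed_deriv[OF A])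
  have qb: "integrable area (lap_form ?A)"
  proof -
    have "bounded (?Q ` disk_closure)"
      by (intro compact_imp_bounded compact_continuous_image compact_disk_closure Q)
    then obtain M where M: "\<And>p. p \<in> disk_closure \<Longrightarrow> cmod (?Q p) \<le> M"
      unfolding bounded_iff by blast
    show ?thesis
    proof (rule integrable_area_bounded[where B = M])
      show "norm (lap_form ?A w) \<le> M" if "w \<in> unit_disk" for w
        using M[OF hoffman_map_tendsto(1)[OF mX that]] by (simp add: hoffman_pull_lap_form[OF mX that])
    qed (rule continuous_imp_measurable_area[OF contq])
  qed
  have meanq: "(LINT w|area. lap_form ?A w) = lap_form ?A 0"
  proof -
    have "(LINT w|area. lap_form ?A w) = (LINT w|area. lap_form (toeplitz ?V) w)"
      by (rule Bochner_Integration.integral_cong) (simp_all add: q)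
    also have "\<dots> = lap_form (toeplitz ?V) 0"
      by (rule lap_form_mean_value[OF V]) (simp add: VT VA)
    finally show ?thesis by (simp add: q)
  qed
  \<comment> \<open>The difference \<open>s - Re (t * lap_form ?A w)\<close> is continuous,
    nonnegative, and has integral 0 by the mean value.\<close>
  have eq: "Re (t * lap_form ?A w) = s" if w: "w \<in> unit_disk" for w
  proof -
    have i: "integrable area (\<lambda>w. s - Re (t * lap_form ?A w))"
      using qb by (intro Bochner_Integration.integrable_diff integrable_Re integrable_mult_right) simp_all
    have "(LINT w|area. s - Re (t * lap_form ?A w)) = s - (LINT w|area. Re (t * lap_form ?A w))"
      using qb by (subst Bochner_Integration.integral_diff) (auto intro!: integrable_Re integrable_mult_right)
    also have "(LINT w|area. Re (t * lap_form ?A w)) = Re (LINT w|area. t * lap_form ?A w)"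
      by (rule integral_Re) (intro integrable_mult_right qb)
    also have "(LINT w|area. t * lap_form ?A w) = t * lap_form ?A 0"
      by (simp only: integral_mult_right_zero meanq)
    finally have "(LINT w|area. s - Re (t * lap_form ?A w)) = 0"
      using s0 by simp
    then have "AE w in area. s - Re (t * lap_form ?A w) = 0"
      by (subst integral_nonneg_eq_0_iff_AE[OF i, symmetric]) (use le in \<open>auto intro!: AE_I2\<close>)
    then have "AE w in area. complex_of_real (s - Re (t * lap_form ?A w)) = 0"
      by eventually_elim (simp only: of_real_eq_0_iff)
    then have "complex_of_real (s - Re (t * lap_form ?A w)) = 0"
      by (rule continuous_AE_zero[OF _ _ w, rotated]) (intro continuous_intros contq)
    then show ?thesis
      by (simp only: of_real_eq_0_iff)
  qed
  show False
    by (rule constant_lap_form_no_mean_value[OF A _ eq int mean]) (use s in auto)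
qed

lemma harmonic_fixed:
  assumes m: "m \<in> disk_closure" and h: "\<And>w. w \<in> unit_disk \<Longrightarrow> lap_form (limit_op m) w = 0"
    and int: "integrable area (berezin (limit_op m))"
  shows "(LINT w|area. berezin (limit_op m) w) = berezin (limit_op m) 0"
proof -
  note A = clinear_limit_op[OF m]
  obtain a b c e where d: "\<And>w. w \<in> unit_disk \<Longrightarrow> wirt (berezin (limit_op m)) (a w) (b w) w"
    "\<And>w. w \<in> unit_disk \<Longrightarrow> wirt a (c w) (mixed_deriv (limit_op m) w) w"
    using berezin_second_derivatives[OF A] by metis
  have "mixed_deriv (limit_op m) w = 0" if w: "w \<in> unit_disk" for w
    using h[OF w] one_minus_norm_sq_pos[OF w] unfolding lap_form_mixed_deriv[OF A w] disk_gap
    by (simp del: of_real_diff)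
  with d(2) have "wirt a (c w) 0 w" if "w \<in> unit_disk" for w
    using that by metis
  from laplacian_zero_mean_value[OF d(1) this int] show ?thesis .
qed

end

theorem corollary3p12:
  fixes S :: "bergman \<Rightarrow> bergman" and uss :: "(complex \<Rightarrow> complex) list list"
  assumes symbols: "\<And>us. us \<in> set uss \<Longrightarrow> us \<noteq> [] \<and> set us \<subseteq> UU"
    and S: "\<And>f. S f = (\<Sum>us\<leftarrow>uss. foldr toeplitz us f)"
  shows "(compact_operator (\<lambda>f. S f - toeplitz (berezin S) f) \<longleftrightarrow> berezin S \<in> HOP) \<and>
    (berezin S \<in> HOP \<longleftrightarrow>
      ((\<lambda>z. of_real ((1 - (cmod z)\<^sup>2)\<^sup>2) * laplacian (berezin S) z) \<longlongrightarrow> 0)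
        (filtercomap cmod (at_left 1)))"
proof -
  have reg: "disk_regular u" if "us \<in> set uss" "u \<in> set us" for us u
    using symbols[OF that(1)] that(2) UU_disk_regular by blast
  have "\<exists>B\<ge>0. \<forall>u\<in>\<Union>(set ` set uss). \<forall>z\<in>unit_disk. cmod (u z) \<le> B"
  proof -
    have "finite (\<Union>(set ` set uss))" by simp
    moreover have "\<forall>u\<in>\<Union>(set ` set uss). \<exists>B\<ge>0. \<forall>z\<in>unit_disk. cmod (u z) \<le> B"
      using reg disk_regular_pos_bound by (metis (no_types, lifting) UN_E less_imp_le)
    ultimately show ?thesis
    proof (induction rule: finite_induct)
      case (insert u F)
      then obtain B C where "0 \<le> B" "\<forall>u\<in>F. \<forall>z\<in>unit_disk. cmod (u z) \<le> B" "\<forall>z\<in>unit_disk. cmod (u z) \<le> C"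
        by auto
      then show ?case
        by (intro exI[of _ "max B C"]) (auto simp: le_max_iff_disj)
    qed auto
  qed
  then obtain B where B: "0 \<le> B" "\<And>us u z. us \<in> set uss \<Longrightarrow> u \<in> set us \<Longrightarrow> z \<in> unit_disk \<Longrightarrow> cmod (u z) \<le> B"
    by blast
  interpret A: regular_symbols uss B
    by standard (use reg B in auto)
  have S_op: "S = A.op"
    using S by (auto simp: toeplitz_sum_def)
  define v where "v = berezin A.op"
  have v: "disk_regular v"
    unfolding v_def by (rule UU_disk_regular[OF A.berezin_UU])
  have nv: "disk_regular (\<lambda>z. - v z)"
    using disk_regular_scale[OF v, of "-1"] by simp
  obtain C where C: "0 < C" "\<And>z. z \<in> unit_disk \<Longrightarrow> cmod (v z) \<le> C"
    using disk_regular_pos_bound[OF v] by blast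
  interpret K: regular_symbols "uss @ [[\<lambda>z. - v z]]" "max B C"
  proof
    fix us u and z :: complex assume u: "us \<in> set (uss @ [[\<lambda>z. - v z]])" "u \<in> set us"
    then show "disk_regular u"
      using reg nv by auto
    assume z: "z \<in> unit_disk"
    show "cmod (u z) \<le> max B C"
      using u B(2)[OF _ _ z, of us u] C(2)[OF z] by (auto simp: le_max_iff_disj)
  qed (use B in auto)
  have sv: "symbol C v"
    unfolding symbol_def using C continuous_imp_measurable_area[OF disk_regular_continuous[OF v]] by blast
  have K: "(\<lambda>f. S f - toeplitz (berezin S) f) = K.op"
    by (simp add: S_op v_def[symmetric] fun_eq_iff toeplitz_uminus[OF sv])
  define W where "W m = hoffman_pull m v" for m
  have W: "symbol C (W m)" if "m \<in> disk_closure" for m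
    unfolding W_def by (rule symbol_hoffman_pull[OF that v C(2)])
  have neg: "hoffman_pull m (\<lambda>z. - v z) w = - W m w" if m: "m \<in> disk_closure" and w: "w \<in> unit_disk" for m w
    unfolding hoffman_pull_def W_def
    by (rule max_ext_eqI[OF hoffman_map_tendsto(1)[OF m w]], rule tendsto_minus,
        rule max_ext_tendsto[OF hoffman_map_tendsto(1)[OF m w]], rule disk_regularD(3)[OF v hoffman_map_tendsto(1)[OF m w]])
  have K_lim: "K.limit_op m f = A.limit_op m f - toeplitz (W m) f" if m: "m \<in> disk_closure" for m f
    using toeplitz_cong[of "hoffman_pull m (\<lambda>z. - v z)" "\<lambda>z. - W m z"] neg[OF m]
    by (simp add: toeplitz_uminus[OF W[OF m]])
  have K_ber: "berezin (K.limit_op m) w = berezin (A.limit_op m) w - berezin (toeplitz (W m)) w"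
    if m: "m \<in> disk_closure" for m w
    unfolding berezin_def K_lim[OF m] cinner.diff_left ..
  have WA: "W m w = berezin (A.limit_op m) w" if "m \<in> disk_closure" "w \<in> unit_disk" for m w
    unfolding W_def v_def by (rule A.hoffman_pull_berezin[OF that])
  let ?H = "\<forall>m\<in>corona. \<forall>w\<in>unit_disk. lap_form (A.limit_op m) w = 0"
  have "(\<forall>m\<in>corona. berezin (K.limit_op m) 0 = 0) \<longleftrightarrow> ?H"
  proof
    assume z: "\<forall>m\<in>corona. berezin (K.limit_op m) 0 = 0"
    have "berezin (toeplitz (hoffman_pull m (berezin A.op))) w = berezin (A.limit_op m) w"
      if "m \<in> corona" "w \<in> unit_disk" for m w
      using K.berezin_limit_zero[OF _ that] z K_ber[of m w] that(1) by (simp add: W_def v_def)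
    note zero = A.fixed_lap_form_zero[OF this]
    show ?H
    proof (intro ballI)
      fix m w assume m: "m \<in> corona" and w: "w \<in> unit_disk"
      note p = hoffman_map_corona[OF m w]
      \<comment> \<open>The form at w is the form at 0 of the limit operator belonging to
        \<open>hoffman_map m w\<close>, where the vanishing is known.\<close>
      have "lap_form (A.limit_op m) w = max_ext (lap_form A.op) (hoffman_map m w)"
        by (rule A.hoffman_pull_lap_form[OF _ w, symmetric]) (use m in simp)
      also have "\<dots> = lap_form (A.limit_op (hoffman_map m w)) 0"
        by (rule A.max_ext_lap_form) (use p in simp)
      also have "\<dots> = 0"
        by (rule zero[OF _ _ p])
      finally show "lap_form (A.limit_op m) w = 0" .
    qed
  next
    assume H: ?H
    show "\<forall>m\<in>corona. berezin (K.limit_op m) 0 = 0"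
    proof
      fix m assume m: "m \<in> corona"
      then have mX: "m \<in> disk_closure" by simp
      \<comment> \<open>At 0 the Berezin transform of a Toeplitz operator is the mean of its symbol,
        so the mean value property says that the two terms of \<open>K_ber\<close> agree
        there.\<close>
      have "(LINT w|area. W m w) = (LINT w|area. berezin (A.limit_op m) w)"
        by (rule Bochner_Integration.integral_cong) (simp_all add: WA[OF mX])
      also have "\<dots> = berezin (A.limit_op m) 0"
      proof (rule A.harmonic_fixed[OF mX])
        show "integrable area (berezin (A.limit_op m))"
          by (rule integrable_area_bounded[where B = C])
            (use continuous_imp_measurable_area wsmooth_berezin[OF A.clinear_limit_op[OF mX], of 0] W[OF mX] WA[OF mX] in \<open>auto simp: symbol_def\<close>)
      qed (use H m in blast)
      finally show "berezin (K.limit_op m) 0 = 0"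
        unfolding K_ber[OF mX] berezin_toeplitz_zero[OF W[OF mX]] by simp
    qed
  qed
  then show ?thesis
    unfolding K unfolding S_op K.compact_operator_iff A.berezin_HOP_iff A.laplacian_boundary_iff by blast
qed

end
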